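(* Let $A,B$ be irreducible, non-permutation square matrices with entries in $\{0,1\}$. The pair $(K_0(\widetilde{\mathcal R}_A),[1_{\widetilde{\mathcal R}_A}])$, consisting of the $K_0$-group of $\widetilde{\mathcal R}_A$ and the position in it of the class of the unit, is invariant under topological conjugacy of the two-sided topological Markov shift $(\bar X_A,\bar\sigma_A)$; that is, if $(\bar X_A,\bar\sigma_A)$ and $(\bar X_B,\bar\sigma_B)$ are topologically conjugate, then there is a group isomorphism $K_0(\widetilde{\mathcal R}_A)\to K_0(\widetilde{\mathcal R}_B)$ carrying $[1_{\widetilde{\mathcal R}_A}]$ to $[1_{\widetilde{\mathcal R}_B}]$.
   Context: For an $N\times N$ $\{0,1\}$-matrix $A$: $\bar X_A=\{(x_i)_{i\in\mathbb Z}\in\{1,\dots,N\}^{\mathbb Z}: A(x_i,x_{i+1})=1\ \forall i\}$ with the product topology and $\bar\sigma_A((x_i)_i)=(x_{i+1})_i$; topological conjugacy is a homeomorphism intertwining the shifts. $\mathcal O_A$ is the Cuntz–Krieger algebra with generating partial isometries $S_i$: $\sum_iS_iS_i^*=1$, $S_i^*S_i=\sum_jA(i,j)S_jS_j^*$; $\mathcal O_{A^t}$ has generators $T_i$: $\sum_iT_iT_i^*=1$, $T_i^*T_i=\sum_jA(j,i)T_jT_j^*$. With $E_A=\sum_iT_i^*T_i\otimes S_iS_i^*$, set $\widetilde{\mathcal R}_A=E_A(\mathcal O_{A^t}\otimes\mathcal O_A)E_A$. It is (isomorphic to) the $C^*$-algebra of the étale groupoid $G_A^{s,u}\rtimes\mathbb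 Z^2=\{(x,p,q,z)\in\bar X_A\times\mathbb Z\times\mathbb Z\times\bar X_A:\ \bar\sigma_A^p(x)\text{ and }z\text{ agree at all sufficiently large coordinates, } \bar\sigma_A^q(x)\text{ and }z\text{ agree at all sufficiently small coordinates}\}$. *)

theory Defs
  imports "HOL-Analysis.Analysis" "HOL-Algebra.Ring"
begin

record 'a star_algebra = "'a ring" +
  scale :: "complex \<Rightarrow> 'a \<Rightarrow> 'a"
  star :: "'a \<Rightarrow> 'a"

record 'a cstar_algebra = "'a star_algebra" +
  cnorm :: "'a \<Rightarrow> real"

text \<open>\<open>star_monoid_algebra M \<tau>\<close> is the *-algebra of finitely supported complex functions on a
  monoid \<open>M\<close> with involution \<open>\<tau>\<close> (an anti-automorphism of order two): convolution product, and the
  conjugate-linear extension of \<open>\<tau>\<close> as adjoint.\<close>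

definition point_mass :: "'m \<Rightarrow> 'm \<Rightarrow> complex" where
  "point_mass u = (\<lambda>w. if w = u then 1 else 0)"

definition star_monoid_algebra ::
    "('m, 'z) monoid_scheme \<Rightarrow> ('m \<Rightarrow> 'm) \<Rightarrow> ('m \<Rightarrow> complex) star_algebra" where
  "star_monoid_algebra M \<tau> =
    \<lparr> carrier = {f. finite {w. f w \<noteq> 0} \<and> {w. f w \<noteq> 0} \<subseteq> carrier M},
      mult = (\<lambda>f g w. \<Sum>(u, v) \<in> {(u, v). f u \<noteq> 0 \<and> g v \<noteq> 0 \<and> u \<otimes>\<^bsub>M\<^esub> v = w}. f u * g v),
      one = point_mass \<one>\<^bsub>M\<^esub>,
      zero = (\<lambda>w. 0),
      add = (\<lambda>f g w. f w + g w),
      scale = (\<lambda>c f w. c * f w),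
      star = (\<lambda>f w. if w \<in> carrier M then cnj (f (\<tau> w)) else 0) \<rparr>"

definition cstar_seminorm :: "('a, 'z) star_algebra_scheme \<Rightarrow> ('a \<Rightarrow> real) \<Rightarrow> bool" where
  "cstar_seminorm R p \<longleftrightarrow>
    (\<forall>x\<in>carrier R. 0 \<le> p x) \<and>
    (\<forall>x\<in>carrier R. \<forall>y\<in>carrier R. p (x \<oplus>\<^bsub>R\<^esub> y) \<le> p x + p y) \<and>
    (\<forall>c. \<forall>x\<in>carrier R. p (scale R c x) = cmod c * p x) \<and>
    (\<forall>x\<in>carrier R. \<forall>y\<in>carrier R. p (x \<otimes>\<^bsub>R\<^esub> y) \<le> p x * p y) \<and>
    (\<forall>x\<in>carrier R. p (star R x \<otimes>\<^bsub>R\<^esub> x) = (p x)\<^sup>2)"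

text \<open>The largest C*-seminorm that vanishes on a set \<open>Z\<close> of relators. The supremum is over a nonempty
  set (it contains \<open>0\<close>); it is meaningful whenever it is bounded at every point, which is the case
  in both uses below.\<close>

definition universal_seminorm :: "('a, 'z) star_algebra_scheme \<Rightarrow> 'a set \<Rightarrow> 'a \<Rightarrow> real" where
  "universal_seminorm R Z x = Sup {p x | p. cstar_seminorm R p \<and> (\<forall>z\<in>Z. p z = 0)}"

text \<open>Separated completion of a *-algebra with respect to a C*-seminorm: Cauchy sequences modulo
  sequences whose difference is null.\<close>

definition cauchy_seqs :: "('a, 'z) star_algebra_scheme \<Rightarrow> ('a \<Rightarrow> real) \<Rightarrow> (nat \<Rightarrow> 'a) set" where
  "cauchy_seqs R p = {x. (\<forall>n. x n \<in> carrier R) \<and>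
     (\<forall>e>0. \<exists>M. \<forall>m\<ge>M. \<forall>n\<ge>M. p (x m \<ominus>\<^bsub>R\<^esub> x n) < e)}"

definition null_rel ::
    "('a, 'z) star_algebra_scheme \<Rightarrow> ('a \<Rightarrow> real) \<Rightarrow> ((nat \<Rightarrow> 'a) \<times> (nat \<Rightarrow> 'a)) set" where
  "null_rel R p = {(x, y). x \<in> cauchy_seqs R p \<and> y \<in> cauchy_seqs R p \<and>
     (\<lambda>n. p (x n \<ominus>\<^bsub>R\<^esub> y n)) \<longlonglongrightarrow> 0}"

definition class_rep :: "'a set \<Rightarrow> 'a" where
  "class_rep X = (SOME x. x \<in> X)"

definition cstar_completion ::
    "('a, 'z) star_algebra_scheme \<Rightarrow> ('a \<Rightarrow> real) \<Rightarrow> (nat \<Rightarrow> 'a) set cstar_algebra" where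
  "cstar_completion R p =
    \<lparr> carrier = cauchy_seqs R p // null_rel R p,
      mult = (\<lambda>X Y. null_rel R p `` {\<lambda>n. class_rep X n \<otimes>\<^bsub>R\<^esub> class_rep Y n}),
      one = null_rel R p `` {\<lambda>n. \<one>\<^bsub>R\<^esub>},
      zero = null_rel R p `` {\<lambda>n. \<zero>\<^bsub>R\<^esub>},
      add = (\<lambda>X Y. null_rel R p `` {\<lambda>n. class_rep X n \<oplus>\<^bsub>R\<^esub> class_rep Y n}),
      scale = (\<lambda>c X. null_rel R p `` {\<lambda>n. scale R c (class_rep X n)}),
      star = (\<lambda>X. null_rel R p `` {\<lambda>n. star R (class_rep X n)}),
      cnorm = (\<lambda>X. lim (\<lambda>n. p (class_rep X n))) \<rparr>"

definition universal_cstar ::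
    "('a, 'z) star_algebra_scheme \<Rightarrow> 'a set \<Rightarrow> (nat \<Rightarrow> 'a) set cstar_algebra" where
  "universal_cstar R Z = cstar_completion R (universal_seminorm R Z)"

text \<open>The canonical *-homomorphism from \<open>R\<close> to \<open>universal_cstar R Z\<close>.\<close>

definition universal_map :: "('a, 'z) star_algebra_scheme \<Rightarrow> 'a set \<Rightarrow> 'a \<Rightarrow> (nat \<Rightarrow> 'a) set" where
  "universal_map R Z x = null_rel R (universal_seminorm R Z) `` {\<lambda>n. x}"

datatype 'g letter = Gen 'g | Adj 'g

fun letter_adj :: "'g letter \<Rightarrow> 'g letter" where
  "letter_adj (Gen i) = Adj i"
| "letter_adj (Adj i) = Gen i"

definition word_monoid :: "'g letter list monoid" where
  "word_monoid = \<lparr> carrier = UNIV, mult = (@), one = [] \<rparr>"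

text \<open>The free unital *-algebra on a set of generators.\<close>

definition free_star_algebra :: "('g letter list \<Rightarrow> complex) star_algebra" where
  "free_star_algebra = star_monoid_algebra word_monoid (\<lambda>w. rev (map letter_adj w))"

definition free_gen :: "'g \<Rightarrow> 'g letter list \<Rightarrow> complex" where
  "free_gen i = point_mass [Gen i]"

text \<open>Relators saying that the generators \<open>s i\<close> are partial isometries with
  \<open>\<Sum>i. s i (s i)\<^sup>* = 1\<close> and \<open>(s i)\<^sup>* (s i) = \<Sum>j. A(i,j) s j (s j)\<^sup>*\<close>.\<close>

definition ck_relators :: "nat^'n^'n \<Rightarrow> ('n letter list \<Rightarrow> complex) set" where
  "ck_relators A =
    (let F = free_star_algebra; s = free_gen; range_proj = (\<lambda>i. s i \<otimes>\<^bsub>F\<^esub> star F (s i)) in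
      {range_proj i \<otimes>\<^bsub>F\<^esub> s i \<ominus>\<^bsub>F\<^esub> s i | i. True} \<union>
      {finsum F range_proj UNIV \<ominus>\<^bsub>F\<^esub> \<one>\<^bsub>F\<^esub>} \<union>
      {(star F (s i) \<otimes>\<^bsub>F\<^esub> s i) \<ominus>\<^bsub>F\<^esub>
         finsum F (\<lambda>j. scale F (of_nat (A $ i $ j)) (range_proj j)) UNIV | i. True})"

definition cuntz_krieger ::
    "nat^'n^'n \<Rightarrow> (nat \<Rightarrow> 'n letter list \<Rightarrow> complex) set cstar_algebra" where
  "cuntz_krieger A = universal_cstar free_star_algebra (ck_relators A)"

definition ck_gen :: "nat^'n^'n \<Rightarrow> 'n \<Rightarrow> (nat \<Rightarrow> 'n letter list \<Rightarrow> complex) set" where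
  "ck_gen A i = universal_map free_star_algebra (ck_relators A) (free_gen i)"

text \<open>The algebraic tensor product of \<open>P\<close> and \<open>Q\<close> is the quotient of the *-algebra of formal linear
  combinations of pairs \<open>(a, b)\<close> by the bilinearity relators. Hence its C*-seminorms are the
  C*-seminorms on formal combinations that vanish on these relators, and completing in the
  largest one yields the maximal C*-tensor product. Cuntz--Krieger algebras are nuclear, so for
  them there is only one C*-tensor product.\<close>

definition pair_star_algebra :: "('a, 'y) star_algebra_scheme \<Rightarrow> ('b, 'z) star_algebra_scheme \<Rightarrow>
    ('a \<times> 'b \<Rightarrow> complex) star_algebra" where
  "pair_star_algebra P Q = star_monoid_algebra (P \<times>\<times> Q) (map_prod (star P) (star Q))"

definition bilinear_relators :: "('a, 'y) star_algebra_scheme \<Rightarrow> ('b, 'z) star_algebra_scheme \<Rightarrow>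
    ('a \<times> 'b \<Rightarrow> complex) set" where
  "bilinear_relators P Q =
    {(\<lambda>w. point_mass (a \<oplus>\<^bsub>P\<^esub> a', b) w - point_mass (a, b) w - point_mass (a', b) w) | a a' b.
       a \<in> carrier P \<and> a' \<in> carrier P \<and> b \<in> carrier Q} \<union>
    {(\<lambda>w. point_mass (a, b \<oplus>\<^bsub>Q\<^esub> b') w - point_mass (a, b) w - point_mass (a, b') w) | a b b'.
       a \<in> carrier P \<and> b \<in> carrier Q \<and> b' \<in> carrier Q} \<union>
    {(\<lambda>w. point_mass (scale P c a, b) w - c * point_mass (a, b) w) | c a b.
       a \<in> carrier P \<and> b \<in> carrier Q} \<union>
    {(\<lambda>w. point_mass (a, scale Q c b) w - c * point_mass (a, b) w) | c a b.
       a \<in> carrier P \<and> b \<in> carrier Q}"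

definition cstar_tensor :: "('a, 'y) star_algebra_scheme \<Rightarrow> ('b, 'z) star_algebra_scheme \<Rightarrow>
    (nat \<Rightarrow> 'a \<times> 'b \<Rightarrow> complex) set cstar_algebra" where
  "cstar_tensor P Q = universal_cstar (pair_star_algebra P Q) (bilinear_relators P Q)"

definition elem_tensor :: "('a, 'y) star_algebra_scheme \<Rightarrow> ('b, 'z) star_algebra_scheme \<Rightarrow>
    'a \<Rightarrow> 'b \<Rightarrow> (nat \<Rightarrow> 'a \<times> 'b \<Rightarrow> complex) set" where
  "elem_tensor P Q a b =
    universal_map (pair_star_algebra P Q) (bilinear_relators P Q) (point_mass (a, b))"

definition corner :: "'a cstar_algebra \<Rightarrow> 'a \<Rightarrow> 'a cstar_algebra" where
  "corner R e = R \<lparr> carrier := {e \<otimes>\<^bsub>R\<^esub> a \<otimes>\<^bsub>R\<^esub> e | a. a \<in> carrier R}, one := e \<rparr>"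

type_synonym 'n ck_elem = "(nat \<Rightarrow> 'n letter list \<Rightarrow> complex) set"
type_synonym 'n ck_tensor_elem = "(nat \<Rightarrow> 'n ck_elem \<times> 'n ck_elem \<Rightarrow> complex) set"

definition ck_tensor :: "nat^'n^'n \<Rightarrow> 'n ck_tensor_elem cstar_algebra" where
  "ck_tensor A = cstar_tensor (cuntz_krieger (transpose A)) (cuntz_krieger A)"

definition ruelle_projection :: "nat^'n^'n \<Rightarrow> 'n ck_tensor_elem" where
  "ruelle_projection A =
    (let Ot = cuntz_krieger (transpose A); T = ck_gen (transpose A);
         O1 = cuntz_krieger A; S = ck_gen A in
      finsum (ck_tensor A)
        (\<lambda>i. elem_tensor Ot O1 (star Ot (T i) \<otimes>\<^bsub>Ot\<^esub> T i) (S i \<otimes>\<^bsub>O1\<^esub> star O1 (S i))) UNIV)"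

definition extended_ruelle :: "nat^'n^'n \<Rightarrow> 'n ck_tensor_elem cstar_algebra" where
  "extended_ruelle A = corner (ck_tensor A) (ruelle_projection A)"

text \<open>An \<open>m \<times> n\<close> matrix is a function of two indices that is zero outside \<open>{..<m} \<times> {..<n}\<close>.\<close>

definition matrices :: "('a, 'z) star_algebra_scheme \<Rightarrow> nat \<Rightarrow> nat \<Rightarrow> (nat \<Rightarrow> nat \<Rightarrow> 'a) set" where
  "matrices R m n = {x. (\<forall>i j. x i j \<in> carrier R) \<and> (\<forall>i j. \<not> (i < m \<and> j < n) \<longrightarrow> x i j = \<zero>\<^bsub>R\<^esub>)}"

text \<open>The argument \<open>n\<close> of \<open>matrix_mult\<close> is the inner dimension.\<close>

definition matrix_mult :: "('a, 'z) star_algebra_scheme \<Rightarrow> nat \<Rightarrow>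
    (nat \<Rightarrow> nat \<Rightarrow> 'a) \<Rightarrow> (nat \<Rightarrow> nat \<Rightarrow> 'a) \<Rightarrow> nat \<Rightarrow> nat \<Rightarrow> 'a" where
  "matrix_mult R n x y = (\<lambda>i j. finsum R (\<lambda>k. x i k \<otimes>\<^bsub>R\<^esub> y k j) {..<n})"

definition matrix_adj ::
    "('a, 'z) star_algebra_scheme \<Rightarrow> (nat \<Rightarrow> nat \<Rightarrow> 'a) \<Rightarrow> nat \<Rightarrow> nat \<Rightarrow> 'a" where
  "matrix_adj R x = (\<lambda>i j. star R (x j i))"

definition projections :: "('a, 'z) star_algebra_scheme \<Rightarrow> (nat \<times> (nat \<Rightarrow> nat \<Rightarrow> 'a)) set" where
  "projections R = {(n, p). p \<in> matrices R n n \<and> matrix_mult R n p p = p \<and> matrix_adj R p = p}"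

definition murray_von_neumann :: "('a, 'z) star_algebra_scheme \<Rightarrow>
    ((nat \<times> (nat \<Rightarrow> nat \<Rightarrow> 'a)) \<times> (nat \<times> (nat \<Rightarrow> nat \<Rightarrow> 'a))) set" where
  "murray_von_neumann R = {((m, p), (n, q)). (m, p) \<in> projections R \<and> (n, q) \<in> projections R \<and>
     (\<exists>v\<in>matrices R n m. matrix_mult R n (matrix_adj R v) v = p \<and>
                         matrix_mult R m v (matrix_adj R v) = q)}"

definition block_sum :: "('a, 'z) star_algebra_scheme \<Rightarrow> nat \<times> (nat \<Rightarrow> nat \<Rightarrow> 'a) \<Rightarrow>
    nat \<times> (nat \<Rightarrow> nat \<Rightarrow> 'a) \<Rightarrow> nat \<times> (nat \<Rightarrow> nat \<Rightarrow> 'a)" where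
  "block_sum R P Q = (case (P, Q) of ((m, p), (n, q)) \<Rightarrow>
     (m + n, \<lambda>i j. if i < m \<and> j < m then p i j
                   else if m \<le> i \<and> m \<le> j then q (i - m) (j - m) else \<zero>\<^bsub>R\<^esub>))"

definition proj_class ::
    "('a, 'z) star_algebra_scheme \<Rightarrow> nat \<times> (nat \<Rightarrow> nat \<Rightarrow> 'a) \<Rightarrow> (nat \<times> (nat \<Rightarrow> nat \<Rightarrow> 'a)) set" where
  "proj_class R P = murray_von_neumann R `` {P}"

definition proj_monoid ::
    "('a, 'z) star_algebra_scheme \<Rightarrow> (nat \<times> (nat \<Rightarrow> nat \<Rightarrow> 'a)) set monoid" where
  "proj_monoid R =
    \<lparr> carrier = projections R // murray_von_neumann R,
      mult = (\<lambda>X Y. proj_class R (block_sum R (class_rep X) (class_rep Y))),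
      one = proj_class R (0, \<lambda>i j. \<zero>\<^bsub>R\<^esub>) \<rparr>"

text \<open>Grothendieck group of a commutative monoid; the class of \<open>(a, b)\<close> is the formal difference
  \<open>a - b\<close>.\<close>

definition grothendieck_rel :: "('v, 'z) monoid_scheme \<Rightarrow> (('v \<times> 'v) \<times> ('v \<times> 'v)) set" where
  "grothendieck_rel V = {((a, b), (c, d)).
     a \<in> carrier V \<and> b \<in> carrier V \<and> c \<in> carrier V \<and> d \<in> carrier V \<and>
     (\<exists>e\<in>carrier V. a \<otimes>\<^bsub>V\<^esub> d \<otimes>\<^bsub>V\<^esub> e = c \<otimes>\<^bsub>V\<^esub> b \<otimes>\<^bsub>V\<^esub> e)}"

definition grothendieck :: "('v, 'z) monoid_scheme \<Rightarrow> ('v \<times> 'v) set monoid" where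
  "grothendieck V =
    \<lparr> carrier = (carrier V \<times> carrier V) // grothendieck_rel V,
      mult = (\<lambda>X Y. grothendieck_rel V ``
        {(fst (class_rep X) \<otimes>\<^bsub>V\<^esub> fst (class_rep Y), snd (class_rep X) \<otimes>\<^bsub>V\<^esub> snd (class_rep Y))}),
      one = grothendieck_rel V `` {(\<one>\<^bsub>V\<^esub>, \<one>\<^bsub>V\<^esub>)} \<rparr>"

type_synonym 'a K0_elem =
  "((nat \<times> (nat \<Rightarrow> nat \<Rightarrow> 'a)) set \<times> (nat \<times> (nat \<Rightarrow> nat \<Rightarrow> 'a)) set) set"

definition K0 :: "('a, 'z) star_algebra_scheme \<Rightarrow> 'a K0_elem monoid" where
  "K0 R = grothendieck (proj_monoid R)"

definition K0_unit :: "('a, 'z) star_algebra_scheme \<Rightarrow> 'a K0_elem" where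
  "K0_unit R = grothendieck_rel (proj_monoid R) ``
     {(proj_class R (1, \<lambda>i j. if i = 0 \<and> j = 0 then \<one>\<^bsub>R\<^esub> else \<zero>\<^bsub>R\<^esub>), \<one>\<^bsub>proj_monoid R\<^esub>)}"

definition zero_one_matrix :: "nat^'n^'n \<Rightarrow> bool" where
  "zero_one_matrix A \<longleftrightarrow> (\<forall>i j. A $ i $ j \<in> {0, 1})"

text \<open>Iterated \<open>**\<close> is the matrix power; \<open>^\<close> on vectors would be the componentwise one. Only positive
  powers count, so the \<open>1 \<times> 1\<close> zero matrix is not irreducible.\<close>

definition irreducible_matrix :: "nat^'n^'n \<Rightarrow> bool" where
  "irreducible_matrix A \<longleftrightarrow> (\<forall>i j. \<exists>k\<ge>1. 0 < (((**) A ^^ k) (mat 1)) $ i $ j)"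

definition is_permutation_matrix :: "nat^'n^'n \<Rightarrow> bool" where
  "is_permutation_matrix A \<longleftrightarrow> (\<exists>\<pi>. bij \<pi> \<and> (\<forall>i j. A $ i $ j = (if j = \<pi> i then 1 else 0)))"

definition markov_space :: "nat^'n^'n \<Rightarrow> (int \<Rightarrow> 'n) set" where
  "markov_space A = {x. \<forall>i. A $ x i $ x (i + 1) = 1}"

definition markov_topology :: "nat^'n^'n \<Rightarrow> (int \<Rightarrow> 'n) topology" where
  "markov_topology A =
    subtopology (product_topology (\<lambda>_. discrete_topology UNIV) UNIV) (markov_space A)"

definition bi_shift :: "(int \<Rightarrow> 'n) \<Rightarrow> int \<Rightarrow> 'n" where
  "bi_shift x = (\<lambda>i. x (i + 1))"

definition topologically_conjugate :: "nat^'n^'n \<Rightarrow> nat^'m^'m \<Rightarrow> bool" where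
  "topologically_conjugate A B \<longleftrightarrow>
    (\<exists>h. homeomorphic_map (markov_topology A) (markov_topology B) h \<and>
         (\<forall>x\<in>markov_space A. h (bi_shift x) = bi_shift (h x)))"

end

(* Code the points of a shift space X by a continuous map w to finitely many letters, so that the
   sequences of codes form a Markov shift; its transition matrix determines an extended Ruelle
   algebra. A conjugacy from X_A to X_B and its inverse are block codes. Reading off windows of
   coordinates of x and h x and enlarging or shrinking the windows one coordinate at a time
   connects the coding of X_A by x_0 with the coding of X_B by (h x)_0. Each step is an elementary
   equivalence A = CD, B = DC of 0-1 matrices.

   For such a pair there are *-homomorphisms between O_A and corners of O_B, prepending a letter to
   the recoded one-sided sequence, and the same for the transposed matrices on the left half. Their
   tensor product maps E_A to a projection equivalent to E_B, so it compresses to a *-homomorphism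
   of the extended Ruelle algebras; the round trip is inner, hence the map is bijective. The
   *-isomorphism induces the isomorphism of K_0 and preserves the unit.

   Universal C*-algebras enter only through their universal property: a *-homomorphism into a
   C*-algebra is contractive, and projections with sum 1 are orthogonal, both without any spectral
   theory. *)

theory Submission
  imports Defs
begin

section \<open>Star algebras\<close>

text \<open>An elementary equivalence need not make \<open>O_A\<close> and \<open>O_B\<close>
  isomorphic. It only maps each into a corner of the other: recoding a one-sided sequence moves its
  starting point by half a letter, so a first letter has to be invented, and different choices give
  different maps. The tensor product repairs this. Its two factors carry the two halves of a
  two-sided sequence, and \<open>E_A\<close> selects the pairs of halves that meet in an admissible
  edge \<open>i j\<close>. The state \<open>u\<close> between \<open>i\<close> and \<open>j\<close>
  is then determined, so the invented letters on both sides can be stripped and \<open>u\<close> put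
  in their place; this move is the partial isometry that joins the image of \<open>E_A\<close> to
  \<open>E_B\<close>. It is here that the entries of \<open>C D\<close> must be exactly 0 or 1: each
  admissible edge passes through one state only. A map that is not unital is regarded throughout as
  a unital map into a corner, so one notion of homomorphism suffices. Norms enter only in building
  homomorphisms out of universal algebras and in showing that generators determine them; bijectivity
  and the effect on K_0 are then pure algebra.\<close>

context abelian_monoid
begin

lemma finsum_in_carrier: "(\<And>i. i \<in> A \<Longrightarrow> f i \<in> carrier G) \<Longrightarrow> finsum G f A \<in> carrier G"
  by (rule finsum_closed) auto

lemma finsum_eqI: "A = B \<Longrightarrow> (\<And>i. i \<in> B \<Longrightarrow> g i \<in> carrier G) \<Longrightarrow> (\<And>i. i \<in> B \<Longrightarrow> f i = g i)
  \<Longrightarrow> finsum G f A = finsum G g B"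
  by (rule finsum_cong') auto

lemma finsum_support:
  assumes "finite B" "A \<subseteq> B" "\<And>i. i \<in> B - A \<Longrightarrow> f i = \<zero>" "\<And>i. i \<in> A \<Longrightarrow> f i \<in> carrier G"
  shows "finsum G f B = finsum G f A"
proof (rule add.finprod_mono_neutral_cong_right)
  show "f \<in> B \<rightarrow> carrier G"
  proof
    fix x assume "x \<in> B"
    then show "f x \<in> carrier G" using assms(3)[of x] assms(4)[of x] by (cases "x \<in> A") auto
  qed
qed (use assms in auto)

lemma finsum_restrict_set:
  assumes "finite B" "\<And>i. i \<in> B \<Longrightarrow> P i \<Longrightarrow> f i \<in> carrier G"
  shows "finsum G (\<lambda>i. if P i then f i else \<zero>) B = finsum G f {i\<in>B. P i}"
proof -
  have "finsum G (\<lambda>i. if P i then f i else \<zero>) B = finsum G (\<lambda>i. if P i then f i else \<zero>) {i\<in>B. P i}"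
    by (rule finsum_support) (use assms in auto)
  also have "\<dots> = finsum G f {i\<in>B. P i}"
    by (rule finsum_eqI) (use assms in auto)
  finally show ?thesis .
qed

lemma finsum_all_zero: "(\<And>i. i \<in> A \<Longrightarrow> f i = \<zero>) \<Longrightarrow> finsum G f A = \<zero>"
  by (rule add.finprod_one_eqI)

lemma finsum_single:
  assumes "finite A" "j \<in> A" "f j \<in> carrier G" "\<And>i. i \<in> A \<Longrightarrow> i \<noteq> j \<Longrightarrow> f i = \<zero>"
  shows "finsum G f A = f j"
proof -
  have "finsum G f A = finsum G f {j}"
    by (rule finsum_support) (use assms in auto)
  then show ?thesis using assms by simp
qed

lemma finsum_add:
  "(\<And>i. i \<in> A \<Longrightarrow> f i \<in> carrier G) \<Longrightarrow> (\<And>i. i \<in> A \<Longrightarrow> g i \<in> carrier G) \<Longrightarrow>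
   finsum G (\<lambda>i. f i \<oplus> g i) A = finsum G f A \<oplus> finsum G g A"
  by (rule finsum_addf) auto

lemma finsum_swap:
  assumes "finite A" "finite B" "\<And>i j. i \<in> A \<Longrightarrow> j \<in> B \<Longrightarrow> f i j \<in> carrier G"
  shows "finsum G (\<lambda>i. finsum G (f i) B) A = finsum G (\<lambda>j. finsum G (\<lambda>i. f i j) A) B"
  using assms(1,3)
proof (induction A rule: finite_induct)
  case empty then show ?case by simp
next
  case (insert a A)
  have "finsum G (\<lambda>i. finsum G (f i) B) (insert a A) =
      finsum G (f a) B \<oplus> finsum G (\<lambda>i. finsum G (f i) B) A"
    using insert by (auto intro!: finsum_insert finsum_in_carrier)
  also have "\<dots> = finsum G (f a) B \<oplus> finsum G (\<lambda>j. finsum G (\<lambda>i. f i j) A) B"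
    using insert by simp
  also have "\<dots> = finsum G (\<lambda>j. f a j \<oplus> finsum G (\<lambda>i. f i j) A) B"
    using insert by (intro finsum_add[symmetric]) (auto intro!: finsum_in_carrier)
  also have "\<dots> = finsum G (\<lambda>j. finsum G (\<lambda>i. f i j) (insert a A)) B"
    using insert by (intro finsum_eqI refl) (auto intro!: finsum_in_carrier)
  finally show ?case .
qed

lemma finsum_disjoint_union:
  assumes "finite A" "\<And>i. i \<in> A \<Longrightarrow> finite (B i)"
    "\<And>i j. i \<in> A \<Longrightarrow> j \<in> A \<Longrightarrow> i \<noteq> j \<Longrightarrow> B i \<inter> B j = {}"
    "\<And>i x. i \<in> A \<Longrightarrow> x \<in> B i \<Longrightarrow> f x \<in> carrier G"
  shows "finsum G f (\<Union>i\<in>A. B i) = finsum G (\<lambda>i. finsum G f (B i)) A"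
proof -
  have "finsum G f (\<Union>(B ` A)) = finsum G (\<lambda>i. finsum G f (B i)) A"
    by (rule add.finprod_UN_disjoint) (use assms in \<open>auto simp: pairwise_def disjnt_def\<close>)
  then show ?thesis by simp
qed

end

locale star_alg = ring R for R (structure) +
  assumes scale_closed [simp, intro]: "x \<in> carrier R \<Longrightarrow> scale R c x \<in> carrier R"
    and scale_add: "x \<in> carrier R \<Longrightarrow> y \<in> carrier R \<Longrightarrow> scale R c (x \<oplus> y) = scale R c x \<oplus> scale R c y"
    and add_scale: "x \<in> carrier R \<Longrightarrow> scale R (c + d) x = scale R c x \<oplus> scale R d x"
    and scale_scale [simp]: "x \<in> carrier R \<Longrightarrow> scale R c (scale R d x) = scale R (c * d) x"
    and scale_one [simp]: "x \<in> carrier R \<Longrightarrow> scale R 1 x = x"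
    and scale_mult_left: "x \<in> carrier R \<Longrightarrow> y \<in> carrier R \<Longrightarrow> scale R c x \<otimes> y = scale R c (x \<otimes> y)"
    and scale_mult_right: "x \<in> carrier R \<Longrightarrow> y \<in> carrier R \<Longrightarrow> x \<otimes> scale R c y = scale R c (x \<otimes> y)"
    and star_closed [simp, intro]: "x \<in> carrier R \<Longrightarrow> star R x \<in> carrier R"
    and star_star [simp]: "x \<in> carrier R \<Longrightarrow> star R (star R x) = x"
    and star_add: "x \<in> carrier R \<Longrightarrow> y \<in> carrier R \<Longrightarrow> star R (x \<oplus> y) = star R x \<oplus> star R y"
    and star_mult: "x \<in> carrier R \<Longrightarrow> y \<in> carrier R \<Longrightarrow> star R (x \<otimes> y) = star R y \<otimes> star R x"
    and star_scale: "x \<in> carrier R \<Longrightarrow> star R (scale R c x) = scale R (cnj c) (star R x)"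
begin

lemma finsum_mult_left:
  assumes "finite A" "a \<in> carrier R" "\<And>i. i \<in> A \<Longrightarrow> f i \<in> carrier R"
  shows "finsum R f A \<otimes> a = finsum R (\<lambda>i. f i \<otimes> a) A"
  by (rule finsum_ldistr) (use assms in auto)

lemma finsum_mult_right:
  assumes "finite A" "a \<in> carrier R" "\<And>i. i \<in> A \<Longrightarrow> f i \<in> carrier R"
  shows "a \<otimes> finsum R f A = finsum R (\<lambda>i. a \<otimes> f i) A"
  by (rule finsum_rdistr) (use assms in auto)

lemma finsum_mult_finsum:
  assumes "finite A" "finite B" "\<And>i. i \<in> A \<Longrightarrow> f i \<in> carrier R" "\<And>j. j \<in> B \<Longrightarrow> g j \<in> carrier R"
  shows "finsum R f A \<otimes> finsum R g B = finsum R (\<lambda>i. finsum R (\<lambda>j. f i \<otimes> g j) B) A"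
proof -
  have "finsum R f A \<otimes> finsum R g B = finsum R (\<lambda>i. f i \<otimes> finsum R g B) A"
    using assms by (intro finsum_mult_left) (auto intro!: finsum_in_carrier)
  also have "\<dots> = finsum R (\<lambda>i. finsum R (\<lambda>j. f i \<otimes> g j) B) A"
    using assms by (intro finsum_eqI refl finsum_mult_right) (auto intro!: finsum_in_carrier)
  finally show ?thesis .
qed

lemma add_cancel_zero: "x \<in> carrier R \<Longrightarrow> x \<oplus> x = x \<Longrightarrow> x = \<zero>"
  using add.l_cancel_one' by metis

lemma scale_zero [simp]: "scale R c \<zero> = \<zero>"
  by (rule add_cancel_zero) (auto simp flip: scale_add)

lemma zero_scale [simp]: "x \<in> carrier R \<Longrightarrow> scale R 0 x = \<zero>"
  by (rule add_cancel_zero) (auto simp flip: add_scale)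

lemma minus_scale: "x \<in> carrier R \<Longrightarrow> \<ominus> x = scale R (-1) x"
proof -
  assume x: "x \<in> carrier R"
  have "scale R (-1) x \<oplus> x = scale R (-1 + 1) x"
    using x by (simp only: add_scale scale_one)
  then show ?thesis using x by (intro minus_equality) auto
qed

lemma star_zero [simp]: "star R \<zero> = \<zero>"
  by (rule add_cancel_zero) (auto simp flip: star_add)

lemma star_one [simp]: "star R \<one> = \<one>"
  using star_mult[of "star R \<one>" \<one>] by auto

lemma star_minus: "x \<in> carrier R \<Longrightarrow> star R (\<ominus> x) = \<ominus> star R x"
  by (simp add: minus_scale star_scale)

lemma star_diff: "x \<in> carrier R \<Longrightarrow> y \<in> carrier R \<Longrightarrow> star R (x \<ominus> y) = star R x \<ominus> star R y"
  by (simp add: minus_eq star_add star_minus)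

lemma scale_minus: "x \<in> carrier R \<Longrightarrow> scale R c (\<ominus> x) = \<ominus> scale R c x"
  by (simp add: minus_scale)

lemma scale_diff: "x \<in> carrier R \<Longrightarrow> y \<in> carrier R \<Longrightarrow> scale R c (x \<ominus> y) = scale R c x \<ominus> scale R c y"
  by (simp add: minus_eq scale_add scale_minus)

lemma star_finsum:
  assumes "finite A" "\<And>i. i \<in> A \<Longrightarrow> f i \<in> carrier R"
  shows "star R (finsum R f A) = finsum R (\<lambda>i. star R (f i)) A"
  using assms
  by (induction A rule: finite_induct) (auto simp: Pi_def star_add finsum_in_carrier)

lemma scale_finsum:
  assumes "finite A" "\<And>i. i \<in> A \<Longrightarrow> f i \<in> carrier R"
  shows "scale R c (finsum R f A) = finsum R (\<lambda>i. scale R c (f i)) A"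
  using assms
  by (induction A rule: finite_induct) (auto simp: Pi_def scale_add finsum_in_carrier)

lemma sum_scale:
  assumes "finite A" "x \<in> carrier R"
  shows "scale R (\<Sum>i\<in>A. c i) x = finsum R (\<lambda>i. scale R (c i) x) A"
  using assms
  by (induction A rule: finite_induct) (auto simp: Pi_def add_scale finsum_in_carrier)

lemma diff_add_cancel: "x \<in> carrier R \<Longrightarrow> y \<in> carrier R \<Longrightarrow> z \<in> carrier R \<Longrightarrow>
   (x \<ominus> y) \<oplus> (y \<ominus> z) = x \<ominus> z"
  by (simp add: minus_eq a_assoc r_neg2 r_neg1)

lemma diff_eq_zero: "x \<in> carrier R \<Longrightarrow> y \<in> carrier R \<Longrightarrow> x \<ominus> y = \<zero> \<longleftrightarrow> x = y"
  by (metis a_inv_closed minus_eq minus_equality minus_minus r_neg)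

lemma diff_self: "x \<in> carrier R \<Longrightarrow> x \<ominus> x = \<zero>"
  by (simp add: diff_eq_zero)

lemma add_diff_add: "x \<in> carrier R \<Longrightarrow> y \<in> carrier R \<Longrightarrow> x' \<in> carrier R \<Longrightarrow> y' \<in> carrier R \<Longrightarrow>
   (x \<oplus> y) \<ominus> (x' \<oplus> y') = (x \<ominus> x') \<oplus> (y \<ominus> y')"
  by algebra

lemma mult_diff_mult: "x \<in> carrier R \<Longrightarrow> y \<in> carrier R \<Longrightarrow> x' \<in> carrier R \<Longrightarrow> y' \<in> carrier R \<Longrightarrow>
   (x \<otimes> y) \<ominus> (x' \<otimes> y') = (x \<ominus> x') \<otimes> y \<oplus> x' \<otimes> (y \<ominus> y')"
  by algebra

lemma diff_swap: "x \<in> carrier R \<Longrightarrow> y \<in> carrier R \<Longrightarrow> \<ominus> (x \<ominus> y) = y \<ominus> x"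
  by algebra

end

text \<open>Preservation of the unit is part of the notion. A map under which the unit goes to a
  smaller projection is treated as a homomorphism into the corner of that projection.\<close>

definition star_hom :: "('a, 'y) star_algebra_scheme \<Rightarrow> ('b, 'z) star_algebra_scheme \<Rightarrow> ('a \<Rightarrow> 'b) \<Rightarrow> bool" where
  "star_hom R S f \<longleftrightarrow>
    (\<forall>x\<in>carrier R. f x \<in> carrier S) \<and>
    (\<forall>x\<in>carrier R. \<forall>y\<in>carrier R. f (x \<oplus>\<^bsub>R\<^esub> y) = f x \<oplus>\<^bsub>S\<^esub> f y) \<and>
    (\<forall>x\<in>carrier R. \<forall>y\<in>carrier R. f (x \<otimes>\<^bsub>R\<^esub> y) = f x \<otimes>\<^bsub>S\<^esub> f y) \<and>
    (\<forall>c. \<forall>x\<in>carrier R. f (scale R c x) = scale S c (f x)) \<and>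
    (\<forall>x\<in>carrier R. f (star R x) = star S (f x)) \<and>
    f \<one>\<^bsub>R\<^esub> = \<one>\<^bsub>S\<^esub>"

locale star_hom_pair = R: star_alg R + S: star_alg S
  for R :: "('a, 'y) star_algebra_scheme" and S :: "('b, 'z) star_algebra_scheme" +
  fixes f
  assumes hom: "star_hom R S f"
begin

lemma closed [simp, intro]: "x \<in> carrier R \<Longrightarrow> f x \<in> carrier S"
  and add: "x \<in> carrier R \<Longrightarrow> y \<in> carrier R \<Longrightarrow> f (x \<oplus>\<^bsub>R\<^esub> y) = f x \<oplus>\<^bsub>S\<^esub> f y"
  and mult: "x \<in> carrier R \<Longrightarrow> y \<in> carrier R \<Longrightarrow> f (x \<otimes>\<^bsub>R\<^esub> y) = f x \<otimes>\<^bsub>S\<^esub> f y"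
  and scale: "x \<in> carrier R \<Longrightarrow> f (scale R c x) = scale S c (f x)"
  and star: "x \<in> carrier R \<Longrightarrow> f (star R x) = star S (f x)"
  and one: "f \<one>\<^bsub>R\<^esub> = \<one>\<^bsub>S\<^esub>"
  using hom unfolding star_hom_def by auto

lemma zero: "f \<zero>\<^bsub>R\<^esub> = \<zero>\<^bsub>S\<^esub>"
  by (rule S.add_cancel_zero) (auto simp flip: add)

lemma diff: "x \<in> carrier R \<Longrightarrow> y \<in> carrier R \<Longrightarrow> f (x \<ominus>\<^bsub>R\<^esub> y) = f x \<ominus>\<^bsub>S\<^esub> f y"
  by (simp add: R.minus_eq S.minus_eq add R.minus_scale S.minus_scale scale)

lemma finsum: "finite A \<Longrightarrow> (\<And>i. i \<in> A \<Longrightarrow> g i \<in> carrier R) \<Longrightarrow>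
   f (finsum R g A) = finsum S (\<lambda>i. f (g i)) A"
  by (induction A rule: finite_induct) (auto simp: Pi_def add zero R.finsum_in_carrier)

end

lemma star_hom_comp: "star_hom R S f \<Longrightarrow> star_hom S T g \<Longrightarrow> star_hom R T (\<lambda>x. g (f x))"
  unfolding star_hom_def by auto

section \<open>Monoid algebras\<close>

locale star_monoid = monoid M for M (structure) +
  fixes \<tau> :: "'a \<Rightarrow> 'a"
  assumes \<tau>_closed [simp, intro]: "u \<in> carrier M \<Longrightarrow> \<tau> u \<in> carrier M"
    and \<tau>_inv [simp]: "u \<in> carrier M \<Longrightarrow> \<tau> (\<tau> u) = u"
    and \<tau>_mult: "u \<in> carrier M \<Longrightarrow> v \<in> carrier M \<Longrightarrow> \<tau> (u \<otimes> v) = \<tau> v \<otimes> \<tau> u"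
begin

abbreviation "S \<equiv> star_monoid_algebra M \<tau>"

lemma \<tau>_one [simp]: "\<tau> \<one> = \<one>"
  using \<tau>_mult[of "\<tau> \<one>" \<one>] by auto

lemma carrier_S: "f \<in> carrier S \<longleftrightarrow> finite {w. f w \<noteq> 0} \<and> {w. f w \<noteq> 0} \<subseteq> carrier M"
  by (simp add: star_monoid_algebra_def)

lemma S_add: "f \<oplus>\<^bsub>S\<^esub> g = (\<lambda>w. f w + g w)" and S_zero: "\<zero>\<^bsub>S\<^esub> = (\<lambda>w. 0)"
  and S_one: "\<one>\<^bsub>S\<^esub> = point_mass \<one>" and S_scale: "scale S c f = (\<lambda>w. c * f w)"
  and S_star: "star S f = (\<lambda>w. if w \<in> carrier M then cnj (f (\<tau> w)) else 0)"
  by (simp_all add: star_monoid_algebra_def)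

text \<open>The convolution may be summed over any finite sets that contain the supports. This lets
  both sides of an identity be summed over one index set.\<close>

lemma S_mult:
  assumes "finite U" "finite V" "{w. f w \<noteq> 0} \<subseteq> U" "{w. g w \<noteq> 0} \<subseteq> V"
  shows "(f \<otimes>\<^bsub>S\<^esub> g) w = (\<Sum>u\<in>U. \<Sum>v\<in>V. if u \<otimes> v = w then f u * g v else 0)"
proof -
  have "(f \<otimes>\<^bsub>S\<^esub> g) w = (\<Sum>(u, v) \<in> {(u, v). f u \<noteq> 0 \<and> g v \<noteq> 0 \<and> u \<otimes> v = w}. f u * g v)"
    by (simp add: star_monoid_algebra_def)
  also have "\<dots> = (\<Sum>(u, v) \<in> U \<times> V. if u \<otimes> v = w then f u * g v else 0)"
    using assms by (intro sum.mono_neutral_cong_left) (auto split: if_splits)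
  also have "\<dots> = (\<Sum>u\<in>U. \<Sum>v\<in>V. if u \<otimes> v = w then f u * g v else 0)"
    by (simp add: sum.cartesian_product)
  finally show ?thesis .
qed

lemma S_mult_supp:
  assumes "f \<in> carrier S" "g \<in> carrier S"
  shows "{w. (f \<otimes>\<^bsub>S\<^esub> g) w \<noteq> 0} \<subseteq> (\<lambda>(u, v). u \<otimes> v) ` ({w. f w \<noteq> 0} \<times> {w. g w \<noteq> 0})"
proof
  fix w assume "w \<in> {w. (f \<otimes>\<^bsub>S\<^esub> g) w \<noteq> 0}"
  then have "(\<Sum>u\<in>{w. f w \<noteq> 0}. \<Sum>v\<in>{w. g w \<noteq> 0}. if u \<otimes> v = w then f u * g v else 0) \<noteq> 0"
    using assms S_mult[of "{w. f w \<noteq> 0}" "{w. g w \<noteq> 0}" f g w] by (auto simp: carrier_S)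
  then obtain u where "u \<in> {w. f w \<noteq> 0}" "(\<Sum>v\<in>{w. g w \<noteq> 0}. if u \<otimes> v = w then f u * g v else 0) \<noteq> 0"
    using sum.not_neutral_contains_not_neutral by blast
  then obtain v where "v \<in> {w. g w \<noteq> 0}" "(if u \<otimes> v = w then f u * g v else 0) \<noteq> 0"
    using sum.not_neutral_contains_not_neutral by blast
  then show "w \<in> (\<lambda>(u, v). u \<otimes> v) ` ({w. f w \<noteq> 0} \<times> {w. g w \<noteq> 0})"
    using \<open>u \<in> _\<close> by (auto split: if_splits)
qed

lemma S_mult_closed: "f \<in> carrier S \<Longrightarrow> g \<in> carrier S \<Longrightarrow> f \<otimes>\<^bsub>S\<^esub> g \<in> carrier S"
proof -
  assume fg: "f \<in> carrier S" "g \<in> carrier S"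
  have "finite {w. (f \<otimes>\<^bsub>S\<^esub> g) w \<noteq> 0}"
    by (rule finite_subset[OF S_mult_supp]) (use fg in \<open>auto simp: carrier_S\<close>)
  then show ?thesis using S_mult_supp[OF fg] fg by (fastforce simp: carrier_S)
qed

lemma point_mass_closed [simp, intro]: "u \<in> carrier M \<Longrightarrow> point_mass u \<in> carrier S"
  by (auto simp: carrier_S point_mass_def)

lemma S_add_closed: "f \<in> carrier S \<Longrightarrow> g \<in> carrier S \<Longrightarrow> f \<oplus>\<^bsub>S\<^esub> g \<in> carrier S"
proof -
  assume fg: "f \<in> carrier S" "g \<in> carrier S"
  have "{w. f w + g w \<noteq> 0} \<subseteq> {w. f w \<noteq> 0} \<union> {w. g w \<noteq> 0}" by auto
  then show ?thesis using fg unfolding carrier_S S_add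
    by (meson finite_Un finite_subset le_sup_iff order_trans)
qed

lemma S_star_closed: "f \<in> carrier S \<Longrightarrow> star S f \<in> carrier S"
proof -
  assume f: "f \<in> carrier S"
  have "{w. star S f w \<noteq> 0} \<subseteq> \<tau> ` {w. f w \<noteq> 0}"
  proof
    fix w assume "w \<in> {w. star S f w \<noteq> 0}"
    then have "w \<in> carrier M" "f (\<tau> w) \<noteq> 0" by (auto simp: S_star split: if_splits)
    then have "w = \<tau> (\<tau> w)" by simp
    then show "w \<in> \<tau> ` {w. f w \<noteq> 0}" using \<open>f (\<tau> w) \<noteq> 0\<close> by blast
  qed
  then have "finite {w. star S f w \<noteq> 0}" using f by (auto simp: carrier_S intro: finite_subset)
  then show ?thesis by (auto simp: carrier_S S_star split: if_splits)
qed

lemma S_mult_assoc: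
  assumes "f \<in> carrier S" "g \<in> carrier S" "h \<in> carrier S"
  shows "(f \<otimes>\<^bsub>S\<^esub> g) \<otimes>\<^bsub>S\<^esub> h = f \<otimes>\<^bsub>S\<^esub> (g \<otimes>\<^bsub>S\<^esub> h)"
proof
  fix w
  let ?F = "{w. f w \<noteq> 0}" and ?G = "{w. g w \<noteq> 0}" and ?H = "{w. h w \<noteq> 0}"
  let ?m = "\<lambda>(u, v). u \<otimes> v"
  have fin [simp]: "finite ?F" "finite ?G" "finite ?H" using assms by (auto simp: carrier_S)
  have "((f \<otimes>\<^bsub>S\<^esub> g) \<otimes>\<^bsub>S\<^esub> h) w =
    (\<Sum>a\<in>?m ` (?F \<times> ?G). \<Sum>x\<in>?H. if a \<otimes> x = w then (f \<otimes>\<^bsub>S\<^esub> g) a * h x else 0)"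
    by (rule S_mult) (use S_mult_supp[of f g] assms in auto)
  also have "\<dots> = (\<Sum>a\<in>?m ` (?F \<times> ?G). \<Sum>x\<in>?H. \<Sum>u\<in>?F. \<Sum>v\<in>?G.
      if u \<otimes> v = a then (if a \<otimes> x = w then f u * g v * h x else 0) else 0)"
    by (intro sum.cong refl)
      (subst S_mult[of ?F ?G f g], auto simp: sum_distrib_right intro!: sum.cong sum.neutral)
  also have "\<dots> = (\<Sum>x\<in>?H. \<Sum>a\<in>?m ` (?F \<times> ?G). \<Sum>u\<in>?F. \<Sum>v\<in>?G.
      if u \<otimes> v = a then (if a \<otimes> x = w then f u * g v * h x else 0) else 0)"
    by (rule sum.swap)
  also have "\<dots> = (\<Sum>x\<in>?H. \<Sum>u\<in>?F. \<Sum>a\<in>?m ` (?F \<times> ?G). \<Sum>v\<in>?G.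
      if u \<otimes> v = a then (if a \<otimes> x = w then f u * g v * h x else 0) else 0)"
    by (intro sum.cong refl sum.swap)
  also have "\<dots> = (\<Sum>x\<in>?H. \<Sum>u\<in>?F. \<Sum>v\<in>?G. \<Sum>a\<in>?m ` (?F \<times> ?G).
      if u \<otimes> v = a then (if a \<otimes> x = w then f u * g v * h x else 0) else 0)"
    by (intro sum.cong refl sum.swap)
  \<comment> \<open>For fixed \<open>u\<close> and \<open>v\<close> exactly one intermediate product
    \<open>a\<close> contributes, so the sum over \<open>a\<close> collapses.\<close>
  also have "\<dots> = (\<Sum>x\<in>?H. \<Sum>u\<in>?F. \<Sum>v\<in>?G. if (u \<otimes> v) \<otimes> x = w then f u * g v * h x else 0)"
    by (intro sum.cong refl) (subst sum.delta', auto)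
  also have "\<dots> = (\<Sum>u\<in>?F. \<Sum>x\<in>?H. \<Sum>v\<in>?G. if (u \<otimes> v) \<otimes> x = w then f u * g v * h x else 0)"
    by (rule sum.swap)
  also have "\<dots> = (\<Sum>u\<in>?F. \<Sum>v\<in>?G. \<Sum>x\<in>?H. if u \<otimes> (v \<otimes> x) = w then f u * (g v * h x) else 0)"
  proof (rule sum.cong[OF refl])
    fix u assume u: "u \<in> ?F"
    show "(\<Sum>x\<in>?H. \<Sum>v\<in>?G. if (u \<otimes> v) \<otimes> x = w then f u * g v * h x else 0) =
      (\<Sum>v\<in>?G. \<Sum>x\<in>?H. if u \<otimes> (v \<otimes> x) = w then f u * (g v * h x) else 0)"
      apply (subst sum.swap)
      apply (intro sum.cong refl)
      subgoal for v x
        using m_assoc[of u v x] u assms by (auto simp: carrier_S subset_iff)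
      done
  qed
  finally have 1: "((f \<otimes>\<^bsub>S\<^esub> g) \<otimes>\<^bsub>S\<^esub> h) w =
     (\<Sum>u\<in>?F. \<Sum>v\<in>?G. \<Sum>x\<in>?H. if u \<otimes> (v \<otimes> x) = w then f u * (g v * h x) else 0)" .
  have "(f \<otimes>\<^bsub>S\<^esub> (g \<otimes>\<^bsub>S\<^esub> h)) w =
    (\<Sum>u\<in>?F. \<Sum>a\<in>?m ` (?G \<times> ?H). if u \<otimes> a = w then f u * (g \<otimes>\<^bsub>S\<^esub> h) a else 0)"
    by (rule S_mult) (use S_mult_supp[of g h] assms in auto)
  also have "\<dots> = (\<Sum>u\<in>?F. \<Sum>a\<in>?m ` (?G \<times> ?H). \<Sum>v\<in>?G. \<Sum>x\<in>?H.
      if v \<otimes> x = a then (if u \<otimes> a = w then f u * (g v * h x) else 0) else 0)"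
    by (intro sum.cong refl)
      (subst S_mult[of ?G ?H g h], auto simp: sum_distrib_left intro!: sum.cong sum.neutral)
  also have "\<dots> = (\<Sum>u\<in>?F. \<Sum>v\<in>?G. \<Sum>a\<in>?m ` (?G \<times> ?H). \<Sum>x\<in>?H.
      if v \<otimes> x = a then (if u \<otimes> a = w then f u * (g v * h x) else 0) else 0)"
    by (intro sum.cong refl sum.swap)
  also have "\<dots> = (\<Sum>u\<in>?F. \<Sum>v\<in>?G. \<Sum>x\<in>?H. \<Sum>a\<in>?m ` (?G \<times> ?H).
      if v \<otimes> x = a then (if u \<otimes> a = w then f u * (g v * h x) else 0) else 0)"
    by (intro sum.cong refl sum.swap)
  also have "\<dots> = (\<Sum>u\<in>?F. \<Sum>v\<in>?G. \<Sum>x\<in>?H. if u \<otimes> (v \<otimes> x) = w then f u * (g v * h x) else 0)"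
    by (intro sum.cong refl) (subst sum.delta', auto)
  finally show "((f \<otimes>\<^bsub>S\<^esub> g) \<otimes>\<^bsub>S\<^esub> h) w = (f \<otimes>\<^bsub>S\<^esub> (g \<otimes>\<^bsub>S\<^esub> h)) w"
    using 1 by simp
qed

lemma S_mult_add_right:
  assumes "f \<in> carrier S" "g \<in> carrier S" "h \<in> carrier S"
  shows "f \<otimes>\<^bsub>S\<^esub> (g \<oplus>\<^bsub>S\<^esub> h) = f \<otimes>\<^bsub>S\<^esub> g \<oplus>\<^bsub>S\<^esub> f \<otimes>\<^bsub>S\<^esub> h"
proof
  fix w
  let ?F = "{w. f w \<noteq> 0}" and ?G = "{w. g w \<noteq> 0} \<union> {w. h w \<noteq> 0}"
  show "(f \<otimes>\<^bsub>S\<^esub> (g \<oplus>\<^bsub>S\<^esub> h)) w = (f \<otimes>\<^bsub>S\<^esub> g \<oplus>\<^bsub>S\<^esub> f \<otimes>\<^bsub>S\<^esub> h) w"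
    unfolding S_add
    by (subst (1 2 3) S_mult[of ?F ?G])
      (use assms in \<open>auto simp: carrier_S distrib_left simp flip: sum.distrib intro!: sum.cong\<close>)
qed

lemma S_mult_add_left:
  assumes "f \<in> carrier S" "g \<in> carrier S" "h \<in> carrier S"
  shows "(g \<oplus>\<^bsub>S\<^esub> h) \<otimes>\<^bsub>S\<^esub> f = g \<otimes>\<^bsub>S\<^esub> f \<oplus>\<^bsub>S\<^esub> h \<otimes>\<^bsub>S\<^esub> f"
proof
  fix w
  let ?F = "{w. f w \<noteq> 0}" and ?G = "{w. g w \<noteq> 0} \<union> {w. h w \<noteq> 0}"
  show "((g \<oplus>\<^bsub>S\<^esub> h) \<otimes>\<^bsub>S\<^esub> f) w = (g \<otimes>\<^bsub>S\<^esub> f \<oplus>\<^bsub>S\<^esub> h \<otimes>\<^bsub>S\<^esub> f) w"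
    unfolding S_add
    by (subst (1 2 3) S_mult[of ?G ?F])
      (use assms in \<open>auto simp: carrier_S distrib_right simp flip: sum.distrib intro!: sum.cong\<close>)
qed

lemma S_one_mult: "f \<in> carrier S \<Longrightarrow> \<one>\<^bsub>S\<^esub> \<otimes>\<^bsub>S\<^esub> f = f"
proof
  fix w assume f: "f \<in> carrier S"
  let ?F = "{w. f w \<noteq> 0}"
  have "(\<one>\<^bsub>S\<^esub> \<otimes>\<^bsub>S\<^esub> f) w = (\<Sum>v\<in>?F. if \<one> \<otimes> v = w then f v else 0)"
    by (subst S_mult[of "{\<one>}" ?F]) (use f in \<open>auto simp: carrier_S S_one point_mass_def intro!: sum.cong\<close>)
  also have "\<dots> = (\<Sum>v\<in>?F. if v = w then f v else 0)"
    using f by (intro sum.cong) (auto simp: carrier_S subset_iff)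
  also have "\<dots> = f w" using f by (subst sum.delta) (auto simp: carrier_S)
  finally show "(\<one>\<^bsub>S\<^esub> \<otimes>\<^bsub>S\<^esub> f) w = f w" .
qed

lemma S_mult_one: "f \<in> carrier S \<Longrightarrow> f \<otimes>\<^bsub>S\<^esub> \<one>\<^bsub>S\<^esub> = f"
proof
  fix w assume f: "f \<in> carrier S"
  let ?F = "{w. f w \<noteq> 0}"
  have "(f \<otimes>\<^bsub>S\<^esub> \<one>\<^bsub>S\<^esub>) w = (\<Sum>v\<in>?F. if v \<otimes> \<one> = w then f v else 0)"
    by (subst S_mult[of ?F "{\<one>}"]) (use f in \<open>auto simp: carrier_S S_one point_mass_def intro!: sum.cong\<close>)
  also have "\<dots> = (\<Sum>v\<in>?F. if v = w then f v else 0)"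
    using f by (intro sum.cong) (auto simp: carrier_S subset_iff)
  also have "\<dots> = f w" using f by (subst sum.delta) (auto simp: carrier_S)
  finally show "(f \<otimes>\<^bsub>S\<^esub> \<one>\<^bsub>S\<^esub>) w = f w" .
qed

lemma S_star_mult:
  assumes "f \<in> carrier S" "g \<in> carrier S"
  shows "star S (f \<otimes>\<^bsub>S\<^esub> g) = star S g \<otimes>\<^bsub>S\<^esub> star S f"
proof
  fix w
  let ?F = "{w. f w \<noteq> 0}" and ?G = "{w. g w \<noteq> 0}"
  have fin [simp]: "finite ?F" "finite ?G" using assms by (auto simp: carrier_S)
  have inj: "inj_on \<tau> ?F" "inj_on \<tau> ?G"
    using assms by (auto simp: carrier_S intro!: inj_on_inverseI[where g=\<tau>])
  have supp: "{w. star S h w \<noteq> 0} \<subseteq> \<tau> ` {w. h w \<noteq> 0}" for h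
  proof
    fix w assume "w \<in> {w. star S h w \<noteq> 0}"
    then have "w \<in> carrier M" "h (\<tau> w) \<noteq> 0" by (auto simp: S_star split: if_splits)
    then have "w = \<tau> (\<tau> w)" by simp
    then show "w \<in> \<tau> ` {w. h w \<noteq> 0}" using \<open>h (\<tau> w) \<noteq> 0\<close> by blast
  qed
  have "(star S g \<otimes>\<^bsub>S\<^esub> star S f) w =
    (\<Sum>u\<in>\<tau> ` ?G. \<Sum>v\<in>\<tau> ` ?F. if u \<otimes> v = w then star S g u * star S f v else 0)"
    by (rule S_mult) (use supp in auto)
  also have "\<dots> = (\<Sum>u\<in>?G. \<Sum>v\<in>?F. if \<tau> u \<otimes> \<tau> v = w then cnj (g u) * cnj (f v) else 0)"
    using assms by (simp add: sum.reindex inj) (intro sum.cong refl, auto simp: S_star carrier_S subset_iff)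
  also have "\<dots> = (\<Sum>v\<in>?F. \<Sum>u\<in>?G. if \<tau> u \<otimes> \<tau> v = w then cnj (g u) * cnj (f v) else 0)"
    by (rule sum.swap)
  also have "\<dots> = star S (f \<otimes>\<^bsub>S\<^esub> g) w"
  proof (cases "w \<in> carrier M")
    case True
    have "star S (f \<otimes>\<^bsub>S\<^esub> g) w = (\<Sum>v\<in>?F. \<Sum>u\<in>?G. if v \<otimes> u = \<tau> w then cnj (f v * g u) else 0)"
      using True by (simp add: S_star S_mult[of ?F ?G] if_distrib[of cnj] cong: if_cong)
    also have "\<dots> = (\<Sum>v\<in>?F. \<Sum>u\<in>?G. if \<tau> u \<otimes> \<tau> v = w then cnj (g u) * cnj (f v) else 0)"
    proof (intro sum.cong refl)
      fix v u assume "v \<in> ?F" "u \<in> ?G"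
      then have c: "v \<in> carrier M" "u \<in> carrier M" using assms by (auto simp: carrier_S)
      have "v \<otimes> u = \<tau> w \<longleftrightarrow> \<tau> u \<otimes> \<tau> v = w"
        using c True by (metis \<tau>_inv \<tau>_mult m_closed)
      then show "(if v \<otimes> u = \<tau> w then cnj (f v * g u) else 0) =
         (if \<tau> u \<otimes> \<tau> v = w then cnj (g u) * cnj (f v) else 0)" by simp
    qed
    finally show ?thesis by simp
  next
    case False
    have "(\<Sum>v\<in>?F. \<Sum>u\<in>?G. if \<tau> u \<otimes> \<tau> v = w then cnj (g u) * cnj (f v) else 0) = 0"
      using assms False by (intro sum.neutral ballI) (auto simp: carrier_S subset_iff)
    then show ?thesis using False by (simp add: S_star)
  qed
  finally show "star S (f \<otimes>\<^bsub>S\<^esub> g) w = (star S g \<otimes>\<^bsub>S\<^esub> star S f) w" by simp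
qed

lemma S_scale_closed: "f \<in> carrier S \<Longrightarrow> scale S c f \<in> carrier S"
proof -
  assume f: "f \<in> carrier S"
  have "{w. c * f w \<noteq> 0} \<subseteq> {w. f w \<noteq> 0}" by auto
  then show ?thesis using f unfolding carrier_S S_scale by (meson finite_subset order_trans)
qed

lemma S_scale_mult_left: "f \<in> carrier S \<Longrightarrow> g \<in> carrier S \<Longrightarrow>
   scale S c f \<otimes>\<^bsub>S\<^esub> g = scale S c (f \<otimes>\<^bsub>S\<^esub> g)"
  unfolding S_scale
  by (rule ext, subst (1 2) S_mult[of "{w. f w \<noteq> 0}" "{w. g w \<noteq> 0}"])
    (auto simp: carrier_S sum_distrib_left intro!: sum.cong)

lemma S_scale_mult_right: "f \<in> carrier S \<Longrightarrow> g \<in> carrier S \<Longrightarrow>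
   f \<otimes>\<^bsub>S\<^esub> scale S c g = scale S c (f \<otimes>\<^bsub>S\<^esub> g)"
  unfolding S_scale
  by (rule ext, subst (1 2) S_mult[of "{w. f w \<noteq> 0}" "{w. g w \<noteq> 0}"])
    (auto simp: carrier_S sum_distrib_left intro!: sum.cong)

lemma star_alg_S: "star_alg S"
proof -
  have "abelian_group S"
  proof (rule abelian_groupI)
    fix x assume x: "x \<in> carrier S"
    show "\<exists>y\<in>carrier S. y \<oplus>\<^bsub>S\<^esub> x = \<zero>\<^bsub>S\<^esub>"
      by (rule bexI[of _ "scale S (-1) x"]) (use x in \<open>auto simp: S_add S_zero S_scale_closed, auto simp: S_scale\<close>)
  next
    show "\<zero>\<^bsub>S\<^esub> \<in> carrier S" by (simp add: carrier_S S_zero)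
  qed (simp_all only: S_add_closed, simp_all add: S_add S_zero algebra_simps)
  moreover have "monoid S"
    by (rule monoidI) (auto simp: S_mult_closed S_mult_assoc S_one_mult S_mult_one, auto simp: S_one)
  ultimately have "ring S"
    by (rule ringI) (auto simp: S_mult_add_left S_mult_add_right)
  moreover have "star_alg_axioms S"
  proof
    fix x assume "x \<in> carrier S"
    then show "star S (star S x) = x"
      by (intro ext) (auto simp: S_star carrier_S subset_iff)
  qed (auto simp: S_scale_closed S_scale_mult_left S_scale_mult_right S_star_closed S_star_mult,
       auto simp: S_scale S_add S_star algebra_simps)
  ultimately show ?thesis by (rule star_alg.intro)
qed

sublocale S: star_alg S
  by (rule star_alg_S)

lemma point_mass_mult: "u \<in> carrier M \<Longrightarrow> v \<in> carrier M \<Longrightarrow>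
    point_mass u \<otimes>\<^bsub>S\<^esub> point_mass v = point_mass (u \<otimes> v)"
  by (rule ext, subst S_mult[of "{u}" "{v}"]) (auto simp: point_mass_def)

lemma point_mass_star: "u \<in> carrier M \<Longrightarrow> star S (point_mass u) = point_mass (\<tau> u)"
  by (rule ext) (auto simp: S_star point_mass_def)

lemma finsum_apply:
  "finite A \<Longrightarrow> (\<And>i. i \<in> A \<Longrightarrow> g i \<in> carrier S) \<Longrightarrow> finsum S g A w = (\<Sum>i\<in>A. g i w)"
  by (induction A rule: finite_induct) (auto simp: Pi_def S_zero S_add)

text \<open>With finite support this is a finite sum, so linear maps, homomorphisms and seminorms
  are controlled by their values on point masses.\<close>

lemma point_mass_expansion:
  assumes "f \<in> carrier S"
  shows "f = finsum S (\<lambda>u. scale S (f u) (point_mass u)) {u. f u \<noteq> 0}"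
proof
  fix w
  have "finsum S (\<lambda>u. scale S (f u) (point_mass u)) {u. f u \<noteq> 0} w
     = (\<Sum>u\<in>{u. f u \<noteq> 0}. f u * point_mass u w)"
    using assms by (subst finsum_apply) (auto intro!: S_scale_closed simp: carrier_S[of f], simp add: S_scale)
  also have "\<dots> = (\<Sum>u\<in>{u. f u \<noteq> 0}. if w = u then f u else 0)"
    by (intro sum.cong) (auto simp: point_mass_def)
  also have "\<dots> = f w" using assms by (subst sum.delta') (auto simp: carrier_S)
  finally show "f w = finsum S (\<lambda>u. scale S (f u) (point_mass u)) {u. f u \<noteq> 0} w" by simp
qed

end

text \<open>The universal property of the monoid algebra: a representation of the monoid that
  respects the involutions extends linearly by \<open>lin\<close>. It is applied to words in
  generators and to pairs \<open>(a, b)\<close> of a tensor product.\<close>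

locale star_monoid_rep = star_monoid M \<tau> + E: star_alg E
  for M :: "('m, 'y) monoid_scheme" (structure) and \<tau> and E :: "('e, 'z) star_algebra_scheme" +
  fixes \<rho> :: "'m \<Rightarrow> 'e"
  assumes rep_closed [simp, intro]: "u \<in> carrier M \<Longrightarrow> \<rho> u \<in> carrier E"
    and rep_mult: "u \<in> carrier M \<Longrightarrow> v \<in> carrier M \<Longrightarrow> \<rho> (u \<otimes> v) = \<rho> u \<otimes>\<^bsub>E\<^esub> \<rho> v"
    and rep_one: "\<rho> \<one> = \<one>\<^bsub>E\<^esub>"
    and rep_star: "u \<in> carrier M \<Longrightarrow> \<rho> (\<tau> u) = star E (\<rho> u)"
begin

definition lin :: "('m \<Rightarrow> complex) \<Rightarrow> 'e" where
  "lin f = finsum E (\<lambda>u. scale E (f u) (\<rho> u)) {u. f u \<noteq> 0}"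

lemma lin_superset:
  assumes "finite U" "{u. f u \<noteq> 0} \<subseteq> U" "U \<subseteq> carrier M"
  shows "lin f = finsum E (\<lambda>u. scale E (f u) (\<rho> u)) U"
  unfolding lin_def by (rule E.finsum_support[symmetric]) (use assms in auto)

lemma lin_closed: "f \<in> carrier S \<Longrightarrow> lin f \<in> carrier E"
  unfolding lin_def by (intro E.finsum_in_carrier) (auto simp: carrier_S)

lemma lin_point_mass: "u \<in> carrier M \<Longrightarrow> lin (point_mass u) = \<rho> u"
  by (subst lin_superset[of "{u}"]) (auto simp: point_mass_def)

lemma lin_add:
  assumes "f \<in> carrier S" "g \<in> carrier S"
  shows "lin (f \<oplus>\<^bsub>S\<^esub> g) = lin f \<oplus>\<^bsub>E\<^esub> lin g"
proof -
  let ?U = "{u. f u \<noteq> 0} \<union> {u. g u \<noteq> 0}"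
  have U: "finite ?U" "?U \<subseteq> carrier M" using assms by (auto simp: carrier_S)
  have "lin (f \<oplus>\<^bsub>S\<^esub> g) = finsum E (\<lambda>u. scale E (f u + g u) (\<rho> u)) ?U"
    using U by (subst lin_superset[of ?U]) (auto simp: S_add)
  also have "\<dots> = finsum E (\<lambda>u. scale E (f u) (\<rho> u) \<oplus>\<^bsub>E\<^esub> scale E (g u) (\<rho> u)) ?U"
    using U by (intro E.finsum_eqI refl E.add_scale) auto
  also have "\<dots> = finsum E (\<lambda>u. scale E (f u) (\<rho> u)) ?U \<oplus>\<^bsub>E\<^esub> finsum E (\<lambda>u. scale E (g u) (\<rho> u)) ?U"
    using U by (intro E.finsum_add) auto
  also have "\<dots> = lin f \<oplus>\<^bsub>E\<^esub> lin g"
    using U by (subst (1 2) lin_superset[of ?U]) auto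
  finally show ?thesis .
qed

lemma lin_scale: "f \<in> carrier S \<Longrightarrow> lin (scale S c f) = scale E c (lin f)"
  by (subst (1 2) lin_superset[of "{u. f u \<noteq> 0}"])
    (auto simp: carrier_S S_scale subset_iff, subst E.scale_finsum, auto intro!: E.finsum_eqI)

lemma lin_finsum: "finite A \<Longrightarrow> (\<And>i. i \<in> A \<Longrightarrow> g i \<in> carrier S) \<Longrightarrow>
   lin (finsum S g A) = finsum E (\<lambda>i. lin (g i)) A"
  by (induction A rule: finite_induct)
    (auto simp: Pi_def lin_add lin_closed S.finsum_in_carrier, simp add: S_zero lin_def)

lemma lin_mult:
  assumes f: "f \<in> carrier S" and g: "g \<in> carrier S"
  shows "lin (f \<otimes>\<^bsub>S\<^esub> g) = lin f \<otimes>\<^bsub>E\<^esub> lin g"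
proof -
  let ?F = "{u. f u \<noteq> 0}" and ?G = "{u. g u \<noteq> 0}"
  have fin: "finite ?F" "finite ?G" and sub: "?F \<subseteq> carrier M" "?G \<subseteq> carrier M"
    using f g by (auto simp: carrier_S)
  have "f \<otimes>\<^bsub>S\<^esub> g = finsum S (\<lambda>u. scale S (f u) (point_mass u)) ?F \<otimes>\<^bsub>S\<^esub> finsum S (\<lambda>v. scale S (g v) (point_mass v)) ?G"
    using point_mass_expansion[OF f] point_mass_expansion[OF g] by simp
  also have "\<dots> = finsum S (\<lambda>u. finsum S (\<lambda>v. scale S (f u) (point_mass u) \<otimes>\<^bsub>S\<^esub> scale S (g v) (point_mass v)) ?G) ?F"
    using fin sub by (intro S.finsum_mult_finsum) auto
  also have "\<dots> = finsum S (\<lambda>u. finsum S (\<lambda>v. scale S (f u * g v) (point_mass (u \<otimes> v))) ?G) ?F"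
    using sub by (intro S.finsum_eqI refl S.finsum_in_carrier)
      (auto simp: S.scale_mult_left S.scale_mult_right point_mass_mult subset_iff mult.commute)
  finally have "lin (f \<otimes>\<^bsub>S\<^esub> g) = finsum E (\<lambda>u. lin (finsum S (\<lambda>v. scale S (f u * g v) (point_mass (u \<otimes> v))) ?G)) ?F"
    using fin sub by (subst lin_finsum[symmetric]) (auto intro!: S.finsum_in_carrier S.scale_closed point_mass_closed)
  also have "\<dots> = finsum E (\<lambda>u. finsum E (\<lambda>v. scale E (f u) (\<rho> u) \<otimes>\<^bsub>E\<^esub> scale E (g v) (\<rho> v)) ?G) ?F"
  proof (intro E.finsum_eqI refl)
    fix u assume u: "u \<in> ?F"
    show "finsum E (\<lambda>v. scale E (f u) (\<rho> u) \<otimes>\<^bsub>E\<^esub> scale E (g v) (\<rho> v)) ?G \<in> carrier E"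
      using u sub by (auto intro!: E.finsum_in_carrier E.m_closed E.scale_closed)
    have "lin (finsum S (\<lambda>v. scale S (f u * g v) (point_mass (u \<otimes> v))) ?G)
      = finsum E (\<lambda>v. lin (scale S (f u * g v) (point_mass (u \<otimes> v)))) ?G"
      using u sub fin by (intro lin_finsum) (auto intro!: S.scale_closed point_mass_closed)
    also have "\<dots> = finsum E (\<lambda>v. scale E (f u) (\<rho> u) \<otimes>\<^bsub>E\<^esub> scale E (g v) (\<rho> v)) ?G"
    proof (intro E.finsum_eqI refl)
      fix v assume v: "v \<in> ?G"
      have "u \<in> carrier M" "v \<in> carrier M" using u v sub by auto
      then show "lin (scale S (f u * g v) (point_mass (u \<otimes> v))) =
          scale E (f u) (\<rho> u) \<otimes>\<^bsub>E\<^esub> scale E (g v) (\<rho> v)"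
        "scale E (f u) (\<rho> u) \<otimes>\<^bsub>E\<^esub> scale E (g v) (\<rho> v) \<in> carrier E"
        by (auto simp: lin_scale lin_point_mass E.scale_mult_left E.scale_mult_right rep_mult mult.commute)
    qed
    finally show "lin (finsum S (\<lambda>v. scale S (f u * g v) (point_mass (u \<otimes> v))) ?G) =
      finsum E (\<lambda>v. scale E (f u) (\<rho> u) \<otimes>\<^bsub>E\<^esub> scale E (g v) (\<rho> v)) ?G" .
  qed
  also have "\<dots> = lin f \<otimes>\<^bsub>E\<^esub> lin g"
    unfolding lin_def using fin sub by (intro E.finsum_mult_finsum[symmetric]) auto
  finally show ?thesis .
qed

lemma lin_star:
  assumes f: "f \<in> carrier S"
  shows "lin (star S f) = star E (lin f)"
proof -
  let ?F = "{u. f u \<noteq> 0}"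
  have fin: "finite ?F" and sub: "?F \<subseteq> carrier M"
    using f by (auto simp: carrier_S)
  have "star S f = star S (finsum S (\<lambda>u. scale S (f u) (point_mass u)) ?F)"
    using point_mass_expansion[OF f] by simp
  also have "\<dots> = finsum S (\<lambda>u. scale S (cnj (f u)) (point_mass (\<tau> u))) ?F"
    using fin sub by (subst S.star_finsum) (auto simp: S.star_scale point_mass_star subset_iff intro!: S.finsum_eqI)
  finally have "lin (star S f) = lin \<dots>" by simp
  also have "\<dots> = finsum E (\<lambda>u. star E (scale E (f u) (\<rho> u))) ?F"
    using fin sub by (subst lin_finsum) (auto simp: lin_scale lin_point_mass rep_star E.star_scale subset_iff intro!: E.finsum_eqI)
  also have "\<dots> = star E (lin f)"
    unfolding lin_def using fin sub by (subst E.star_finsum) auto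
  finally show ?thesis .
qed

lemma star_hom_lin: "star_hom S E lin"
  unfolding star_hom_def
  by (auto simp: lin_closed lin_add lin_mult lin_scale lin_star S_one lin_point_mass rep_one)

end

section \<open>Seminorms and completions\<close>

locale cstar_semi = star_alg R for R (structure) +
  fixes p :: "'a \<Rightarrow> real"
  assumes seminorm: "cstar_seminorm R p"
begin

lemma p_nonneg [simp]: "x \<in> carrier R \<Longrightarrow> 0 \<le> p x"
  and p_add: "x \<in> carrier R \<Longrightarrow> y \<in> carrier R \<Longrightarrow> p (x \<oplus> y) \<le> p x + p y"
  and p_scale: "x \<in> carrier R \<Longrightarrow> p (scale R c x) = cmod c * p x"
  and p_mult: "x \<in> carrier R \<Longrightarrow> y \<in> carrier R \<Longrightarrow> p (x \<otimes> y) \<le> p x * p y"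
  and p_cstar: "x \<in> carrier R \<Longrightarrow> p (star R x \<otimes> x) = (p x)\<^sup>2"
  using seminorm unfolding cstar_seminorm_def by auto

lemma p_zero [simp]: "p \<zero> = 0"
  using p_scale[of \<zero> 0] by simp

lemma p_minus [simp]: "x \<in> carrier R \<Longrightarrow> p (\<ominus> x) = p x"
  by (simp add: minus_scale p_scale)

lemma p_diff: "x \<in> carrier R \<Longrightarrow> y \<in> carrier R \<Longrightarrow> p (x \<ominus> y) \<le> p x + p y"
  using p_add[of x "\<ominus> y"] by (simp add: minus_eq)

lemma p_diff_commute: "x \<in> carrier R \<Longrightarrow> y \<in> carrier R \<Longrightarrow> p (x \<ominus> y) = p (y \<ominus> x)"
  using p_minus[of "x \<ominus> y"] diff_swap[of x y] by simp

lemma p_diff_triangle: "x \<in> carrier R \<Longrightarrow> y \<in> carrier R \<Longrightarrow> z \<in> carrier R \<Longrightarrow>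
   p (x \<ominus> z) \<le> p (x \<ominus> y) + p (y \<ominus> z)"
  using p_add[of "x \<ominus> y" "y \<ominus> z"] diff_add_cancel[of x y z] by simp

lemma p_diff_ge: "x \<in> carrier R \<Longrightarrow> y \<in> carrier R \<Longrightarrow> \<bar>p x - p y\<bar> \<le> p (x \<ominus> y)"
proof -
  assume xy: "x \<in> carrier R" "y \<in> carrier R"
  have "(x \<ominus> y) \<oplus> y = x" "(y \<ominus> x) \<oplus> x = y" using xy by (simp_all add: minus_eq a_assoc l_neg)
  then have "p x \<le> p (x \<ominus> y) + p y" "p y \<le> p (y \<ominus> x) + p x"
    using xy p_add[of "x \<ominus> y" y] p_add[of "y \<ominus> x" x] by auto
  then show ?thesis using p_diff_commute[OF xy] by linarith
qed

text \<open>The C*-identity and submultiplicativity bound the square of \<open>p y\<close> by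
  \<open>p (star R y) * p y\<close>; applied to \<open>x\<close> and to its adjoint this gives both
  inequalities.\<close>

lemma p_star [simp]: "x \<in> carrier R \<Longrightarrow> p (star R x) = p x"
proof -
  have le: "p y \<le> p (star R y)" if y: "y \<in> carrier R" for y
  proof -
    have "(p y)\<^sup>2 \<le> p (star R y) * p y" using y p_cstar p_mult[of "star R y" y] by simp
    then have "p y * p y \<le> p (star R y) * p y" by (simp add: power2_eq_square)
    then show ?thesis using p_nonneg[OF star_closed[OF y]] mult_right_le_imp_le[of "p y" "p y" "p (star R y)"]
      by linarith
  qed
  assume "x \<in> carrier R" then show ?thesis using le[of x] le[of "star R x"] by simp
qed

text \<open>The value at the unit equals its own square, hence is 0 or 1. It is 0 for the zero
  seminorm, so equality with 1 cannot be claimed.\<close>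

lemma p_one_le: "p \<one> \<le> 1"
proof -
  have "p \<one> = (p \<one>)\<^sup>2" using p_cstar[of \<one>] by simp
  then have "p \<one> * (p \<one> - 1) = 0" by (simp add: power2_eq_square algebra_simps)
  then show ?thesis by auto
qed

lemma p_finsum:
  "finite A \<Longrightarrow> (\<And>i. i \<in> A \<Longrightarrow> f i \<in> carrier R) \<Longrightarrow> p (finsum R f A) \<le> (\<Sum>i\<in>A. p (f i))"
proof (induction A rule: finite_induct)
  case (insert a A)
  then show ?case using p_add[of "f a" "finsum R f A"] by (simp add: Pi_def finsum_in_carrier)
qed simp

text \<open>This is how a seminorm that vanishes on relators takes equal values on the two sides of
  a relation.\<close>

lemma p_zero_diff: "x \<in> carrier R \<Longrightarrow> y \<in> carrier R \<Longrightarrow> p (x \<ominus> y) = 0 \<Longrightarrow> p x = p y"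
  using p_diff_ge[of x y] by simp

text \<open>\<open>converges x l\<close> does not determine \<open>l\<close> when \<open>p\<close> is only a seminorm.\<close>

definition converges :: "(nat \<Rightarrow> 'a) \<Rightarrow> 'a \<Rightarrow> bool" where
  "converges x l \<longleftrightarrow> (\<forall>n. x n \<in> carrier R) \<and> l \<in> carrier R \<and> (\<lambda>n. p (x n \<ominus> l)) \<longlonglongrightarrow> 0"

lemma convergesI:
  assumes "\<And>n. x n \<in> carrier R" "l \<in> carrier R" "\<And>n. p (x n \<ominus> l) \<le> e n" "e \<longlonglongrightarrow> 0"
  shows "converges x l"
proof -
  have "(\<lambda>n. p (x n \<ominus> l)) \<longlonglongrightarrow> 0"
    by (rule tendsto_sandwich[of "\<lambda>_. 0" _ _ e]) (use assms in auto)
  then show ?thesis using assms by (simp add: converges_def)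
qed

lemma convergesD: "converges x l \<Longrightarrow> x n \<in> carrier R" "converges x l \<Longrightarrow> l \<in> carrier R"
  "converges x l \<Longrightarrow> (\<lambda>n. p (x n \<ominus> l)) \<longlonglongrightarrow> 0"
  by (auto simp: converges_def)

lemma converges_const: "l \<in> carrier R \<Longrightarrow> converges (\<lambda>_. l) l"
  by (simp add: converges_def diff_self)

lemma converges_norm:
  assumes "converges x l" shows "(\<lambda>n. p (x n)) \<longlonglongrightarrow> p l"
proof -
  have "(\<lambda>n. p (x n) - p l) \<longlonglongrightarrow> 0"
    by (rule tendsto_rabs_zero_cancel, rule tendsto_sandwich[of "\<lambda>_. 0" _ _ "\<lambda>n. p (x n \<ominus> l)"])
      (use assms p_diff_ge in \<open>auto simp: converges_def\<close>)
  then show ?thesis by (simp add: LIM_zero_iff)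
qed

lemma converges_add:
  assumes "converges x l" "converges y m" shows "converges (\<lambda>n. x n \<oplus> y n) (l \<oplus> m)"
proof (rule convergesI)
  note [simp, intro] = convergesD(1,2)[OF assms(1)] convergesD(1,2)[OF assms(2)]
  show "p (x n \<oplus> y n \<ominus> (l \<oplus> m)) \<le> p (x n \<ominus> l) + p (y n \<ominus> m)" for n
    by (simp add: add_diff_add p_add)
  show "(\<lambda>n. p (x n \<ominus> l) + p (y n \<ominus> m)) \<longlonglongrightarrow> 0"
    using assms by (auto simp: converges_def intro!: tendsto_add_zero)
qed (use assms in \<open>auto simp: converges_def\<close>)

lemma converges_scale:
  assumes "converges x l" shows "converges (\<lambda>n. scale R c (x n)) (scale R c l)"
proof (rule convergesI)
  note [simp, intro] = convergesD(1,2)[OF assms(1)]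
  show "p (scale R c (x n) \<ominus> scale R c l) \<le> cmod c * p (x n \<ominus> l)" for n
    by (simp add: p_scale flip: scale_diff)
  show "(\<lambda>n. cmod c * p (x n \<ominus> l)) \<longlonglongrightarrow> 0"
    using assms by (auto simp: converges_def intro!: tendsto_mult_right_zero)
qed (use assms in \<open>auto simp: converges_def\<close>)

lemma converges_minus:
  assumes "converges x l" shows "converges (\<lambda>n. \<ominus> x n) (\<ominus> l)"
proof -
  have "converges (\<lambda>n. scale R (-1) (x n)) (scale R (-1) l)" by (rule converges_scale[OF assms])
  then show ?thesis using assms by (simp add: minus_scale converges_def)
qed

lemma converges_diff:
  "converges x l \<Longrightarrow> converges y m \<Longrightarrow> converges (\<lambda>n. x n \<ominus> y n) (l \<ominus> m)"
  unfolding minus_eq by (intro converges_add converges_minus)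

lemma converges_star:
  assumes "converges x l" shows "converges (\<lambda>n. star R (x n)) (star R l)"
  using assms by (auto simp: converges_def simp flip: star_diff)

lemma converges_mult:
  assumes "converges x l" "converges y m" shows "converges (\<lambda>n. x n \<otimes> y n) (l \<otimes> m)"
proof (rule convergesI)
  note [simp, intro] = convergesD(1,2)[OF assms(1)] convergesD(1,2)[OF assms(2)]
  show "p (x n \<otimes> y n \<ominus> l \<otimes> m) \<le> p (x n \<ominus> l) * p (y n) + p l * p (y n \<ominus> m)" for n
  proof -
    have "p (x n \<otimes> y n \<ominus> l \<otimes> m) \<le> p ((x n \<ominus> l) \<otimes> y n) + p (l \<otimes> (y n \<ominus> m))"
      by (simp add: mult_diff_mult p_add)
    also have "\<dots> \<le> p (x n \<ominus> l) * p (y n) + p l * p (y n \<ominus> m)"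
      by (intro add_mono p_mult) auto
    finally show ?thesis .
  qed
  have "(\<lambda>n. p (x n \<ominus> l) * p (y n) + p l * p (y n \<ominus> m)) \<longlonglongrightarrow> 0 * p m + p l * 0"
    by (intro tendsto_intros converges_norm assms convergesD(3))
  then show "(\<lambda>n. p (x n \<ominus> l) * p (y n) + p l * p (y n \<ominus> m)) \<longlonglongrightarrow> 0" by simp
qed (use assms in \<open>auto simp: converges_def\<close>)

lemma converges_unique:
  assumes "converges x l" "converges x m" shows "p (l \<ominus> m) = 0"
proof -
  have "converges (\<lambda>n. x n \<ominus> x n) (l \<ominus> m)" by (intro converges_diff assms)
  then have "(\<lambda>n. p (x n \<ominus> x n)) \<longlonglongrightarrow> p (l \<ominus> m)" by (rule converges_norm)
  moreover have "p (x n \<ominus> x n) = 0" for n using assms by (simp add: diff_self converges_def)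
  ultimately show ?thesis by (simp add: LIMSEQ_const_iff)
qed

lemma converges_Cauchy:
  assumes "converges x l" shows "x \<in> cauchy_seqs R p"
  unfolding cauchy_seqs_def
proof (intro CollectI conjI allI impI)
  note [simp, intro] = convergesD(1,2)[OF assms(1)]
  fix e :: real assume "e > 0"
  then obtain M where M: "\<And>n. n \<ge> M \<Longrightarrow> p (x n \<ominus> l) < e / 2"
    using convergesD(3)[OF assms] by (force simp: lim_sequentially dist_real_def dest!: spec[of _ "e/2"])
  have "p (x m \<ominus> x n) < e" if "m \<ge> M" "n \<ge> M" for m n
    using p_diff_triangle[of "x m" l "x n"] M[OF that(1)] M[OF that(2)] p_diff_commute[of "x n" l] by auto
  then show "\<exists>M. \<forall>m\<ge>M. \<forall>n\<ge>M. p (x m \<ominus> x n) < e" by blast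
qed (use assms in \<open>auto simp: converges_def\<close>)

end

locale cstar = cstar_semi R "cnorm R" for R (structure) +
  assumes norm_zeroD: "x \<in> carrier R \<Longrightarrow> cnorm R x = 0 \<Longrightarrow> x = \<zero>"
    and complete: "X \<in> cauchy_seqs R (cnorm R) \<Longrightarrow> \<exists>l. converges X l"
begin

lemma limit_unique: "converges x l \<Longrightarrow> converges x m \<Longrightarrow> l = m"
  by (meson converges_unique convergesD(2) diff_eq_zero minus_closed norm_zeroD)

lemma star_mult_zeroD: "x \<in> carrier R \<Longrightarrow> star R x \<otimes> x = \<zero> \<Longrightarrow> x = \<zero>"
  using p_cstar[of x] norm_zeroD by auto

end

section \<open>The separated completion as a C*-algebra\<close>

context cstar_semi
begin

abbreviation "CS \<equiv> cauchy_seqs R p"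
abbreviation "NR \<equiv> null_rel R p"
abbreviation cls :: "(nat \<Rightarrow> 'a) \<Rightarrow> (nat \<Rightarrow> 'a) set" where "cls x \<equiv> NR `` {x}"
abbreviation "K \<equiv> cstar_completion R p"

lemma CS_closed [simp]: "x \<in> CS \<Longrightarrow> x n \<in> carrier R"
  by (simp add: cauchy_seqs_def)

lemma CS_const [simp, intro]: "x \<in> carrier R \<Longrightarrow> (\<lambda>n. x) \<in> CS"
  by (rule converges_Cauchy[OF converges_const])

lemma NR_iff: "(x, y) \<in> NR \<longleftrightarrow> x \<in> CS \<and> y \<in> CS \<and> (\<lambda>n. p (x n \<ominus> y n)) \<longlonglongrightarrow> 0"
  by (simp add: null_rel_def)

lemma NR_equiv: "equiv CS NR"
proof (rule equivI)
  show "NR \<subseteq> CS \<times> CS" by (auto simp: null_rel_def)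
  show "refl_on CS NR" by (rule refl_onI) (simp add: NR_iff diff_self)
  show "sym NR"
  proof (rule symI)
    fix x y assume "(x, y) \<in> NR"
    then show "(y, x) \<in> NR"
      unfolding NR_iff by (simp add: p_diff_commute[of "y n" "x n" for n])
  qed
  show "trans NR"
  proof (rule transI)
    fix x y z assume a: "(x, y) \<in> NR" "(y, z) \<in> NR"
    then have cs: "x \<in> CS" "y \<in> CS" "z \<in> CS" unfolding NR_iff by blast+
    have "(\<lambda>n. p (x n \<ominus> z n)) \<longlonglongrightarrow> 0"
    proof (rule tendsto_sandwich[of "\<lambda>_. 0" _ _ "\<lambda>n. p (x n \<ominus> y n) + p (y n \<ominus> z n)"])
      show "(\<lambda>n. p (x n \<ominus> y n) + p (y n \<ominus> z n)) \<longlonglongrightarrow> 0"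
        using a unfolding NR_iff by (intro tendsto_add_zero) blast+
    qed (use cs in \<open>auto intro!: always_eventually p_diff_triangle\<close>)
    then show "(x, z) \<in> NR" using cs unfolding NR_iff by blast
  qed
qed

lemma cls_eq: "x \<in> CS \<Longrightarrow> y \<in> CS \<Longrightarrow> cls x = cls y \<longleftrightarrow> (x, y) \<in> NR"
  by (rule eq_equiv_class_iff[OF NR_equiv])

lemma cls_eqI: "(x, y) \<in> NR \<Longrightarrow> cls x = cls y"
  by (rule equiv_class_eq[OF NR_equiv])

lemma rep_rel: "x \<in> CS \<Longrightarrow> (x, class_rep (cls x)) \<in> NR"
proof -
  assume "x \<in> CS"
  then have "x \<in> cls x" by (rule equiv_class_self[OF NR_equiv])
  then have "class_rep (cls x) \<in> cls x" unfolding class_rep_def by (rule someI[where P = "\<lambda>z. z \<in> cls x"])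
  then show ?thesis by simp
qed

lemma K_carrier: "X \<in> carrier K \<longleftrightarrow> (\<exists>x\<in>CS. X = cls x)"
  by (auto simp: cstar_completion_def quotient_def)

lemma CS_Lim0:
  "x \<in> CS \<longleftrightarrow> (\<forall>n. x n \<in> carrier R) \<and> (\<forall>e>0. \<exists>M. \<forall>m\<ge>M. \<forall>n\<ge>M. p (x m \<ominus> x n) < e)"
  by (simp only: cauchy_seqs_def mem_Collect_eq)

lemma CS_E:
  assumes "x \<in> CS" "e > 0"
  obtains M where "\<And>m n. m \<ge> M \<Longrightarrow> n \<ge> M \<Longrightarrow> p (x m \<ominus> x n) < e"
proof -
  have "\<exists>M. \<forall>m\<ge>M. \<forall>n\<ge>M. p (x m \<ominus> x n) < e" using assms unfolding CS_Lim0 by blast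
  then show ?thesis using that by blast
qed

lemma CS_bounded:
  assumes "x \<in> CS" obtains B where "B \<ge> 0" "\<And>n. p (x n) \<le> B"
proof -
  obtain M where M: "\<And>m n. m \<ge> M \<Longrightarrow> n \<ge> M \<Longrightarrow> p (x m \<ominus> x n) < 1"
    using CS_E[OF assms zero_less_one] by blast
  define B where "B = Max ((\<lambda>n. p (x n)) ` {..M}) + 1"
  have le: "p (x n) \<le> Max ((\<lambda>n. p (x n)) ` {..M})" if "n \<le> M" for n
    by (rule Max_ge) (use that in auto)
  have "p (x n) \<le> B" for n
  proof (cases "n \<le> M")
    case True then show ?thesis using le[of n] unfolding B_def by linarith
  next
    case False
    then have "p (x n) \<le> p (x M) + 1"
      using M[of n M] p_diff_ge[OF CS_closed[OF assms] CS_closed[OF assms], of n M] by linarith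
    then show ?thesis using le[of M] unfolding B_def by linarith
  qed
  moreover have "B \<ge> 0" using calculation[of 0] p_nonneg[OF CS_closed[OF assms], of 0] by linarith
  ultimately show ?thesis using that by blast
qed

lemma CS_add: "x \<in> CS \<Longrightarrow> y \<in> CS \<Longrightarrow> (\<lambda>n. x n \<oplus> y n) \<in> CS"
  unfolding CS_Lim0[of "\<lambda>n. x n \<oplus> y n"]
proof (intro conjI allI impI)
  assume a: "x \<in> CS" and b: "y \<in> CS"
  show "x n \<oplus> y n \<in> carrier R" for n using a b by auto
  fix e :: real assume e: "e > 0"
  obtain M where M: "\<And>m n. m \<ge> M \<Longrightarrow> n \<ge> M \<Longrightarrow> p (x m \<ominus> x n) < e/2"
    using CS_E[OF a half_gt_zero[OF e]] by blast
  obtain N where N: "\<And>m n. m \<ge> N \<Longrightarrow> n \<ge> N \<Longrightarrow> p (y m \<ominus> y n) < e/2"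
    using CS_E[OF b half_gt_zero[OF e]] by blast
  have "p ((x m \<oplus> y m) \<ominus> (x n \<oplus> y n)) < e" if "m \<ge> max M N" "n \<ge> max M N" for m n
    using M[of m n] N[of m n] that a b p_add[of "x m \<ominus> x n" "y m \<ominus> y n"] by (simp add: add_diff_add)
  then show "\<exists>M. \<forall>m\<ge>M. \<forall>n\<ge>M. p ((x m \<oplus> y m) \<ominus> (x n \<oplus> y n)) < e" by blast
qed

lemma CS_mult:
  assumes x: "x \<in> CS" and y: "y \<in> CS" shows "(\<lambda>n. x n \<otimes> y n) \<in> CS"
proof -
  obtain B where B: "B \<ge> 0" "\<And>n. p (x n) \<le> B" using CS_bounded[OF x] by blast
  obtain C where C: "C \<ge> 0" "\<And>n. p (y n) \<le> C" using CS_bounded[OF y] by blast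
  show ?thesis unfolding CS_Lim0[of "\<lambda>n. x n \<otimes> y n"]
  proof (intro conjI allI impI)
    show "x n \<otimes> y n \<in> carrier R" for n using x y by auto
    fix e :: real assume "e > 0"
    define d where "d = e / (B + C + 1)"
    have d: "d > 0" using \<open>e > 0\<close> B C by (simp add: d_def)
    obtain M where M: "\<And>m n. m \<ge> M \<Longrightarrow> n \<ge> M \<Longrightarrow> p (x m \<ominus> x n) < d"
      using CS_E[OF x d] by blast
    obtain N where N: "\<And>m n. m \<ge> N \<Longrightarrow> n \<ge> N \<Longrightarrow> p (y m \<ominus> y n) < d"
      using CS_E[OF y d] by blast
    have "p ((x m \<otimes> y m) \<ominus> (x n \<otimes> y n)) < e" if "m \<ge> max M N" "n \<ge> max M N" for m n
    proof -
      have "p ((x m \<otimes> y m) \<ominus> (x n \<otimes> y n)) \<le> p ((x m \<ominus> x n) \<otimes> y m) + p (x n \<otimes> (y m \<ominus> y n))"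
        using x y by (simp add: mult_diff_mult p_add)
      also have "\<dots> \<le> p (x m \<ominus> x n) * p (y m) + p (x n) * p (y m \<ominus> y n)"
        using x y by (intro add_mono p_mult) auto
      also have "\<dots> \<le> d * C + B * d"
        using x y M[of m n] N[of m n] that B C d by (intro add_mono mult_mono) auto
      also have "\<dots> < d * (B + C + 1)" using d by (simp add: algebra_simps)
      also have "\<dots> = e" using B C by (simp add: d_def)
      finally show ?thesis .
    qed
    then show "\<exists>M. \<forall>m\<ge>M. \<forall>n\<ge>M. p ((x m \<otimes> y m) \<ominus> (x n \<otimes> y n)) < e" by blast
  qed
qed

lemma CS_scale: "x \<in> CS \<Longrightarrow> (\<lambda>n. scale R c (x n)) \<in> CS"
proof -
  assume x: "x \<in> CS"
  have "(\<lambda>n. scale R c \<one> \<otimes> x n) \<in> CS" by (rule CS_mult[OF CS_const x]) auto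
  then show ?thesis using x by (simp add: scale_mult_left)
qed

lemma CS_star: "x \<in> CS \<Longrightarrow> (\<lambda>n. star R (x n)) \<in> CS"
  unfolding CS_Lim0 by (auto simp flip: star_diff)

lemma NR_I:
  assumes "x \<in> CS" "y \<in> CS" "\<And>n. p (x n \<ominus> y n) \<le> e n" "e \<longlonglongrightarrow> 0"
  shows "(x, y) \<in> NR"
proof -
  have "(\<lambda>n. p (x n \<ominus> y n)) \<longlonglongrightarrow> 0"
  proof (rule tendsto_sandwich[of "\<lambda>_. 0" _ _ e])
    show "\<forall>\<^sub>F n in sequentially. 0 \<le> p (x n \<ominus> y n)"
      using assms(1,2) by (intro always_eventually allI p_nonneg minus_closed CS_closed)
    show "\<forall>\<^sub>F n in sequentially. p (x n \<ominus> y n) \<le> e n"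
      using assms(3) by (intro always_eventually allI)
  qed (use assms(4) in simp_all)
  then show ?thesis unfolding NR_iff using assms(1,2) by blast
qed

lemma NR_D: assumes "(x, y) \<in> NR"
  shows "x \<in> CS" "y \<in> CS" "(\<lambda>n. p (x n \<ominus> y n)) \<longlonglongrightarrow> 0"
  using assms unfolding NR_iff by blast+

lemma NR_add:
  assumes x: "(x, x') \<in> NR" and y: "(y, y') \<in> NR"
  shows "(\<lambda>n. x n \<oplus> y n, \<lambda>n. x' n \<oplus> y' n) \<in> NR"
proof (rule NR_I)
  note cs = NR_D(1,2)[OF x] NR_D(1,2)[OF y]
  note [simp] = CS_closed[OF cs(1)] CS_closed[OF cs(2)] CS_closed[OF cs(3)] CS_closed[OF cs(4)]
  show "p (x n \<oplus> y n \<ominus> (x' n \<oplus> y' n)) \<le> p (x n \<ominus> x' n) + p (y n \<ominus> y' n)" for n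
    by (simp add: add_diff_add p_add)
  show "(\<lambda>n. p (x n \<ominus> x' n) + p (y n \<ominus> y' n)) \<longlonglongrightarrow> 0"
    by (rule tendsto_add_zero[OF NR_D(3)[OF x] NR_D(3)[OF y]])
  show "(\<lambda>n. x n \<oplus> y n) \<in> CS" "(\<lambda>n. x' n \<oplus> y' n) \<in> CS" using cs CS_add by blast+
qed

lemma NR_mult:
  assumes x: "(x, x') \<in> NR" and y: "(y, y') \<in> NR"
  shows "(\<lambda>n. x n \<otimes> y n, \<lambda>n. x' n \<otimes> y' n) \<in> NR"
proof -
  note cs = NR_D(1,2)[OF x] NR_D(1,2)[OF y]
  note [simp] = CS_closed[OF cs(1)] CS_closed[OF cs(2)] CS_closed[OF cs(3)] CS_closed[OF cs(4)]
  obtain B where B: "B \<ge> 0" "\<And>n. p (x' n) \<le> B" using CS_bounded[OF cs(2)] by blast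
  obtain C where C: "C \<ge> 0" "\<And>n. p (y n) \<le> C" using CS_bounded[OF cs(3)] by blast
  have le: "p (x n \<otimes> y n \<ominus> (x' n \<otimes> y' n)) \<le> p (x n \<ominus> x' n) * C + B * p (y n \<ominus> y' n)" for n
  proof -
    have "p (x n \<otimes> y n \<ominus> (x' n \<otimes> y' n)) \<le> p ((x n \<ominus> x' n) \<otimes> y n) + p (x' n \<otimes> (y n \<ominus> y' n))"
      by (simp add: mult_diff_mult p_add)
    also have "\<dots> \<le> p (x n \<ominus> x' n) * p (y n) + p (x' n) * p (y n \<ominus> y' n)"
      by (intro add_mono p_mult) auto
    also have "\<dots> \<le> p (x n \<ominus> x' n) * C + B * p (y n \<ominus> y' n)"
      by (intro add_mono mult_mono B C) auto
    finally show ?thesis .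
  qed
  have "(\<lambda>n. p (x n \<ominus> x' n) * C + B * p (y n \<ominus> y' n)) \<longlonglongrightarrow> 0 * C + B * 0"
    by (intro tendsto_intros NR_D(3)[OF x] NR_D(3)[OF y])
  then show ?thesis by (intro NR_I[OF CS_mult CS_mult le] cs) simp
qed

lemma NR_scale:
  assumes x: "(x, x') \<in> NR" shows "(\<lambda>n. scale R c (x n), \<lambda>n. scale R c (x' n)) \<in> NR"
proof (rule NR_I)
  note cs = NR_D(1,2)[OF x]
  note [simp] = CS_closed[OF cs(1)] CS_closed[OF cs(2)]
  show "p (scale R c (x n) \<ominus> scale R c (x' n)) \<le> cmod c * p (x n \<ominus> x' n)" for n
    by (simp add: p_scale flip: scale_diff)
  show "(\<lambda>n. cmod c * p (x n \<ominus> x' n)) \<longlonglongrightarrow> 0"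
    by (rule tendsto_mult_right_zero[OF NR_D(3)[OF x]])
qed (use CS_scale NR_D[OF x] in blast)+

lemma NR_star:
  assumes x: "(x, x') \<in> NR" shows "(\<lambda>n. star R (x n), \<lambda>n. star R (x' n)) \<in> NR"
proof (rule NR_I)
  note cs = NR_D(1,2)[OF x]
  note [simp] = CS_closed[OF cs(1)] CS_closed[OF cs(2)]
  show "p (star R (x n) \<ominus> star R (x' n)) \<le> p (x n \<ominus> x' n)" for n
    by (simp flip: star_diff)
qed (use CS_star NR_D[OF x] in blast)+

lemma K_add: "x \<in> CS \<Longrightarrow> y \<in> CS \<Longrightarrow> cls x \<oplus>\<^bsub>K\<^esub> cls y = cls (\<lambda>n. x n \<oplus> y n)"
  by (simp add: cstar_completion_def) (intro cls_eqI[symmetric] NR_add rep_rel)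

lemma K_mult: "x \<in> CS \<Longrightarrow> y \<in> CS \<Longrightarrow> cls x \<otimes>\<^bsub>K\<^esub> cls y = cls (\<lambda>n. x n \<otimes> y n)"
  by (simp add: cstar_completion_def) (intro cls_eqI[symmetric] NR_mult rep_rel)

lemma K_scale: "x \<in> CS \<Longrightarrow> scale K c (cls x) = cls (\<lambda>n. scale R c (x n))"
  by (simp add: cstar_completion_def) (intro cls_eqI[symmetric] NR_scale rep_rel)

lemma K_star: "x \<in> CS \<Longrightarrow> star K (cls x) = cls (\<lambda>n. star R (x n))"
  by (simp add: cstar_completion_def) (intro cls_eqI[symmetric] NR_star rep_rel)

lemma K_zero: "\<zero>\<^bsub>K\<^esub> = cls (\<lambda>n. \<zero>)" and K_one: "\<one>\<^bsub>K\<^esub> = cls (\<lambda>n. \<one>)"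
  by (simp_all add: cstar_completion_def)

lemma CS_convergent: "x \<in> CS \<Longrightarrow> convergent (\<lambda>n. p (x n))"
proof (rule Cauchy_convergent, rule metric_CauchyI)
  fix e :: real assume x: "x \<in> CS" and e: "e > 0"
  obtain M where M: "\<And>m n. m \<ge> M \<Longrightarrow> n \<ge> M \<Longrightarrow> p (x m \<ominus> x n) < e"
    using CS_E[OF x e] by blast
  have "dist (p (x m)) (p (x n)) < e" if "m \<ge> M" "n \<ge> M" for m n
    using M[OF that] p_diff_ge[of "x m" "x n"] x by (simp add: dist_real_def)
  then show "\<exists>M. \<forall>m\<ge>M. \<forall>n\<ge>M. dist (p (x m)) (p (x n)) < e" by blast
qed

text \<open>The norm of a class is defined along its chosen representative. A null difference leaves
  the limit of the seminorms unchanged, so every representative computes it.\<close>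

lemma K_norm: "x \<in> CS \<Longrightarrow> (\<lambda>n. p (x n)) \<longlonglongrightarrow> cnorm K (cls x)"
proof -
  assume x: "x \<in> CS"
  let ?y = "class_rep (cls x)"
  have r: "(x, ?y) \<in> NR" by (rule rep_rel[OF x])
  then have y: "?y \<in> CS" by (simp add: NR_iff)
  have "(\<lambda>n. p (?y n)) \<longlonglongrightarrow> cnorm K (cls x)"
    using CS_convergent[OF y] by (simp add: cstar_completion_def convergent_LIMSEQ_iff)
  moreover have "(\<lambda>n. p (x n) - p (?y n)) \<longlonglongrightarrow> 0"
    by (rule tendsto_rabs_zero_cancel, rule tendsto_sandwich[of "\<lambda>_. 0" _ _ "\<lambda>n. p (x n \<ominus> ?y n)"])
      (use r p_diff_ge in \<open>auto simp: NR_iff\<close>)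
  ultimately have "(\<lambda>n. (p (x n) - p (?y n)) + p (?y n)) \<longlonglongrightarrow> 0 + cnorm K (cls x)"
    by (intro tendsto_add)
  then show ?thesis by simp
qed

lemma K_norm_eqI: "x \<in> CS \<Longrightarrow> (\<lambda>n. p (x n)) \<longlonglongrightarrow> a \<Longrightarrow> cnorm K (cls x) = a"
  using LIMSEQ_unique K_norm by blast

lemma K_I [intro]: "x \<in> CS \<Longrightarrow> cls x \<in> carrier K"
  unfolding K_carrier by blast

lemma K_E: "X \<in> carrier K \<Longrightarrow> (\<And>x. x \<in> CS \<Longrightarrow> X = cls x \<Longrightarrow> P) \<Longrightarrow> P"
  unfolding K_carrier by blast

lemma star_alg_K: "star_alg K"
proof -
  note simps = K_zero K_one K_add K_mult K_scale K_star K_I CS_add CS_mult CS_scale CS_star CS_const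
  have "abelian_group K"
  proof (rule abelian_groupI)
    fix X assume "X \<in> carrier K"
    then obtain x where x: "x \<in> CS" "X = cls x" by (rule K_E)
    have "(\<lambda>n. scale R (-1) (x n) \<oplus> x n) = (\<lambda>n. \<zero>)"
      using x by (intro ext) (simp add: l_neg flip: minus_scale)
    then have "cls (\<lambda>n. scale R (-1) (x n)) \<oplus>\<^bsub>K\<^esub> X = \<zero>\<^bsub>K\<^esub>"
      using x by (simp add: simps)
    then show "\<exists>Y\<in>carrier K. Y \<oplus>\<^bsub>K\<^esub> X = \<zero>\<^bsub>K\<^esub>"
      using x CS_scale K_I by blast
  next
    fix X Y assume "X \<in> carrier K" "Y \<in> carrier K"
    then obtain x y where x: "x \<in> CS" "X = cls x" and y: "y \<in> CS" "Y = cls y" by (elim K_E)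
    show "X \<oplus>\<^bsub>K\<^esub> Y \<in> carrier K" using x y by (simp add: simps)
    have "x n \<oplus> y n = y n \<oplus> x n" for n using x y by (simp add: a_comm)
    then show "X \<oplus>\<^bsub>K\<^esub> Y = Y \<oplus>\<^bsub>K\<^esub> X" using x y by (simp add: simps)
  next
    fix X Y Z assume "X \<in> carrier K" "Y \<in> carrier K" "Z \<in> carrier K"
    then show "X \<oplus>\<^bsub>K\<^esub> Y \<oplus>\<^bsub>K\<^esub> Z = X \<oplus>\<^bsub>K\<^esub> (Y \<oplus>\<^bsub>K\<^esub> Z)"
      by (elim K_E) (simp add: simps a_assoc)
  next
    fix X assume "X \<in> carrier K"
    then show "\<zero>\<^bsub>K\<^esub> \<oplus>\<^bsub>K\<^esub> X = X" by (elim K_E) (simp add: simps)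
  qed (simp add: simps)
  moreover have "monoid K"
  proof (rule monoidI)
    fix X Y assume "X \<in> carrier K" "Y \<in> carrier K"
    then show "X \<otimes>\<^bsub>K\<^esub> Y \<in> carrier K" by (elim K_E) (simp add: simps)
  next
    fix X Y Z assume "X \<in> carrier K" "Y \<in> carrier K" "Z \<in> carrier K"
    then show "X \<otimes>\<^bsub>K\<^esub> Y \<otimes>\<^bsub>K\<^esub> Z = X \<otimes>\<^bsub>K\<^esub> (Y \<otimes>\<^bsub>K\<^esub> Z)"
      by (elim K_E) (simp add: simps m_assoc)
  next
    fix X assume "X \<in> carrier K"
    then show "\<one>\<^bsub>K\<^esub> \<otimes>\<^bsub>K\<^esub> X = X" "X \<otimes>\<^bsub>K\<^esub> \<one>\<^bsub>K\<^esub> = X" by (elim K_E, simp add: simps)+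
  qed (simp add: simps)
  ultimately have "ring K"
    by (rule ringI) (elim K_E, simp add: simps l_distr r_distr)+
  moreover have "star_alg_axioms K"
    by standard
     (elim K_E, simp add: simps scale_add add_scale star_add star_mult star_scale scale_mult_left scale_mult_right)+
  ultimately show ?thesis by (rule star_alg.intro)
qed

lemma seminorm_K: "cstar_seminorm K (cnorm K)"
  unfolding cstar_seminorm_def
proof (intro conjI ballI allI)
  fix X Y c assume "X \<in> carrier K" "Y \<in> carrier K"
  then obtain x y where x: "x \<in> CS" "X = cls x" and y: "y \<in> CS" "Y = cls y" by (elim K_E)
  note nx = K_norm[OF x(1), folded x(2)] and ny = K_norm[OF y(1), folded y(2)]
  show "0 \<le> cnorm K X" by (rule LIMSEQ_le_const[OF nx]) (use x in auto)
  show "cnorm K (X \<oplus>\<^bsub>K\<^esub> Y) \<le> cnorm K X + cnorm K Y"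
    using x y K_norm[OF CS_add[OF x(1) y(1)]]
    by (intro LIMSEQ_le[OF _ tendsto_add[OF nx ny]]) (auto simp: K_add p_add)
  show "cnorm K (X \<otimes>\<^bsub>K\<^esub> Y) \<le> cnorm K X * cnorm K Y"
    using x y K_norm[OF CS_mult[OF x(1) y(1)]]
    by (intro LIMSEQ_le[OF _ tendsto_mult[OF nx ny]]) (auto simp: K_mult p_mult)
  show "cnorm K (scale K c X) = cmod c * cnorm K X"
    using x tendsto_mult_left[OF nx, of "cmod c"] by (simp add: K_scale) (rule K_norm_eqI, auto simp: CS_scale p_scale)
  show "cnorm K (star K X \<otimes>\<^bsub>K\<^esub> X) = (cnorm K X)\<^sup>2"
    using x tendsto_power[OF nx, of 2] by (simp add: K_star K_mult CS_star)
      (rule K_norm_eqI, auto simp: CS_star CS_mult p_cstar)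
qed

definition emb :: "'a \<Rightarrow> (nat \<Rightarrow> 'a) set" where "emb x = cls (\<lambda>n. x)"

lemma emb_hom: "star_hom R K emb"
  unfolding star_hom_def emb_def
  by (auto simp: K_carrier K_add K_mult K_scale K_star K_one)

lemma norm_emb: "x \<in> carrier R \<Longrightarrow> cnorm K (emb x) = p x"
  unfolding emb_def by (rule K_norm_eqI) auto

interpretation K: cstar_semi K "cnorm K"
  by (intro cstar_semi.intro cstar_semi_axioms.intro star_alg_K seminorm_K)

sublocale emb: star_hom_pair R K emb
  by (intro star_hom_pair.intro star_alg_K star_alg_axioms star_hom_pair_axioms.intro emb_hom)

lemma K_diff: "x \<in> CS \<Longrightarrow> y \<in> CS \<Longrightarrow> cls x \<ominus>\<^bsub>K\<^esub> cls y = cls (\<lambda>n. x n \<ominus> y n)"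
  by (simp add: K.minus_eq minus_eq K.minus_scale K_I minus_scale K_scale K_add CS_scale)

text \<open>The class of a Cauchy sequence is the limit of the embedded terms of that same sequence,
  because the distance to the term \<open>x m\<close> is the limit of
  \<open>p (x m \<ominus> x n)\<close> in \<open>n\<close>.\<close>

lemma emb_dense:
  assumes x: "x \<in> CS" shows "K.converges (\<lambda>n. emb (x n)) (cls x)"
  unfolding K.converges_def
proof (intro conjI allI)
  show "(\<lambda>m. cnorm K (emb (x m) \<ominus>\<^bsub>K\<^esub> cls x)) \<longlonglongrightarrow> 0"
  proof (rule LIMSEQ_I)
    fix e :: real assume e: "e > 0"
    obtain M where M: "\<And>m n. m \<ge> M \<Longrightarrow> n \<ge> M \<Longrightarrow> p (x m \<ominus> x n) < e / 2"
      using CS_E[OF x half_gt_zero[OF e]] by blast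
    have "norm (cnorm K (emb (x m) \<ominus>\<^bsub>K\<^esub> cls x) - 0) < e" if m: "m \<ge> M" for m
    proof -
      have e: "emb (x m) \<ominus>\<^bsub>K\<^esub> cls x = cls (\<lambda>n. x m \<ominus> x n)"
        unfolding emb_def using x by (simp add: K_diff)
      have c: "(\<lambda>n. x m \<ominus> x n) \<in> CS"
        using CS_add[OF CS_const CS_scale[OF x, of "-1"], of "x m"] x by (simp add: minus_eq minus_scale)
      have "cnorm K (cls (\<lambda>n. x m \<ominus> x n)) \<le> e / 2"
        by (rule LIMSEQ_le_const2[OF K_norm[OF c]]) (use M[OF m] in \<open>auto intro!: exI[of _ M] less_imp_le\<close>)
      moreover have "0 \<le> cnorm K (cls (\<lambda>n. x m \<ominus> x n))"
        using c by (intro K.p_nonneg) (auto simp: K_carrier)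
      ultimately show ?thesis using e \<open>e > 0\<close> by simp
    qed
    then show "\<exists>no. \<forall>n\<ge>no. norm (cnorm K (emb (x n) \<ominus>\<^bsub>K\<^esub> cls x) - 0) < e" by blast
  qed
qed (use x in \<open>auto intro!: emb.closed\<close>)

lemma cstar_K: "cstar K"
proof (intro cstar.intro cstar_axioms.intro)
  show "cstar_semi K (cnorm K)" by (rule K.cstar_semi_axioms)
  fix X assume "X \<in> carrier K" and n0: "cnorm K X = 0"
  then obtain x where x: "x \<in> CS" "X = cls x" by (auto simp: K_carrier)
  have "(x, \<lambda>n. \<zero>) \<in> NR" using x n0 K_norm[OF x(1)] by (auto simp: NR_iff minus_eq)
  then show "X = \<zero>\<^bsub>K\<^esub>" using x cls_eqI by (simp add: K_zero)
next
  fix X assume X: "X \<in> cauchy_seqs K (cnorm K)"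
  have Xc [simp]: "X n \<in> carrier K" for n by (rule K.CS_closed[OF X])
  \<comment> \<open>Diagonal argument: \<open>X n\<close> is approximated by an embedded element
    \<open>z n\<close> up to 1/(n+1). The sequence \<open>z\<close> is then Cauchy in
    \<open>R\<close>, and its class is the limit of \<open>X\<close>.\<close>
  have "\<exists>z\<in>carrier R. cnorm K (emb z \<ominus>\<^bsub>K\<^esub> X n) < 1 / Suc n" for n
  proof -
    obtain x where x: "x \<in> CS" "X n = cls x" using Xc[of n] unfolding K_carrier by blast
    have "\<forall>\<^sub>F m in sequentially. cnorm K (emb (x m) \<ominus>\<^bsub>K\<^esub> X n) < 1 / Suc n"
      using order_tendstoD(2)[OF K.convergesD(3)[OF emb_dense[OF x(1)]], of "1 / Suc n"] x by simp
    then obtain m where "cnorm K (emb (x m) \<ominus>\<^bsub>K\<^esub> X n) < 1 / Suc n"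
      by (auto simp: eventually_sequentially)
    then show ?thesis using x by (intro bexI[of _ "x m"]) auto
  qed
  then obtain z where z [simp]: "\<And>n. z n \<in> carrier R"
    and zX: "\<And>n. cnorm K (emb (z n) \<ominus>\<^bsub>K\<^esub> X n) < 1 / Suc n" by metis
  have inv0: "(\<lambda>n. 1 / real (Suc n)) \<longlonglongrightarrow> 0" using LIMSEQ_inverse_real_of_nat by (simp add: field_simps)
  have z_CS: "z \<in> CS" unfolding CS_Lim0
  proof (intro conjI allI impI)
    fix e :: real assume e: "e > 0"
    obtain M where M: "\<And>m n. m \<ge> M \<Longrightarrow> n \<ge> M \<Longrightarrow> cnorm K (X m \<ominus>\<^bsub>K\<^esub> X n) < e / 3"
      by (rule K.CS_E[OF X, of "e/3"]) (use e in auto)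
    obtain N where N: "\<And>n. n \<ge> N \<Longrightarrow> 1 / real (Suc n) < e / 3"
      using order_tendstoD(2)[OF inv0, of "e/3"] e by (auto simp: eventually_sequentially)
    have "p (z m \<ominus> z n) < e" if "m \<ge> max M N" "n \<ge> max M N" for m n
    proof -
      have "p (z m \<ominus> z n) = cnorm K (emb (z m) \<ominus>\<^bsub>K\<^esub> emb (z n))"
        by (simp add: norm_emb flip: emb.diff)
      also have "\<dots> \<le> cnorm K (emb (z m) \<ominus>\<^bsub>K\<^esub> X m) + (cnorm K (X m \<ominus>\<^bsub>K\<^esub> X n) + cnorm K (X n \<ominus>\<^bsub>K\<^esub> emb (z n)))"
        using K.p_diff_triangle[of "emb (z m)" "X m" "emb (z n)"] K.p_diff_triangle[of "X m" "X n" "emb (z n)"]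
        by simp
      also have "\<dots> < e / 3 + (e / 3 + e / 3)"
        using that M[of m n] zX[of m] zX[of n] N[of m] N[of n] K.p_diff_commute[of "X n" "emb (z n)"]
        by (intro add_strict_mono) auto
      finally show ?thesis by simp
    qed
    then show "\<exists>M. \<forall>m\<ge>M. \<forall>n\<ge>M. p (z m \<ominus> z n) < e" by blast
  qed simp
  have "K.converges (\<lambda>n. X n \<ominus>\<^bsub>K\<^esub> emb (z n)) \<zero>\<^bsub>K\<^esub>"
  proof (rule K.convergesI[OF _ _ _ inv0])
    show "cnorm K (X n \<ominus>\<^bsub>K\<^esub> emb (z n) \<ominus>\<^bsub>K\<^esub> \<zero>\<^bsub>K\<^esub>) \<le> 1 / real (Suc n)" for n
      using zX[of n] K.p_diff_commute[of "X n" "emb (z n)"] by (simp add: K.minus_eq[of _ "\<zero>\<^bsub>K\<^esub>"])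
  qed auto
  then have "K.converges (\<lambda>n. (X n \<ominus>\<^bsub>K\<^esub> emb (z n)) \<oplus>\<^bsub>K\<^esub> emb (z n)) (\<zero>\<^bsub>K\<^esub> \<oplus>\<^bsub>K\<^esub> cls z)"
    by (rule K.converges_add[OF _ emb_dense[OF z_CS]])
  moreover have "(X n \<ominus>\<^bsub>K\<^esub> emb (z n)) \<oplus>\<^bsub>K\<^esub> emb (z n) = X n" for n
    by (simp add: K.minus_eq K.a_assoc K.l_neg)
  ultimately show "\<exists>l. K.converges X l" by auto
qed

lemma K_approx:
  assumes "X \<in> carrier K"
  obtains x where "x \<in> CS" "K.converges (\<lambda>n. emb (x n)) X"
  using assms emb_dense by (auto simp: K_carrier)

end

section \<open>Universal C*-algebras\<close>

locale completion_extension = cstar_semi R p + E: cstar E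
  for R :: "('a, 'y) star_algebra_scheme" (structure) and p and E :: "('e, 'z) cstar_algebra_scheme" +
  fixes f :: "'a \<Rightarrow> 'e"
  assumes f_hom: "star_hom R E f" and f_le: "x \<in> carrier R \<Longrightarrow> cnorm E (f x) \<le> p x"
begin

sublocale f: star_hom_pair R E f
  by (intro star_hom_pair.intro star_alg_axioms E.star_alg_axioms star_hom_pair_axioms.intro f_hom)

lemma f_Cauchy: "x \<in> CS \<Longrightarrow> \<exists>l. E.converges (\<lambda>n. f (x n)) l"
proof (rule E.complete)
  assume x: "x \<in> CS"
  show "(\<lambda>n. f (x n)) \<in> cauchy_seqs E (cnorm E)" unfolding cauchy_seqs_def
  proof (intro CollectI conjI allI impI)
    fix e :: real assume e: "e > 0"
    obtain M where M: "\<And>m n. m \<ge> M \<Longrightarrow> n \<ge> M \<Longrightarrow> p (x m \<ominus> x n) < e"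
      using CS_E[OF x e] by blast
    have "cnorm E (f (x m) \<ominus>\<^bsub>E\<^esub> f (x n)) < e" if "m \<ge> M" "n \<ge> M" for m n
      using M[OF that] f_le[of "x m \<ominus> x n"] CS_closed[OF x] by (simp add: f.diff)
    then show "\<exists>M. \<forall>m\<ge>M. \<forall>n\<ge>M. cnorm E (f (x m) \<ominus>\<^bsub>E\<^esub> f (x n)) < e" by blast
  qed (use x in auto)
qed

definition ext :: "(nat \<Rightarrow> 'a) set \<Rightarrow> 'e" where
  "ext X = (SOME l. \<exists>x\<in>CS. X = cls x \<and> E.converges (\<lambda>n. f (x n)) l)"

text \<open>Extension by continuity. The definition of \<open>ext\<close> picks the limit along some
  representative; since \<open>f\<close> is contractive, equivalent sequences have images with null
  difference, so any representative has that limit.\<close>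

lemma ext_limit:
  assumes x: "x \<in> CS" shows "E.converges (\<lambda>n. f (x n)) (ext (cls x))"
proof -
  have "\<exists>l. \<exists>y\<in>CS. cls x = cls y \<and> E.converges (\<lambda>n. f (y n)) l"
    using f_Cauchy[OF x] x by blast
  then have "\<exists>y\<in>CS. cls x = cls y \<and> E.converges (\<lambda>n. f (y n)) (ext (cls x))"
    unfolding ext_def by (rule someI_ex)
  then obtain y where y: "y \<in> CS" "cls x = cls y" and l: "E.converges (\<lambda>n. f (y n)) (ext (cls x))"
    by blast
  have xy: "(x, y) \<in> NR" using cls_eq[OF x y(1)] y(2) by simp
  have "E.converges (\<lambda>n. f (x n) \<ominus>\<^bsub>E\<^esub> f (y n)) \<zero>\<^bsub>E\<^esub>"
  proof (rule E.convergesI)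
    show "cnorm E (f (x n) \<ominus>\<^bsub>E\<^esub> f (y n) \<ominus>\<^bsub>E\<^esub> \<zero>\<^bsub>E\<^esub>) \<le> p (x n \<ominus> y n)" for n
      using x y f_le[of "x n \<ominus> y n"] by (simp add: f.diff E.minus_eq[of _ "\<zero>\<^bsub>E\<^esub>"])
    show "(\<lambda>n. p (x n \<ominus> y n)) \<longlonglongrightarrow> 0" by (rule NR_D(3)[OF xy])
  qed (use x y in auto)
  then have "E.converges (\<lambda>n. (f (x n) \<ominus>\<^bsub>E\<^esub> f (y n)) \<oplus>\<^bsub>E\<^esub> f (y n)) (\<zero>\<^bsub>E\<^esub> \<oplus>\<^bsub>E\<^esub> ext (cls x))"
    by (rule E.converges_add[OF _ l])
  moreover have "(f (x n) \<ominus>\<^bsub>E\<^esub> f (y n)) \<oplus>\<^bsub>E\<^esub> f (y n) = f (x n)" for n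
    using x y by (simp add: E.minus_eq E.a_assoc E.l_neg)
  ultimately show ?thesis using E.convergesD(2)[OF l] by simp
qed

lemma ext_emb: "x \<in> carrier R \<Longrightarrow> ext (emb x) = f x"
  unfolding emb_def
  by (rule E.limit_unique[OF ext_limit[OF CS_const] E.converges_const]) auto

lemma ext_hom: "star_hom K E ext"
  unfolding star_hom_def
proof (intro conjI ballI allI)
  fix X Y c assume "X \<in> carrier K" "Y \<in> carrier K"
  then obtain x y where x: "x \<in> CS" "X = cls x" and y: "y \<in> CS" "Y = cls y" by (elim K_E)
  note lx = ext_limit[OF x(1), folded x(2)] and ly = ext_limit[OF y(1), folded y(2)]
  show "ext X \<in> carrier E" by (rule E.convergesD(2)[OF lx])
  have "E.converges (\<lambda>n. f (x n \<oplus> y n)) (ext (X \<oplus>\<^bsub>K\<^esub> Y))"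
    using ext_limit[OF CS_add[OF x(1) y(1)]] x y by (simp add: K_add)
  then show "ext (X \<oplus>\<^bsub>K\<^esub> Y) = ext X \<oplus>\<^bsub>E\<^esub> ext Y"
    using E.limit_unique[OF _ E.converges_add[OF lx ly]] x y by (simp add: f.add)
  have "E.converges (\<lambda>n. f (x n \<otimes> y n)) (ext (X \<otimes>\<^bsub>K\<^esub> Y))"
    using ext_limit[OF CS_mult[OF x(1) y(1)]] x y by (simp add: K_mult)
  then show "ext (X \<otimes>\<^bsub>K\<^esub> Y) = ext X \<otimes>\<^bsub>E\<^esub> ext Y"
    using E.limit_unique[OF _ E.converges_mult[OF lx ly]] x y by (simp add: f.mult)
  have "E.converges (\<lambda>n. f (scale R c (x n))) (ext (scale K c X))"
    using ext_limit[OF CS_scale[OF x(1)]] x by (simp add: K_scale)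
  then show "ext (scale K c X) = scale E c (ext X)"
    using E.limit_unique[OF _ E.converges_scale[OF lx]] x by (simp add: f.scale)
  have "E.converges (\<lambda>n. f (star R (x n))) (ext (star K X))"
    using ext_limit[OF CS_star[OF x(1)]] x by (simp add: K_star)
  then show "ext (star K X) = star E (ext X)"
    using E.limit_unique[OF _ E.converges_star[OF lx]] x by (simp add: f.star)
next
  show "ext \<one>\<^bsub>K\<^esub> = \<one>\<^bsub>E\<^esub>" using ext_emb[of \<one>] f.one emb.one by simp
qed

end

text \<open>\<open>bounded\<close> makes the supremum over all admissible seminorms finite at every
  element. Without it \<open>Sup\<close> of an unbounded set of reals would carry no
  information.\<close>

locale universal_alg = star_alg R for R (structure) +
  fixes Z :: "'a set"
  assumes Z_closed: "Z \<subseteq> carrier R"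
    and bounded: "x \<in> carrier R \<Longrightarrow>
      \<exists>B. \<forall>p. cstar_seminorm R p \<longrightarrow> (\<forall>z\<in>Z. p z = 0) \<longrightarrow> p x \<le> B"
begin

abbreviation "sn \<equiv> {p. cstar_seminorm R p \<and> (\<forall>z\<in>Z. p z = 0)}"
abbreviation "us \<equiv> universal_seminorm R Z"

lemma us_eq: "us x = (SUP p\<in>sn. p x)"
  unfolding universal_seminorm_def by (rule arg_cong[of _ _ Sup]) auto

lemma sn_zero: "(\<lambda>_. 0) \<in> sn"
  by (simp add: cstar_seminorm_def)

lemma sn_semi: "p \<in> sn \<Longrightarrow> cstar_semi R p"
  by (intro cstar_semi.intro star_alg_axioms cstar_semi_axioms.intro) auto

lemma sn_bdd: "x \<in> carrier R \<Longrightarrow> bdd_above ((\<lambda>p. p x) ` sn)"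
  using bounded[of x] by (auto simp: bdd_above_def)

lemma le_us: "p \<in> sn \<Longrightarrow> x \<in> carrier R \<Longrightarrow> p x \<le> us x"
  unfolding us_eq by (rule cSUP_upper[OF _ sn_bdd])

lemma us_least: "(\<And>p. p \<in> sn \<Longrightarrow> p x \<le> B) \<Longrightarrow> us x \<le> B"
  unfolding us_eq by (rule cSUP_least) (use sn_zero in auto)

lemma us_nonneg: "x \<in> carrier R \<Longrightarrow> 0 \<le> us x"
  using le_us[OF sn_zero] by simp

lemma us_seminorm: "cstar_seminorm R us"
  unfolding cstar_seminorm_def
proof (intro conjI ballI allI)
  fix x y c assume x: "x \<in> carrier R" and y: "y \<in> carrier R"
  show "0 \<le> us x" by (rule us_nonneg[OF x])
  show "us (x \<oplus> y) \<le> us x + us y"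
  proof (rule us_least)
    fix p assume p: "p \<in> sn"
    interpret p: cstar_semi R p by (rule sn_semi[OF p])
    show "p (x \<oplus> y) \<le> us x + us y"
      using p.p_add[OF x y] le_us[OF p x] le_us[OF p y] by simp
  qed
  show "us (x \<otimes> y) \<le> us x * us y"
  proof (rule us_least)
    fix p assume p: "p \<in> sn"
    interpret p: cstar_semi R p by (rule sn_semi[OF p])
    show "p (x \<otimes> y) \<le> us x * us y"
      using p.p_mult[OF x y] mult_mono[OF le_us[OF p x] le_us[OF p y] us_nonneg[OF x] p.p_nonneg[OF y]]
      by simp
  qed
  have scale_le: "us (scale R c x) \<le> cmod c * us x" if x: "x \<in> carrier R" for x c
  proof (rule us_least)
    fix p assume p: "p \<in> sn"
    interpret p: cstar_semi R p by (rule sn_semi[OF p])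
    show "p (scale R c x) \<le> cmod c * us x"
      using p.p_scale[OF x] mult_left_mono[OF le_us[OF p x], of "cmod c"] by simp
  qed
  show "us (scale R c x) = cmod c * us x"
  proof (cases "c = 0")
    case True
    have "us \<zero> = 0"
      using scale_le[of \<zero> 0] us_nonneg[of \<zero>] by simp
    then show ?thesis using True x by simp
  next
    case False
    \<comment> \<open>The reverse inequality is the inequality already proved, applied to the scalar
      \<open>1 / c\<close>.\<close>
    have "us x \<le> cmod (1 / c) * us (scale R c x)"
      using scale_le[of "scale R c x" "1/c"] x False by simp
    then have "cmod c * us x \<le> us (scale R c x)"
      using False by (simp add: norm_divide field_simps)
    then show ?thesis using scale_le[OF x, of c] by simp
  qed
  have "us (star R x \<otimes> x) \<le> (us x)\<^sup>2"
  proof (rule us_least)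
    fix p assume p: "p \<in> sn"
    interpret p: cstar_semi R p by (rule sn_semi[OF p])
    show "p (star R x \<otimes> x) \<le> (us x)\<^sup>2"
      using p.p_cstar[OF x] power_mono[OF le_us[OF p x] p.p_nonneg[OF x]] by simp
  qed
  \<comment> \<open>Taking the square root before the supremum avoids commuting a supremum with
    squaring.\<close>
  moreover have "us x \<le> sqrt (us (star R x \<otimes> x))"
  proof (rule us_least)
    fix p assume p: "p \<in> sn"
    interpret p: cstar_semi R p by (rule sn_semi[OF p])
    show "p x \<le> sqrt (us (star R x \<otimes> x))"
      using p.p_cstar[OF x] le_us[OF p, of "star R x \<otimes> x"] x by (simp add: real_le_rsqrt)
  qed
  then have "(us x)\<^sup>2 \<le> us (star R x \<otimes> x)"
    using us_nonneg[OF x] us_nonneg[of "star R x \<otimes> x"] x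
    by (metis m_closed power_mono real_sqrt_pow2 star_closed)
  ultimately show "us (star R x \<otimes> x) = (us x)\<^sup>2" by simp
qed

sublocale us: cstar_semi R us
  by (intro cstar_semi.intro star_alg_axioms cstar_semi_axioms.intro us_seminorm)

abbreviation "U \<equiv> universal_cstar R Z"
abbreviation "\<iota> \<equiv> universal_map R Z"

lemma iota_emb: "\<iota> x = us.emb x"
  by (simp add: universal_map_def us.emb_def)

lemma cstar_U: "cstar U"
  unfolding universal_cstar_def by (rule us.cstar_K)

lemma iota_hom: "star_hom R U \<iota>"
proof -
  have "\<iota> = us.emb" by (rule HOL.ext) (rule iota_emb)
  then show ?thesis using us.emb_hom unfolding universal_cstar_def by simp
qed

lemma iota_zero: "z \<in> Z \<Longrightarrow> \<iota> z = \<zero>\<^bsub>U\<^esub>"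
proof -
  assume z: "z \<in> Z"
  interpret K: cstar U by (rule cstar_U)
  interpret h: star_hom_pair R U \<iota>
    by (intro star_hom_pair.intro star_alg_axioms K.star_alg_axioms star_hom_pair_axioms.intro iota_hom)
  have "us z = 0" by (rule antisym, rule us_least) (use z Z_closed us_nonneg in auto)
  then show ?thesis using z Z_closed us.norm_emb[of z] 
    by (intro K.norm_zeroD h.closed) (auto simp: iota_emb universal_cstar_def)
qed

text \<open>Pulling the norm of \<open>E\<close> back along \<open>f\<close> gives one of the
  seminorms in the supremum. Hence \<open>f\<close> is contractive for the universal seminorm and
  extends to the completion.\<close>

lemma universal_property:
  assumes "cstar E" "star_hom R E f" "\<And>z. z \<in> Z \<Longrightarrow> f z = \<zero>\<^bsub>E\<^esub>"
  shows "\<exists>g. star_hom U E g \<and> (\<forall>x\<in>carrier R. g (\<iota> x) = f x)"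
proof -
  interpret E: cstar E by fact
  interpret f: star_hom_pair R E f
    by (intro star_hom_pair.intro star_alg_axioms E.star_alg_axioms star_hom_pair_axioms.intro assms)
  have sn: "(\<lambda>x. cnorm E (f x)) \<in> sn"
    unfolding cstar_seminorm_def using assms(3)
    by (auto simp: f.add f.mult f.scale f.star E.p_add E.p_mult E.p_scale E.p_cstar)
  interpret completion_extension R us E f
    by (intro completion_extension.intro us.cstar_semi_axioms assms(1) completion_extension_axioms.intro assms(2))
      (use le_us[OF sn] in auto)
  show ?thesis using ext_hom ext_emb unfolding universal_cstar_def iota_emb by blast
qed

text \<open>Equality of \<open>f\<close> and \<open>g\<close> passes from the image of \<open>\<iota>\<close> to its closure; both are contractive, which
  is shown below to be automatic.\<close>

lemma contractive_eqI:
  assumes "cstar E" "star_hom U E f" "star_hom U E g" "\<And>x. x \<in> carrier R \<Longrightarrow> f (\<iota> x) = g (\<iota> x)"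
    and "\<And>x. x \<in> carrier U \<Longrightarrow> cnorm E (f x) \<le> cnorm U x" "\<And>x. x \<in> carrier U \<Longrightarrow> cnorm E (g x) \<le> cnorm U x"
    and X: "X \<in> carrier U"
  shows "f X = g X"
proof -
  interpret E: cstar E by fact
  interpret K: cstar U by (rule cstar_U)
  have lim: "E.converges (\<lambda>n. h (x n)) (h X)"
    if "star_hom U E h" and le: "\<And>x. x \<in> carrier U \<Longrightarrow> cnorm E (h x) \<le> cnorm U x" and "K.converges x X" for h x
  proof -
    interpret h: star_hom_pair U E h
      by (intro star_hom_pair.intro K.star_alg_axioms E.star_alg_axioms star_hom_pair_axioms.intro that)
    show ?thesis
    proof (rule E.convergesI)
      show "cnorm E (h (x n) \<ominus>\<^bsub>E\<^esub> h X) \<le> cnorm U (x n \<ominus>\<^bsub>U\<^esub> X)" for n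
        using le[of "x n \<ominus>\<^bsub>U\<^esub> X"] K.convergesD(1,2)[OF that(3)] by (simp add: h.diff)
      show "(\<lambda>n. cnorm U (x n \<ominus>\<^bsub>U\<^esub> X)) \<longlonglongrightarrow> 0" by (rule K.convergesD(3)[OF that(3)])
    qed (use K.convergesD(1,2)[OF that(3)] in auto)
  qed
  obtain x where x: "x \<in> us.CS" "K.converges (\<lambda>n. \<iota> (x n)) X"
    using us.K_approx X unfolding iota_emb universal_cstar_def by blast
  have "E.converges (\<lambda>n. f (\<iota> (x n))) (f X)" "E.converges (\<lambda>n. g (\<iota> (x n))) (g X)"
    using lim x assms by blast+
  moreover have "f (\<iota> (x n)) = g (\<iota> (x n))" for n using assms(4) x(1) by simp
  ultimately show ?thesis by (auto intro: E.limit_unique)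
qed

end

section \<open>Automatic contractivity\<close>

context cstar
begin

text \<open>For \<open>cnorm b < 1\<close> the recursion \<open>y \<mapsto> (b\<^sup>2 + y\<^sup>2) / 2\<close> converges to \<open>y = 1 - sqrt (1 - b\<^sup>2)\<close>,
  so \<open>b\<close> is the real part of the unitary \<open>b + \<i> (1 - y)\<close>.\<close>

lemma seminorm_le_one:
  assumes q: "cstar_seminorm R q" and b [simp]: "b \<in> carrier R" "star R b = b" and lt: "cnorm R b < 1"
  shows "q b \<le> 1"
proof -
  interpret q: cstar_semi R q
    by (intro cstar_semi.intro star_alg_axioms cstar_semi_axioms.intro q)
  let ?n = "cnorm R" and ?h = "scale R (1/2)"
  define r where "r = ?n b"
  have r: "0 \<le> r" "r < 1" using lt by (auto simp: r_def)
  define y where "y = rec_nat \<zero> (\<lambda>_ y. ?h (b \<otimes> b \<oplus> y \<otimes> y))"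
  have y0: "y 0 = \<zero>" and yS: "y (Suc n) = ?h (b \<otimes> b \<oplus> y n \<otimes> y n)" for n by (simp_all add: y_def)
  have yc [simp]: "y n \<in> carrier R" for n by (induction n) (auto simp: y0 yS)
  have ystar: "star R (y n) = y n" for n
    by (induction n) (auto simp: y0 yS star_scale star_add star_mult)
  \<comment> \<open>Each \<open>y n\<close> is a polynomial in \<open>b\<close>. That the limit
    commutes with \<open>b\<close> is what cancels the cross terms of
    \<open>star R u \<otimes> u\<close> below.\<close>
  have ycomm: "y n \<otimes> b = b \<otimes> y n" for n
  proof (induction n)
    case (Suc n)
    have "y n \<otimes> y n \<otimes> b = b \<otimes> (y n \<otimes> y n)" using Suc by (metis m_assoc yc b(1))
    then show ?case by (simp add: yS scale_mult_left scale_mult_right l_distr r_distr m_assoc)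
  qed (simp add: y0)
  have yn: "?n (y n) \<le> r" for n
  proof (induction n)
    case (Suc n)
    have "?n (y (Suc n)) \<le> (1/2) * (?n b * ?n b + ?n (y n) * ?n (y n))"
      using p_add[of "b \<otimes> b" "y n \<otimes> y n"] p_mult[of b b] p_mult[of "y n" "y n"]
      by (simp add: yS p_scale)
    also have "\<dots> \<le> (1/2) * (r * 1 + r * 1)"
      using Suc r p_nonneg[OF yc, of n] by (intro mult_left_mono add_mono mult_mono) (auto simp: r_def)
    finally show ?case by simp
  qed (simp add: y0 r)
  \<comment> \<open>A difference of squares splits as d y' + y d with d = y' - y. Both iterates have
    norm at most \<open>r\<close>, so after halving each step contracts by the factor
    \<open>r\<close>.\<close>
  have ydiff: "?n (y (Suc n) \<ominus> y n) \<le> r ^ n" for n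
  proof (induction n)
    case 0
    have "y (Suc 0) \<ominus> y 0 = y (Suc 0)" by (simp add: y0 minus_eq)
    then show ?case using yn[of "Suc 0"] r by simp
  next
    case (Suc n)
    have c: "y (Suc n) \<otimes> y n = y n \<otimes> y (Suc n)"
    proof -
      have "b \<otimes> b \<otimes> y n = y n \<otimes> (b \<otimes> b)" using ycomm[of n] by (metis m_assoc yc b(1))
      then show ?thesis unfolding yS by (simp add: scale_mult_left scale_mult_right l_distr r_distr m_assoc)
    qed
    have "y (Suc (Suc n)) \<ominus> y (Suc n) = ?h ((b \<otimes> b \<oplus> y (Suc n) \<otimes> y (Suc n)) \<ominus> (b \<otimes> b \<oplus> y n \<otimes> y n))"
      using yS[of "Suc n"] yS[of n] by (simp add: scale_diff)
    also have "(b \<otimes> b \<oplus> y (Suc n) \<otimes> y (Suc n)) \<ominus> (b \<otimes> b \<oplus> y n \<otimes> y n) =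
      (y (Suc n) \<ominus> y n) \<otimes> y (Suc n) \<oplus> y n \<otimes> (y (Suc n) \<ominus> y n)"
      by (simp add: add_diff_add diff_self mult_diff_mult)
    finally have "?n (y (Suc (Suc n)) \<ominus> y (Suc n)) = (1/2) * ?n ((y (Suc n) \<ominus> y n) \<otimes> y (Suc n) \<oplus> y n \<otimes> (y (Suc n) \<ominus> y n))"
      by (simp add: p_scale)
    also have "\<dots> \<le> (1/2) * (?n ((y (Suc n) \<ominus> y n) \<otimes> y (Suc n)) + ?n (y n \<otimes> (y (Suc n) \<ominus> y n)))"
      by (intro mult_left_mono p_add) auto
    also have "\<dots> \<le> (1/2) * (?n (y (Suc n) \<ominus> y n) * ?n (y (Suc n)) + ?n (y n) * ?n (y (Suc n) \<ominus> y n))"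
      by (intro mult_left_mono add_mono p_mult) auto
    also have "\<dots> \<le> (1/2) * (r ^ n * r + r * r ^ n)"
      using Suc yn r by (intro mult_left_mono add_mono mult_mono) auto
    finally show ?case by simp
  qed
  \<comment> \<open>Telescoping the steps gives a tail of the geometric series in
    \<open>r\<close>.\<close>
  have tail: "?n (y (n + k) \<ominus> y n) \<le> r ^ n / (1 - r)" for n k
  proof -
    have "?n (y (n + k) \<ominus> y n) \<le> (\<Sum>i<k. r ^ (n + i))"
    proof (induction k)
      case (Suc k)
      have "?n (y (n + Suc k) \<ominus> y n) \<le> ?n (y (Suc (n + k)) \<ominus> y (n + k)) + ?n (y (n + k) \<ominus> y n)"
        using p_diff_triangle[of "y (n + Suc k)" "y (n + k)" "y n"] by simp
      then show ?case using Suc ydiff[of "n + k"] by simp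
    qed (simp add: diff_self)
    also have "\<dots> = r ^ n * (\<Sum>i<k. r ^ i)" by (simp add: sum_distrib_left power_add)
    also have "\<dots> \<le> r ^ n * (1 / (1 - r))"
      using r sum_le_suminf[OF summable_geometric, of r "{..<k}"] suminf_geometric[of r]
      by (intro mult_left_mono) auto
    finally show ?thesis by simp
  qed
  have "y \<in> cauchy_seqs R ?n" unfolding cauchy_seqs_def
  proof (intro CollectI conjI allI impI)
    fix e :: real assume "e > 0"
    have "(\<lambda>n. r ^ n / (1 - r)) \<longlonglongrightarrow> 0 / (1 - r)" using r by (intro tendsto_intros LIMSEQ_realpow_zero) auto
    then obtain M where M: "\<And>n. n \<ge> M \<Longrightarrow> r ^ n / (1 - r) < e"
      using \<open>e > 0\<close> order_tendstoD(2)[of "\<lambda>n. r ^ n / (1 - r)" 0 sequentially e] by (auto simp: eventually_sequentially)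
    have "?n (y m \<ominus> y n) < e" if "m \<ge> M" "n \<ge> M" for m n
    proof (cases "m \<ge> n")
      case True
      then show ?thesis using tail[of n "m - n"] M[OF that(2)] by simp
    next
      case False
      then show ?thesis using tail[of m "n - m"] M[OF that(1)] p_diff_commute[of "y m" "y n"] by simp
    qed
    then show "\<exists>M. \<forall>m\<ge>M. \<forall>n\<ge>M. ?n (y m \<ominus> y n) < e" by blast
  qed simp
  then obtain l where l: "converges y l" using complete by blast
  note [simp] = convergesD(2)[OF l]
  have "converges (\<lambda>n. y (Suc n)) (?h (b \<otimes> b \<oplus> l \<otimes> l))"
    unfolding yS by (intro converges_scale converges_add converges_mult converges_const l) auto
  moreover have "converges (\<lambda>n. y (Suc n)) l"
    using l by (auto simp: converges_def intro: LIMSEQ_Suc)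
  ultimately have leq: "l = ?h (b \<otimes> b \<oplus> l \<otimes> l)" by (rule limit_unique[rotated])
  have "converges (\<lambda>n. y n \<otimes> b) (b \<otimes> l)"
    unfolding ycomm by (intro converges_mult converges_const l) auto
  then have lcomm: "l \<otimes> b = b \<otimes> l"
    using converges_mult[OF l converges_const[of b]] limit_unique by auto
  have "converges y (star R l)" using converges_star[OF l] by (simp add: ystar)
  then have lstar: "star R l = l" using l limit_unique by blast
  define c where "c = \<one> \<ominus> l"
  have c [simp]: "c \<in> carrier R" "star R c = c" by (auto simp: c_def star_diff lstar)
  have "b \<otimes> b \<oplus> l \<otimes> l = l \<oplus> l"
  proof -
    have "l \<oplus> l = scale R (1 + 1) l" by (simp only: add_scale \<open>l \<in> carrier R\<close> scale_one)
    also have "\<dots> = scale R (1 + 1) (?h (b \<otimes> b \<oplus> l \<otimes> l))" using leq by simp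
    finally show ?thesis by simp
  qed
  then have bl: "b \<otimes> b = (l \<oplus> l) \<ominus> l \<otimes> l"
    by (metis a_assoc b(1) a_inv_closed \<open>l \<in> carrier R\<close> m_closed minus_eq r_neg r_zero)
  \<comment> \<open>The fixed-point equation for \<open>l\<close> is the equation b^2 + (1 - l)^2 =
    1 in another form.\<close>
  have sq: "b \<otimes> b \<oplus> c \<otimes> c = \<one>"
  proof -
    have "c \<otimes> c = (\<one> \<ominus> (l \<oplus> l)) \<oplus> l \<otimes> l"
      by (simp add: c_def minus_eq l_distr r_distr l_minus r_minus minus_add a_assoc)
    then have "b \<otimes> b \<oplus> c \<otimes> c = ((l \<oplus> l) \<ominus> l \<otimes> l) \<oplus> ((\<one> \<ominus> (l \<oplus> l)) \<oplus> l \<otimes> l)"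
      by (simp add: bl)
    also have "(x \<ominus> y) \<oplus> ((\<one> \<ominus> x) \<oplus> y) = \<one>" if "x \<in> carrier R" "y \<in> carrier R" for x y
      using that by algebra
    then have "((l \<oplus> l) \<ominus> l \<otimes> l) \<oplus> ((\<one> \<ominus> (l \<oplus> l)) \<oplus> l \<otimes> l) = \<one>" by simp
    finally show ?thesis .
  qed
  have bc: "b \<otimes> c = c \<otimes> b"
    using lcomm by (simp add: c_def minus_eq l_distr r_distr l_minus r_minus)
  define u where "u = b \<oplus> scale R \<i> c"
  have u [simp]: "u \<in> carrier R" by (simp add: u_def)
  have us: "star R u = b \<oplus> scale R (- \<i>) c" by (simp add: u_def star_add star_scale)
  have "star R u \<otimes> u = (b \<otimes> b \<oplus> c \<otimes> c) \<oplus> (scale R \<i> (b \<otimes> c) \<oplus> scale R (- \<i>) (b \<otimes> c))"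
    by (simp add: us, simp add: u_def l_distr r_distr scale_mult_left scale_mult_right scale_add bc a_ac)
  also have "\<dots> = \<one>" by (simp add: sq flip: add_scale)
  \<comment> \<open>Since \<open>u\<close> is isometric, \<open>q\<close> is evaluated only at the
    unit, where every C*-seminorm is at most 1. No comparison of \<open>q\<close> with the norm
    enters.\<close>
  finally have "(q u)\<^sup>2 \<le> 1" using q.p_cstar[OF u] q.p_one_le by simp
  then have qu: "q u \<le> 1" by (metis abs_square_le_1 abs_le_D1)
  have "u \<oplus> star R u = (b \<oplus> b) \<oplus> (scale R \<i> c \<oplus> scale R (- \<i>) c)"
    by (simp add: us, simp add: u_def a_ac)
  also have "\<dots> = b \<oplus> b" by (simp flip: add_scale)
  also have "\<dots> = scale R (1 + 1) b" by (simp only: add_scale b(1) scale_one)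
  finally have "q (scale R (1 + 1) b) \<le> q u + q (star R u)" using q.p_add[of u "star R u"] by simp
  then show ?thesis using qu by (simp add: q.p_scale)
qed

text \<open>This replaces the spectral radius formula. A self-adjoint \<open>b\<close> is divided by
  its norm plus \<open>e\<close> so that the strict inequality of \<open>seminorm_le_one\<close>
  holds; a general \<open>x\<close> is reduced to \<open>star R x \<otimes> x\<close> by the
  C*-identity.\<close>

theorem contractive:
  assumes q: "cstar_seminorm R q" and x: "x \<in> carrier R"
  shows "q x \<le> cnorm R x"
proof -
  interpret q: cstar_semi R q
    by (intro cstar_semi.intro star_alg_axioms cstar_semi_axioms.intro q)
  let ?n = "cnorm R"
  have sa: "q b \<le> ?n b" if b: "b \<in> carrier R" "star R b = b" for b
  proof (rule field_le_epsilon)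
    fix e :: real assume e: "e > 0"
    define s where "s = ?n b + e"
    have s: "s > 0" using e b by (simp add: s_def add_nonneg_pos)
    let ?b = "scale R (complex_of_real (1 / s)) b"
    have "?n ?b = (1 / s) * ?n b" using s b by (simp add: p_scale norm_divide)
    moreover have "?n b < s" using e by (simp add: s_def)
    moreover have "(1 / s) * ?n b < 1" using s \<open>?n b < s\<close> by (simp add: field_simps)
    ultimately have "?n ?b < 1" by linarith
    then have "q ?b \<le> 1" using b by (intro seminorm_le_one[OF q]) (auto simp: star_scale)
    moreover have "q ?b = (1 / s) * q b" using s b by (simp add: q.p_scale norm_divide)
    ultimately have "(1 / s) * q b \<le> 1" by linarith
    then have "q b \<le> s" using s by (simp add: field_simps)
    then show "q b \<le> ?n b + e" by (simp add: s_def)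
  qed
  have "(q x)\<^sup>2 \<le> (?n x)\<^sup>2"
    using sa[of "star R x \<otimes> x"] x by (simp add: q.p_cstar p_cstar star_mult)
  then show ?thesis using x by (meson p_nonneg power2_le_imp_le)
qed

end

lemma star_hom_contractive:
  assumes "cstar R" "cstar E" "star_hom R E f" "x \<in> carrier R"
  shows "cnorm E (f x) \<le> cnorm R x"
proof -
  interpret R: cstar R by fact
  interpret E: cstar E by fact
  interpret f: star_hom_pair R E f
    by (intro star_hom_pair.intro R.star_alg_axioms E.star_alg_axioms star_hom_pair_axioms.intro assms)
  have "cstar_seminorm R (\<lambda>x. cnorm E (f x))"
    unfolding cstar_seminorm_def
    by (auto simp: f.add f.mult f.scale f.star E.p_add E.p_mult E.p_scale E.p_cstar)
  then show ?thesis using R.contractive assms(4) by blast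
qed

lemma (in universal_alg) universal_unique:
  assumes "cstar E" "star_hom U E f" "star_hom U E g" "\<And>x. x \<in> carrier R \<Longrightarrow> f (\<iota> x) = g (\<iota> x)" "X \<in> carrier U"
  shows "f X = g X"
  by (rule contractive_eqI) (use assms star_hom_contractive[OF cstar_U assms(1)] in auto)

section \<open>Corners and orthogonality of projections\<close>

context star_alg
begin

definition projection :: "'a \<Rightarrow> bool" where
  "projection e \<longleftrightarrow> e \<in> carrier R \<and> star R e = e \<and> e \<otimes> e = e"

lemma projectionD [simp]: "projection e \<Longrightarrow> e \<in> carrier R" "projection e \<Longrightarrow> star R e = e"
  "projection e \<Longrightarrow> e \<otimes> e = e"
  by (auto simp: projection_def)

lemma projection_one [simp]: "projection \<one>" by (simp add: projection_def)

lemma projection_absorb: "projection e \<Longrightarrow> x \<in> carrier R \<Longrightarrow> e \<otimes> (e \<otimes> x) = e \<otimes> x"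
  by (simp flip: m_assoc)

text \<open>With the projection p = \<open>star R w \<otimes> w\<close>, the element x = w p - w has
  \<open>star R x \<otimes> x\<close> equal to p - p - p + p, so it vanishes. The cancellation law
  \<open>z\<close> is a hypothesis because only a *-algebra is assumed; in a C*-algebra it is
  \<open>star_mult_zeroD\<close>.\<close>

lemma partial_isometry:
  assumes w: "w \<in> carrier R" and pr: "projection (star R w \<otimes> w)" and z: "\<And>x. x \<in> carrier R \<Longrightarrow> star R x \<otimes> x = \<zero> \<Longrightarrow> x = \<zero>"
  shows "w \<otimes> star R w \<otimes> w = w" "projection (w \<otimes> star R w)"
proof -
  let ?p = "star R w \<otimes> w"
  have p: "?p \<in> carrier R" "?p \<otimes> ?p = ?p" "star R ?p = ?p" using pr by auto
  have dist: "(a \<ominus> b) \<otimes> (c \<ominus> d) = (a \<otimes> c \<ominus> a \<otimes> d) \<ominus> (b \<otimes> c \<ominus> b \<otimes> d)"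
    if "a \<in> carrier R" "b \<in> carrier R" "c \<in> carrier R" "d \<in> carrier R" for a b c d
    using that by algebra
  have "star R (w \<otimes> ?p \<ominus> w) = ?p \<otimes> star R w \<ominus> star R w"
    using w p by (simp add: star_diff star_mult[of w ?p])
  then have "star R (w \<otimes> ?p \<ominus> w) \<otimes> (w \<otimes> ?p \<ominus> w) =
    ((?p \<otimes> star R w) \<otimes> (w \<otimes> ?p) \<ominus> (?p \<otimes> star R w) \<otimes> w) \<ominus> (star R w \<otimes> (w \<otimes> ?p) \<ominus> star R w \<otimes> w)"
    using w by (simp add: dist)
  moreover have "(?p \<otimes> star R w) \<otimes> (w \<otimes> ?p) = ?p \<otimes> (?p \<otimes> ?p)" "(?p \<otimes> star R w) \<otimes> w = ?p \<otimes> ?p"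
    "star R w \<otimes> (w \<otimes> ?p) = ?p \<otimes> ?p" using w by (simp_all only: m_assoc star_closed m_closed)
  ultimately have "star R (w \<otimes> ?p \<ominus> w) \<otimes> (w \<otimes> ?p \<ominus> w) = \<zero>"
    by (simp only: p(2) diff_self[OF p(1)] diff_self[OF zero_closed])
  then have "w \<otimes> ?p \<ominus> w = \<zero>" by (rule z[rotated]) (use w in simp)
  then have wp: "w \<otimes> ?p = w" using w by (simp add: diff_eq_zero)
  then show "w \<otimes> star R w \<otimes> w = w" using w by (simp only: m_assoc star_closed)
  have "w \<otimes> star R w \<otimes> (w \<otimes> star R w) = (w \<otimes> ?p) \<otimes> star R w"
    using w by (simp only: m_assoc star_closed m_closed)
  then show "projection (w \<otimes> star R w)"
    using w unfolding projection_def wp by (simp add: star_mult)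
qed

end

locale corner_alg = star_alg R for R :: "'a cstar_algebra" (structure) + fixes e
  assumes e: "projection e"
begin

abbreviation "C \<equiv> corner R e"

lemma e_simps [simp]: "e \<in> carrier R" "star R e = e" "e \<otimes> e = e" using e by auto

lemma C_simps [simp]: "mult C = mult R" "add C = add R" "zero C = zero R" "one C = e" "scale C = scale R"
  "star C = star R" "cnorm C = cnorm R"
  by (simp_all add: corner_def)

lemma C_carrier: "x \<in> carrier C \<longleftrightarrow> x \<in> carrier R \<and> e \<otimes> x = x \<and> x \<otimes> e = x"
proof
  assume "x \<in> carrier C"
  then obtain a where "a \<in> carrier R" "x = e \<otimes> a \<otimes> e" by (auto simp: corner_def)
  then show "x \<in> carrier R \<and> e \<otimes> x = x \<and> x \<otimes> e = x"
    by (auto simp: m_assoc projection_absorb[OF e])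
next
  assume "x \<in> carrier R \<and> e \<otimes> x = x \<and> x \<otimes> e = x"
  then have "x = e \<otimes> x \<otimes> e" "x \<in> carrier R" by auto
  then show "x \<in> carrier C" by (auto simp: corner_def)
qed

lemma C_I: "x \<in> carrier R \<Longrightarrow> e \<otimes> x = x \<Longrightarrow> x \<otimes> e = x \<Longrightarrow> x \<in> carrier C"
  by (simp add: C_carrier)

lemma C_D: "x \<in> carrier C \<Longrightarrow> x \<in> carrier R" by (simp add: C_carrier)

lemma star_alg_C: "star_alg C"
proof -
  have "abelian_group C"
  proof (rule abelian_groupI)
    fix x assume "x \<in> carrier C"
    then show "\<exists>y\<in>carrier C. y \<oplus>\<^bsub>C\<^esub> x = \<zero>\<^bsub>C\<^esub>"
      by (intro bexI[of _ "\<ominus> x"]) (auto simp: C_carrier l_neg l_minus r_minus)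
  qed (auto simp: C_carrier l_distr r_distr a_ac)
  moreover have "monoid C"
  proof (rule monoidI)
    fix x y assume "x \<in> carrier C" "y \<in> carrier C"
    then have xy: "x \<in> carrier R" "y \<in> carrier R" "e \<otimes> x = x" "y \<otimes> e = y" by (auto simp: C_carrier)
    then have "e \<otimes> (x \<otimes> y) = x \<otimes> y" by (simp flip: m_assoc)
    then show "x \<otimes>\<^bsub>C\<^esub> y \<in> carrier C" using xy by (simp add: C_carrier m_assoc)
  qed (auto simp: C_carrier m_assoc)
  ultimately have "ring C"
    by (rule ringI) (auto simp: C_carrier l_distr r_distr)
  moreover have "star_alg_axioms C"
  proof
    fix x assume "x \<in> carrier C"
    then show "star C x \<in> carrier C"
      using star_mult[of e x] star_mult[of x e] by (auto simp: C_carrier)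
  qed (auto simp: C_carrier scale_mult_left scale_mult_right scale_add add_scale star_add star_mult star_scale)
  ultimately show ?thesis by (rule star_alg.intro)
qed

lemma C_minus: "x \<in> carrier C \<Longrightarrow> \<ominus>\<^bsub>C\<^esub> x = \<ominus> x"
proof -
  interpret C: star_alg C by (rule star_alg_C)
  assume "x \<in> carrier C" then show ?thesis by (simp add: C.minus_scale minus_scale C_D)
qed

lemma C_diff: "x \<in> carrier C \<Longrightarrow> y \<in> carrier C \<Longrightarrow> x \<ominus>\<^bsub>C\<^esub> y = x \<ominus> y"
  by (simp add: a_minus_def C_minus)

lemma C_finsum: "finite A \<Longrightarrow> (\<And>i. i \<in> A \<Longrightarrow> f i \<in> carrier C) \<Longrightarrow> finsum C f A = finsum R f A"
proof (induction A rule: finite_induct)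
  interpret C: star_alg C by (rule star_alg_C)
  case empty show ?case using C.finsum_empty by simp
next
  interpret C: star_alg C by (rule star_alg_C)
  case (insert a A)
  then show ?case by (simp add: C.finsum_insert Pi_def C_D)
qed

end

locale corner_cstar = cstar R + corner_alg R e for R :: "'a cstar_algebra" (structure) and e
begin

text \<open>Only completeness is at stake. Multiplication by \<open>e\<close> on either side is
  continuous, so a limit of elements fixed by \<open>e\<close> on both sides is fixed by it
  too.\<close>

lemma cstar_C: "cstar C"
proof -
  interpret C: star_alg C by (rule star_alg_C)
  interpret C: cstar_semi C "cnorm C"
    by (intro cstar_semi.intro C.star_alg_axioms cstar_semi_axioms.intro)
      (auto simp: cstar_seminorm_def C_D p_add p_mult p_scale p_cstar)
  show ?thesis
  proof (intro cstar.intro C.cstar_semi_axioms cstar_axioms.intro)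
    fix x assume "x \<in> carrier C" "cnorm C x = 0"
    then show "x = \<zero>\<^bsub>C\<^esub>" using norm_zeroD[OF C_D, of x] by simp
  next
    fix X assume X: "X \<in> cauchy_seqs C (cnorm C)"
    have Xc: "X n \<in> carrier C" for n by (rule C.CS_closed[OF X])
    have "X \<in> cauchy_seqs R (cnorm R)"
      unfolding CS_Lim0
    proof (intro conjI allI impI)
      show "X n \<in> carrier R" for n by (rule C_D[OF Xc])
      fix e' :: real assume "e' > 0"
      then show "\<exists>M. \<forall>m\<ge>M. \<forall>n\<ge>M. cnorm R (X m \<ominus> X n) < e'"
        using X[unfolded C.CS_Lim0] by (simp only: C_diff Xc C_simps)
    qed
    then obtain l where l: "converges X l" using complete by blast
    have "converges (\<lambda>n. e \<otimes> X n) (e \<otimes> l)" "converges (\<lambda>n. X n \<otimes> e) (l \<otimes> e)"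
      by (rule converges_mult[OF converges_const l], simp) (rule converges_mult[OF l converges_const], simp)
    moreover have "(\<lambda>n. e \<otimes> X n) = X" "(\<lambda>n. X n \<otimes> e) = X"
      using Xc by (simp_all add: C_carrier)
    ultimately have "e \<otimes> l = l" "l \<otimes> e = l"
      by (metis limit_unique l)+
    then have lc: "l \<in> carrier C" using l by (intro C_I) (auto simp: converges_def)
    have "C.converges X l"
      unfolding C.converges_def using l[unfolded converges_def] lc Xc by (simp add: C_diff)
    then show "\<exists>l. C.converges X l" by blast
  qed
qed

end

section \<open>Projections with sum one are orthogonal\<close>

context cstar
begin

lemma projection_norm: "projection e \<Longrightarrow> cnorm R e \<le> 1"
proof -
  assume "projection e"
  then have "cnorm R e = (cnorm R e)\<^sup>2" using p_cstar[of e] by simp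
  then have "cnorm R e * (cnorm R e - 1) = 0" by (simp add: power2_eq_square algebra_simps)
  then show ?thesis by auto
qed

text \<open>Averaging \<open>(1 + z b)\<^sup>2\<close> and \<open>(1 + \<i> z b)\<^sup>2\<close> gives \<open>1 + (1 + \<i>) z b\<close>, so the set of \<open>z\<close> with
  \<open>1 + z b\<close> in the unit ball is unbounded.\<close>

lemma one_extreme:
  assumes b [simp]: "b \<in> carrier R" "star R b = b"
    and "cnorm R (\<one> \<oplus> b) \<le> 1" "cnorm R (\<one> \<ominus> b) \<le> 1"
  shows "b = \<zero>"
proof -
  let ?n = "cnorm R"
  define v where "v z = \<one> \<oplus> scale R z b" for z
  have v [simp]: "v z \<in> carrier R" for z by (simp add: v_def)
  have vv: "v y \<otimes> v z = \<one> \<oplus> scale R (y + z) b \<oplus> scale R (y * z) (b \<otimes> b)" for y z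
    by (simp add: v_def l_distr r_distr scale_mult_left scale_mult_right scale_add add_scale a_ac mult.commute)
  have h2: "\<one> \<oplus> \<one> = scale R 2 \<one>" using add_scale[of \<one> 1 1] by simp
  have half: "scale R (1/2) (v y \<otimes> v y \<oplus> v z \<otimes> v z) = \<one> \<oplus> scale R (y + z) b \<oplus> scale R ((y*y + z*z)/2) (b \<otimes> b)" for y z
  proof -
    have "v y \<otimes> v y \<oplus> v z \<otimes> v z = (\<one> \<oplus> \<one>) \<oplus> (scale R (y+y) b \<oplus> scale R (z + z) b) \<oplus> (scale R (y*y) (b \<otimes> b) \<oplus> scale R (z*z) (b \<otimes> b))"
      by (simp add: vv a_ac)
    also have "\<dots> = scale R 2 \<one> \<oplus> scale R (y + y + (z + z)) b \<oplus> scale R (y*y + z*z) (b \<otimes> b)"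
      by (simp add: h2 flip: add_scale)
    finally show ?thesis by (simp add: scale_add algebra_simps add_divide_distrib)
  qed
  have avg: "?n (scale R (1/2) (v y \<otimes> v y \<oplus> v z \<otimes> v z)) \<le> 1" if "?n (v y) \<le> 1" "?n (v z) \<le> 1" for y z
  proof -
    have "?n (v w \<otimes> v w) \<le> 1" if "?n (v w) \<le> 1" for w
      using p_mult[of "v w" "v w"] mult_mono[OF that that] p_nonneg[of "v w"] by simp
    then show ?thesis using p_add[of "v y \<otimes> v y" "v z \<otimes> v z"] that by (simp add: p_scale) (smt (verit))
  qed
  have v1: "?n (v 1) \<le> 1" "?n (v (-1)) \<le> 1"
    using assms by (simp_all add: v_def minus_eq minus_scale)
  have bb: "?n (\<one> \<oplus> b \<otimes> b) \<le> 1" using avg[OF v1] half[of 1 "-1"] by simp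
  \<comment> \<open>For real \<open>s\<close> of modulus 1 the adjoint of
    \<open>v (\<i> * s)\<close> is \<open>v (- \<i> * s)\<close>, and their product is 1 + b^2. That
    element lies in the unit ball as the average of the squares of \<open>v 1\<close> and
    \<open>v (-1)\<close>.\<close>
  have vi: "?n (v (\<i> * s)) \<le> 1" if "s = 1 \<or> s = -1" for s
  proof -
    have "star R (v (\<i> * s)) = v (- \<i> * s)" using that by (auto simp: v_def star_add star_scale)
    then have "star R (v (\<i> * s)) \<otimes> v (\<i> * s) = \<one> \<oplus> b \<otimes> b" using that by (auto simp: vv)
    then have "(?n (v (\<i> * s)))\<^sup>2 \<le> 1" using p_cstar[of "v (\<i> * s)"] bb by simp
    then show ?thesis by (metis abs_square_le_1 abs_le_D1)
  qed
  \<comment> \<open>All four rotations of \<open>z\<close> by powers of \<open>\<i>\<close> are kept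
    together, so that the averaging step can be repeated.\<close>
  define Q where "Q z \<longleftrightarrow> (\<forall>k. ?n (v (\<i> ^ k * z)) \<le> 1)" for z
  have pow: "\<i> ^ k = 1 \<or> \<i> ^ k = -1 \<or> \<i> ^ k = \<i> \<or> \<i> ^ k = - \<i>" for k
    by (induction k) auto
  have Q1: "Q 1" unfolding Q_def
  proof
    fix k show "?n (v (\<i> ^ k * 1)) \<le> 1"
      using pow[of k] v1 vi[of 1] vi[of "-1"] by auto
  qed
  have Qstep: "Q ((1 + \<i>) * z)" if "Q z" for z
    unfolding Q_def
  proof
    fix k
    let ?y = "\<i> ^ k * z" and ?z = "\<i> ^ Suc k * z"
    have "?n (scale R (1/2) (v ?y \<otimes> v ?y \<oplus> v ?z \<otimes> v ?z)) \<le> 1"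
      using that unfolding Q_def by (intro avg) blast+
    \<comment> \<open>The two averaged points differ by the factor \<open>\<i>\<close>, so their
      quadratic terms cancel and only the linear term (1 + i) z b survives.\<close>
    moreover have "?y * ?y + ?z * ?z = 0" by (simp add: algebra_simps)
    moreover have "?y + ?z = \<i> ^ k * ((1 + \<i>) * z)" by (simp add: algebra_simps)
    ultimately show "?n (v (\<i> ^ k * ((1 + \<i>) * z))) \<le> 1"
      unfolding half by (simp add: v_def)
  qed
  have Qn: "Q ((1 + \<i>) ^ n)" for n by (induction n) (use Q1 Qstep in auto)
  \<comment> \<open>The modulus of 1 + i is the square root of 2, which exceeds 1, so these
    multiples of \<open>b\<close> would be unbounded unless \<open>b\<close> vanishes.\<close>
  have bound: "sqrt 2 ^ n * ?n b \<le> 2" for n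
  proof -
    have "?n (v ((1 + \<i>) ^ n)) \<le> 1" using Qn[of n] unfolding Q_def by (metis mult_1 power_0)
    moreover have "scale R ((1 + \<i>) ^ n) b = v ((1 + \<i>) ^ n) \<ominus> \<one>"
      unfolding v_def by (simp add: minus_eq a_ac r_neg r_neg2)
    ultimately have "?n (scale R ((1 + \<i>) ^ n) b) \<le> 2"
      using p_diff[of "v ((1 + \<i>) ^ n)" \<one>] p_one_le by simp
    moreover have "cmod (1 + \<i>) = sqrt 2" by (simp add: cmod_def)
    ultimately show ?thesis by (simp add: p_scale norm_power)
  qed
  have "?n b = 0"
  proof (rule ccontr)
    assume "?n b \<noteq> 0"
    then have pos: "?n b > 0" using p_nonneg[OF b(1)] by linarith
    obtain n where "2 / ?n b < sqrt 2 ^ n" using real_arch_pow[of "sqrt 2"] by auto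
    then show False using bound[of n] pos by (simp add: field_simps)
  qed
  then show ?thesis by (rule norm_zeroD[rotated]) simp
qed

text \<open>The bound on 1 - a l is a norm form of positivity. With M the number of terms and b = a
  j / M, the vanishing sum gives M (1 + b) = 1 + sum over l \<noteq> j of (1 - a l), and trivially M
  (1 - b) = (M - 1) 1 + (1 - a j). Both have norm at most M, so \<open>one_extreme\<close> applies
  to b.\<close>

lemma sum_zero_imp_zero:
  assumes fin: "finite L" and a [simp]: "\<And>l. l \<in> L \<Longrightarrow> a l \<in> carrier R" "\<And>l. l \<in> L \<Longrightarrow> star R (a l) = a l"
    and le: "\<And>l. l \<in> L \<Longrightarrow> cnorm R (\<one> \<ominus> a l) \<le> 1" and sum: "finsum R a L = \<zero>" and j: "j \<in> L"
  shows "a j = \<zero>"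
proof -
  let ?n = "cnorm R"
  define M where "M = card L"
  have M: "M > 0" using j fin card_gt_0_iff by (auto simp: M_def)
  define b where "b = scale R (1 / of_nat M) (a j)"
  have b [simp]: "b \<in> carrier R" "star R b = b" using j by (auto simp: b_def star_scale)
  have Mb: "scale R (of_nat M) b = a j" using j M by (simp add: b_def)
  have bound: "?n x \<le> 1" if "x \<in> carrier R" "?n (scale R (of_nat M) x) \<le> M" for x
    using that M by (simp add: p_scale)
  have M1: "scale R (of_nat M) \<one> = finsum R (\<lambda>l. \<one>) L"
    using sum_scale[OF fin, of \<one> "\<lambda>_. 1"] by (simp add: M_def)
  have "?n (\<one> \<oplus> b) \<le> 1"
  proof (rule bound)
    have "finsum R a L = a j \<oplus> finsum R a (L - {j})"
      using j fin by (subst finsum_insert[symmetric]) (auto simp: insert_absorb)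
    then have aj: "a j = \<ominus> finsum R a (L - {j})"
      using sum j by (metis a(1) finsum_in_carrier Diff_iff minus_equality)
    have "finsum R (\<lambda>l. \<one>) L = \<one> \<oplus> finsum R (\<lambda>l. \<one>) (L - {j})"
      using j fin by (subst finsum_insert[symmetric]) (auto simp: insert_absorb)
    moreover have "finsum R (\<lambda>l. \<one> \<ominus> a l) (L - {j}) = finsum R (\<lambda>l. \<one>) (L - {j}) \<oplus> a j"
    proof -
      have "finsum R (\<lambda>l. \<ominus> a l) (L - {j}) = scale R (-1) (finsum R a (L - {j}))"
        using fin by (subst scale_finsum) (auto simp: minus_scale intro!: finsum_eqI)
      also have "\<dots> = a j"
        unfolding aj by (rule minus_scale[symmetric]) (auto intro!: finsum_in_carrier)
      finally show ?thesis unfolding minus_eq by (subst finsum_add) auto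
    qed
    ultimately have "scale R (of_nat M) (\<one> \<oplus> b) = \<one> \<oplus> finsum R (\<lambda>l. \<one> \<ominus> a l) (L - {j})"
      using j by (simp add: scale_add Mb M1 a_assoc finsum_in_carrier)
    then have "?n (scale R (of_nat M) (\<one> \<oplus> b)) \<le> ?n \<one> + ?n (finsum R (\<lambda>l. \<one> \<ominus> a l) (L - {j}))"
      by (simp add: p_add finsum_in_carrier)
    also have "\<dots> \<le> 1 + (\<Sum>l\<in>L - {j}. ?n (\<one> \<ominus> a l))"
      using fin by (intro add_mono p_one_le p_finsum) auto
    also have "\<dots> \<le> 1 + (\<Sum>l\<in>L - {j}. 1)" by (intro add_mono sum_mono le) auto
    also have "\<dots> = M" using j fin M by (simp add: M_def card_Diff_singleton)
    finally show "?n (scale R (of_nat M) (\<one> \<oplus> b)) \<le> M" .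
  qed simp
  moreover have "?n (\<one> \<ominus> b) \<le> 1"
  proof (rule bound)
    have "scale R (of_nat M) (\<one> \<ominus> b) = scale R (of_nat M) \<one> \<ominus> a j"
      by (simp add: scale_diff Mb)
    also have "scale R (of_nat M) \<one> = scale R (of_nat (M - 1)) \<one> \<oplus> \<one>"
      using M add_scale[of \<one> "of_nat (M - 1)" 1] by (simp add: of_nat_diff)
    finally have "scale R (of_nat M) (\<one> \<ominus> b) = scale R (of_nat (M - 1)) \<one> \<oplus> (\<one> \<ominus> a j)"
      using j by (simp add: minus_eq a_assoc)
    then have "?n (scale R (of_nat M) (\<one> \<ominus> b)) \<le> ?n (scale R (of_nat (M - 1)) \<one>) + ?n (\<one> \<ominus> a j)"
      using j by (simp add: p_add)
    also have "\<dots> \<le> of_nat (M - 1) * 1 + 1"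
      using p_one_le M le[OF j] by (intro add_mono) (simp_all add: p_scale mult_left_le del: of_nat_diff)
    finally show "?n (scale R (of_nat M) (\<one> \<ominus> b)) \<le> M" using M by (simp add: of_nat_diff)
  qed simp
  ultimately have "b = \<zero>" by (rule one_extreme[rotated 2]) auto
  then show ?thesis using Mb j by simp
qed

end

text \<open>Compressing the sum by \<open>e i\<close> and removing the term \<open>e i\<close>
  leaves elements \<open>e i \<otimes> e l \<otimes> e i\<close> of the corner with sum zero. They
  are positive in the sense of \<open>sum_zero_imp_zero\<close>, hence each is zero, and such an
  element is the adjoint of \<open>e l \<otimes> e i\<close> times
  \<open>e l \<otimes> e i\<close>.\<close>

theorem projections_orthogonal:
  fixes R :: "'a cstar_algebra" (structure)
  assumes "cstar R" "finite L" and pr: "\<And>l. l \<in> L \<Longrightarrow> star_alg.projection R (e l)"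
    and sum: "finsum R e L = \<one>" and ij: "i \<in> L" "j \<in> L" "i \<noteq> j"
  shows "e i \<otimes> e j = \<zero>"
proof -
  interpret cstar R by fact
  interpret corner_cstar R "e i"
    by (intro corner_cstar.intro corner_alg.intro corner_alg_axioms.intro assms star_alg_axioms ij)
  interpret C: cstar "corner R (e i)" by (rule cstar_C)
  note [simp] = projectionD[OF pr]
  define a where "a l = e i \<otimes> e l \<otimes> e i" for l
  have aC: "a l \<in> carrier C" if "l \<in> L" for l
    using that by (intro C_I) (auto simp: a_def m_assoc projection_absorb[OF e])
  have ai: "a i = e i" by (simp add: a_def)
  have "finsum R a L = e i \<otimes> finsum R e L \<otimes> e i"
    unfolding a_def using assms(2) ij
    by (simp add: finsum_mult_left finsum_mult_right finsum_in_carrier)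
  then have s1: "finsum R a L = e i" by (simp add: sum)
  have "finsum R a L = a i \<oplus> finsum R a (L - {i})"
    using ij assms(2) aC by (subst finsum_insert[symmetric]) (auto simp: insert_absorb C_D)
  then have s: "finsum R a (L - {i}) = \<zero>"
    using s1 ai aC by (metis C_D Diff_iff add.l_cancel_one e_simps(1) finsum_in_carrier)
  have "a j = \<zero>\<^bsub>C\<^esub>"
  proof (rule C.sum_zero_imp_zero[of "L - {i}" a j])
    fix l assume l: "l \<in> L - {i}"
    then show "a l \<in> carrier C" using aC by simp
    show "star C (a l) = a l" using l by (simp add: a_def star_mult m_assoc)
    \<comment> \<open>The unit of the corner minus \<open>a l\<close> is the compression of the
      projection 1 - e l, which gives the norm bound 1.\<close>
    have "\<one>\<^bsub>C\<^esub> \<ominus>\<^bsub>C\<^esub> a l = e i \<otimes> (\<one> \<ominus> e l) \<otimes> e i"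
      using l aC C_diff[of "e i" "a l"] C.one_closed by (simp add: a_def minus_eq l_distr r_distr l_minus r_minus)
    also have "cnorm R \<dots> \<le> cnorm R (e i) * cnorm R (\<one> \<ominus> e l) * cnorm R (e i)"
    proof -
      have "cnorm R (e i \<otimes> (\<one> \<ominus> e l) \<otimes> e i) \<le> cnorm R (e i \<otimes> (\<one> \<ominus> e l)) * cnorm R (e i)"
        using l by (intro p_mult) auto
      also have "\<dots> \<le> cnorm R (e i) * cnorm R (\<one> \<ominus> e l) * cnorm R (e i)"
        using l by (intro mult_right_mono p_mult) auto
      finally show ?thesis .
    qed
    also have "\<dots> \<le> 1 * 1 * 1"
    proof (intro mult_mono projection_norm)
      have "star R (\<one> \<ominus> e l) = \<one> \<ominus> e l" using l by (simp add: star_diff)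
      moreover have "(\<one> \<ominus> e l) \<otimes> (\<one> \<ominus> e l) = \<one> \<ominus> e l"
        using l by (simp add: minus_eq l_distr r_distr l_minus r_minus a_assoc r_neg1 r_neg2 r_neg l_neg)
      ultimately show "projection (\<one> \<ominus> e l)" using l unfolding projection_def by simp
    qed (use l e in auto)
    finally show "cnorm C (\<one>\<^bsub>C\<^esub> \<ominus>\<^bsub>C\<^esub> a l) \<le> 1" by simp
  next
    show "finsum C a (L - {i}) = \<zero>\<^bsub>C\<^esub>" by (subst C_finsum) (use s aC assms(2) in auto)
  qed (use ij assms(2) in auto)
  then have "star R (e j \<otimes> e i) \<otimes> (e j \<otimes> e i) = \<zero>"
    using ij by (simp add: a_def star_mult m_assoc projection_absorb[OF pr])
  then have "e j \<otimes> e i = \<zero>" by (rule star_mult_zeroD[rotated]) (use ij in simp)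
  then have "star R (e j \<otimes> e i) = \<zero>" by simp
  then show ?thesis using ij by (simp add: star_mult)
qed

section \<open>Cuntz--Krieger algebras over a finite subset of the letters\<close>

lemma star_hom_pairI:
  "star_alg R \<Longrightarrow> star_alg S \<Longrightarrow> star_hom R S f \<Longrightarrow> star_hom_pair R S f"
  by (intro star_hom_pair.intro star_hom_pair_axioms.intro)

lemma (in star_monoid) star_hom_eqI:
  assumes "star_alg E" "star_hom S E f" "star_hom S E g"
    and pm: "\<And>u. u \<in> carrier M \<Longrightarrow> f (point_mass u) = g (point_mass u)" and x: "x \<in> carrier S"
  shows "f x = g x"
proof -
  interpret E: star_alg E by fact
  interpret f: star_hom_pair S E f by (rule star_hom_pairI[OF star_alg_S assms(1,2)])
  interpret g: star_hom_pair S E g by (rule star_hom_pairI[OF star_alg_S assms(1,3)])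
  let ?X = "{u. x u \<noteq> 0}"
  have fin: "finite ?X" "?X \<subseteq> carrier M" using x by (auto simp: carrier_S)
  have cl: "scale S (x u) (point_mass u) \<in> carrier S" if "u \<in> ?X" for u using that fin by auto
  have "f x = finsum E (\<lambda>u. f (scale S (x u) (point_mass u))) ?X"
    by (subst (1) point_mass_expansion[OF x]) (rule f.finsum[OF fin(1) cl])
  also have "\<dots> = finsum E (\<lambda>u. g (scale S (x u) (point_mass u))) ?X"
  proof (rule E.finsum_eqI[OF refl])
    fix u assume u: "u \<in> ?X"
    show "g (scale S (x u) (point_mass u)) \<in> carrier E" by (rule g.closed[OF cl[OF u]])
    have "u \<in> carrier M" using u fin by auto
    then show "f (scale S (x u) (point_mass u)) = g (scale S (x u) (point_mass u))"
      by (simp add: f.scale g.scale pm)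
  qed
  also have "\<dots> = g x"
    by (subst (2) point_mass_expansion[OF x]) (rule g.finsum[OF fin(1) cl, symmetric])
  finally show ?thesis .
qed

text \<open>The bound depends on \<open>x\<close> and on \<open>B\<close> but not on
  \<open>p\<close>. This is the uniformity that \<open>bounded\<close> in
  \<open>universal_alg\<close> asks for.\<close>

lemma (in star_monoid) seminorm_bound:
  assumes "cstar_seminorm S p" "x \<in> carrier S" "\<And>u. u \<in> carrier M \<Longrightarrow> p (point_mass u) \<le> B u"
  shows "p x \<le> (\<Sum>u\<in>{u. x u \<noteq> 0}. cmod (x u) * B u)"
proof -
  interpret p: cstar_semi S p by (intro cstar_semi.intro star_alg_S cstar_semi_axioms.intro assms)
  let ?X = "{u. x u \<noteq> 0}"
  have fin: "finite ?X" "?X \<subseteq> carrier M" using assms(2) by (auto simp: carrier_S)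
  have "p x = p (finsum S (\<lambda>u. scale S (x u) (point_mass u)) ?X)"
    by (subst (1) point_mass_expansion[OF assms(2)]) simp
  also have "\<dots> \<le> (\<Sum>u\<in>?X. p (scale S (x u) (point_mass u)))"
    using fin by (intro p.p_finsum) auto
  also have "\<dots> \<le> (\<Sum>u\<in>?X. cmod (x u) * B u)"
  proof (rule sum_mono)
    fix u assume "u \<in> ?X"
    then have "u \<in> carrier M" using fin by auto
    then show "p (scale S (x u) (point_mass u)) \<le> cmod (x u) * B u"
      by (simp add: p.p_scale assms(3) mult_left_mono)
  qed
  finally show ?thesis .
qed

lemma letter_adj_letter_adj [simp]: "letter_adj (letter_adj l) = l"
  by (cases l) auto

interpretation F: star_monoid word_monoid "\<lambda>w. rev (map letter_adj w)"
proof
qed (auto simp: word_monoid_def rev_map comp_def)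

lemma F_eq: "free_star_algebra = F.S"
  by (simp add: free_star_algebra_def)

lemma word_simps [simp]: "carrier word_monoid = UNIV" "mult word_monoid = (@)" "\<one>\<^bsub>word_monoid\<^esub> = []"
  by (simp_all add: word_monoid_def)

interpretation FS: star_alg free_star_algebra
  unfolding F_eq by (rule F.star_alg_S)

lemma free_gen_closed [simp, intro]: "free_gen i \<in> carrier free_star_algebra"
  by (auto simp: F_eq free_gen_def)

primrec word_rep :: "('e, 'z) star_algebra_scheme \<Rightarrow> ('g \<Rightarrow> 'e) \<Rightarrow> 'g letter list \<Rightarrow> 'e" where
  "word_rep E g [] = \<one>\<^bsub>E\<^esub>"
| "word_rep E g (l # w) = (case l of Gen i \<Rightarrow> g i | Adj i \<Rightarrow> star E (g i)) \<otimes>\<^bsub>E\<^esub> word_rep E g w"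

lemma free_hom_exists:
  fixes g :: "'g \<Rightarrow> 'e" and E :: "('e, 'z) star_algebra_scheme"
  assumes "star_alg E" "\<And>i. g i \<in> carrier E"
  shows "\<exists>f. star_hom free_star_algebra E f \<and> (\<forall>i. f (free_gen i) = g i)"
proof -
  interpret E: star_alg E by fact
  have lc [simp]: "(case l of Gen i \<Rightarrow> g i | Adj i \<Rightarrow> star E (g i)) \<in> carrier E" for l
    using assms(2) by (cases l) auto
  have wc [simp]: "word_rep E g w \<in> carrier E" for w by (induction w) auto
  have app: "word_rep E g (v @ w) = word_rep E g v \<otimes>\<^bsub>E\<^esub> word_rep E g w" for v w
    by (induction v) (auto simp: E.m_assoc)
  have "star_monoid_rep_axioms word_monoid (\<lambda>w. rev (map letter_adj w)) E (word_rep E g)"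
  proof
    fix w :: "'g letter list"
    show "word_rep E g (rev (map letter_adj w)) = star E (word_rep E g w)"
    proof (induction w)
      case (Cons l w)
      then show ?case using assms(2) by (cases l) (simp_all add: app E.star_mult)
    qed simp
  qed (simp_all add: app)
  then interpret r: star_monoid_rep word_monoid "\<lambda>w. rev (map letter_adj w)" E "word_rep E g"
    by (intro star_monoid_rep.intro F.star_monoid_axioms assms)
  have "r.lin (free_gen i) = g i" for i
    unfolding free_gen_def using assms(2) by (subst r.lin_point_mass) auto
  then show ?thesis using r.star_hom_lin unfolding F_eq by blast
qed

lemma free_hom_unique:
  fixes f g :: "('g letter list \<Rightarrow> complex) \<Rightarrow> 'e" and E :: "('e, 'z) star_algebra_scheme"
  assumes "star_alg E" "star_hom free_star_algebra E f" "star_hom free_star_algebra E g"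
    and gen: "\<And>i. f (free_gen i) = g (free_gen i)" and x: "x \<in> carrier free_star_algebra"
  shows "f x = g x"
proof -
  interpret f: star_hom_pair free_star_algebra E f by (rule star_hom_pairI[OF FS.star_alg_axioms assms(1,2)])
  interpret g: star_hom_pair free_star_algebra E g by (rule star_hom_pairI[OF FS.star_alg_axioms assms(1,3)])
  have letter: "f (point_mass [l]) = g (point_mass [l])" for l
  proof (cases l)
    case (Gen i) then show ?thesis using gen[of i] by (simp add: free_gen_def)
  next
    case (Adj i)
    then have "point_mass [l] = star free_star_algebra (free_gen i)"
      by (simp add: F_eq free_gen_def F.point_mass_star)
    then show ?thesis by (simp add: f.star g.star gen)
  qed
  have word: "f (point_mass w) = g (point_mass w)" for w
  proof (induction w)
    case Nil
    have "point_mass ([] :: 'g letter list) = \<one>\<^bsub>free_star_algebra\<^esub>" by (simp add: F_eq F.S_one)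
    then show ?case by (simp add: f.one g.one)
  next
    case (Cons l w)
    have "point_mass (l # w) = point_mass [l] \<otimes>\<^bsub>free_star_algebra\<^esub> point_mass w"
      unfolding F_eq by (subst F.point_mass_mult) auto
    moreover have "point_mass v \<in> carrier free_star_algebra" for v :: "'g letter list"
      unfolding F_eq by (rule F.point_mass_closed) simp
    ultimately show ?case using Cons letter[of l] by (simp add: f.mult g.mult)
  qed
  show ?thesis
    by (rule F.star_hom_eqI[OF assms(1) assms(2,3)[unfolded F_eq] _ x[unfolded F_eq]]) (rule word)
qed

text \<open>The letters outside \<open>I\<close> are sent to \<open>0\<close>, so that all algebras of a chain of recodings live over
  one type of letters.\<close>

definition gck_relators :: "'g set \<Rightarrow> ('g \<Rightarrow> 'g \<Rightarrow> bool) \<Rightarrow> ('g letter list \<Rightarrow> complex) set" where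
  "gck_relators I A =
    (let F = free_star_algebra; s = free_gen; range_proj = (\<lambda>i. s i \<otimes>\<^bsub>F\<^esub> star F (s i)) in
      {range_proj i \<otimes>\<^bsub>F\<^esub> s i \<ominus>\<^bsub>F\<^esub> s i | i. i \<in> I} \<union>
      {finsum F range_proj I \<ominus>\<^bsub>F\<^esub> \<one>\<^bsub>F\<^esub>} \<union>
      {(star F (s i) \<otimes>\<^bsub>F\<^esub> s i) \<ominus>\<^bsub>F\<^esub> finsum F range_proj {j\<in>I. A i j} | i. i \<in> I} \<union>
      {s i | i. i \<notin> I})"

definition gck :: "'g set \<Rightarrow> ('g \<Rightarrow> 'g \<Rightarrow> bool) \<Rightarrow> (nat \<Rightarrow> 'g letter list \<Rightarrow> complex) set cstar_algebra" where
  "gck I A = universal_cstar free_star_algebra (gck_relators I A)"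

definition gck_gen :: "'g set \<Rightarrow> ('g \<Rightarrow> 'g \<Rightarrow> bool) \<Rightarrow> 'g \<Rightarrow> (nat \<Rightarrow> 'g letter list \<Rightarrow> complex) set" where
  "gck_gen I A i = universal_map free_star_algebra (gck_relators I A) (free_gen i)"

text \<open>The relations of \<open>gck_relators\<close> stated for elements of an arbitrary
  algebra. By \<open>hom_relators\<close> these are the images of generators under homomorphisms
  that kill the relators.\<close>

definition ck_family :: "('e, 'z) star_algebra_scheme \<Rightarrow> 'g set \<Rightarrow> ('g \<Rightarrow> 'g \<Rightarrow> bool) \<Rightarrow> ('g \<Rightarrow> 'e) \<Rightarrow> bool" where
  "ck_family E I A g \<longleftrightarrow>
    (\<forall>i. g i \<in> carrier E) \<and>
    (\<forall>i\<in>I. g i \<otimes>\<^bsub>E\<^esub> star E (g i) \<otimes>\<^bsub>E\<^esub> g i = g i) \<and>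
    finsum E (\<lambda>i. g i \<otimes>\<^bsub>E\<^esub> star E (g i)) I = \<one>\<^bsub>E\<^esub> \<and>
    (\<forall>i\<in>I. star E (g i) \<otimes>\<^bsub>E\<^esub> g i = finsum E (\<lambda>j. g j \<otimes>\<^bsub>E\<^esub> star E (g j)) {j\<in>I. A i j}) \<and>
    (\<forall>i. i \<notin> I \<longrightarrow> g i = \<zero>\<^bsub>E\<^esub>)"

lemma hom_relators:
  fixes f :: "('g letter list \<Rightarrow> complex) \<Rightarrow> 'e" and E :: "('e, 'z) star_algebra_scheme"
  assumes "star_alg E" "finite I" and f: "star_hom free_star_algebra E f"
  shows "(\<forall>z\<in>gck_relators I A. f z = \<zero>\<^bsub>E\<^esub>) \<longleftrightarrow> ck_family E I A (\<lambda>i. f (free_gen i))"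
proof -
  interpret E: star_alg E by fact
  interpret f: star_hom_pair free_star_algebra E f by (rule star_hom_pairI[OF FS.star_alg_axioms assms(1) f])
  let ?F = "free_star_algebra :: ('g letter list \<Rightarrow> complex) star_algebra"
  let ?r = "\<lambda>i. free_gen i \<otimes>\<^bsub>?F\<^esub> star ?F (free_gen i)"
  let ?g = "\<lambda>i. f (free_gen i)"
  have rc [simp, intro]: "?r i \<in> carrier ?F" for i by auto
  have fr: "f (?r i) = ?g i \<otimes>\<^bsub>E\<^esub> star E (?g i)" for i by (simp add: f.mult f.star)
  have fs: "f (finsum ?F ?r J) = finsum E (\<lambda>i. ?g i \<otimes>\<^bsub>E\<^esub> star E (?g i)) J" if "finite J" for J
    using that by (subst f.finsum) (auto simp: fr)
  have fsc: "finsum ?F ?r J \<in> carrier ?F" for J by (rule FS.finsum_in_carrier) auto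
  have c1: "f (?r i \<otimes>\<^bsub>?F\<^esub> free_gen i \<ominus>\<^bsub>?F\<^esub> free_gen i) = \<zero>\<^bsub>E\<^esub> \<longleftrightarrow> ?g i \<otimes>\<^bsub>E\<^esub> star E (?g i) \<otimes>\<^bsub>E\<^esub> ?g i = ?g i" for i
    by (simp add: f.diff f.mult f.star E.diff_eq_zero)
  have c2: "f (finsum ?F ?r I \<ominus>\<^bsub>?F\<^esub> \<one>\<^bsub>?F\<^esub>) = \<zero>\<^bsub>E\<^esub> \<longleftrightarrow> finsum E (\<lambda>i. ?g i \<otimes>\<^bsub>E\<^esub> star E (?g i)) I = \<one>\<^bsub>E\<^esub>"
    using fsc[of I] by (simp add: f.diff f.one fs[OF assms(2)] E.diff_eq_zero E.finsum_in_carrier)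
  have fin: "finite {j\<in>I. A i j}" for i using assms(2) by simp
  have c3: "f ((star ?F (free_gen i) \<otimes>\<^bsub>?F\<^esub> free_gen i) \<ominus>\<^bsub>?F\<^esub> finsum ?F ?r {j\<in>I. A i j}) = \<zero>\<^bsub>E\<^esub>
     \<longleftrightarrow> star E (?g i) \<otimes>\<^bsub>E\<^esub> ?g i = finsum E (\<lambda>j. ?g j \<otimes>\<^bsub>E\<^esub> star E (?g j)) {j\<in>I. A i j}" for i
    using fsc[of "{j\<in>I. A i j}"] by (simp add: f.diff f.mult f.star fs[OF fin] E.diff_eq_zero E.finsum_in_carrier)
  have eq: "gck_relators I A = (\<lambda>i. ?r i \<otimes>\<^bsub>?F\<^esub> free_gen i \<ominus>\<^bsub>?F\<^esub> free_gen i) ` I \<union> {finsum ?F ?r I \<ominus>\<^bsub>?F\<^esub> \<one>\<^bsub>?F\<^esub>} \<union>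
    (\<lambda>i. (star ?F (free_gen i) \<otimes>\<^bsub>?F\<^esub> free_gen i) \<ominus>\<^bsub>?F\<^esub> finsum ?F ?r {j\<in>I. A i j}) ` I \<union> free_gen ` (- I)"
    unfolding gck_relators_def Let_def by auto
  show ?thesis unfolding eq ball_Un ball_simps c1 c2 c3 ck_family_def by auto
qed

text \<open>An admissible seminorm is at most 1 on every generator: on x =
  \<open>star s \<otimes> s\<close> it satisfies p(x)^2 = p(x), by the partial isometry relator, and
  generators outside \<open>I\<close> have seminorm 0. Hence it is at most 1 on every word.\<close>

lemma gck_universal:
  assumes fin: "finite (I :: 'g set)"
  shows "universal_alg free_star_algebra (gck_relators I A)"
proof (intro universal_alg.intro FS.star_alg_axioms universal_alg_axioms.intro)
  let ?F = "free_star_algebra :: ('g letter list \<Rightarrow> complex) star_algebra"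
  have fsc: "finsum ?F (\<lambda>i. free_gen i \<otimes>\<^bsub>?F\<^esub> star ?F (free_gen i)) J \<in> carrier ?F" for J
    by (rule FS.finsum_in_carrier) auto
  show "gck_relators I A \<subseteq> carrier ?F"
    unfolding gck_relators_def Let_def by (auto intro!: FS.minus_closed fsc)
  fix x assume x: "x \<in> carrier ?F"
  show "\<exists>B. \<forall>p. cstar_seminorm ?F p \<longrightarrow> (\<forall>z\<in>gck_relators I A. p z = 0) \<longrightarrow> p x \<le> B"
  proof (intro exI allI impI)
    fix p assume p: "cstar_seminorm ?F p" and Z: "\<forall>z\<in>gck_relators I A. p z = 0"
    interpret p: cstar_semi ?F p by (intro cstar_semi.intro FS.star_alg_axioms cstar_semi_axioms.intro p)
    have gen: "p (free_gen i) \<le> 1" for i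
    proof (cases "i \<in> I")
      case True
      let ?s = "free_gen i"
      have z: "p (?s \<otimes>\<^bsub>?F\<^esub> star ?F ?s \<otimes>\<^bsub>?F\<^esub> ?s \<ominus>\<^bsub>?F\<^esub> ?s) = 0"
        using Z True unfolding gck_relators_def Let_def by blast
      let ?x = "star ?F ?s \<otimes>\<^bsub>?F\<^esub> ?s"
      \<comment> \<open>Multiplying the relator by the adjoint of the generator turns it into x^2 -
        x.\<close>
      have "star ?F ?s \<otimes>\<^bsub>?F\<^esub> (?s \<otimes>\<^bsub>?F\<^esub> star ?F ?s \<otimes>\<^bsub>?F\<^esub> ?s \<ominus>\<^bsub>?F\<^esub> ?s) = ?x \<otimes>\<^bsub>?F\<^esub> ?x \<ominus>\<^bsub>?F\<^esub> ?x"
        by (simp add: FS.minus_eq FS.r_distr FS.r_minus FS.m_assoc)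
      then have "p (?x \<otimes>\<^bsub>?F\<^esub> ?x \<ominus>\<^bsub>?F\<^esub> ?x) \<le> p (star ?F ?s) * 0"
        using p.p_mult[of "star ?F ?s" "?s \<otimes>\<^bsub>?F\<^esub> star ?F ?s \<otimes>\<^bsub>?F\<^esub> ?s \<ominus>\<^bsub>?F\<^esub> ?s"] z by simp
      then have "p (?x \<otimes>\<^bsub>?F\<^esub> ?x \<ominus>\<^bsub>?F\<^esub> ?x) = 0"
        by (intro antisym p.p_nonneg) auto
      then have "p (?x \<otimes>\<^bsub>?F\<^esub> ?x) = p ?x" by (intro p.p_zero_diff) auto
      moreover have "p (?x \<otimes>\<^bsub>?F\<^esub> ?x) = (p ?x)\<^sup>2"
        using p.p_cstar[of ?x] by (simp add: FS.star_mult)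
      ultimately have "p ?x * (p ?x - 1) = 0" by (simp add: power2_eq_square algebra_simps)
      then have "p ?x \<le> 1" by auto
      then have "(p ?s)\<^sup>2 \<le> 1" by (simp add: p.p_cstar)
      then show ?thesis by (metis abs_square_le_1 abs_le_D1)
    next
      case False
      then have "free_gen i \<in> gck_relators I A" unfolding gck_relators_def Let_def by blast
      then show ?thesis using Z by simp
    qed
    have letter: "p (point_mass [l]) \<le> 1" for l
    proof (cases l)
      case (Gen i) then show ?thesis using gen[of i] by (simp add: free_gen_def)
    next
      case (Adj i)
      then have "point_mass [l] = star ?F (free_gen i)"
        by (simp add: F_eq free_gen_def F.point_mass_star)
      then show ?thesis using gen[of i] by simp
    qed
    have word: "p (point_mass w) \<le> 1" for w
    proof (induction w)
      case Nil
      have "point_mass ([] :: 'g letter list) = \<one>\<^bsub>?F\<^esub>" by (simp add: F_eq F.S_one)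
      then show ?case using p.p_one_le by simp
    next
      case (Cons l w)
      have c: "point_mass v \<in> carrier ?F" for v
        unfolding F_eq by (rule F.point_mass_closed) simp
      have "point_mass (l # w) = point_mass [l] \<otimes>\<^bsub>?F\<^esub> point_mass w"
        unfolding F_eq by (subst F.point_mass_mult) auto
      then have "p (point_mass (l # w)) \<le> p (point_mass [l]) * p (point_mass w)"
        using p.p_mult[OF c c] by simp
      also have "\<dots> \<le> 1 * 1" by (intro mult_mono letter Cons p.p_nonneg c) simp
      finally show ?case by simp
    qed
    show "p x \<le> (\<Sum>u\<in>{u. x u \<noteq> 0}. cmod (x u) * 1)"
      by (rule F.seminorm_bound[OF p[unfolded F_eq] x[unfolded F_eq]]) (rule word)
  qed
qed

context
  fixes I :: "'g set" and A :: "'g \<Rightarrow> 'g \<Rightarrow> bool"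
  assumes fin: "finite I"
begin

interpretation U: universal_alg free_star_algebra "gck_relators I A"
  by (rule gck_universal[OF fin])

lemma gck_cstar: "cstar (gck I A)"
  unfolding gck_def by (rule U.cstar_U)

lemma gck_family: "ck_family (gck I A) I A (gck_gen I A)"
proof -
  interpret K: cstar "gck I A" by (rule gck_cstar)
  show ?thesis
    using hom_relators[OF K.star_alg_axioms fin, of U.\<iota> A] U.iota_hom U.iota_zero
    unfolding gck_def gck_gen_def[abs_def] by blast
qed

lemma gck_hom_exists:
  assumes E: "cstar E" and g: "ck_family E I A g"
  shows "\<exists>\<phi>. star_hom (gck I A) E \<phi> \<and> (\<forall>i. \<phi> (gck_gen I A i) = g i)"
proof -
  interpret E: cstar E by fact
  have "\<And>i. g i \<in> carrier E" using g unfolding ck_family_def by blast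
  then obtain f where f: "star_hom free_star_algebra E f" "\<And>i. f (free_gen i) = g i"
    using free_hom_exists[OF E.star_alg_axioms, of g] by blast
  have "\<forall>z\<in>gck_relators I A. f z = \<zero>\<^bsub>E\<^esub>"
    unfolding hom_relators[OF E.star_alg_axioms fin f(1)] f(2) by (rule g)
  then obtain h where "star_hom U.U E h" "\<forall>x\<in>carrier free_star_algebra. h (U.\<iota> x) = f x"
    using U.universal_property[OF E f(1)] by blast
  then show ?thesis unfolding gck_def gck_gen_def using f(2) free_gen_closed by metis
qed

lemma gck_hom_unique:
  assumes E: "cstar E" and f: "star_hom (gck I A) E f" "star_hom (gck I A) E g"
    and gen: "\<And>i. i \<in> I \<Longrightarrow> f (gck_gen I A i) = g (gck_gen I A i)" and x: "x \<in> carrier (gck I A)"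
  shows "f x = g x"
proof -
  interpret E: cstar E by fact
  interpret K: cstar "gck I A" by (rule gck_cstar)
  interpret f: star_hom_pair "gck I A" E f by (rule star_hom_pairI[OF K.star_alg_axioms E.star_alg_axioms f(1)])
  interpret g: star_hom_pair "gck I A" E g by (rule star_hom_pairI[OF K.star_alg_axioms E.star_alg_axioms f(2)])
  have gen': "f (gck_gen I A i) = g (gck_gen I A i)" for i
  proof (cases "i \<in> I")
    case False
    then have "gck_gen I A i = \<zero>\<^bsub>gck I A\<^esub>" using gck_family unfolding ck_family_def by blast
    then show ?thesis by (simp add: f.zero g.zero)
  qed (rule gen)
  have h: "star_hom free_star_algebra E (\<lambda>x. f (U.\<iota> x))" "star_hom free_star_algebra E (\<lambda>x. g (U.\<iota> x))"
    using star_hom_comp[OF U.iota_hom] f unfolding gck_def by blast+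
  have "f (U.\<iota> y) = g (U.\<iota> y)" if "y \<in> carrier free_star_algebra" for y
    by (rule free_hom_unique[OF E.star_alg_axioms h _ that]) (use gen' in \<open>simp add: gck_gen_def\<close>)
  then show ?thesis using U.universal_unique[OF E] f x unfolding gck_def by blast
qed

end

section \<open>Tensor products\<close>

locale tensor = P: cstar P + Q: cstar Q
  for P :: "'a cstar_algebra" and Q :: "'b cstar_algebra"
begin

abbreviation "M \<equiv> P \<times>\<times> Q"
abbreviation "\<tau> \<equiv> map_prod (star P) (star Q)"
abbreviation "PS \<equiv> pair_star_algebra P Q"
abbreviation "BR \<equiv> bilinear_relators P Q"
abbreviation "T \<equiv> cstar_tensor P Q"
abbreviation "t \<equiv> elem_tensor P Q"

sublocale M: star_monoid M \<tau>
proof (intro star_monoid.intro star_monoid_axioms.intro)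
  show "monoid M" by (rule DirProd_monoid) (rule P.is_monoid, rule Q.is_monoid)
qed (auto simp: P.star_mult Q.star_mult)

lemma PS_eq: "PS = M.S" by (simp add: pair_star_algebra_def)

lemma pm_closed [simp]: "a \<in> carrier P \<Longrightarrow> b \<in> carrier Q \<Longrightarrow> point_mass (a, b) \<in> carrier M.S"
  by (rule M.point_mass_closed) simp

lemma relator_add: "(\<lambda>w. point_mass u w - point_mass v w - point_mass v' w) =
   point_mass u \<oplus>\<^bsub>M.S\<^esub> scale M.S (-1) (point_mass v) \<oplus>\<^bsub>M.S\<^esub> scale M.S (-1) (point_mass v')"
  by (rule ext) (simp add: M.S_add M.S_scale)

lemma relator_scale: "(\<lambda>w. point_mass u w - c * point_mass v w) =
   point_mass u \<oplus>\<^bsub>M.S\<^esub> scale M.S (-1) (scale M.S c (point_mass v))"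
  by (rule ext) (simp add: M.S_add M.S_scale)

lemma relators_closed: "BR \<subseteq> carrier M.S"
  unfolding bilinear_relators_def relator_add relator_scale
  by (auto intro!: M.S.a_closed M.S.scale_closed pm_closed)

lemma diff_relator_add: "a \<in> carrier P \<Longrightarrow> a' \<in> carrier P \<Longrightarrow> b \<in> carrier Q \<Longrightarrow>
    point_mass (a \<oplus>\<^bsub>P\<^esub> a', b) \<ominus>\<^bsub>M.S\<^esub> (point_mass (a, b) \<oplus>\<^bsub>M.S\<^esub> point_mass (a', b)) \<in> BR"
  "a \<in> carrier P \<Longrightarrow> b \<in> carrier Q \<Longrightarrow> b' \<in> carrier Q \<Longrightarrow>
    point_mass (a, b \<oplus>\<^bsub>Q\<^esub> b') \<ominus>\<^bsub>M.S\<^esub> (point_mass (a, b) \<oplus>\<^bsub>M.S\<^esub> point_mass (a, b')) \<in> BR"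
  "a \<in> carrier P \<Longrightarrow> b \<in> carrier Q \<Longrightarrow>
    point_mass (scale P c a, b) \<ominus>\<^bsub>M.S\<^esub> scale M.S c (point_mass (a, b)) \<in> BR"
  "a \<in> carrier P \<Longrightarrow> b \<in> carrier Q \<Longrightarrow>
    point_mass (a, scale Q c b) \<ominus>\<^bsub>M.S\<^esub> scale M.S c (point_mass (a, b)) \<in> BR"
proof -
  have d: "x \<ominus>\<^bsub>M.S\<^esub> (y \<oplus>\<^bsub>M.S\<^esub> z) = x \<oplus>\<^bsub>M.S\<^esub> scale M.S (-1) y \<oplus>\<^bsub>M.S\<^esub> scale M.S (-1) z"
    if "x \<in> carrier M.S" "y \<in> carrier M.S" "z \<in> carrier M.S" for x y z
    using that by (simp add: M.S.minus_eq M.S.minus_add M.S.a_assoc flip: M.S.minus_scale)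
  have e: "x \<ominus>\<^bsub>M.S\<^esub> y = x \<oplus>\<^bsub>M.S\<^esub> scale M.S (-1) y"
    if "x \<in> carrier M.S" "y \<in> carrier M.S" for x y
    using that by (simp add: M.S.minus_eq M.S.minus_scale)
  show "point_mass (a \<oplus>\<^bsub>P\<^esub> a', b) \<ominus>\<^bsub>M.S\<^esub> (point_mass (a, b) \<oplus>\<^bsub>M.S\<^esub> point_mass (a', b)) \<in> BR" if "a \<in> carrier P" "a' \<in> carrier P" "b \<in> carrier Q"
  proof -
    have "point_mass (a \<oplus>\<^bsub>P\<^esub> a', b) \<ominus>\<^bsub>M.S\<^esub> (point_mass (a, b) \<oplus>\<^bsub>M.S\<^esub> point_mass (a', b)) = (\<lambda>w. point_mass (a \<oplus>\<^bsub>P\<^esub> a', b) w - point_mass (a, b) w - point_mass (a', b) w)"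
      using that by (simp only: relator_add) (rule d, simp_all)
    then show ?thesis using that unfolding bilinear_relators_def
      by (simp only:) (rule UnI1, rule UnI1, rule UnI1, rule CollectI, intro exI conjI, rule refl, simp_all)
  qed
  show "point_mass (a, b \<oplus>\<^bsub>Q\<^esub> b') \<ominus>\<^bsub>M.S\<^esub> (point_mass (a, b) \<oplus>\<^bsub>M.S\<^esub> point_mass (a, b')) \<in> BR" if "a \<in> carrier P" "b \<in> carrier Q" "b' \<in> carrier Q"
  proof -
    have "point_mass (a, b \<oplus>\<^bsub>Q\<^esub> b') \<ominus>\<^bsub>M.S\<^esub> (point_mass (a, b) \<oplus>\<^bsub>M.S\<^esub> point_mass (a, b')) = (\<lambda>w. point_mass (a, b \<oplus>\<^bsub>Q\<^esub> b') w - point_mass (a, b) w - point_mass (a, b') w)"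
      using that by (simp only: relator_add) (rule d, simp_all)
    then show ?thesis using that unfolding bilinear_relators_def
      by (simp only:) (rule UnI1, rule UnI1, rule UnI2, rule CollectI, intro exI conjI, rule refl, simp_all)
  qed
  show "point_mass (scale P c a, b) \<ominus>\<^bsub>M.S\<^esub> scale M.S c (point_mass (a, b)) \<in> BR" if "a \<in> carrier P" "b \<in> carrier Q"
  proof -
    have "point_mass (scale P c a, b) \<ominus>\<^bsub>M.S\<^esub> scale M.S c (point_mass (a, b)) = (\<lambda>w. point_mass (scale P c a, b) w - c * point_mass (a, b) w)"
      using that by (simp only: relator_scale) (rule e, simp_all)
    then show ?thesis using that unfolding bilinear_relators_def
      by (simp only:) (rule UnI1, rule UnI2, rule CollectI, intro exI conjI, rule refl, simp_all)
  qed
  show "point_mass (a, scale Q c b) \<ominus>\<^bsub>M.S\<^esub> scale M.S c (point_mass (a, b)) \<in> BR" if "a \<in> carrier P" "b \<in> carrier Q"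
  proof -
    have "point_mass (a, scale Q c b) \<ominus>\<^bsub>M.S\<^esub> scale M.S c (point_mass (a, b)) = (\<lambda>w. point_mass (a, scale Q c b) w - c * point_mass (a, b) w)"
      using that by (simp only: relator_scale) (rule e, simp_all)
    then show ?thesis using that unfolding bilinear_relators_def
      by (simp only:) (rule UnI2, rule CollectI, intro exI conjI, rule refl, simp_all)
  qed
qed

text \<open>Point masses are multiplicative but not additive; additivity and homogeneity in one slot
  hold only up to relators, on which \<open>p\<close> vanishes. With the unit in the other slot
  \<open>p\<close> thus becomes a C*-seminorm on a C*-algebra, and \<open>contractive\<close> bounds
  it by the norm.\<close>

lemma left_seminorm:
  assumes p: "cstar_seminorm M.S p" and Z: "\<forall>z\<in>BR. p z = 0"
  shows "cstar_seminorm P (\<lambda>a. p (point_mass (a, \<one>\<^bsub>Q\<^esub>)))" "cstar_seminorm Q (\<lambda>b. p (point_mass (\<one>\<^bsub>P\<^esub>, b)))"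
proof -
  interpret p: cstar_semi M.S p by (intro cstar_semi.intro M.star_alg_S cstar_semi_axioms.intro p)
  have eq: "p x = p y" if "x \<ominus>\<^bsub>M.S\<^esub> y \<in> BR" "x \<in> carrier M.S" "y \<in> carrier M.S" for x y
    using that Z p.p_zero_diff by blast
  have mult: "point_mass (a, b) \<otimes>\<^bsub>M.S\<^esub> point_mass (a', b') = point_mass (a \<otimes>\<^bsub>P\<^esub> a', b \<otimes>\<^bsub>Q\<^esub> b')"
    if "a \<in> carrier P" "a' \<in> carrier P" "b \<in> carrier Q" "b' \<in> carrier Q" for a a' b b'
    using that by (subst M.point_mass_mult) auto
  have star: "star M.S (point_mass (a, b)) = point_mass (star P a, star Q b)"
    if "a \<in> carrier P" "b \<in> carrier Q" for a b
    using that by (subst M.point_mass_star) auto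
  show "cstar_seminorm P (\<lambda>a. p (point_mass (a, \<one>\<^bsub>Q\<^esub>)))"
    unfolding cstar_seminorm_def
  proof (intro conjI ballI allI)
    fix a a' c assume a: "a \<in> carrier P" "a' \<in> carrier P"
    show "0 \<le> p (point_mass (a, \<one>\<^bsub>Q\<^esub>))" using a by simp
    have "p (point_mass (a \<oplus>\<^bsub>P\<^esub> a', \<one>\<^bsub>Q\<^esub>)) = p (point_mass (a, \<one>\<^bsub>Q\<^esub>) \<oplus>\<^bsub>M.S\<^esub> point_mass (a', \<one>\<^bsub>Q\<^esub>))"
      by (rule eq[OF diff_relator_add(1)]) (use a in auto)
    then show "p (point_mass (a \<oplus>\<^bsub>P\<^esub> a', \<one>\<^bsub>Q\<^esub>)) \<le> p (point_mass (a, \<one>\<^bsub>Q\<^esub>)) + p (point_mass (a', \<one>\<^bsub>Q\<^esub>))"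
      using a by (simp add: p.p_add)
    have "p (point_mass (scale P c a, \<one>\<^bsub>Q\<^esub>)) = p (scale M.S c (point_mass (a, \<one>\<^bsub>Q\<^esub>)))"
      by (rule eq[OF diff_relator_add(3)]) (use a in auto)
    then show "p (point_mass (scale P c a, \<one>\<^bsub>Q\<^esub>)) = cmod c * p (point_mass (a, \<one>\<^bsub>Q\<^esub>))"
      using a by (simp add: p.p_scale)
    show "p (point_mass (a \<otimes>\<^bsub>P\<^esub> a', \<one>\<^bsub>Q\<^esub>)) \<le> p (point_mass (a, \<one>\<^bsub>Q\<^esub>)) * p (point_mass (a', \<one>\<^bsub>Q\<^esub>))"
      using p.p_mult[of "point_mass (a, \<one>\<^bsub>Q\<^esub>)" "point_mass (a', \<one>\<^bsub>Q\<^esub>)"] a by (simp add: mult)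
    show "p (point_mass (star P a \<otimes>\<^bsub>P\<^esub> a, \<one>\<^bsub>Q\<^esub>)) = (p (point_mass (a, \<one>\<^bsub>Q\<^esub>)))\<^sup>2"
      using p.p_cstar[of "point_mass (a, \<one>\<^bsub>Q\<^esub>)"] a by (simp add: mult star)
  qed
  show "cstar_seminorm Q (\<lambda>b. p (point_mass (\<one>\<^bsub>P\<^esub>, b)))"
    unfolding cstar_seminorm_def
  proof (intro conjI ballI allI)
    fix b b' c assume b: "b \<in> carrier Q" "b' \<in> carrier Q"
    show "0 \<le> p (point_mass (\<one>\<^bsub>P\<^esub>, b))" using b by simp
    have "p (point_mass (\<one>\<^bsub>P\<^esub>, b \<oplus>\<^bsub>Q\<^esub> b')) = p (point_mass (\<one>\<^bsub>P\<^esub>, b) \<oplus>\<^bsub>M.S\<^esub> point_mass (\<one>\<^bsub>P\<^esub>, b'))"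
      by (rule eq[OF diff_relator_add(2)]) (use b in auto)
    then show "p (point_mass (\<one>\<^bsub>P\<^esub>, b \<oplus>\<^bsub>Q\<^esub> b')) \<le> p (point_mass (\<one>\<^bsub>P\<^esub>, b)) + p (point_mass (\<one>\<^bsub>P\<^esub>, b'))"
      using b by (simp add: p.p_add)
    have "p (point_mass (\<one>\<^bsub>P\<^esub>, scale Q c b)) = p (scale M.S c (point_mass (\<one>\<^bsub>P\<^esub>, b)))"
      by (rule eq[OF diff_relator_add(4)]) (use b in auto)
    then show "p (point_mass (\<one>\<^bsub>P\<^esub>, scale Q c b)) = cmod c * p (point_mass (\<one>\<^bsub>P\<^esub>, b))"
      using b by (simp add: p.p_scale)
    show "p (point_mass (\<one>\<^bsub>P\<^esub>, b \<otimes>\<^bsub>Q\<^esub> b')) \<le> p (point_mass (\<one>\<^bsub>P\<^esub>, b)) * p (point_mass (\<one>\<^bsub>P\<^esub>, b'))"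
      using p.p_mult[of "point_mass (\<one>\<^bsub>P\<^esub>, b)" "point_mass (\<one>\<^bsub>P\<^esub>, b')"] b by (simp add: mult)
    show "p (point_mass (\<one>\<^bsub>P\<^esub>, star Q b \<otimes>\<^bsub>Q\<^esub> b)) = (p (point_mass (\<one>\<^bsub>P\<^esub>, b)))\<^sup>2"
      using p.p_cstar[of "point_mass (\<one>\<^bsub>P\<^esub>, b)"] b by (simp add: mult star)
  qed
qed

text \<open>The pair (a, b) is the product of (a, 1) and (1, b), so every admissible seminorm of it
  is at most the product of the two norms.\<close>

lemma universal_PS: "universal_alg M.S BR"
proof (intro universal_alg.intro M.star_alg_S universal_alg_axioms.intro relators_closed)
  fix x assume x: "x \<in> carrier M.S"
  show "\<exists>B. \<forall>p. cstar_seminorm M.S p \<longrightarrow> (\<forall>z\<in>BR. p z = 0) \<longrightarrow> p x \<le> B"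
  proof (intro exI allI impI)
    fix p assume p: "cstar_seminorm M.S p" and Z: "\<forall>z\<in>BR. p z = 0"
    interpret p: cstar_semi M.S p by (intro cstar_semi.intro M.star_alg_S cstar_semi_axioms.intro p)
    have "p (point_mass (a, b)) \<le> cnorm P a * cnorm Q b" if "a \<in> carrier P" "b \<in> carrier Q" for a b
    proof -
      have "point_mass (a, b) = point_mass (a, \<one>\<^bsub>Q\<^esub>) \<otimes>\<^bsub>M.S\<^esub> point_mass (\<one>\<^bsub>P\<^esub>, b)"
        using that by (subst M.point_mass_mult) auto
      then have "p (point_mass (a, b)) \<le> p (point_mass (a, \<one>\<^bsub>Q\<^esub>)) * p (point_mass (\<one>\<^bsub>P\<^esub>, b))"
        using that p.p_mult[of "point_mass (a, \<one>\<^bsub>Q\<^esub>)" "point_mass (\<one>\<^bsub>P\<^esub>, b)"] by simp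
      also have "\<dots> \<le> cnorm P a * cnorm Q b"
        using that P.contractive[OF left_seminorm(1)[OF p Z]] Q.contractive[OF left_seminorm(2)[OF p Z]]
        by (intro mult_mono) auto
      finally show ?thesis .
    qed
    then show "p x \<le> (\<Sum>u\<in>{u. x u \<noteq> 0}. cmod (x u) * (case u of (a, b) \<Rightarrow> cnorm P a * cnorm Q b))"
      by (intro M.seminorm_bound[OF p x]) auto
  qed
qed

sublocale U: universal_alg M.S BR by (rule universal_PS)

lemma T_eq: "T = U.U" by (simp add: cstar_tensor_def PS_eq)

lemma t_eq: "t a b = U.\<iota> (point_mass (a, b))" by (simp add: elem_tensor_def PS_eq)

lemma cstar_T: "cstar T" unfolding T_eq by (rule U.cstar_U)

sublocale T: cstar T by (rule cstar_T)

sublocale i: star_hom_pair M.S T U.\<iota>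
  by (rule star_hom_pairI[OF M.star_alg_S T.star_alg_axioms]) (unfold T_eq, rule U.iota_hom)

lemma t_closed [simp, intro]: "a \<in> carrier P \<Longrightarrow> b \<in> carrier Q \<Longrightarrow> t a b \<in> carrier T"
  unfolding t_eq by (rule i.closed) simp

lemma t_mult: "a \<in> carrier P \<Longrightarrow> b \<in> carrier Q \<Longrightarrow> a' \<in> carrier P \<Longrightarrow> b' \<in> carrier Q \<Longrightarrow>
   t a b \<otimes>\<^bsub>T\<^esub> t a' b' = t (a \<otimes>\<^bsub>P\<^esub> a') (b \<otimes>\<^bsub>Q\<^esub> b')"
  unfolding t_eq by (subst i.mult[symmetric], simp, simp, subst M.point_mass_mult) auto

lemma t_star: "a \<in> carrier P \<Longrightarrow> b \<in> carrier Q \<Longrightarrow> star T (t a b) = t (star P a) (star Q b)"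
  unfolding t_eq by (subst i.star[symmetric], simp, subst M.point_mass_star) auto

lemma t_one: "t \<one>\<^bsub>P\<^esub> \<one>\<^bsub>Q\<^esub> = \<one>\<^bsub>T\<^esub>"
  unfolding t_eq using i.one by (simp add: M.S_one)

lemma iota_eq:
  assumes "x \<ominus>\<^bsub>M.S\<^esub> y \<in> BR" "x \<in> carrier M.S" "y \<in> carrier M.S"
  shows "U.\<iota> x = U.\<iota> y"
proof -
  have "U.\<iota> x \<ominus>\<^bsub>T\<^esub> U.\<iota> y = \<zero>\<^bsub>T\<^esub>"
    using U.iota_zero[OF assms(1)] assms(2,3) by (simp add: i.diff T_eq)
  then show ?thesis using assms(2,3) by (simp add: T.diff_eq_zero)
qed

lemma t_add_left: "a \<in> carrier P \<Longrightarrow> a' \<in> carrier P \<Longrightarrow> b \<in> carrier Q \<Longrightarrow> t (a \<oplus>\<^bsub>P\<^esub> a') b = t a b \<oplus>\<^bsub>T\<^esub> t a' b"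
  unfolding t_eq by (subst iota_eq[OF diff_relator_add(1)]) (auto simp: i.add)

lemma t_add_right: "a \<in> carrier P \<Longrightarrow> b \<in> carrier Q \<Longrightarrow> b' \<in> carrier Q \<Longrightarrow> t a (b \<oplus>\<^bsub>Q\<^esub> b') = t a b \<oplus>\<^bsub>T\<^esub> t a b'"
  unfolding t_eq by (subst iota_eq[OF diff_relator_add(2)]) (auto simp: i.add)

lemma t_scale_left: "a \<in> carrier P \<Longrightarrow> b \<in> carrier Q \<Longrightarrow> t (scale P c a) b = scale T c (t a b)"
  unfolding t_eq by (subst iota_eq[OF diff_relator_add(3)]) (auto simp: i.scale)

lemma t_scale_right: "a \<in> carrier P \<Longrightarrow> b \<in> carrier Q \<Longrightarrow> t a (scale Q c b) = scale T c (t a b)"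
  unfolding t_eq by (subst iota_eq[OF diff_relator_add(4)]) (auto simp: i.scale)

lemma t_zero_left [simp]: "b \<in> carrier Q \<Longrightarrow> t \<zero>\<^bsub>P\<^esub> b = \<zero>\<^bsub>T\<^esub>"
  using t_scale_left[of "\<zero>\<^bsub>P\<^esub>" b 0] by simp

lemma t_zero_right [simp]: "a \<in> carrier P \<Longrightarrow> t a \<zero>\<^bsub>Q\<^esub> = \<zero>\<^bsub>T\<^esub>"
  using t_scale_right[of a "\<zero>\<^bsub>Q\<^esub>" 0] by simp

lemma t_finsum_left:
  assumes "finite A" "b \<in> carrier Q" "\<And>i. i \<in> A \<Longrightarrow> f i \<in> carrier P"
  shows "t (finsum P f A) b = finsum T (\<lambda>i. t (f i) b) A"
  using assms
  by (induction A rule: finite_induct) (auto simp: Pi_def t_add_left P.finsum_in_carrier)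

lemma t_finsum_right:
  assumes "finite A" "a \<in> carrier P" "\<And>i. i \<in> A \<Longrightarrow> f i \<in> carrier Q"
  shows "t a (finsum Q f A) = finsum T (\<lambda>i. t a (f i)) A"
  using assms
  by (induction A rule: finite_induct) (auto simp: Pi_def t_add_right Q.finsum_in_carrier)

lemma t_projection: "P.projection e \<Longrightarrow> Q.projection f \<Longrightarrow> T.projection (t e f)"
  unfolding T.projection_def by (simp add: t_star t_mult)

text \<open>The data is one map of pairs instead of two commuting homomorphisms. This allows
  \<open>\<rho> a b\<close> to be an elementary tensor in a corner, where neither factor acts
  separately as an element.\<close>

lemma tensor_hom_exists:
  assumes E: "cstar E"
    and closed: "\<And>a b. a \<in> carrier P \<Longrightarrow> b \<in> carrier Q \<Longrightarrow> \<rho> a b \<in> carrier E"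
    and mult: "\<And>a b a' b'. a \<in> carrier P \<Longrightarrow> b \<in> carrier Q \<Longrightarrow> a' \<in> carrier P \<Longrightarrow> b' \<in> carrier Q \<Longrightarrow>
       \<rho> (a \<otimes>\<^bsub>P\<^esub> a') (b \<otimes>\<^bsub>Q\<^esub> b') = \<rho> a b \<otimes>\<^bsub>E\<^esub> \<rho> a' b'"
    and star: "\<And>a b. a \<in> carrier P \<Longrightarrow> b \<in> carrier Q \<Longrightarrow> \<rho> (star P a) (star Q b) = star E (\<rho> a b)"
    and one: "\<rho> \<one>\<^bsub>P\<^esub> \<one>\<^bsub>Q\<^esub> = \<one>\<^bsub>E\<^esub>"
    and add: "\<And>a a' b. a \<in> carrier P \<Longrightarrow> a' \<in> carrier P \<Longrightarrow> b \<in> carrier Q \<Longrightarrow> \<rho> (a \<oplus>\<^bsub>P\<^esub> a') b = \<rho> a b \<oplus>\<^bsub>E\<^esub> \<rho> a' b"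
      "\<And>a b b'. a \<in> carrier P \<Longrightarrow> b \<in> carrier Q \<Longrightarrow> b' \<in> carrier Q \<Longrightarrow> \<rho> a (b \<oplus>\<^bsub>Q\<^esub> b') = \<rho> a b \<oplus>\<^bsub>E\<^esub> \<rho> a b'"
    and scale: "\<And>a b c. a \<in> carrier P \<Longrightarrow> b \<in> carrier Q \<Longrightarrow> \<rho> (scale P c a) b = scale E c (\<rho> a b)"
      "\<And>a b c. a \<in> carrier P \<Longrightarrow> b \<in> carrier Q \<Longrightarrow> \<rho> a (scale Q c b) = scale E c (\<rho> a b)"
  shows "\<exists>\<Phi>. star_hom T E \<Phi> \<and> (\<forall>a\<in>carrier P. \<forall>b\<in>carrier Q. \<Phi> (t a b) = \<rho> a b)"
proof -
  interpret E: cstar E by fact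
  interpret r: star_monoid_rep M \<tau> E "\<lambda>(a, b). \<rho> a b"
    by (intro star_monoid_rep.intro M.star_monoid_axioms E.star_alg_axioms star_monoid_rep_axioms.intro)
      (auto simp: closed mult star one)
  have lin [simp]: "r.lin (point_mass (a, b)) = \<rho> a b" if "a \<in> carrier P" "b \<in> carrier Q" for a b
    using r.lin_point_mass[of "(a, b)"] that by simp
  interpret l: star_hom_pair M.S E r.lin
    by (rule star_hom_pairI[OF M.star_alg_S E.star_alg_axioms r.star_hom_lin])
  have k1: "x \<oplus>\<^bsub>E\<^esub> (y \<oplus>\<^bsub>E\<^esub> (\<ominus>\<^bsub>E\<^esub> x \<oplus>\<^bsub>E\<^esub> \<ominus>\<^bsub>E\<^esub> y)) = \<zero>\<^bsub>E\<^esub>"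
    if "x \<in> carrier E" "y \<in> carrier E" for x y
  proof -
    have "x \<oplus>\<^bsub>E\<^esub> (y \<oplus>\<^bsub>E\<^esub> (\<ominus>\<^bsub>E\<^esub> x \<oplus>\<^bsub>E\<^esub> \<ominus>\<^bsub>E\<^esub> y)) = (x \<oplus>\<^bsub>E\<^esub> y) \<oplus>\<^bsub>E\<^esub> \<ominus>\<^bsub>E\<^esub> (x \<oplus>\<^bsub>E\<^esub> y)"
      using that by (simp add: E.minus_add E.a_assoc)
    then show ?thesis using that by (simp add: E.r_neg)
  qed
  have k2: "scale E c x \<oplus>\<^bsub>E\<^esub> scale E (- c) x = \<zero>\<^bsub>E\<^esub>" if "x \<in> carrier E" for x c
    using that by (simp flip: E.add_scale)
  have "r.lin z = \<zero>\<^bsub>E\<^esub>" if "z \<in> BR" for z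
    using that closed unfolding bilinear_relators_def relator_add relator_scale
    by (auto simp: l.add l.scale add scale E.a_assoc E.minus_scale[symmetric] P.a_closed Q.a_closed k1 k2)
  then obtain g where "star_hom U.U E g" "\<forall>x\<in>carrier M.S. g (U.\<iota> x) = r.lin x"
    using U.universal_property[OF E r.star_hom_lin] by blast
  then show ?thesis unfolding t_eq T_eq using lin pm_closed by (metis)
qed

lemma tensor_hom_unique:
  assumes E: "cstar E" and f: "star_hom T E f" and g: "star_hom T E g"
    and eq: "\<And>a b. a \<in> carrier P \<Longrightarrow> b \<in> carrier Q \<Longrightarrow> f (t a b) = g (t a b)" and x: "x \<in> carrier T"
  shows "f x = g x"
proof -
  interpret E: cstar E by fact
  have "f (U.\<iota> y) = g (U.\<iota> y)" if y: "y \<in> carrier M.S" for y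
  proof (rule M.star_hom_eqI[OF E.star_alg_axioms _ _ _ y])
    show "star_hom M.S E (\<lambda>x. f (U.\<iota> x))" by (rule star_hom_comp[OF i.hom f])
    show "star_hom M.S E (\<lambda>x. g (U.\<iota> x))" by (rule star_hom_comp[OF i.hom g])
    fix u assume "u \<in> carrier M"
    then show "f (U.\<iota> (point_mass u)) = g (U.\<iota> (point_mass u))"
      using eq by (cases u) (simp add: t_eq)
  qed
  then show ?thesis using U.universal_unique[OF E] f g x unfolding T_eq by blast
qed

end

lemma corner_cstarI: "cstar R \<Longrightarrow> star_alg.projection R e \<Longrightarrow> corner_cstar R e"
  by (intro corner_cstar.intro corner_alg.intro corner_alg_axioms.intro)
    (auto simp: cstar_def cstar_semi_def)

text \<open>Each factor map is unital only for its corner, so the product map sends the unit to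
  \<open>elem_tensor P' Q' e f\<close> and takes values in the corner of that projection.\<close>

lemma tensor_functor:
  fixes P :: "'a cstar_algebra" and Q :: "'b cstar_algebra"
    and P' :: "'c cstar_algebra" and Q' :: "'d cstar_algebra"
  assumes "cstar P" "cstar Q" "cstar P'" "cstar Q'"
    and e: "star_alg.projection P' e" and f: "star_alg.projection Q' f"
    and \<phi>: "star_hom P (corner P' e) \<phi>" and \<psi>: "star_hom Q (corner Q' f) \<psi>"
  shows "\<exists>\<Phi>. star_hom (cstar_tensor P Q) (corner (cstar_tensor P' Q') (elem_tensor P' Q' e f)) \<Phi> \<and>
    (\<forall>a\<in>carrier P. \<forall>b\<in>carrier Q. \<Phi> (elem_tensor P Q a b) = elem_tensor P' Q' (\<phi> a) (\<psi> b))"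
proof -
  interpret D: tensor P Q by (intro tensor.intro assms)
  interpret D': tensor P' Q' by (intro tensor.intro assms)
  interpret CP: corner_cstar P' e by (rule corner_cstarI[OF assms(3) e])
  interpret CQ: corner_cstar Q' f by (rule corner_cstarI[OF assms(4) f])
  interpret CT: corner_cstar D'.T "D'.t e f" by (rule corner_cstarI[OF D'.cstar_T D'.t_projection[OF e f]])
  interpret CP': cstar CP.C by (rule CP.cstar_C)
  interpret CQ': cstar CQ.C by (rule CQ.cstar_C)
  interpret \<phi>: star_hom_pair P CP.C \<phi> by (rule star_hom_pairI[OF D.P.star_alg_axioms CP'.star_alg_axioms \<phi>])
  interpret \<psi>: star_hom_pair Q CQ.C \<psi> by (rule star_hom_pairI[OF D.Q.star_alg_axioms CQ'.star_alg_axioms \<psi>])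
  have p: "\<phi> a \<in> carrier P'" "e \<otimes>\<^bsub>P'\<^esub> \<phi> a = \<phi> a" "\<phi> a \<otimes>\<^bsub>P'\<^esub> e = \<phi> a" if "a \<in> carrier P" for a
    using \<phi>.closed[OF that] CP.C_carrier by blast+
  have q: "\<psi> a \<in> carrier Q'" "f \<otimes>\<^bsub>Q'\<^esub> \<psi> a = \<psi> a" "\<psi> a \<otimes>\<^bsub>Q'\<^esub> f = \<psi> a" if "a \<in> carrier Q" for a
    using \<psi>.closed[OF that] CQ.C_carrier by blast+
  show ?thesis
  proof (rule D.tensor_hom_exists[OF CT.cstar_C])
    fix a b assume "a \<in> carrier P" "b \<in> carrier Q"
    then show "D'.t (\<phi> a) (\<psi> b) \<in> carrier CT.C"
      by (intro CT.C_I) (simp_all add: p q D'.t_mult)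
  qed (simp_all add: p q \<phi>.mult \<psi>.mult D'.t_mult \<phi>.star \<psi>.star D'.t_star \<phi>.one \<psi>.one
     \<phi>.add \<psi>.add D'.t_add_left D'.t_add_right \<phi>.scale \<psi>.scale D'.t_scale_left D'.t_scale_right)
qed

section \<open>Elementary equivalence of Cuntz--Krieger families\<close>

context abelian_monoid
begin

text \<open>Orthogonality enters in this form: a product of two sums whose off-diagonal terms vanish
  becomes one sum over the common indices.\<close>

lemma finsum_diagonal:
  assumes "finite A" "finite B" "\<And>i j. i \<in> A \<Longrightarrow> j \<in> B \<Longrightarrow> i \<noteq> j \<Longrightarrow> f i j = \<zero>"
    "\<And>i. i \<in> A \<Longrightarrow> i \<in> B \<Longrightarrow> f i i \<in> carrier G"
  shows "finsum G (\<lambda>i. finsum G (f i) B) A = finsum G (\<lambda>i. f i i) (A \<inter> B)"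
proof -
  have "finsum G (\<lambda>i. finsum G (f i) B) A = finsum G (\<lambda>i. if i \<in> B then f i i else \<zero>) A"
  proof (rule finsum_eqI[OF refl])
    fix i assume i: "i \<in> A"
    show "(if i \<in> B then f i i else \<zero>) \<in> carrier G" using assms(4)[OF i] by simp
    show "finsum G (f i) B = (if i \<in> B then f i i else \<zero>)"
    proof (cases "i \<in> B")
      case True
      have "finsum G (f i) B = f i i"
        by (rule finsum_single[where j = i]) (use assms(2,3,4) i True in auto)
      then show ?thesis using True by simp
    next
      case False
      have "finsum G (f i) B = \<zero>"
        by (rule finsum_all_zero) (use assms(3)[OF i] False in blast)
      then show ?thesis using False by simp
    qed
  qed
  also have "\<dots> = finsum G (\<lambda>i. f i i) {i\<in>A. i \<in> B}"
    by (rule finsum_restrict_set[OF assms(1) assms(4)])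
  also have "{i\<in>A. i \<in> B} = A \<inter> B" by blast
  finally show ?thesis .
qed

end

locale ck_algebra = cstar R for R :: "'o cstar_algebra" (structure) +
  fixes J :: "'h set" and B :: "'h \<Rightarrow> 'h \<Rightarrow> bool" and s :: "'h \<Rightarrow> 'o"
  assumes fin_J: "finite J" and family: "ck_family R J B s"
begin

text \<open>In the picture of one-sided admissible sequences \<open>s u\<close> prepends the letter
  \<open>u\<close>, \<open>q u\<close> is the indicator of the sequences that begin with
  \<open>u\<close>, and \<open>Pr V\<close> of those that begin with a letter of
  \<open>V\<close>.\<close>

definition q :: "'h \<Rightarrow> 'o" where "q u = s u \<otimes> star R (s u)"
definition Pr :: "'h set \<Rightarrow> 'o" where "Pr V = finsum R q V"

lemma s_closed [simp, intro]: "s u \<in> carrier R"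
  and s_partial: "u \<in> J \<Longrightarrow> s u \<otimes> star R (s u) \<otimes> s u = s u"
  and s_outside: "u \<notin> J \<Longrightarrow> s u = \<zero>"
  using family unfolding ck_family_def by auto

lemma q_closed [simp, intro]: "q u \<in> carrier R" by (simp add: q_def)

lemma Pr_closed [simp, intro]: "Pr V \<in> carrier R" unfolding Pr_def by (rule finsum_in_carrier) simp

lemma Pr_J: "Pr J = \<one>"
  using family unfolding ck_family_def Pr_def q_def by blast

lemma s_star_s: "u \<in> J \<Longrightarrow> star R (s u) \<otimes> s u = Pr {v\<in>J. B u v}"
  using family unfolding ck_family_def Pr_def q_def[abs_def] by blast

lemma q_star: "star R (q u) = q u" by (simp add: q_def star_mult)

lemma q_s: "u \<in> J \<Longrightarrow> q u \<otimes> s u = s u" by (simp add: q_def s_partial)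

lemma s_star_q: "u \<in> J \<Longrightarrow> star R (s u) \<otimes> q u = star R (s u)"
  using arg_cong[OF q_s, of u "star R"] by (simp add: star_mult q_star)

lemma q_idem: "u \<in> J \<Longrightarrow> q u \<otimes> q u = q u"
proof -
  assume u: "u \<in> J"
  have "q u \<otimes> q u = (q u \<otimes> s u) \<otimes> star R (s u)" by (subst (2) q_def) (simp add: m_assoc)
  then show ?thesis by (simp add: q_s u, simp add: q_def)
qed

lemma q_orth: "u \<in> J \<Longrightarrow> v \<in> J \<Longrightarrow> u \<noteq> v \<Longrightarrow> q u \<otimes> q v = \<zero>"
proof (rule projections_orthogonal[OF cstar_axioms fin_J])
  show "projection (q l)" if "l \<in> J" for l
    unfolding projection_def using that by (simp add: q_star q_idem)
  show "finsum R q J = \<one>" using Pr_J by (simp add: Pr_def)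
qed

lemma s_star_s_orth: "u \<in> J \<Longrightarrow> v \<in> J \<Longrightarrow> u \<noteq> v \<Longrightarrow> star R (s u) \<otimes> s v = \<zero>"
proof -
  assume a: "u \<in> J" "v \<in> J" "u \<noteq> v"
  have "star R (s u) \<otimes> s v = (star R (s u) \<otimes> q u) \<otimes> (q v \<otimes> s v)" using a by (simp add: s_star_q q_s)
  also have "\<dots> = star R (s u) \<otimes> (q u \<otimes> q v) \<otimes> s v" by (simp add: m_assoc)
  finally show ?thesis using a by (simp add: q_orth)
qed

lemma Pr_star: "finite V \<Longrightarrow> star R (Pr V) = Pr V"
  unfolding Pr_def by (subst star_finsum) (simp_all add: q_star)

lemma fin_sub: "V \<subseteq> J \<Longrightarrow> finite V" using fin_J finite_subset by blast

lemma Pr_empty [simp]: "Pr {} = \<zero>" by (simp add: Pr_def)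

lemma Pr_mult: "V \<subseteq> J \<Longrightarrow> L \<subseteq> J \<Longrightarrow> Pr V \<otimes> Pr L = Pr (V \<inter> L)"
proof -
  assume V: "V \<subseteq> J" and L: "L \<subseteq> J"
  note f = fin_sub[OF V] fin_sub[OF L]
  have "Pr V \<otimes> Pr L = finsum R (\<lambda>u. finsum R (\<lambda>v. q u \<otimes> q v) L) V"
    unfolding Pr_def using f by (intro finsum_mult_finsum) auto
  also have "\<dots> = finsum R (\<lambda>u. q u \<otimes> q u) (V \<inter> L)"
    by (rule finsum_diagonal[OF f]) (use V L q_orth in auto)
  also have "\<dots> = Pr (V \<inter> L)"
    unfolding Pr_def by (rule finsum_eqI[OF refl]) (use V q_idem in auto)
  finally show ?thesis .
qed

lemma Pr_s: "V \<subseteq> J \<Longrightarrow> u \<in> V \<Longrightarrow> Pr V \<otimes> s u = s u"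
proof -
  assume V: "V \<subseteq> J" and u: "u \<in> V"
  have uJ: "u \<in> J" using V u by blast
  have "Pr V \<otimes> s u = finsum R (\<lambda>v. q v \<otimes> s u) V"
    unfolding Pr_def using fin_sub[OF V] by (intro finsum_mult_left) auto
  also have "\<dots> = q u \<otimes> s u"
  proof (rule finsum_single[OF fin_sub[OF V] u])
    fix v assume v: "v \<in> V" "v \<noteq> u"
    have "q v \<otimes> s u = s v \<otimes> (star R (s v) \<otimes> s u)" by (simp add: q_def m_assoc)
    then show "q v \<otimes> s u = \<zero>" using s_star_s_orth[of v u] v uJ V by auto
  qed simp
  finally show ?thesis by (simp add: q_s uJ)
qed

lemma Pr_union: "finite N \<Longrightarrow> (\<And>i. i \<in> N \<Longrightarrow> V i \<subseteq> J) \<Longrightarrow>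
   (\<And>i j. i \<in> N \<Longrightarrow> j \<in> N \<Longrightarrow> i \<noteq> j \<Longrightarrow> V i \<inter> V j = {}) \<Longrightarrow> Pr (\<Union>i\<in>N. V i) = finsum R (\<lambda>i. Pr (V i)) N"
  unfolding Pr_def by (rule finsum_disjoint_union) (use fin_sub in auto)

end

text \<open>The matrix factorisations \<open>A = C D\<close> and \<open>B = D C\<close> with all four matrices of zeros and ones.\<close>

locale elementary =
  fixes I :: "'g set" and J :: "'h set" and A :: "'g \<Rightarrow> 'g \<Rightarrow> bool" and B :: "'h \<Rightarrow> 'h \<Rightarrow> bool"
    and C :: "'g \<Rightarrow> 'h \<Rightarrow> bool" and D :: "'h \<Rightarrow> 'g \<Rightarrow> bool"
  assumes finite_I: "finite I" and finite_J: "finite J"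
    and A_iff: "i \<in> I \<Longrightarrow> j \<in> I \<Longrightarrow> A i j \<longleftrightarrow> (\<exists>u\<in>J. C i u \<and> D u j)"
    and A_unique: "i \<in> I \<Longrightarrow> j \<in> I \<Longrightarrow> u \<in> J \<Longrightarrow> v \<in> J \<Longrightarrow> C i u \<Longrightarrow> D u j \<Longrightarrow> C i v \<Longrightarrow> D v j \<Longrightarrow> u = v"
    and B_iff: "u \<in> J \<Longrightarrow> v \<in> J \<Longrightarrow> B u v \<longleftrightarrow> (\<exists>i\<in>I. D u i \<and> C i v)"
    and B_unique: "u \<in> J \<Longrightarrow> v \<in> J \<Longrightarrow> i \<in> I \<Longrightarrow> j \<in> I \<Longrightarrow> D u i \<Longrightarrow> C i v \<Longrightarrow> D u j \<Longrightarrow> C j v \<Longrightarrow> i = j"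
    and D_into: "i \<in> I \<Longrightarrow> \<exists>u\<in>J. D u i"
    and C_into: "u \<in> J \<Longrightarrow> \<exists>i\<in>I. C i u"
    and C_from: "i \<in> I \<Longrightarrow> \<exists>u\<in>J. C i u"
    and D_from: "u \<in> J \<Longrightarrow> \<exists>i\<in>I. D u i"
begin

lemma swap: "elementary J I B A D C"
  by (rule elementary.intro[OF finite_J finite_I B_iff B_unique A_iff A_unique C_into D_into D_from C_from])

text \<open>Transposing reverses the direction of reading, so this instance recodes the left halves.
  What says that every letter has an outgoing \<open>C\<close> or \<open>D\<close> edge becomes the
  existence of incoming ones, which the choice of \<open>cc\<close> needs.\<close>

lemma transposed: "elementary I J (\<lambda>i j. A j i) (\<lambda>u v. B v u) (\<lambda>i u. D u i) (\<lambda>u i. C i u)"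
proof (rule elementary.intro[OF finite_I finite_J _ _ _ _ C_from D_from D_into C_into])
  show "A j i \<longleftrightarrow> (\<exists>u\<in>J. D u i \<and> C j u)" if "i \<in> I" "j \<in> I" for i j
    unfolding A_iff[OF that(2,1)] by (rule bex_cong[OF refl]) (rule conj_commute)
  show "B v u \<longleftrightarrow> (\<exists>i\<in>I. C i u \<and> D v i)" if "u \<in> J" "v \<in> J" for u v
    unfolding B_iff[OF that(2,1)] by (rule bex_cong[OF refl]) (rule conj_commute)
  show "u = v" if "i \<in> I" "j \<in> I" "u \<in> J" "v \<in> J" "D u i" "C j u" "D v i" "C j v" for i j u v
    by (rule A_unique[OF that(2,1,3,4,6,5,8,7)])
  show "i = j" if "u \<in> J" "v \<in> J" "i \<in> I" "j \<in> I" "C i u" "D v i" "C j u" "D v j" for u v i j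
    by (rule B_unique[OF that(2,1,3,4,6,5,8,7)])
qed

end

locale elementary_rep = elementary I J A B C D + ck_algebra R J B s
  for I :: "'g set" and J :: "'h set" and A B C D and R :: "'o cstar_algebra" (structure) and s
begin

text \<open>The \<open>A\<close>-sequence \<open>i\<^sub>0 i\<^sub>1 \<dots>\<close> is recoded as the \<open>B\<close>-sequence \<open>(cc i\<^sub>0) u\<^sub>0 u\<^sub>1 \<dots>\<close>, where \<open>u\<^sub>k\<close> is the state
  that \<open>A = C D\<close> passes between \<open>i\<^sub>k\<close> and \<open>i\<^sub>k\<^sub>+\<^sub>1\<close>. Prepending \<open>i\<close> becomes \<open>gg i\<close>: \<open>yy u\<close> strips the
  leading \<open>cc\<close>, then \<open>u\<close> and \<open>cc i\<close> are put in front. The projection \<open>ff\<close> is the range of the recoding.\<close>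

definition Cs :: "'g \<Rightarrow> 'h set" where "Cs i = {u\<in>J. C i u}"
definition Ds :: "'h \<Rightarrow> 'g set" where "Ds u = {i\<in>I. D u i}"
definition cc :: "'g \<Rightarrow> 'h" where "cc i = (SOME u. u \<in> J \<and> D u i)"
definition pp :: "'g \<Rightarrow> 'o" where "pp i = Pr (Cs i)"
definition rr :: "'g \<Rightarrow> 'o" where "rr i = s (cc i) \<otimes> pp i"
definition yy :: "'h \<Rightarrow> 'o" where "yy u = finsum R (\<lambda>i. star R (rr i)) (Ds u)"
definition zz :: "'g \<Rightarrow> 'o" where "zz i = finsum R (\<lambda>u. s u \<otimes> yy u) (Cs i)"
definition gg :: "'g \<Rightarrow> 'o" where "gg i = (if i \<in> I then rr i \<otimes> zz i else \<zero>)"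
definition ff :: 'o where "ff = finsum R (\<lambda>i. rr i \<otimes> star R (rr i)) I"

lemma cc: "i \<in> I \<Longrightarrow> cc i \<in> J" "i \<in> I \<Longrightarrow> D (cc i) i"
  using someI_ex[of "\<lambda>u. u \<in> J \<and> D u i"] D_into unfolding cc_def by blast+

lemma Cs_J: "Cs i \<subseteq> J" and Ds_I: "Ds u \<subseteq> I" by (auto simp: Cs_def Ds_def)

lemma fin [simp, intro]: "finite (Cs i)" "finite (Ds u)" "finite I" "finite J"
  using finite_I finite_J by (auto simp: Cs_def Ds_def)

lemma closed [simp, intro]: "pp i \<in> carrier R" "rr i \<in> carrier R" "yy u \<in> carrier R" "zz i \<in> carrier R"
  "gg i \<in> carrier R" "ff \<in> carrier R"
proof -
  show p: "pp i \<in> carrier R" for i by (simp add: pp_def)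
  show r: "rr i \<in> carrier R" for i by (simp add: rr_def p)
  show y: "yy u \<in> carrier R" for u unfolding yy_def by (rule finsum_in_carrier) (simp add: r)
  show z: "zz i \<in> carrier R" for i unfolding zz_def by (rule finsum_in_carrier) (simp add: y)
  show "gg i \<in> carrier R" by (simp add: gg_def r z)
  show "ff \<in> carrier R" unfolding ff_def by (rule finsum_in_carrier) (simp add: r)
qed

lemma pp_star: "star R (pp i) = pp i" unfolding pp_def by (rule Pr_star) simp

lemma pp_idem: "pp i \<otimes> pp i = pp i" unfolding pp_def using Pr_mult[OF Cs_J Cs_J, of i i] by simp

text \<open>That \<open>D C\<close> has no entry above 1 means that the sets \<open>Cs i\<close>
  with \<open>i \<in> Ds u\<close> are disjoint; with \<open>B_row\<close> they partition row
  \<open>u\<close> of \<open>B\<close>. \<open>Ds_disjoint\<close> is the same for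
  \<open>C D\<close> and the rows of \<open>A\<close>.\<close>

lemma Cs_disjoint: "u \<in> J \<Longrightarrow> i \<in> Ds u \<Longrightarrow> j \<in> Ds u \<Longrightarrow> i \<noteq> j \<Longrightarrow> Cs i \<inter> Cs j = {}"
  unfolding Cs_def Ds_def using B_unique[of u _ i j] by blast

lemma Ds_disjoint: "i \<in> I \<Longrightarrow> u \<in> Cs i \<Longrightarrow> v \<in> Cs i \<Longrightarrow> u \<noteq> v \<Longrightarrow> Ds u \<inter> Ds v = {}"
  unfolding Cs_def Ds_def using A_unique[of i _ u v] by blast

lemma B_row: "u \<in> J \<Longrightarrow> {v\<in>J. B u v} = (\<Union>i\<in>Ds u. Cs i)"
  unfolding Cs_def Ds_def using B_iff[of u] by blast

lemma A_row: "i \<in> I \<Longrightarrow> {j\<in>I. A i j} = (\<Union>u\<in>Cs i. Ds u)"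
  unfolding Cs_def Ds_def using A_iff[of i] by blast

lemma ss_pp: "u \<in> J \<Longrightarrow> i \<in> Ds u \<Longrightarrow> star R (s u) \<otimes> s u \<otimes> pp i = pp i"
proof -
  assume u: "u \<in> J" and i: "i \<in> Ds u"
  have "{v\<in>J. B u v} \<inter> Cs i = Cs i" unfolding B_row[OF u] using i by blast
  then show ?thesis using Pr_mult[of "{v\<in>J. B u v}" "Cs i"] Cs_J[of i] by (simp add: s_star_s[OF u] pp_def)
qed

lemma pp_orth: "u \<in> J \<Longrightarrow> i \<in> Ds u \<Longrightarrow> j \<in> Ds u \<Longrightarrow> i \<noteq> j \<Longrightarrow> pp i \<otimes> pp j = \<zero>"
  unfolding pp_def using Pr_mult[OF Cs_J Cs_J, of i j] Cs_disjoint[of u i j] by simp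

lemma cc_Ds: "i \<in> I \<Longrightarrow> i \<in> Ds (cc i)" using cc by (simp add: Ds_def)

lemma rr_star: "star R (rr i) = pp i \<otimes> star R (s (cc i))"
  by (simp add: rr_def star_mult pp_star)

lemma rr_pp: "rr i \<otimes> pp i = rr i" by (simp add: rr_def m_assoc pp_idem)

lemma pp_rr_star: "pp i \<otimes> star R (rr i) = star R (rr i)"
  using arg_cong[OF rr_pp, of "star R"] by (simp add: star_mult pp_star)

lemma rr_star_rr: "i \<in> I \<Longrightarrow> star R (rr i) \<otimes> rr i = pp i"
proof -
  assume i: "i \<in> I"
  have "star R (rr i) \<otimes> rr i = pp i \<otimes> (star R (s (cc i)) \<otimes> s (cc i) \<otimes> pp i)"
    unfolding rr_star by (simp add: rr_def m_assoc)
  then show ?thesis using ss_pp[OF cc(1)[OF i] cc_Ds[OF i]] by (simp add: pp_idem)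
qed

text \<open>The choice \<open>cc\<close> need not be injective. If two letters share the prepended
  letter, the recoded sequences still differ in the second one, because the sets \<open>Cs\<close>
  are then disjoint.\<close>

lemma rr_star_rr_orth: "i \<in> I \<Longrightarrow> j \<in> I \<Longrightarrow> i \<noteq> j \<Longrightarrow> star R (rr i) \<otimes> rr j = \<zero>"
proof (cases "cc i = cc j")
  case True
  assume ij: "i \<in> I" "j \<in> I" "i \<noteq> j"
  have "star R (rr i) \<otimes> rr j = pp i \<otimes> (star R (s (cc j)) \<otimes> s (cc j) \<otimes> pp j)"
    unfolding rr_star by (simp add: rr_def m_assoc True)
  also have "\<dots> = pp i \<otimes> pp j" using ss_pp[OF cc(1)[OF ij(2)] cc_Ds[OF ij(2)]] by simp
  finally show ?thesis using pp_orth[OF cc(1)[OF ij(1)] cc_Ds[OF ij(1)] _ ij(3)] cc_Ds[OF ij(2)] True by simp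
next
  case False
  assume ij: "i \<in> I" "j \<in> I" "i \<noteq> j"
  have "star R (rr i) \<otimes> rr j = pp i \<otimes> ((star R (s (cc i)) \<otimes> s (cc j)) \<otimes> pp j)"
    unfolding rr_star by (simp add: rr_def m_assoc)
  then show ?thesis using s_star_s_orth[OF cc(1)[OF ij(1)] cc(1)[OF ij(2)] False] by simp
qed

lemma yy_star: "star R (yy u) = finsum R rr (Ds u)"
  unfolding yy_def by (subst star_finsum) auto

lemma yy_yy_star: "yy u \<otimes> star R (yy v) = finsum R pp (Ds u \<inter> Ds v)"
proof -
  have "yy u \<otimes> star R (yy v) = finsum R (\<lambda>i. finsum R (\<lambda>j. star R (rr i) \<otimes> rr j) (Ds v)) (Ds u)"
    unfolding yy_star by (unfold yy_def, intro finsum_mult_finsum) auto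
  also have "\<dots> = finsum R (\<lambda>i. star R (rr i) \<otimes> rr i) (Ds u \<inter> Ds v)"
    by (rule finsum_diagonal) (use Ds_I rr_star_rr_orth in \<open>auto simp: subset_iff\<close>)
  also have "\<dots> = finsum R pp (Ds u \<inter> Ds v)"
    by (rule finsum_eqI[OF refl]) (use Ds_I rr_star_rr in \<open>auto simp: subset_iff\<close>)
  finally show ?thesis .
qed

text \<open>The range of \<open>yy u\<close> is exactly the domain of \<open>s u\<close>, since the
  sets \<open>Cs i\<close> with \<open>i \<in> Ds u\<close> exhaust row \<open>u\<close> of
  \<open>B\<close>. Nothing is lost when \<open>u\<close> is prepended after stripping.\<close>

lemma yy_yy_star_same: "u \<in> J \<Longrightarrow> yy u \<otimes> star R (yy u) = star R (s u) \<otimes> s u"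
proof -
  assume u: "u \<in> J"
  have "finsum R pp (Ds u) = Pr (\<Union>i\<in>Ds u. Cs i)"
    unfolding pp_def[abs_def] by (rule Pr_union[symmetric]) (use Cs_J Cs_disjoint[OF u] in auto)
  then show ?thesis using yy_yy_star[of u u] by (simp add: s_star_s[OF u] B_row[OF u])
qed

lemma ss_yy: "u \<in> J \<Longrightarrow> star R (s u) \<otimes> s u \<otimes> yy u = yy u"
proof -
  assume u: "u \<in> J"
  have "star R (s u) \<otimes> s u \<otimes> yy u = finsum R (\<lambda>i. star R (s u) \<otimes> s u \<otimes> star R (rr i)) (Ds u)"
    unfolding yy_def by (rule finsum_mult_right) auto
  also have "\<dots> = yy u" unfolding yy_def
  proof (rule finsum_eqI[OF refl])
    fix i assume i: "i \<in> Ds u"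
    have "star R (s u) \<otimes> s u \<otimes> star R (rr i) = (star R (s u) \<otimes> s u \<otimes> pp i) \<otimes> star R (rr i)"
      by (subst (1) pp_rr_star[symmetric]) (simp add: m_assoc)
    then show "star R (s u) \<otimes> s u \<otimes> star R (rr i) = star R (rr i)" using ss_pp[OF u i] pp_rr_star by simp
  qed simp
  finally show ?thesis .
qed

lemma yy_star_yy: "u \<in> J \<Longrightarrow> star R (yy u) \<otimes> yy u = finsum R (\<lambda>i. rr i \<otimes> star R (rr i)) (Ds u)"
proof -
  assume u: "u \<in> J"
  have "star R (yy u) \<otimes> yy u = finsum R (\<lambda>i. finsum R (\<lambda>j. rr i \<otimes> star R (rr j)) (Ds u)) (Ds u)"
    unfolding yy_star by (unfold yy_def, intro finsum_mult_finsum) auto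
  also have "\<dots> = finsum R (\<lambda>i. rr i \<otimes> star R (rr i)) (Ds u \<inter> Ds u)"
  proof (rule finsum_diagonal)
    fix i j assume ij: "i \<in> Ds u" "j \<in> Ds u" "i \<noteq> j"
    have "rr i \<otimes> star R (rr j) = s (cc i) \<otimes> (pp i \<otimes> pp j) \<otimes> star R (s (cc j))"
      unfolding rr_star by (simp add: rr_def m_assoc)
    then show "rr i \<otimes> star R (rr j) = \<zero>" using pp_orth[OF u ij] by simp
  qed auto
  finally show ?thesis by simp
qed

lemma zz_star: "star R (zz i) = finsum R (\<lambda>u. star R (yy u) \<otimes> star R (s u)) (Cs i)"
  unfolding zz_def by (subst star_finsum) (auto simp: star_mult)

text \<open>Terms for distinct states are orthogonal because one letter \<open>j\<close> cannot
  follow \<open>i\<close> through two states. The diagonal terms are the range projections of the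
  states that \<open>i\<close> can reach.\<close>

lemma zz_zz_star: "i \<in> I \<Longrightarrow> zz i \<otimes> star R (zz i) = pp i"
proof -
  assume i: "i \<in> I"
  have "zz i \<otimes> star R (zz i) =
    finsum R (\<lambda>u. finsum R (\<lambda>v. s u \<otimes> yy u \<otimes> (star R (yy v) \<otimes> star R (s v))) (Cs i)) (Cs i)"
    unfolding zz_star by (unfold zz_def, intro finsum_mult_finsum) auto
  also have "\<dots> = finsum R (\<lambda>u. s u \<otimes> yy u \<otimes> (star R (yy u) \<otimes> star R (s u))) (Cs i \<inter> Cs i)"
  proof (rule finsum_diagonal)
    fix u v assume uv: "u \<in> Cs i" "v \<in> Cs i" "u \<noteq> v"
    have "s u \<otimes> yy u \<otimes> (star R (yy v) \<otimes> star R (s v)) = s u \<otimes> (yy u \<otimes> star R (yy v)) \<otimes> star R (s v)"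
      by (simp add: m_assoc)
    also have "yy u \<otimes> star R (yy v) = \<zero>" unfolding yy_yy_star Ds_disjoint[OF i uv] by simp
    finally show "s u \<otimes> yy u \<otimes> (star R (yy v) \<otimes> star R (s v)) = \<zero>" by simp
  qed auto
  also have "\<dots> = finsum R q (Cs i)"
  proof (rule finsum_eqI)
    fix u assume "u \<in> Cs i"
    then have u: "u \<in> J" using Cs_J by blast
    have "s u \<otimes> yy u \<otimes> (star R (yy u) \<otimes> star R (s u)) = s u \<otimes> (yy u \<otimes> star R (yy u)) \<otimes> star R (s u)"
      by (simp add: m_assoc)
    also have "\<dots> = q u \<otimes> q u" by (simp add: yy_yy_star_same u q_def m_assoc)
    finally show "s u \<otimes> yy u \<otimes> (star R (yy u) \<otimes> star R (s u)) = q u" by (simp add: q_idem u)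
  qed auto
  finally show ?thesis by (simp add: pp_def Pr_def)
qed

lemma pp_zz: "pp i \<otimes> zz i = zz i"
proof -
  have "pp i \<otimes> zz i = finsum R (\<lambda>u. pp i \<otimes> (s u \<otimes> yy u)) (Cs i)"
    unfolding zz_def by (rule finsum_mult_right) auto
  also have "\<dots> = zz i" unfolding zz_def
  proof (rule finsum_eqI[OF refl])
    fix u assume "u \<in> Cs i"
    then show "pp i \<otimes> (s u \<otimes> yy u) = s u \<otimes> yy u"
      using Pr_s[OF Cs_J, of u i] by (simp add: pp_def flip: m_assoc)
  qed auto
  finally show ?thesis .
qed

lemma gg_gg_star: "i \<in> I \<Longrightarrow> gg i \<otimes> star R (gg i) = rr i \<otimes> star R (rr i)"
proof -
  assume i: "i \<in> I"
  have "gg i \<otimes> star R (gg i) = rr i \<otimes> (zz i \<otimes> star R (zz i)) \<otimes> star R (rr i)"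
    using i by (simp add: gg_def star_mult m_assoc)
  then show ?thesis using i by (simp add: zz_zz_star rr_pp)
qed

lemma gg_partial: "i \<in> I \<Longrightarrow> gg i \<otimes> star R (gg i) \<otimes> gg i = gg i"
proof -
  assume i: "i \<in> I"
  have "rr i \<otimes> star R (rr i) \<otimes> gg i = rr i \<otimes> (star R (rr i) \<otimes> rr i) \<otimes> zz i"
    using i by (simp add: gg_def m_assoc)
  also have "\<dots> = gg i" using i by (simp add: rr_star_rr rr_pp) (simp add: gg_def)
  finally show ?thesis by (simp add: gg_gg_star[OF i])
qed

text \<open>The Cuntz-Krieger relation for row \<open>i\<close> of \<open>A\<close>: going back
  through \<open>zz i\<close> leads to the codes of the letters in \<open>Ds u\<close> for the
  states \<open>u\<close> reached from \<open>i\<close>, and these sets partition the row.\<close>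

lemma gg_star_gg: "i \<in> I \<Longrightarrow> star R (gg i) \<otimes> gg i = finsum R (\<lambda>j. rr j \<otimes> star R (rr j)) {j\<in>I. A i j}"
proof -
  assume i: "i \<in> I"
  have "star R (gg i) \<otimes> gg i = star R (zz i) \<otimes> (star R (rr i) \<otimes> rr i \<otimes> zz i)"
    using i by (simp add: gg_def star_mult m_assoc)
  also have "\<dots> = star R (zz i) \<otimes> zz i" using i by (simp add: rr_star_rr pp_zz)
  also have "\<dots> = finsum R (\<lambda>u. finsum R (\<lambda>v. star R (yy u) \<otimes> star R (s u) \<otimes> (s v \<otimes> yy v)) (Cs i)) (Cs i)"
    unfolding zz_star by (unfold zz_def, intro finsum_mult_finsum) auto
  also have "\<dots> = finsum R (\<lambda>u. star R (yy u) \<otimes> star R (s u) \<otimes> (s u \<otimes> yy u)) (Cs i \<inter> Cs i)"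
  proof (rule finsum_diagonal)
    fix u v assume uv: "u \<in> Cs i" "v \<in> Cs i" "u \<noteq> v"
    have "star R (yy u) \<otimes> star R (s u) \<otimes> (s v \<otimes> yy v) = star R (yy u) \<otimes> (star R (s u) \<otimes> s v) \<otimes> yy v"
      by (simp add: m_assoc)
    also have "star R (s u) \<otimes> s v = \<zero>" using s_star_s_orth uv Cs_J by blast
    finally show "star R (yy u) \<otimes> star R (s u) \<otimes> (s v \<otimes> yy v) = \<zero>" by simp
  qed auto
  also have "\<dots> = finsum R (\<lambda>u. finsum R (\<lambda>j. rr j \<otimes> star R (rr j)) (Ds u)) (Cs i)"
  proof (rule finsum_eqI)
    fix u assume "u \<in> Cs i"
    then have u: "u \<in> J" using Cs_J by blast
    have "star R (yy u) \<otimes> star R (s u) \<otimes> (s u \<otimes> yy u) = star R (yy u) \<otimes> (star R (s u) \<otimes> s u \<otimes> yy u)"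
      by (simp add: m_assoc)
    then show "star R (yy u) \<otimes> star R (s u) \<otimes> (s u \<otimes> yy u) = finsum R (\<lambda>j. rr j \<otimes> star R (rr j)) (Ds u)"
      by (simp add: ss_yy[OF u] yy_star_yy[OF u])
  qed (auto intro!: finsum_in_carrier)
  also have "\<dots> = finsum R (\<lambda>j. rr j \<otimes> star R (rr j)) (\<Union>u\<in>Cs i. Ds u)"
    by (rule finsum_disjoint_union[symmetric]) (use Ds_disjoint[OF i] in auto)
  finally show ?thesis by (simp add: A_row[OF i])
qed

lemma ff_rr: "i \<in> I \<Longrightarrow> ff \<otimes> rr i = rr i"
proof -
  assume i: "i \<in> I"
  have "ff \<otimes> rr i = finsum R (\<lambda>j. rr j \<otimes> star R (rr j) \<otimes> rr i) I"
    unfolding ff_def by (rule finsum_mult_left) auto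
  also have "\<dots> = rr i \<otimes> star R (rr i) \<otimes> rr i"
  proof (rule finsum_single[OF finite_I i])
    fix j assume j: "j \<in> I" "j \<noteq> i"
    show "rr j \<otimes> star R (rr j) \<otimes> rr i = \<zero>" using rr_star_rr_orth[OF j(1) i j(2)] by (simp add: m_assoc)
  qed simp
  also have "\<dots> = rr i" using i by (simp add: m_assoc rr_star_rr rr_pp)
  finally show ?thesis .
qed

lemma ff_star: "star R ff = ff"
  unfolding ff_def by (subst star_finsum) (auto simp: star_mult)

lemma ff_projection: "projection ff"
  unfolding projection_def
proof (intro conjI)
  have "ff \<otimes> ff = finsum R (\<lambda>i. ff \<otimes> (rr i \<otimes> star R (rr i))) I"
    by (subst (2) ff_def) (rule finsum_mult_right, auto)
  also have "\<dots> = ff" unfolding ff_def[symmetric]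
    by (subst (2) ff_def) (rule finsum_eqI, auto simp: ff_rr simp flip: m_assoc)
  finally show "ff \<otimes> ff = ff" .
qed (simp_all add: ff_star)

lemma rr_star_ff: "i \<in> I \<Longrightarrow> star R (rr i) \<otimes> ff = star R (rr i)"
  using arg_cong[OF ff_rr, of i "star R"] by (simp add: star_mult ff_star)

lemma yy_ff: "yy u \<otimes> ff = yy u"
proof -
  have "yy u \<otimes> ff = finsum R (\<lambda>i. star R (rr i) \<otimes> ff) (Ds u)"
    unfolding yy_def by (rule finsum_mult_left) auto
  also have "\<dots> = yy u" unfolding yy_def
    by (rule finsum_eqI[OF refl]) (use Ds_I rr_star_ff in auto)
  finally show ?thesis .
qed

lemma zz_ff: "zz i \<otimes> ff = zz i"
proof -
  have "zz i \<otimes> ff = finsum R (\<lambda>u. s u \<otimes> yy u \<otimes> ff) (Cs i)"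
    unfolding zz_def by (rule finsum_mult_left) auto
  also have "\<dots> = zz i" unfolding zz_def
    by (rule finsum_eqI[OF refl]) (simp_all add: m_assoc yy_ff)
  finally show ?thesis .
qed

sublocale FC: corner_cstar R ff
  by (rule corner_cstarI[OF cstar_axioms ff_projection])

lemma gg_corner: "gg i \<in> carrier (corner R ff)"
  by (rule FC.C_I) (auto simp: gg_def m_assoc zz_ff, simp flip: m_assoc add: ff_rr)

lemma rr_rr_corner: "i \<in> I \<Longrightarrow> rr i \<otimes> star R (rr i) \<in> carrier (corner R ff)"
  by (rule FC.C_I) (simp, simp add: ff_rr flip: m_assoc, simp add: rr_star_ff m_assoc)

lemma gg_family: "ck_family (corner R ff) I A gg"
proof -
  interpret C: cstar "corner R ff" by (rule FC.cstar_C)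
  have sum: "finsum (corner R ff) (\<lambda>i. gg i \<otimes> star R (gg i)) V = finsum R (\<lambda>i. rr i \<otimes> star R (rr i)) V"
    if V: "V \<subseteq> I" for V
  proof -
    have finK: "finite V" using V finite_I finite_subset by blast
    have "finsum (corner R ff) (\<lambda>i. gg i \<otimes> star R (gg i)) V =
        finsum (corner R ff) (\<lambda>i. rr i \<otimes> star R (rr i)) V"
      by (rule C.finsum_eqI[OF refl]) (use V in \<open>auto simp: gg_gg_star rr_rr_corner\<close>)
    also have "\<dots> = finsum R (\<lambda>i. rr i \<otimes> star R (rr i)) V"
      by (rule FC.C_finsum[OF finK]) (use V rr_rr_corner in auto)
    finally show ?thesis .
  qed
  have fam: "finsum (corner R ff) (\<lambda>i. gg i \<otimes> star R (gg i)) I = ff"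
    unfolding sum[OF subset_refl] by (simp only: ff_def)
  have rows: "star R (gg i) \<otimes> gg i = finsum (corner R ff) (\<lambda>i. gg i \<otimes> star R (gg i)) {j\<in>I. A i j}"
    if "i \<in> I" for i
    using gg_star_gg[OF that] by (subst sum) auto
  show ?thesis
    unfolding ck_family_def FC.C_simps
  proof (intro conjI allI ballI impI)
    show "gg i \<in> carrier (corner R ff)" for i by (rule gg_corner)
    show "gg i \<otimes> star R (gg i) \<otimes> gg i = gg i" if "i \<in> I" for i by (rule gg_partial[OF that])
    show "finsum (corner R ff) (\<lambda>i. gg i \<otimes> star R (gg i)) I = ff" by (rule fam)
    show "star R (gg i) \<otimes> gg i = finsum (corner R ff) (\<lambda>j. gg j \<otimes> star R (gg j)) {j\<in>I. A i j}"
      if "i \<in> I" for i by (rule rows[OF that])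
    show "gg i = \<zero>" if "i \<notin> I" for i using that by (simp add: gg_def)
  qed
qed

end

text \<open>Conjugation by an isometry is unital only as a map into the corner of its range
  projection, the form needed for comparing it with the round trip by uniqueness on
  generators.\<close>

lemma conjugation_hom:
  fixes R :: "'a cstar_algebra" (structure)
  assumes "cstar R" "v \<in> carrier R" and iso: "star R v \<otimes> v = \<one>"
  shows "star_alg.projection R (v \<otimes> star R v)"
    "star_hom R (corner R (v \<otimes> star R v)) (\<lambda>x. v \<otimes> x \<otimes> star R v)"
proof -
  interpret cstar R by fact
  note [simp] = assms(2)
  have k: "star R v \<otimes> (v \<otimes> x) = x" if "x \<in> carrier R" for x
    using that by (simp add: iso flip: m_assoc)
  show pr: "projection (v \<otimes> star R v)"
    unfolding projection_def by (simp add: star_mult m_assoc k)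
  interpret C: corner_cstar R "v \<otimes> star R v" by (rule corner_cstarI[OF cstar_axioms pr])
  show "star_hom R (corner R (v \<otimes> star R v)) (\<lambda>x. v \<otimes> x \<otimes> star R v)"
    unfolding star_hom_def
    by (auto simp: C.C_carrier m_assoc k star_mult l_distr r_distr scale_mult_left scale_mult_right)
qed

section \<open>The recoding homomorphism and its round trip\<close>

context elementary
begin

abbreviation "OA \<equiv> gck I A"
abbreviation "OB \<equiv> gck J B"
abbreviation "a \<equiv> gck_gen I A"
abbreviation "b \<equiv> gck_gen J B"

lemma rep: "elementary_rep I J A B C D OB b"
  by (intro elementary_rep.intro elementary_axioms ck_algebra.intro ck_algebra_axioms.intro
    gck_cstar gck_family finite_J)

interpretation e: elementary_rep I J A B C D OB b by (rule rep)

definition "unit = e.ff"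
text \<open>Fixing one homomorphism by choice gives it a name, under which its swapped and
  transposed instances can be mentioned in statements. \<open>gck_hom_unique\<close> shows that the
  generators determine it anyway.\<close>

definition "phi = (SOME \<phi>. star_hom OA (corner OB unit) \<phi> \<and> (\<forall>i. \<phi> (a i) = e.gg i))"

lemma phi: "star_hom OA (corner OB unit) phi" "phi (a i) = e.gg i"
proof -
  have "\<exists>\<phi>. star_hom OA (corner OB unit) \<phi> \<and> (\<forall>i. \<phi> (a i) = e.gg i)"
    unfolding unit_def by (rule gck_hom_exists[OF finite_I e.FC.cstar_C e.gg_family])
  then have "star_hom OA (corner OB unit) phi \<and> (\<forall>i. phi (a i) = e.gg i)"
    unfolding phi_def by (rule someI_ex)
  then show "star_hom OA (corner OB unit) phi" "phi (a i) = e.gg i" by blast+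
qed

lemma unit_projection: "star_alg.projection OB unit"
  unfolding unit_def by (rule e.ff_projection)

text \<open>On one-sided sequences \<open>phi\<close> prepends the letter \<open>cc\<close>, and the swapped map prepends another one;
  the isometry \<open>v\<close> prepends both.\<close>

lemma round_trip:
  "\<exists>v\<in>carrier OA. star OA v \<otimes>\<^bsub>OA\<^esub> v = \<one>\<^bsub>OA\<^esub> \<and>
    (\<forall>x\<in>carrier OA. elementary.phi J I B A D C (phi x) = v \<otimes>\<^bsub>OA\<^esub> x \<otimes>\<^bsub>OA\<^esub> star OA v)"
proof -
  interpret s: elementary J I B A D C by (rule swap)
  interpret e': elementary_rep J I B A D C OA a by (rule s.rep)
  define \<psi> where "\<psi> = s.phi"
  have psi_gen: "\<psi> (b u) = e'.gg u" for u unfolding \<psi>_def by (rule s.phi(2))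
  have psi_hom: "star_hom OB (corner OA e'.ff) \<psi>" using s.phi(1) unfolding s.unit_def \<psi>_def .
  interpret OAff: cstar "corner OA e'.ff" by (rule e'.FC.cstar_C)
  interpret OBff: cstar "corner OB e.ff" by (rule e.FC.cstar_C)
  interpret psi: star_hom_pair OB "corner OA e'.ff" \<psi>
    by (rule star_hom_pairI[OF e.star_alg_axioms OAff.star_alg_axioms psi_hom])
  interpret phi: star_hom_pair OA "corner OB e.ff" phi
    by (rule star_hom_pairI[OF e'.star_alg_axioms OBff.star_alg_axioms phi(1)[unfolded unit_def]])
  have psi_c [simp]: "\<psi> x \<in> carrier OA" if "x \<in> carrier OB" for x
    by (rule e'.FC.C_D[OF psi.closed[OF that]])
  have psi_mult: "\<psi> (x \<otimes>\<^bsub>OB\<^esub> y) = \<psi> x \<otimes>\<^bsub>OA\<^esub> \<psi> y" if "x \<in> carrier OB" "y \<in> carrier OB" for x y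
    using psi.mult[OF that] by simp
  have psi_star: "\<psi> (star OB x) = star OA (\<psi> x)" if "x \<in> carrier OB" for x
    using psi.star[OF that] by simp
  have psi_sum: "\<psi> (finsum OB g N) = finsum OA (\<lambda>i. \<psi> (g i)) N"
    if "finite N" "\<And>i. i \<in> N \<Longrightarrow> g i \<in> carrier OB" for g and N :: "'i set"
    using that by (subst psi.finsum[OF that(1)]) (auto intro!: e'.FC.C_finsum)
  note assoc = e'.m_assoc
  \<comment> \<open>The round trip puts the letter chosen for \<open>cc i\<close> in front. It
    reaches \<open>i\<close> through the state \<open>cc i\<close>, so it may precede
    \<open>i\<close> in an \<open>A\<close>-sequence.\<close>
  define \<kappa> where "\<kappa> i = e'.cc (e.cc i)" for i
  \<comment> \<open>\<open>v\<close> prepends to each sequence the letter \<open>\<kappa> i\<close>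
    that belongs to its first letter \<open>i\<close>.\<close>
  define v where "v = finsum OA (\<lambda>i. a (\<kappa> i) \<otimes>\<^bsub>OA\<^esub> e'.q i) I"
  have v [simp]: "v \<in> carrier OA" unfolding v_def by (rule e'.finsum_in_carrier) simp
  have \<kappa>: "\<kappa> i \<in> I" "C (\<kappa> i) (e.cc i)" "A (\<kappa> i) i" if i: "i \<in> I" for i
  proof -
    show 1: "\<kappa> i \<in> I" "C (\<kappa> i) (e.cc i)" unfolding \<kappa>_def using e'.cc[OF e.cc(1)[OF i]] by blast+
    then show "A (\<kappa> i) i" using A_iff[OF 1(1) i] e.cc[OF i] by blast
  qed
  have va: "v \<otimes>\<^bsub>OA\<^esub> a i = a (\<kappa> i) \<otimes>\<^bsub>OA\<^esub> a i" if i: "i \<in> I" for i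
  proof -
    have "v \<otimes>\<^bsub>OA\<^esub> a i = finsum OA (\<lambda>j. a (\<kappa> j) \<otimes>\<^bsub>OA\<^esub> e'.q j \<otimes>\<^bsub>OA\<^esub> a i) I"
      unfolding v_def by (rule e'.finsum_mult_left) (auto simp: finite_I)
    also have "\<dots> = a (\<kappa> i) \<otimes>\<^bsub>OA\<^esub> e'.q i \<otimes>\<^bsub>OA\<^esub> a i"
    proof (rule e'.finsum_single[OF finite_I i])
      fix j assume j: "j \<in> I" "j \<noteq> i"
      have "a (\<kappa> j) \<otimes>\<^bsub>OA\<^esub> e'.q j \<otimes>\<^bsub>OA\<^esub> a i = a (\<kappa> j) \<otimes>\<^bsub>OA\<^esub> a j \<otimes>\<^bsub>OA\<^esub> (star OA (a j) \<otimes>\<^bsub>OA\<^esub> a i)"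
        by (simp add: e'.q_def assoc)
      then show "a (\<kappa> j) \<otimes>\<^bsub>OA\<^esub> e'.q j \<otimes>\<^bsub>OA\<^esub> a i = \<zero>\<^bsub>OA\<^esub>"
        using e'.s_star_s_orth[OF j(1) i j(2)] by simp
    qed simp
    also have "\<dots> = a (\<kappa> i) \<otimes>\<^bsub>OA\<^esub> a i" using e'.q_s[OF i] by (simp add: assoc)
    finally show ?thesis .
  qed
  have vv: "star OA v \<otimes>\<^bsub>OA\<^esub> v = \<one>\<^bsub>OA\<^esub>"
  proof -
    have vs: "star OA v = finsum OA (\<lambda>i. e'.q i \<otimes>\<^bsub>OA\<^esub> star OA (a (\<kappa> i))) I"
      unfolding v_def by (subst e'.star_finsum) (auto simp: finite_I e'.star_mult e'.q_star)
    have "star OA v \<otimes>\<^bsub>OA\<^esub> v = finsum OA (\<lambda>i. finsum OA (\<lambda>j.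
        e'.q i \<otimes>\<^bsub>OA\<^esub> star OA (a (\<kappa> i)) \<otimes>\<^bsub>OA\<^esub> (a (\<kappa> j) \<otimes>\<^bsub>OA\<^esub> e'.q j)) I) I"
      unfolding vs by (unfold v_def, rule e'.finsum_mult_finsum) (auto simp: finite_I)
    also have "\<dots> = finsum OA (\<lambda>i. e'.q i \<otimes>\<^bsub>OA\<^esub> star OA (a (\<kappa> i)) \<otimes>\<^bsub>OA\<^esub> (a (\<kappa> i) \<otimes>\<^bsub>OA\<^esub> e'.q i)) (I \<inter> I)"
    proof (rule e'.finsum_diagonal[OF finite_I finite_I])
      fix i j assume ij: "i \<in> I" "j \<in> I" "i \<noteq> j"
      have "e'.q i \<otimes>\<^bsub>OA\<^esub> star OA (a (\<kappa> i)) \<otimes>\<^bsub>OA\<^esub> (a (\<kappa> j) \<otimes>\<^bsub>OA\<^esub> e'.q j) =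
        e'.q i \<otimes>\<^bsub>OA\<^esub> ((star OA (a (\<kappa> i)) \<otimes>\<^bsub>OA\<^esub> a (\<kappa> j)) \<otimes>\<^bsub>OA\<^esub> e'.q j)"
        by (simp add: assoc)
      also have "\<dots> = \<zero>\<^bsub>OA\<^esub>"
      proof (cases "\<kappa> i = \<kappa> j")
        case False
        then show ?thesis using e'.s_star_s_orth[OF \<kappa>(1)[OF ij(1)] \<kappa>(1)[OF ij(2)]] by simp
      next
        \<comment> \<open>\<open>\<kappa>\<close> need not be injective. When two values coincide,
          the middle factor is a sum of range projections and the outer factors
          \<open>e'.q i\<close> and \<open>e'.q j\<close> are orthogonal.\<close>
        case True
        let ?X = "{l\<in>I. A (\<kappa> j) l}"
        have q1: "e'.q l = e'.Pr {l}" if "l \<in> I" for l by (simp add: e'.Pr_def)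
        have "(star OA (a (\<kappa> i)) \<otimes>\<^bsub>OA\<^esub> a (\<kappa> j)) \<otimes>\<^bsub>OA\<^esub> e'.q j = e'.Pr (?X \<inter> {j})"
          unfolding True e'.s_star_s[OF \<kappa>(1)[OF ij(2)]] q1[OF ij(2)] by (rule e'.Pr_mult) (use ij in auto)
        then have "e'.q i \<otimes>\<^bsub>OA\<^esub> ((star OA (a (\<kappa> i)) \<otimes>\<^bsub>OA\<^esub> a (\<kappa> j)) \<otimes>\<^bsub>OA\<^esub> e'.q j) = e'.Pr ({i} \<inter> (?X \<inter> {j}))"
          unfolding q1[OF ij(1)] by (simp only:) (rule e'.Pr_mult, use ij in auto)
        moreover have "{i} \<inter> (?X \<inter> {j}) = {}" using ij(3) by blast
        ultimately show ?thesis by (simp only: e'.Pr_empty)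
      qed
      finally show "e'.q i \<otimes>\<^bsub>OA\<^esub> star OA (a (\<kappa> i)) \<otimes>\<^bsub>OA\<^esub> (a (\<kappa> j) \<otimes>\<^bsub>OA\<^esub> e'.q j) = \<zero>\<^bsub>OA\<^esub>" .
    qed simp
    also have "\<dots> = finsum OA e'.q I"
    proof (rule e'.finsum_eqI)
      fix i assume i: "i \<in> I"
      let ?X = "{l\<in>I. A (\<kappa> i) l}"
      have q1: "e'.q i = e'.Pr {i}" by (simp add: e'.Pr_def)
      have "(star OA (a (\<kappa> i)) \<otimes>\<^bsub>OA\<^esub> a (\<kappa> i)) \<otimes>\<^bsub>OA\<^esub> e'.q i = e'.Pr (?X \<inter> {i})"
        unfolding e'.s_star_s[OF \<kappa>(1)[OF i]] q1 by (rule e'.Pr_mult) (use i in auto)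
      moreover have "?X \<inter> {i} = {i}" using \<kappa>(3)[OF i] i by blast
      ultimately have "(star OA (a (\<kappa> i)) \<otimes>\<^bsub>OA\<^esub> a (\<kappa> i)) \<otimes>\<^bsub>OA\<^esub> e'.q i = e'.q i" using q1 by simp
      moreover have "e'.q i \<otimes>\<^bsub>OA\<^esub> star OA (a (\<kappa> i)) \<otimes>\<^bsub>OA\<^esub> (a (\<kappa> i) \<otimes>\<^bsub>OA\<^esub> e'.q i) =
        e'.q i \<otimes>\<^bsub>OA\<^esub> ((star OA (a (\<kappa> i)) \<otimes>\<^bsub>OA\<^esub> a (\<kappa> i)) \<otimes>\<^bsub>OA\<^esub> e'.q i)"
        by (simp add: assoc)
      ultimately show "e'.q i \<otimes>\<^bsub>OA\<^esub> star OA (a (\<kappa> i)) \<otimes>\<^bsub>OA\<^esub> (a (\<kappa> i) \<otimes>\<^bsub>OA\<^esub> e'.q i) = e'.q i"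
        using e'.q_idem[OF i] by simp
    qed auto
    finally show ?thesis using e'.Pr_J by (simp add: e'.Pr_def)
  qed
  have sets: "e'.Ds i = e.Cs i" "e'.Cs u = e.Ds u" for i u
    by (auto simp: e'.Ds_def e.Cs_def e'.Cs_def e.Ds_def)
  \<comment> \<open>\<open>e'.zz w\<close> is a sum of terms that strip a state and prepend a letter
    of \<open>e.Ds w\<close>. The adjoint of \<open>e'.yy i\<close> on the right singles out the
    letter \<open>i\<close>, and what remains of its term is \<open>a i\<close>.\<close>
  have zy: "e'.zz w \<otimes>\<^bsub>OA\<^esub> star OA (e'.yy i) = a i" if w: "w \<in> J" and i: "i \<in> e.Ds w" for w i
  proof -
    have iI: "i \<in> I" using i e.Ds_I by blast
    have i': "i \<in> e'.Cs w" using i sets by simp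
    have "e'.zz w \<otimes>\<^bsub>OA\<^esub> star OA (e'.yy i) =
      finsum OA (\<lambda>j. a j \<otimes>\<^bsub>OA\<^esub> e'.yy j \<otimes>\<^bsub>OA\<^esub> star OA (e'.yy i)) (e'.Cs w)"
      unfolding e'.zz_def by (rule e'.finsum_mult_left) auto
    also have "\<dots> = a i \<otimes>\<^bsub>OA\<^esub> e'.yy i \<otimes>\<^bsub>OA\<^esub> star OA (e'.yy i)"
    proof (rule e'.finsum_single[OF e'.fin(1) i'])
      fix j assume j: "j \<in> e'.Cs w" "j \<noteq> i"
      have "e'.yy j \<otimes>\<^bsub>OA\<^esub> star OA (e'.yy i) = \<zero>\<^bsub>OA\<^esub>"
        unfolding e'.yy_yy_star e'.Ds_disjoint[OF w j(1) i' j(2)] by simp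
      then show "a j \<otimes>\<^bsub>OA\<^esub> e'.yy j \<otimes>\<^bsub>OA\<^esub> star OA (e'.yy i) = \<zero>\<^bsub>OA\<^esub>" by (simp add: assoc)
    qed simp
    also have "\<dots> = a i" using e'.yy_yy_star_same[OF iI] e'.s_partial[OF iI] by (simp add: assoc)
    finally show ?thesis .
  qed
  have psi_b: "\<psi> (b u) = e'.rr u \<otimes>\<^bsub>OA\<^esub> e'.zz u" if "u \<in> J" for u
    using that by (simp add: psi_gen e'.gg_def)
  have psi_pp: "\<psi> (e.pp i) = star OA (e'.yy i) \<otimes>\<^bsub>OA\<^esub> e'.yy i" if i: "i \<in> I" for i
  proof -
    have "\<psi> (e.pp i) = finsum OA (\<lambda>u. \<psi> (e.q u)) (e.Cs i)"
      unfolding e.pp_def e.Pr_def by (rule psi_sum) auto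
    also have "\<dots> = finsum OA (\<lambda>u. e'.rr u \<otimes>\<^bsub>OA\<^esub> star OA (e'.rr u)) (e.Cs i)"
    proof (rule e'.finsum_eqI[OF refl])
      fix u assume "u \<in> e.Cs i"
      then have u: "u \<in> J" using e.Cs_J by blast
      have "\<psi> (e.q u) = e'.gg u \<otimes>\<^bsub>OA\<^esub> star OA (e'.gg u)"
        unfolding e.q_def by (simp add: psi_mult psi_star psi_gen)
      then show "\<psi> (e.q u) = e'.rr u \<otimes>\<^bsub>OA\<^esub> star OA (e'.rr u)" using e'.gg_gg_star[OF u] by simp
    qed simp
    finally show ?thesis using e'.yy_star_yy[OF i] sets by simp
  qed
  \<comment> \<open>The images of \<open>e.rr i\<close> and \<open>e.zz i\<close> end and begin with
    \<open>e'.yy i\<close> and its adjoint. In the product these merge into the source projection of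
    \<open>a i\<close>, which leaves \<open>a i\<close> between \<open>v\<close> and its
    adjoint.\<close>
  have psi_rr: "\<psi> (e.rr i) = v \<otimes>\<^bsub>OA\<^esub> a i \<otimes>\<^bsub>OA\<^esub> e'.yy i" if i: "i \<in> I" for i
  proof -
    let ?w = "e.cc i"
    have w: "?w \<in> J" "i \<in> e.Ds ?w" using e.cc[OF i] e.cc_Ds[OF i] by blast+
    have "\<psi> (e.rr i) = e'.rr ?w \<otimes>\<^bsub>OA\<^esub> (e'.zz ?w \<otimes>\<^bsub>OA\<^esub> star OA (e'.yy i)) \<otimes>\<^bsub>OA\<^esub> e'.yy i"
      unfolding e.rr_def by (simp add: psi_mult psi_b[OF w(1)] psi_pp[OF i] assoc)
    also have "\<dots> = a (\<kappa> i) \<otimes>\<^bsub>OA\<^esub> (e'.pp ?w \<otimes>\<^bsub>OA\<^esub> a i) \<otimes>\<^bsub>OA\<^esub> e'.yy i"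
      unfolding zy[OF w] e'.rr_def \<kappa>_def by (simp add: assoc)
    also have "e'.pp ?w \<otimes>\<^bsub>OA\<^esub> a i = a i"
      unfolding e'.pp_def by (rule e'.Pr_s[OF e'.Cs_J]) (use w sets in simp)
    finally show ?thesis using va[OF i] by simp
  qed
  have psi_by: "\<psi> (b u \<otimes>\<^bsub>OB\<^esub> e.yy u) = e'.rr u \<otimes>\<^bsub>OA\<^esub> star OA v" if u: "u \<in> J" for u
  proof -
    have "\<psi> (e.yy u) = finsum OA (\<lambda>j. star OA (e'.yy j) \<otimes>\<^bsub>OA\<^esub> star OA (a j) \<otimes>\<^bsub>OA\<^esub> star OA v) (e.Ds u)"
    proof -
      have "\<psi> (e.yy u) = finsum OA (\<lambda>j. \<psi> (star OB (e.rr j))) (e.Ds u)"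
        unfolding e.yy_def by (rule psi_sum) auto
      also have "\<dots> = finsum OA (\<lambda>j. star OA (e'.yy j) \<otimes>\<^bsub>OA\<^esub> star OA (a j) \<otimes>\<^bsub>OA\<^esub> star OA v) (e.Ds u)"
      proof (rule e'.finsum_eqI[OF refl])
        fix j assume "j \<in> e.Ds u"
        then have j: "j \<in> I" using e.Ds_I by blast
        show "\<psi> (star OB (e.rr j)) = star OA (e'.yy j) \<otimes>\<^bsub>OA\<^esub> star OA (a j) \<otimes>\<^bsub>OA\<^esub> star OA v"
          by (simp add: psi_star psi_rr[OF j] e'.star_mult assoc)
      qed simp
      finally show ?thesis .
    qed
    then have "\<psi> (b u \<otimes>\<^bsub>OB\<^esub> e.yy u) = e'.rr u \<otimes>\<^bsub>OA\<^esub> (e'.zz u \<otimes>\<^bsub>OA\<^esub>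
        finsum OA (\<lambda>j. star OA (e'.yy j) \<otimes>\<^bsub>OA\<^esub> star OA (a j) \<otimes>\<^bsub>OA\<^esub> star OA v) (e.Ds u))"
      by (simp add: psi_mult psi_b[OF u] assoc e'.finsum_in_carrier)
    also have "e'.zz u \<otimes>\<^bsub>OA\<^esub> finsum OA (\<lambda>j. star OA (e'.yy j) \<otimes>\<^bsub>OA\<^esub> star OA (a j) \<otimes>\<^bsub>OA\<^esub> star OA v) (e.Ds u) =
      finsum OA (\<lambda>j. e'.zz u \<otimes>\<^bsub>OA\<^esub> (star OA (e'.yy j) \<otimes>\<^bsub>OA\<^esub> star OA (a j) \<otimes>\<^bsub>OA\<^esub> star OA v)) (e.Ds u)"
      by (rule e'.finsum_mult_right) auto
    also have "\<dots> = finsum OA (\<lambda>j. e'.q j \<otimes>\<^bsub>OA\<^esub> star OA v) (e.Ds u)"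
    proof (rule e'.finsum_eqI[OF refl])
      fix j assume j: "j \<in> e.Ds u"
      have "e'.zz u \<otimes>\<^bsub>OA\<^esub> (star OA (e'.yy j) \<otimes>\<^bsub>OA\<^esub> star OA (a j) \<otimes>\<^bsub>OA\<^esub> star OA v) =
        (e'.zz u \<otimes>\<^bsub>OA\<^esub> star OA (e'.yy j)) \<otimes>\<^bsub>OA\<^esub> star OA (a j) \<otimes>\<^bsub>OA\<^esub> star OA v"
        by (simp add: assoc)
      then show "e'.zz u \<otimes>\<^bsub>OA\<^esub> (star OA (e'.yy j) \<otimes>\<^bsub>OA\<^esub> star OA (a j) \<otimes>\<^bsub>OA\<^esub> star OA v) = e'.q j \<otimes>\<^bsub>OA\<^esub> star OA v"
        unfolding zy[OF u j] by (simp add: e'.q_def)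
    qed simp
    also have "\<dots> = e'.pp u \<otimes>\<^bsub>OA\<^esub> star OA v"
      unfolding e'.pp_def e'.Pr_def sets by (rule e'.finsum_mult_left[symmetric]) auto
    finally show ?thesis using e'.rr_pp[of u] by (simp flip: assoc)
  qed
  have psi_zz: "\<psi> (e.zz i) = star OA (e'.yy i) \<otimes>\<^bsub>OA\<^esub> star OA v" for i
  proof -
    have "\<psi> (e.zz i) = finsum OA (\<lambda>u. \<psi> (b u \<otimes>\<^bsub>OB\<^esub> e.yy u)) (e.Cs i)"
      unfolding e.zz_def by (rule psi_sum) auto
    also have "\<dots> = finsum OA (\<lambda>u. e'.rr u \<otimes>\<^bsub>OA\<^esub> star OA v) (e.Cs i)"
      by (rule e'.finsum_eqI[OF refl]) (use e.Cs_J psi_by in auto)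
    also have "\<dots> = finsum OA e'.rr (e.Cs i) \<otimes>\<^bsub>OA\<^esub> star OA v"
      by (rule e'.finsum_mult_left[symmetric]) auto
    finally show ?thesis using e'.yy_star[of i] sets by simp
  qed
  have round: "\<psi> (phi (a i)) = v \<otimes>\<^bsub>OA\<^esub> a i \<otimes>\<^bsub>OA\<^esub> star OA v" if i: "i \<in> I" for i
  proof -
    have "\<psi> (phi (a i)) = \<psi> (e.rr i) \<otimes>\<^bsub>OA\<^esub> \<psi> (e.zz i)"
      using i by (simp add: phi(2) e.gg_def psi_mult)
    also have "\<dots> = v \<otimes>\<^bsub>OA\<^esub> (a i \<otimes>\<^bsub>OA\<^esub> (e'.yy i \<otimes>\<^bsub>OA\<^esub> star OA (e'.yy i))) \<otimes>\<^bsub>OA\<^esub> star OA v"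
      by (simp add: psi_rr[OF i] psi_zz assoc)
    also have "a i \<otimes>\<^bsub>OA\<^esub> (e'.yy i \<otimes>\<^bsub>OA\<^esub> star OA (e'.yy i)) = a i"
      using e'.yy_yy_star_same[OF i] e'.s_partial[OF i] by (simp add: assoc)
    finally show ?thesis .
  qed
  have psi_ff: "\<psi> e.ff = v \<otimes>\<^bsub>OA\<^esub> star OA v"
  proof -
    have "\<psi> e.ff = finsum OA (\<lambda>i. \<psi> (e.rr i \<otimes>\<^bsub>OB\<^esub> star OB (e.rr i))) I"
      unfolding e.ff_def by (rule psi_sum) (auto simp: finite_I)
    also have "\<dots> = finsum OA (\<lambda>i. v \<otimes>\<^bsub>OA\<^esub> e'.q i \<otimes>\<^bsub>OA\<^esub> star OA v) I"
    proof (rule e'.finsum_eqI[OF refl])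
      fix i assume i: "i \<in> I"
      have "\<psi> (e.rr i \<otimes>\<^bsub>OB\<^esub> star OB (e.rr i)) =
        v \<otimes>\<^bsub>OA\<^esub> ((a i \<otimes>\<^bsub>OA\<^esub> (e'.yy i \<otimes>\<^bsub>OA\<^esub> star OA (e'.yy i))) \<otimes>\<^bsub>OA\<^esub> star OA (a i)) \<otimes>\<^bsub>OA\<^esub> star OA v"
        by (simp add: psi_mult psi_star psi_rr[OF i] e'.star_mult assoc)
      also have "a i \<otimes>\<^bsub>OA\<^esub> (e'.yy i \<otimes>\<^bsub>OA\<^esub> star OA (e'.yy i)) = a i"
        using e'.yy_yy_star_same[OF i] e'.s_partial[OF i] by (simp add: assoc)
      finally show "\<psi> (e.rr i \<otimes>\<^bsub>OB\<^esub> star OB (e.rr i)) = v \<otimes>\<^bsub>OA\<^esub> e'.q i \<otimes>\<^bsub>OA\<^esub> star OA v"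
        by (simp add: e'.q_def)
    qed simp
    also have "\<dots> = finsum OA (\<lambda>i. v \<otimes>\<^bsub>OA\<^esub> e'.q i) I \<otimes>\<^bsub>OA\<^esub> star OA v"
      by (rule e'.finsum_mult_left[symmetric]) (auto simp: finite_I)
    also have "finsum OA (\<lambda>i. v \<otimes>\<^bsub>OA\<^esub> e'.q i) I = v \<otimes>\<^bsub>OA\<^esub> finsum OA e'.q I"
      by (rule e'.finsum_mult_right[symmetric]) (auto simp: finite_I)
    also have "finsum OA e'.q I = \<one>\<^bsub>OA\<^esub>" using e'.Pr_J by (simp add: e'.Pr_def)
    finally show ?thesis by simp
  qed
  note cj = conjugation_hom[OF e'.cstar_axioms v vv]
  interpret VC: corner_cstar OA "v \<otimes>\<^bsub>OA\<^esub> star OA v" by (rule corner_cstarI[OF e'.cstar_axioms cj(1)])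
  have eC: "phi x \<in> carrier OB" if "x \<in> carrier OA" for x by (rule e.FC.C_D[OF phi.closed[OF that]])
  \<comment> \<open>The composite takes values in the corner of \<open>e'.ff\<close>, but its unit
    is only \<open>v\<close> times its adjoint, by \<open>psi_ff\<close>. It is moved to that
    smaller corner so that it can be compared with the conjugation on generators.\<close>
  have hom: "star_hom OA (corner OA (v \<otimes>\<^bsub>OA\<^esub> star OA v)) (\<lambda>x. \<psi> (phi x))"
    unfolding star_hom_def
  proof (intro conjI ballI allI)
    have one: "\<psi> (phi \<one>\<^bsub>OA\<^esub>) = v \<otimes>\<^bsub>OA\<^esub> star OA v"
      using phi.one psi_ff by simp
    then show "\<psi> (phi \<one>\<^bsub>OA\<^esub>) = \<one>\<^bsub>corner OA (v \<otimes>\<^bsub>OA\<^esub> star OA v)\<^esub>" by simp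
    fix x y c assume x: "x \<in> carrier OA" and y: "y \<in> carrier OA"
    show "\<psi> (phi x) \<in> carrier (corner OA (v \<otimes>\<^bsub>OA\<^esub> star OA v))"
    proof (rule VC.C_I)
      show "\<psi> (phi x) \<in> carrier OA" using eC[OF x] by simp
      have "e.ff \<otimes>\<^bsub>OB\<^esub> phi x = phi x" "phi x \<otimes>\<^bsub>OB\<^esub> e.ff = phi x"
        using phi.closed[OF x] unfolding e.FC.C_carrier by blast+
      then show "v \<otimes>\<^bsub>OA\<^esub> star OA v \<otimes>\<^bsub>OA\<^esub> \<psi> (phi x) = \<psi> (phi x)"
        "\<psi> (phi x) \<otimes>\<^bsub>OA\<^esub> (v \<otimes>\<^bsub>OA\<^esub> star OA v) = \<psi> (phi x)"
        using psi_mult[of e.ff "phi x"] psi_mult[of "phi x" e.ff] eC[OF x] by (simp_all add: psi_ff)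
    qed
    show "\<psi> (phi (x \<oplus>\<^bsub>OA\<^esub> y)) = \<psi> (phi x) \<oplus>\<^bsub>corner OA (v \<otimes>\<^bsub>OA\<^esub> star OA v)\<^esub> \<psi> (phi y)"
      using phi.add[OF x y] psi.add[OF eC[OF x] eC[OF y]] by simp
    show "\<psi> (phi (x \<otimes>\<^bsub>OA\<^esub> y)) = \<psi> (phi x) \<otimes>\<^bsub>corner OA (v \<otimes>\<^bsub>OA\<^esub> star OA v)\<^esub> \<psi> (phi y)"
      using phi.mult[OF x y] psi.mult[OF eC[OF x] eC[OF y]] by simp
    show "\<psi> (phi (scale OA c x)) = scale (corner OA (v \<otimes>\<^bsub>OA\<^esub> star OA v)) c (\<psi> (phi x))"
      using phi.scale[OF x] psi.scale[OF eC[OF x]] by simp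
    show "\<psi> (phi (star OA x)) = star (corner OA (v \<otimes>\<^bsub>OA\<^esub> star OA v)) (\<psi> (phi x))"
      using phi.star[OF x] psi.star[OF eC[OF x]] by simp
  qed
  have "\<psi> (phi x) = v \<otimes>\<^bsub>OA\<^esub> x \<otimes>\<^bsub>OA\<^esub> star OA v" if x: "x \<in> carrier OA" for x
    by (rule gck_hom_unique[OF finite_I VC.cstar_C hom cj(2) round x])
  then show ?thesis using v vv unfolding \<psi>_def by blast
qed

end

section \<open>Extended Ruelle algebras over a finite set of letters\<close>

definition gck_tensor :: "'g set \<Rightarrow> ('g \<Rightarrow> 'g \<Rightarrow> bool) \<Rightarrow> 'g ck_tensor_elem cstar_algebra" where
  "gck_tensor I A = cstar_tensor (gck I (\<lambda>i j. A j i)) (gck I A)"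

definition gck_elem :: "'g set \<Rightarrow> ('g \<Rightarrow> 'g \<Rightarrow> bool) \<Rightarrow> 'g ck_elem \<Rightarrow> 'g ck_elem \<Rightarrow> 'g ck_tensor_elem" where
  "gck_elem I A = elem_tensor (gck I (\<lambda>i j. A j i)) (gck I A)"

definition gck_proj :: "'g set \<Rightarrow> ('g \<Rightarrow> 'g \<Rightarrow> bool) \<Rightarrow> 'g ck_tensor_elem" where
  "gck_proj I A =
    (let Ot = gck I (\<lambda>i j. A j i); T = gck_gen I (\<lambda>i j. A j i); O1 = gck I A; S = gck_gen I A in
      finsum (gck_tensor I A) (\<lambda>i. gck_elem I A (star Ot (T i) \<otimes>\<^bsub>Ot\<^esub> T i) (S i \<otimes>\<^bsub>O1\<^esub> star O1 (S i))) I)"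

definition gruelle :: "'g set \<Rightarrow> ('g \<Rightarrow> 'g \<Rightarrow> bool) \<Rightarrow> 'g ck_tensor_elem cstar_algebra" where
  "gruelle I A = corner (gck_tensor I A) (gck_proj I A)"

context
  fixes I :: "'g set" and A :: "'g \<Rightarrow> 'g \<Rightarrow> bool"
  assumes fin: "finite I"
begin

interpretation S: ck_algebra "gck I A" I A "gck_gen I A"
  by (intro ck_algebra.intro ck_algebra_axioms.intro gck_cstar gck_family fin)

interpretation T: ck_algebra "gck I (\<lambda>i j. A j i)" I "\<lambda>i j. A j i" "gck_gen I (\<lambda>i j. A j i)"
  by (intro ck_algebra.intro ck_algebra_axioms.intro gck_cstar gck_family fin)

interpretation D: tensor "gck I (\<lambda>i j. A j i)" "gck I A"
  by (intro tensor.intro S.cstar_axioms T.cstar_axioms)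

lemma gck_tensor_cstar: "cstar (gck_tensor I A)"
  unfolding gck_tensor_def by (rule D.cstar_T)

lemma gck_proj_eq: "gck_proj I A = finsum D.T (\<lambda>u. D.t (T.Pr {v\<in>I. A v u}) (S.q u)) I"
proof -
  have "gck_proj I A = finsum D.T (\<lambda>u. D.t (star (gck I (\<lambda>i j. A j i)) (gck_gen I (\<lambda>i j. A j i) u)
      \<otimes>\<^bsub>gck I (\<lambda>i j. A j i)\<^esub> gck_gen I (\<lambda>i j. A j i) u) (S.q u)) I"
    unfolding gck_proj_def Let_def gck_tensor_def gck_elem_def S.q_def[abs_def] ..
  also have "\<dots> = finsum D.T (\<lambda>u. D.t (T.Pr {v\<in>I. A v u}) (S.q u)) I"
    by (rule D.T.finsum_eqI[OF refl]) (auto simp: T.s_star_s)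
  finally show ?thesis .
qed

lemma gck_proj_projection: "star_alg.projection (gck_tensor I A) (gck_proj I A)"
  unfolding gck_tensor_def
proof (unfold D.T.projection_def, intro conjI)
  let ?P = "\<lambda>u. T.Pr {v\<in>I. A v u}"
  have fin': "finite {v\<in>I. A v u}" for u using fin by simp
  show c: "gck_proj I A \<in> carrier D.T"
    unfolding gck_proj_eq by (rule D.T.finsum_in_carrier) simp
  show "star D.T (gck_proj I A) = gck_proj I A"
    unfolding gck_proj_eq using fin by (subst D.T.star_finsum) (auto simp: D.t_star S.q_star T.Pr_star fin')
  have "gck_proj I A \<otimes>\<^bsub>D.T\<^esub> gck_proj I A =
      finsum D.T (\<lambda>u. finsum D.T (\<lambda>v. D.t (?P u) (S.q u) \<otimes>\<^bsub>D.T\<^esub> D.t (?P v) (S.q v)) I) I"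
    unfolding gck_proj_eq using fin by (intro D.T.finsum_mult_finsum) auto
  also have "\<dots> = finsum D.T (\<lambda>u. D.t (?P u) (S.q u) \<otimes>\<^bsub>D.T\<^esub> D.t (?P u) (S.q u)) (I \<inter> I)"
    by (rule D.T.finsum_diagonal[OF fin fin]) (auto simp: D.t_mult S.q_orth)
  also have "\<dots> = gck_proj I A" unfolding gck_proj_eq
    by (rule D.T.finsum_eqI) (auto simp: D.t_mult S.q_idem T.Pr_mult)
  finally show "gck_proj I A \<otimes>\<^bsub>D.T\<^esub> gck_proj I A = gck_proj I A" .
qed

text \<open>Both forms of the projection arise from the sum of \<open>D.t (T.q v) (S.q u)\<close>
  over all edges from \<open>v\<close> to \<open>u\<close>, the indicator of the pairs of
  half-sequences that meet in an edge. \<open>gck_proj_eq\<close> groups it by the right letter,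
  this form by the left one.\<close>

lemma gck_proj_pairs: "gck_proj I A = finsum D.T (\<lambda>v. D.t (T.q v) (S.Pr {u\<in>I. A v u})) I"
proof -
  let ?x = "\<lambda>v u. D.t (T.q v) (S.q u)"
  have "gck_proj I A = finsum D.T (\<lambda>u. finsum D.T (\<lambda>v. if A v u then ?x v u else \<zero>\<^bsub>D.T\<^esub>) I) I"
    unfolding gck_proj_eq
  proof (rule D.T.finsum_eqI[OF refl])
    fix u
    have "D.t (T.Pr {v\<in>I. A v u}) (S.q u) = finsum D.T (\<lambda>v. ?x v u) {v\<in>I. A v u}"
      unfolding T.Pr_def by (rule D.t_finsum_left) (auto simp: fin)
    also have "\<dots> = finsum D.T (\<lambda>v. if A v u then ?x v u else \<zero>\<^bsub>D.T\<^esub>) I"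
      by (rule D.T.finsum_restrict_set[symmetric]) (auto simp: fin)
    finally show "D.t (T.Pr {v\<in>I. A v u}) (S.q u) = finsum D.T (\<lambda>v. if A v u then ?x v u else \<zero>\<^bsub>D.T\<^esub>) I" .
    show "finsum D.T (\<lambda>v. if A v u then ?x v u else \<zero>\<^bsub>D.T\<^esub>) I \<in> carrier D.T"
      by (rule D.T.finsum_in_carrier) simp
  qed
  also have "\<dots> = finsum D.T (\<lambda>v. finsum D.T (\<lambda>u. if A v u then ?x v u else \<zero>\<^bsub>D.T\<^esub>) I) I"
    by (rule D.T.finsum_swap[OF fin fin]) simp
  also have "\<dots> = finsum D.T (\<lambda>v. D.t (T.q v) (S.Pr {u\<in>I. A v u})) I"
  proof (rule D.T.finsum_eqI[OF refl])
    fix v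
    have "D.t (T.q v) (S.Pr {u\<in>I. A v u}) = finsum D.T (\<lambda>u. ?x v u) {u\<in>I. A v u}"
      unfolding S.Pr_def by (rule D.t_finsum_right) (auto simp: fin)
    also have "\<dots> = finsum D.T (\<lambda>u. if A v u then ?x v u else \<zero>\<^bsub>D.T\<^esub>) I"
      by (rule D.T.finsum_restrict_set[symmetric]) (auto simp: fin)
    finally show "finsum D.T (\<lambda>u. if A v u then ?x v u else \<zero>\<^bsub>D.T\<^esub>) I = D.t (T.q v) (S.Pr {u\<in>I. A v u})" by simp
  qed simp
  finally show ?thesis .
qed

end

section \<open>Isomorphism of the corners\<close>

context elementary
begin

text \<open>\<open>\<Phi>\<close> recodes both halves, each with an invented letter at the cut. For
  halves that meet in the edge from \<open>i\<close> to \<open>j\<close>, \<open>w\<close> strips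
  both invented letters and puts the state \<open>u\<close> between \<open>i\<close> and
  \<open>j\<close> at the end of the left half. The outcome is a pair of halves that meet in an edge
  of \<open>B\<close>, and every such pair arises in this way.\<close>

lemma lift:
  "\<exists>\<Phi> w. star_hom (gck_tensor I A) (corner (gck_tensor J B)
       (gck_elem J B (elementary.unit I J (\<lambda>u v. B v u) (\<lambda>i u. D u i) (\<lambda>u i. C i u)) unit)) \<Phi> \<and>
    (\<forall>x\<in>carrier (gck I (\<lambda>i j. A j i)). \<forall>y\<in>carrier OA. \<Phi> (gck_elem I A x y) =
      gck_elem J B (elementary.phi I J (\<lambda>i j. A j i) (\<lambda>u v. B v u) (\<lambda>i u. D u i) (\<lambda>u i. C i u) x) (phi y)) \<and>
    w \<in> carrier (gck_tensor J B) \<and>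
    w \<otimes>\<^bsub>gck_tensor J B\<^esub> star (gck_tensor J B) w = gck_proj J B \<and>
    star (gck_tensor J B) w \<otimes>\<^bsub>gck_tensor J B\<^esub> w = \<Phi> (gck_proj I A)"
proof -
  interpret t: elementary I J "\<lambda>i j. A j i" "\<lambda>u v. B v u" "\<lambda>i u. D u i" "\<lambda>u i. C i u" by (rule transposed)
  interpret e: elementary_rep I J A B C D OB b by (rule rep)
  interpret f: elementary_rep I J "\<lambda>i j. A j i" "\<lambda>u v. B v u" "\<lambda>i u. D u i" "\<lambda>u i. C i u" t.OB t.b by (rule t.rep)
  interpret OA: ck_algebra OA I A a
    by (intro ck_algebra.intro ck_algebra_axioms.intro gck_cstar gck_family finite_I)
  interpret OAt: ck_algebra t.OA I "\<lambda>i j. A j i" t.a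
    by (intro ck_algebra.intro ck_algebra_axioms.intro gck_cstar gck_family finite_I)
  interpret X: tensor t.OA OA by (intro tensor.intro OA.cstar_axioms OAt.cstar_axioms)
  interpret Y: tensor t.OB OB by (intro tensor.intro e.cstar_axioms f.cstar_axioms)
  interpret OBe: cstar "corner OB e.ff" by (rule e.FC.cstar_C)
  interpret OBf: cstar "corner t.OB f.ff" by (rule f.FC.cstar_C)
  have ue: "unit = e.ff" "t.unit = f.ff" unfolding unit_def t.unit_def by (rule refl)+
  interpret phi: star_hom_pair OA "corner OB e.ff" phi
    by (rule star_hom_pairI[OF OA.star_alg_axioms OBe.star_alg_axioms phi(1)[unfolded ue]])
  interpret tphi: star_hom_pair t.OA "corner t.OB f.ff" t.phi
    by (rule star_hom_pairI[OF OAt.star_alg_axioms OBf.star_alg_axioms t.phi(1)[unfolded ue]])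
  obtain \<Phi> where hom: "star_hom X.T (corner Y.T (Y.t f.ff e.ff)) \<Phi>"
    and Phi: "\<And>x y. x \<in> carrier t.OA \<Longrightarrow> y \<in> carrier OA \<Longrightarrow> \<Phi> (X.t x y) = Y.t (t.phi x) (phi y)"
    using tensor_functor[OF OAt.cstar_axioms OA.cstar_axioms f.cstar_axioms e.cstar_axioms f.ff_projection e.ff_projection
       tphi.hom phi.hom] by blast
  interpret YC: corner_cstar Y.T "Y.t f.ff e.ff"
    by (rule corner_cstarI[OF Y.cstar_T Y.t_projection[OF f.ff_projection e.ff_projection]])
  interpret YCc: cstar "corner Y.T (Y.t f.ff e.ff)" by (rule YC.cstar_C)
  interpret Ph: star_hom_pair X.T "corner Y.T (Y.t f.ff e.ff)" \<Phi>
    by (rule star_hom_pairI[OF X.T.star_alg_axioms YCc.star_alg_axioms hom])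
  define w where "w = finsum Y.T (\<lambda>u. Y.t (t.b u \<otimes>\<^bsub>t.OB\<^esub> f.yy u) (e.yy u)) J"
  have w [simp]: "w \<in> carrier Y.T" unfolding w_def by (rule Y.T.finsum_in_carrier) simp
  have ws: "star Y.T w = finsum Y.T (\<lambda>u. Y.t (star t.OB (f.yy u) \<otimes>\<^bsub>t.OB\<^esub> star t.OB (t.b u)) (star OB (e.yy u))) J"
    unfolding w_def by (subst Y.T.star_finsum) (auto simp: finite_J Y.t_star f.star_mult)
  \<comment> \<open>Letters \<open>i\<close> and \<open>j\<close> in the two intersections would
    form an edge that passes through both \<open>u\<close> and \<open>v\<close>, against
    \<open>A_unique\<close>. Hence one intersection is empty, which kills the cross terms of
    \<open>w\<close> times its adjoint.\<close>
  have disj: "f.Ds u \<inter> f.Ds v = {} \<or> e.Ds u \<inter> e.Ds v = {}" if "u \<in> J" "v \<in> J" "u \<noteq> v" for u v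
    using A_unique[of _ _ u v] that unfolding f.Ds_def e.Ds_def by blast
  have ww: "w \<otimes>\<^bsub>Y.T\<^esub> star Y.T w = gck_proj J B"
  proof -
    let ?g = "\<lambda>u v. Y.t (t.b u \<otimes>\<^bsub>t.OB\<^esub> f.yy u) (e.yy u) \<otimes>\<^bsub>Y.T\<^esub>
        Y.t (star t.OB (f.yy v) \<otimes>\<^bsub>t.OB\<^esub> star t.OB (t.b v)) (star OB (e.yy v))"
    have g: "?g u v = Y.t (t.b u \<otimes>\<^bsub>t.OB\<^esub> (f.yy u \<otimes>\<^bsub>t.OB\<^esub> star t.OB (f.yy v)) \<otimes>\<^bsub>t.OB\<^esub> star t.OB (t.b v))
       (e.yy u \<otimes>\<^bsub>OB\<^esub> star OB (e.yy v))" for u v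
      by (simp add: Y.t_mult f.m_assoc)
    have "w \<otimes>\<^bsub>Y.T\<^esub> star Y.T w = finsum Y.T (\<lambda>u. finsum Y.T (?g u) J) J"
      unfolding ws by (unfold w_def, rule Y.T.finsum_mult_finsum) (auto simp: finite_J)
    also have "\<dots> = finsum Y.T (\<lambda>u. ?g u u) (J \<inter> J)"
    proof (rule Y.T.finsum_diagonal[OF finite_J finite_J])
      fix u v assume uv: "u \<in> J" "v \<in> J" "u \<noteq> v"
      show "?g u v = \<zero>\<^bsub>Y.T\<^esub>"
        using disj[OF uv] unfolding g f.yy_yy_star e.yy_yy_star
        by (auto simp: f.finsum_in_carrier e.finsum_in_carrier)
    qed simp
    also have "\<dots> = finsum Y.T (\<lambda>u. Y.t (f.q u) (e.Pr {v\<in>J. B u v})) J"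
    proof (rule Y.T.finsum_eqI)
      fix u assume u: "u \<in> J"
      have "t.b u \<otimes>\<^bsub>t.OB\<^esub> (f.yy u \<otimes>\<^bsub>t.OB\<^esub> star t.OB (f.yy u)) \<otimes>\<^bsub>t.OB\<^esub> star t.OB (t.b u) = f.q u \<otimes>\<^bsub>t.OB\<^esub> f.q u"
        unfolding f.yy_yy_star_same[OF u] by (simp add: f.q_def f.m_assoc)
      then show "?g u u = Y.t (f.q u) (e.Pr {v\<in>J. B u v})"
        unfolding g e.yy_yy_star_same[OF u] e.s_star_s[OF u] by (simp only: f.q_idem[OF u])
    qed simp_all
    also have "\<dots> = gck_proj J B" by (rule gck_proj_pairs[OF finite_J, symmetric])
    finally show ?thesis .
  qed
  \<comment> \<open>\<open>F i\<close> and \<open>E j\<close> are the range projections of the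
    images of the generators on the left and on the right. Both sides of the equation for the source
    of \<open>w\<close> are sums of tensors \<open>?x i j\<close>.\<close>
  define F where "F i = f.rr i \<otimes>\<^bsub>t.OB\<^esub> star t.OB (f.rr i)" for i
  define E where "E i = e.rr i \<otimes>\<^bsub>OB\<^esub> star OB (e.rr i)" for i
  have FE [simp]: "F i \<in> carrier t.OB" "E i \<in> carrier OB" for i by (simp_all add: F_def E_def)
  let ?x = "\<lambda>i j. Y.t (F i) (E j)"
  have z [simp]: "(if P then ?x i j else \<zero>\<^bsub>Y.T\<^esub>) \<in> carrier Y.T" for P i j by simp
  have zs [simp]: "finsum Y.T (\<lambda>j. if P j then ?x (g j) (h j) else \<zero>\<^bsub>Y.T\<^esub>) N \<in> carrier Y.T" for P g h and N :: "'n set"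
    by (rule Y.T.finsum_in_carrier) simp
  have zss [simp]: "finsum Y.T (\<lambda>i. finsum Y.T (\<lambda>j. if P i j then ?x i j else \<zero>\<^bsub>Y.T\<^esub>) I) I \<in> carrier Y.T" for P
    by (rule Y.T.finsum_in_carrier) simp
  have sw: "star Y.T w \<otimes>\<^bsub>Y.T\<^esub> w = finsum Y.T (\<lambda>u. finsum Y.T (\<lambda>i. finsum Y.T (\<lambda>j. if C i u \<and> D u j then ?x i j else \<zero>\<^bsub>Y.T\<^esub>) I) I) J"
  proof -
    let ?g = "\<lambda>u v. Y.t (star t.OB (f.yy u) \<otimes>\<^bsub>t.OB\<^esub> star t.OB (t.b u)) (star OB (e.yy u)) \<otimes>\<^bsub>Y.T\<^esub>
        Y.t (t.b v \<otimes>\<^bsub>t.OB\<^esub> f.yy v) (e.yy v)"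
    have g: "?g u v = Y.t (star t.OB (f.yy u) \<otimes>\<^bsub>t.OB\<^esub> (star t.OB (t.b u) \<otimes>\<^bsub>t.OB\<^esub> t.b v \<otimes>\<^bsub>t.OB\<^esub> f.yy v))
       (star OB (e.yy u) \<otimes>\<^bsub>OB\<^esub> e.yy v)" for u v
      by (simp add: Y.t_mult f.m_assoc)
    have "star Y.T w \<otimes>\<^bsub>Y.T\<^esub> w = finsum Y.T (\<lambda>u. finsum Y.T (?g u) J) J"
      unfolding ws by (unfold w_def, rule Y.T.finsum_mult_finsum) (auto simp: finite_J)
    also have "\<dots> = finsum Y.T (\<lambda>u. ?g u u) (J \<inter> J)"
    proof (rule Y.T.finsum_diagonal[OF finite_J finite_J])
      fix u v assume uv: "u \<in> J" "v \<in> J" "u \<noteq> v"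
      show "?g u v = \<zero>\<^bsub>Y.T\<^esub>" unfolding g f.s_star_s_orth[OF uv] by simp
    qed simp
    also have "\<dots> = finsum Y.T (\<lambda>u. finsum Y.T (\<lambda>i. finsum Y.T (\<lambda>j. if C i u \<and> D u j then ?x i j else \<zero>\<^bsub>Y.T\<^esub>) I) I) J"
    proof (rule Y.T.finsum_eqI)
      fix u assume u: "u \<in> J"
      have "?g u u = Y.t (finsum t.OB F (f.Ds u)) (finsum OB E (e.Ds u))"
        unfolding g f.ss_yy[OF u] f.yy_star_yy[OF u] e.yy_star_yy[OF u] F_def E_def ..
      also have "\<dots> = finsum Y.T (\<lambda>i. Y.t (F i) (finsum OB E (e.Ds u))) (f.Ds u)"
        by (rule Y.t_finsum_left) (auto simp: e.finsum_in_carrier)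
      also have "\<dots> = finsum Y.T (\<lambda>i. finsum Y.T (\<lambda>j. ?x i j) (e.Ds u)) (f.Ds u)"
      proof (rule Y.T.finsum_eqI[OF refl])
        show "finsum Y.T (\<lambda>j. ?x i j) (e.Ds u) \<in> carrier Y.T" for i by (rule Y.T.finsum_in_carrier) simp
        show "Y.t (F i) (finsum OB E (e.Ds u)) = finsum Y.T (\<lambda>j. ?x i j) (e.Ds u)" for i
          by (rule Y.t_finsum_right) simp_all
      qed
      also have "\<dots> = finsum Y.T (\<lambda>i. if C i u then finsum Y.T (\<lambda>j. ?x i j) (e.Ds u) else \<zero>\<^bsub>Y.T\<^esub>) I"
        unfolding f.Ds_def by (rule Y.T.finsum_restrict_set[symmetric]) (auto simp: finite_I intro!: Y.T.finsum_in_carrier)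
      also have "\<dots> = finsum Y.T (\<lambda>i. finsum Y.T (\<lambda>j. if C i u \<and> D u j then ?x i j else \<zero>\<^bsub>Y.T\<^esub>) I) I"
      proof (rule Y.T.finsum_eqI[OF refl])
        fix i
        show "(if C i u then finsum Y.T (\<lambda>j. ?x i j) (e.Ds u) else \<zero>\<^bsub>Y.T\<^esub>) =
          finsum Y.T (\<lambda>j. if C i u \<and> D u j then ?x i j else \<zero>\<^bsub>Y.T\<^esub>) I"
        proof (cases "C i u")
          case True
          then show ?thesis unfolding e.Ds_def
            using Y.T.finsum_restrict_set[OF finite_I, of "D u" "\<lambda>j. ?x i j"] by simp
        next
          case False
          then show ?thesis by (simp add: Y.T.finsum_all_zero)
        qed
      qed simp
      finally show "?g u u = finsum Y.T (\<lambda>i. finsum Y.T (\<lambda>j. if C i u \<and> D u j then ?x i j else \<zero>\<^bsub>Y.T\<^esub>) I) I" .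
    qed simp_all
    finally show ?thesis .
  qed
  have PA: "\<Phi> (gck_proj I A) = finsum Y.T (\<lambda>j. finsum Y.T (\<lambda>i. if A i j then ?x i j else \<zero>\<^bsub>Y.T\<^esub>) I) I"
  proof -
    let ?h = "\<lambda>u. X.t (OAt.Pr {v\<in>I. A v u}) (OA.q u)"
    have "\<Phi> (gck_proj I A) = finsum (corner Y.T (Y.t f.ff e.ff)) (\<lambda>u. \<Phi> (?h u)) I"
      unfolding gck_proj_eq[OF finite_I] by (rule Ph.finsum[OF finite_I]) simp
    also have "\<dots> = finsum Y.T (\<lambda>u. \<Phi> (?h u)) I"
      by (rule YC.C_finsum[OF finite_I]) simp
    also have "\<dots> = finsum Y.T (\<lambda>j. finsum Y.T (\<lambda>i. if A i j then ?x i j else \<zero>\<^bsub>Y.T\<^esub>) I) I"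
    proof (rule Y.T.finsum_eqI[OF refl])
      fix j assume j: "j \<in> I"
      have "t.phi (OAt.Pr {v\<in>I. A v j}) = star t.OB (f.gg j) \<otimes>\<^bsub>t.OB\<^esub> f.gg j"
        unfolding OAt.s_star_s[OF j, symmetric]
        using tphi.mult[of "star t.OA (t.a j)" "t.a j"] tphi.star[of "t.a j"] by (simp add: t.phi(2))
      then have 1: "t.phi (OAt.Pr {v\<in>I. A v j}) = finsum t.OB F {i\<in>I. A i j}"
        unfolding f.gg_star_gg[OF j] F_def .
      have "phi (OA.q j) = e.gg j \<otimes>\<^bsub>OB\<^esub> star OB (e.gg j)"
        unfolding OA.q_def using phi.mult[of "a j" "star OA (a j)"] phi.star[of "a j"] by (simp add: phi(2))
      then have 2: "phi (OA.q j) = E j" unfolding E_def e.gg_gg_star[OF j] .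
      have "\<Phi> (?h j) = Y.t (finsum t.OB F {i\<in>I. A i j}) (E j)" by (simp add: Phi 1 2)
      also have "\<dots> = finsum Y.T (\<lambda>i. ?x i j) {i\<in>I. A i j}"
        by (rule Y.t_finsum_left) (auto simp: finite_I)
      also have "\<dots> = finsum Y.T (\<lambda>i. if A i j then ?x i j else \<zero>\<^bsub>Y.T\<^esub>) I"
        by (rule Y.T.finsum_restrict_set[symmetric]) (auto simp: finite_I)
      finally show "\<Phi> (?h j) = finsum Y.T (\<lambda>i. if A i j then ?x i j else \<zero>\<^bsub>Y.T\<^esub>) I" .
    qed simp
    finally show ?thesis .
  qed
  have "star Y.T w \<otimes>\<^bsub>Y.T\<^esub> w = finsum Y.T (\<lambda>j. finsum Y.T (\<lambda>i. if A i j then ?x i j else \<zero>\<^bsub>Y.T\<^esub>) I) I"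
  proof -
    let ?y = "\<lambda>u i j. if C i u \<and> D u j then ?x i j else \<zero>\<^bsub>Y.T\<^esub>"
    \<comment> \<open>Each admissible edge passes through exactly one state and all other pairs
      through none. Summing out the state therefore counts each edge of \<open>A\<close>
      once.\<close>
    have yc: "finsum Y.T (\<lambda>u. ?y u i j) J = (if A i j then ?x i j else \<zero>\<^bsub>Y.T\<^esub>)" if i: "i \<in> I" and j: "j \<in> I" for i j
    proof (cases "A i j")
      case True
      then obtain u where u: "u \<in> J" "C i u" "D u j" using A_iff[OF i j] by blast
      have "finsum Y.T (\<lambda>u. ?y u i j) J = ?y u i j"
        by (rule Y.T.finsum_single[OF finite_J u(1)]) (use A_unique[OF i j _ u(1) _ _ u(2,3)] in auto)
      then show ?thesis using u True by simp
    next
      case False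
      then show ?thesis using A_iff[OF i j] by (auto intro!: Y.T.finsum_all_zero)
    qed
    have "star Y.T w \<otimes>\<^bsub>Y.T\<^esub> w = finsum Y.T (\<lambda>i. finsum Y.T (\<lambda>u. finsum Y.T (\<lambda>j. ?y u i j) I) J) I"
      unfolding sw by (rule Y.T.finsum_swap[OF finite_J finite_I]) simp
    also have "\<dots> = finsum Y.T (\<lambda>i. finsum Y.T (\<lambda>j. finsum Y.T (\<lambda>u. ?y u i j) J) I) I"
    proof (rule Y.T.finsum_eqI[OF refl])
      fix i
      show "finsum Y.T (\<lambda>u. finsum Y.T (\<lambda>j. ?y u i j) I) J = finsum Y.T (\<lambda>j. finsum Y.T (\<lambda>u. ?y u i j) J) I"
        by (rule Y.T.finsum_swap[OF finite_J finite_I]) simp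
    qed (intro Y.T.finsum_in_carrier z)
    also have "\<dots> = finsum Y.T (\<lambda>i. finsum Y.T (\<lambda>j. if A i j then ?x i j else \<zero>\<^bsub>Y.T\<^esub>) I) I"
      by (intro Y.T.finsum_eqI refl yc) (auto intro!: Y.T.finsum_in_carrier)
    also have "\<dots> = finsum Y.T (\<lambda>j. finsum Y.T (\<lambda>i. if A i j then ?x i j else \<zero>\<^bsub>Y.T\<^esub>) I) I"
      by (rule Y.T.finsum_swap[OF finite_I finite_I]) simp
    finally show ?thesis .
  qed
  then have "star Y.T w \<otimes>\<^bsub>Y.T\<^esub> w = \<Phi> (gck_proj I A)" using PA by simp
  then show ?thesis
    using hom Phi w ww unfolding gck_tensor_def gck_elem_def ue by blast
qed

end

text \<open>The composite of the two compressed maps is the inner automorphism given by the unitary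
  \<open>g = w' \<Phi>'(w) v\<close> of the corner.\<close>

lemma corner_round_trip:
  fixes M :: "'a cstar_algebra" and M' :: "'b cstar_algebra"
  assumes M: "cstar M" and M': "cstar M'"
    and e: "star_alg.projection M e" and e': "star_alg.projection M' e'"
    and c: "star_alg.projection M c" and c': "star_alg.projection M' c'"
    and \<Phi>: "star_hom M (corner M' c') \<Phi>" and \<Psi>: "star_hom M' (corner M c) \<Psi>"
    and w: "w \<in> carrier M'" "w \<otimes>\<^bsub>M'\<^esub> star M' w = e'" "star M' w \<otimes>\<^bsub>M'\<^esub> w = \<Phi> e"
    and w': "w' \<in> carrier M" "w' \<otimes>\<^bsub>M\<^esub> star M w' = e" "star M w' \<otimes>\<^bsub>M\<^esub> w' = \<Psi> e'"
    and v: "v \<in> carrier M" "star M v \<otimes>\<^bsub>M\<^esub> v = \<one>\<^bsub>M\<^esub>"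
    and round: "\<And>x. x \<in> carrier M \<Longrightarrow> \<Psi> (\<Phi> x) = v \<otimes>\<^bsub>M\<^esub> x \<otimes>\<^bsub>M\<^esub> star M v"
  defines "f \<equiv> \<lambda>x. w \<otimes>\<^bsub>M'\<^esub> \<Phi> x \<otimes>\<^bsub>M'\<^esub> star M' w" and "f' \<equiv> \<lambda>y. w' \<otimes>\<^bsub>M\<^esub> \<Psi> y \<otimes>\<^bsub>M\<^esub> star M w'"
  shows "star_hom (corner M e) (corner M' e') f"
    and "inj_on (\<lambda>x. f' (f x)) (carrier (corner M e))"
    and "carrier (corner M e) \<subseteq> (\<lambda>x. f' (f x)) ` carrier (corner M e)"
proof -
  interpret M: cstar M by fact
  interpret M': cstar M' by fact
  interpret Me: corner_cstar M e by (rule corner_cstarI[OF M e])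
  interpret Me': corner_cstar M' e' by (rule corner_cstarI[OF M' e'])
  interpret Mc: corner_cstar M c by (rule corner_cstarI[OF M c])
  interpret Mc': corner_cstar M' c' by (rule corner_cstarI[OF M' c'])
  interpret Cc: cstar "corner M c" by (rule Mc.cstar_C)
  interpret Cc': cstar "corner M' c'" by (rule Mc'.cstar_C)
  interpret Ph: star_hom_pair M "corner M' c'" \<Phi>
    by (rule star_hom_pairI[OF M.star_alg_axioms Cc'.star_alg_axioms \<Phi>])
  interpret Ps: star_hom_pair M' "corner M c" \<Psi>
    by (rule star_hom_pairI[OF M'.star_alg_axioms Cc.star_alg_axioms \<Psi>])
  note [simp] = w(1) w'(1) v(1)
  have Phc [simp]: "\<Phi> x \<in> carrier M'" if "x \<in> carrier M" for x by (rule Mc'.C_D[OF Ph.closed[OF that]])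
  have Psc [simp]: "\<Psi> x \<in> carrier M" if "x \<in> carrier M'" for x by (rule Mc.C_D[OF Ps.closed[OF that]])
  have Phm: "\<Phi> (x \<otimes>\<^bsub>M\<^esub> y) = \<Phi> x \<otimes>\<^bsub>M'\<^esub> \<Phi> y" if "x \<in> carrier M" "y \<in> carrier M" for x y
    using Ph.mult[OF that] by simp
  have Psm: "\<Psi> (x \<otimes>\<^bsub>M'\<^esub> y) = \<Psi> x \<otimes>\<^bsub>M\<^esub> \<Psi> y" if "x \<in> carrier M'" "y \<in> carrier M'" for x y
    using Ps.mult[OF that] by simp
  have Phs: "\<Phi> (star M x) = star M' (\<Phi> x)" if "x \<in> carrier M" for x
    using Ph.star[OF that] by simp
  have Pss: "\<Psi> (star M' x) = star M (\<Psi> x)" if "x \<in> carrier M'" for x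
    using Ps.star[OF that] by simp
  have Phe: "\<Phi> e \<otimes>\<^bsub>M'\<^esub> \<Phi> e = \<Phi> e" using Phm[of e e] by simp
  have Pse: "\<Psi> e' \<otimes>\<^bsub>M\<^esub> \<Psi> e' = \<Psi> e'" using Psm[of e' e'] by simp
  \<comment> \<open>The source of \<open>w\<close> is \<open>\<Phi> e\<close>, a projection, so
    \<open>w\<close> is a partial isometry and absorbs its range and source projections.\<close>
  have ew: "e' \<otimes>\<^bsub>M'\<^esub> w = w" and we: "w \<otimes>\<^bsub>M'\<^esub> \<Phi> e = w"
  proof -
    have p: "M'.projection (star M' w \<otimes>\<^bsub>M'\<^esub> w)"
      unfolding M'.projection_def using Phe Phs[of e] by (simp add: w(3))
    have h: "w \<otimes>\<^bsub>M'\<^esub> star M' w \<otimes>\<^bsub>M'\<^esub> w = w"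
      by (rule M'.partial_isometry(1)[OF w(1) p M'.star_mult_zeroD])
    show "e' \<otimes>\<^bsub>M'\<^esub> w = w" using h unfolding w(2) .
    have "w \<otimes>\<^bsub>M'\<^esub> (star M' w \<otimes>\<^bsub>M'\<^esub> w) = w" using h by (simp add: M'.m_assoc)
    then show "w \<otimes>\<^bsub>M'\<^esub> \<Phi> e = w" unfolding w(3) .
  qed
  have ew': "e \<otimes>\<^bsub>M\<^esub> w' = w'" and we': "w' \<otimes>\<^bsub>M\<^esub> \<Psi> e' = w'"
  proof -
    have p: "M.projection (star M w' \<otimes>\<^bsub>M\<^esub> w')"
      unfolding M.projection_def using Pse Pss[of e'] by (simp add: w'(3))
    have h: "w' \<otimes>\<^bsub>M\<^esub> star M w' \<otimes>\<^bsub>M\<^esub> w' = w'"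
      by (rule M.partial_isometry(1)[OF w'(1) p M.star_mult_zeroD])
    show "e \<otimes>\<^bsub>M\<^esub> w' = w'" using h unfolding w'(2) .
    have "w' \<otimes>\<^bsub>M\<^esub> (star M w' \<otimes>\<^bsub>M\<^esub> w') = w'" using h by (simp add: M.m_assoc)
    then show "w' \<otimes>\<^bsub>M\<^esub> \<Psi> e' = w'" unfolding w'(3) .
  qed
  have swe: "star M' w \<otimes>\<^bsub>M'\<^esub> e' = star M' w" "\<Phi> e \<otimes>\<^bsub>M'\<^esub> star M' w = star M' w"
    using arg_cong[OF ew, of "star M'"] arg_cong[OF we, of "star M'"] Phs[of e] by (simp_all add: M'.star_mult)
  show "star_hom (corner M e) (corner M' e') f"
    unfolding star_hom_def
  proof (intro conjI ballI allI)
    show "f \<one>\<^bsub>corner M e\<^esub> = \<one>\<^bsub>corner M' e'\<^esub>"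
      unfolding f_def using we w(2) by simp
    fix x y k assume x: "x \<in> carrier (corner M e)" and y: "y \<in> carrier (corner M e)"
    note xy [simp] = Me.C_D[OF x] Me.C_D[OF y]
    show "f x \<in> carrier (corner M' e')"
    proof (rule Me'.C_I)
      show "e' \<otimes>\<^bsub>M'\<^esub> f x = f x" unfolding f_def using ew by (simp flip: M'.m_assoc)
      show "f x \<otimes>\<^bsub>M'\<^esub> e' = f x" unfolding f_def using swe by (simp add: M'.m_assoc)
    qed (simp add: f_def)
    show "f (x \<oplus>\<^bsub>corner M e\<^esub> y) = f x \<oplus>\<^bsub>corner M' e'\<^esub> f y"
      unfolding f_def using Ph.add[OF xy] by (simp add: M'.l_distr M'.r_distr)
    show "f (scale (corner M e) k x) = scale (corner M' e') k (f x)"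
      unfolding f_def using Ph.scale[OF xy(1)] by (simp add: M'.scale_mult_left M'.scale_mult_right)
    show "f (star (corner M e) x) = star (corner M' e') (f x)"
      unfolding f_def by (simp add: M'.star_mult Phs M'.m_assoc)
    have "f x \<otimes>\<^bsub>M'\<^esub> f y = w \<otimes>\<^bsub>M'\<^esub> \<Phi> x \<otimes>\<^bsub>M'\<^esub> (star M' w \<otimes>\<^bsub>M'\<^esub> w) \<otimes>\<^bsub>M'\<^esub> \<Phi> y \<otimes>\<^bsub>M'\<^esub> star M' w"
      unfolding f_def by (simp add: M'.m_assoc)
    also have "\<dots> = w \<otimes>\<^bsub>M'\<^esub> (\<Phi> x \<otimes>\<^bsub>M'\<^esub> \<Phi> e) \<otimes>\<^bsub>M'\<^esub> \<Phi> y \<otimes>\<^bsub>M'\<^esub> star M' w"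
      unfolding w(3) by (simp add: M'.m_assoc)
    also have "\<Phi> x \<otimes>\<^bsub>M'\<^esub> \<Phi> e = \<Phi> x"
      using x Phm[of x e] by (simp add: Me.C_carrier)
    finally show "f (x \<otimes>\<^bsub>corner M e\<^esub> y) = f x \<otimes>\<^bsub>corner M' e'\<^esub> f y"
      unfolding f_def by (simp add: Phm M'.m_assoc)
  qed
  define g where "g = w' \<otimes>\<^bsub>M\<^esub> \<Psi> w \<otimes>\<^bsub>M\<^esub> v"
  have g [simp]: "g \<in> carrier M" by (simp add: g_def)
  have gs: "star M g = star M v \<otimes>\<^bsub>M\<^esub> (star M (\<Psi> w) \<otimes>\<^bsub>M\<^esub> star M w')"
    by (simp add: g_def M.star_mult)
  have fg: "f' (f x) = g \<otimes>\<^bsub>M\<^esub> x \<otimes>\<^bsub>M\<^esub> star M g" if x: "x \<in> carrier M" for x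
  proof -
    have "f' (f x) = w' \<otimes>\<^bsub>M\<^esub> (\<Psi> w \<otimes>\<^bsub>M\<^esub> \<Psi> (\<Phi> x) \<otimes>\<^bsub>M\<^esub> star M (\<Psi> w)) \<otimes>\<^bsub>M\<^esub> star M w'"
      unfolding f_def f'_def using x by (simp add: Psm Pss)
    then show ?thesis unfolding round[OF x] gs using x by (simp add: g_def M.m_assoc)
  qed
  have gg: "star M g \<otimes>\<^bsub>M\<^esub> g = e"
  proof -
    have "star M g \<otimes>\<^bsub>M\<^esub> g = star M v \<otimes>\<^bsub>M\<^esub> (star M (\<Psi> w) \<otimes>\<^bsub>M\<^esub> (star M w' \<otimes>\<^bsub>M\<^esub> w') \<otimes>\<^bsub>M\<^esub> \<Psi> w) \<otimes>\<^bsub>M\<^esub> v"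
      unfolding gs by (simp add: g_def M.m_assoc)
    also have "star M (\<Psi> w) \<otimes>\<^bsub>M\<^esub> (star M w' \<otimes>\<^bsub>M\<^esub> w') \<otimes>\<^bsub>M\<^esub> \<Psi> w = \<Psi> (star M' w \<otimes>\<^bsub>M'\<^esub> (e' \<otimes>\<^bsub>M'\<^esub> w))"
      unfolding w'(3) by (simp add: Psm Pss M.m_assoc)
    also have "\<dots> = \<Psi> (\<Phi> e)" by (simp only: ew w(3))
    also have "\<dots> = v \<otimes>\<^bsub>M\<^esub> e \<otimes>\<^bsub>M\<^esub> star M v" by (rule round) simp
    also have "star M v \<otimes>\<^bsub>M\<^esub> (v \<otimes>\<^bsub>M\<^esub> e \<otimes>\<^bsub>M\<^esub> star M v) \<otimes>\<^bsub>M\<^esub> v =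
        (star M v \<otimes>\<^bsub>M\<^esub> v) \<otimes>\<^bsub>M\<^esub> e \<otimes>\<^bsub>M\<^esub> (star M v \<otimes>\<^bsub>M\<^esub> v)"
      by (simp add: M.m_assoc)
    finally show ?thesis by (simp add: v(2))
  qed
  have gg': "g \<otimes>\<^bsub>M\<^esub> star M g = e"
  proof -
    have one: "v \<otimes>\<^bsub>M\<^esub> star M v = \<Psi> (\<Phi> \<one>\<^bsub>M\<^esub>)" using round[of "\<one>\<^bsub>M\<^esub>"] by simp
    have "\<Phi> e \<otimes>\<^bsub>M'\<^esub> \<Phi> \<one>\<^bsub>M\<^esub> = \<Phi> e" using Phm[of e "\<one>\<^bsub>M\<^esub>"] by simp
    \<comment> \<open>\<open>v\<close> times its adjoint is \<open>\<Psi> (\<Phi> \<one>)\<close>.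
      It disappears next to \<open>\<Psi> w\<close> because \<open>w\<close> absorbs
      \<open>\<Phi> e\<close> and therefore also the larger projection
      \<open>\<Phi> \<one>\<close>.\<close>
    then have w1: "w \<otimes>\<^bsub>M'\<^esub> \<Phi> \<one>\<^bsub>M\<^esub> = w"
      using we by (metis M'.m_assoc M.one_closed Me.e_simps(1) Phc w(1))
    have "g \<otimes>\<^bsub>M\<^esub> star M g = w' \<otimes>\<^bsub>M\<^esub> (\<Psi> w \<otimes>\<^bsub>M\<^esub> (v \<otimes>\<^bsub>M\<^esub> star M v)) \<otimes>\<^bsub>M\<^esub> star M (\<Psi> w) \<otimes>\<^bsub>M\<^esub> star M w'"
      unfolding gs by (simp add: g_def M.m_assoc)
    also have "\<Psi> w \<otimes>\<^bsub>M\<^esub> (v \<otimes>\<^bsub>M\<^esub> star M v) = \<Psi> w"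
      unfolding one using Psm[of w "\<Phi> \<one>\<^bsub>M\<^esub>"] w1 by simp
    also have "w' \<otimes>\<^bsub>M\<^esub> \<Psi> w \<otimes>\<^bsub>M\<^esub> star M (\<Psi> w) \<otimes>\<^bsub>M\<^esub> star M w' = w' \<otimes>\<^bsub>M\<^esub> \<Psi> (w \<otimes>\<^bsub>M'\<^esub> star M' w) \<otimes>\<^bsub>M\<^esub> star M w'"
      by (simp add: Psm Pss M.m_assoc)
    also have "\<dots> = e" unfolding w(2) we' w'(2) ..
    finally show ?thesis .
  qed
  show "inj_on (\<lambda>x. f' (f x)) (carrier (corner M e))"
  proof (rule inj_on_inverseI[where g = "\<lambda>y. star M g \<otimes>\<^bsub>M\<^esub> y \<otimes>\<^bsub>M\<^esub> g"])
    fix x assume x: "x \<in> carrier (corner M e)"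
    note [simp] = Me.C_D[OF x]
    have "star M g \<otimes>\<^bsub>M\<^esub> f' (f x) \<otimes>\<^bsub>M\<^esub> g = (star M g \<otimes>\<^bsub>M\<^esub> g) \<otimes>\<^bsub>M\<^esub> x \<otimes>\<^bsub>M\<^esub> (star M g \<otimes>\<^bsub>M\<^esub> g)"
      unfolding fg[OF Me.C_D[OF x]] by (simp add: M.m_assoc)
    then show "star M g \<otimes>\<^bsub>M\<^esub> f' (f x) \<otimes>\<^bsub>M\<^esub> g = x" using x unfolding gg by (simp add: Me.C_carrier)
  qed
  show "carrier (corner M e) \<subseteq> (\<lambda>x. f' (f x)) ` carrier (corner M e)"
  proof
    fix x assume x: "x \<in> carrier (corner M e)"
    note [simp] = Me.C_D[OF x]
    \<comment> \<open>The preimage is the conjugate of \<open>x\<close> by the adjoint of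
      \<open>g\<close>; the outer factors \<open>e\<close> put it into the corner at sight and are
      absorbed by \<open>g\<close> afterwards.\<close>
    let ?y = "e \<otimes>\<^bsub>M\<^esub> (star M g \<otimes>\<^bsub>M\<^esub> x \<otimes>\<^bsub>M\<^esub> g) \<otimes>\<^bsub>M\<^esub> e"
    have y: "?y \<in> carrier (corner M e)"
      by (rule Me.C_I) (simp, simp add: M.projection_absorb[OF e] M.m_assoc, simp add: M.m_assoc)
    have ge: "g \<otimes>\<^bsub>M\<^esub> e = g"
    proof -
      have p: "M.projection (star M g \<otimes>\<^bsub>M\<^esub> g)" unfolding gg by (rule e)
      have "g \<otimes>\<^bsub>M\<^esub> (star M g \<otimes>\<^bsub>M\<^esub> g) = g"
        using M.partial_isometry(1)[OF g p M.star_mult_zeroD] by (simp add: M.m_assoc)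
      then show ?thesis unfolding gg .
    qed
    have eg: "e \<otimes>\<^bsub>M\<^esub> star M g = star M g"
      using M.star_mult[of g e] unfolding ge by simp
    have "f' (f ?y) = (g \<otimes>\<^bsub>M\<^esub> e) \<otimes>\<^bsub>M\<^esub> star M g \<otimes>\<^bsub>M\<^esub> x \<otimes>\<^bsub>M\<^esub> g \<otimes>\<^bsub>M\<^esub> (e \<otimes>\<^bsub>M\<^esub> star M g)"
      unfolding fg[OF Me.C_D[OF y]] by (simp add: M.m_assoc)
    also have "\<dots> = (g \<otimes>\<^bsub>M\<^esub> star M g) \<otimes>\<^bsub>M\<^esub> x \<otimes>\<^bsub>M\<^esub> (g \<otimes>\<^bsub>M\<^esub> star M g)"
      unfolding ge eg by (simp add: M.m_assoc)
    finally have "f' (f ?y) = x" using x unfolding gg' by (simp add: Me.C_carrier)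
    then show "x \<in> (\<lambda>x. f' (f x)) ` carrier (corner M e)" using y by (metis (no_types, lifting) image_eqI)
  qed
qed

definition star_isomorphic :: "('a, 'y) star_algebra_scheme \<Rightarrow> ('b, 'z) star_algebra_scheme \<Rightarrow> bool" where
  "star_isomorphic R S \<longleftrightarrow> (\<exists>f. star_hom R S f \<and> bij_betw f (carrier R) (carrier S))"

text \<open>The round trips of the two factors are conjugations by isometries \<open>v2\<close> and
  \<open>v1\<close>. On elementary tensors the composite is conjugation by their tensor product, and
  elementary tensors determine a homomorphism.\<close>

lemma (in elementary) gck_round_trip:
  assumes "star_hom (gck_tensor I A) (corner (gck_tensor J B) c') \<Phi>"
    and \<Phi>: "\<forall>x\<in>carrier (gck I (\<lambda>i j. A j i)). \<forall>y\<in>carrier OA. \<Phi> (gck_elem I A x y) =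
      gck_elem J B (elementary.phi I J (\<lambda>i j. A j i) (\<lambda>u v. B v u) (\<lambda>i u. D u i) (\<lambda>u i. C i u) x) (phi y)"
    and c': "star_alg.projection (gck_tensor J B) c'"
    and "star_hom (gck_tensor J B) (corner (gck_tensor I A) c) \<Psi>"
    and \<Psi>: "\<forall>x\<in>carrier (gck J (\<lambda>i j. B j i)). \<forall>y\<in>carrier OB. \<Psi> (gck_elem J B x y) =
      gck_elem I A (elementary.phi J I (\<lambda>i j. B j i) (\<lambda>u v. A v u) (\<lambda>i u. C u i) (\<lambda>u i. D i u) x)
        (elementary.phi J I B A D C y)"
    and c: "star_alg.projection (gck_tensor I A) c"
  shows "\<exists>v\<in>carrier (gck_tensor I A). star (gck_tensor I A) v \<otimes>\<^bsub>gck_tensor I A\<^esub> v = \<one>\<^bsub>gck_tensor I A\<^esub> \<and>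
    (\<forall>x\<in>carrier (gck_tensor I A). \<Psi> (\<Phi> x) = v \<otimes>\<^bsub>gck_tensor I A\<^esub> x \<otimes>\<^bsub>gck_tensor I A\<^esub> star (gck_tensor I A) v)"
proof -
  interpret t: elementary I J "\<lambda>i j. A j i" "\<lambda>u v. B v u" "\<lambda>i u. D u i" "\<lambda>u i. C i u" by (rule transposed)
  interpret X: tensor t.OA OA by (intro tensor.intro gck_cstar finite_I)
  interpret Y: tensor t.OB OB by (intro tensor.intro gck_cstar finite_J)
  have eqs: "gck_tensor I A = X.T" "gck_elem I A = X.t" "gck_tensor J B = Y.T" "gck_elem J B = Y.t"
    by (simp_all add: gck_tensor_def gck_elem_def)
  note assms = assms[unfolded eqs]
  obtain v1 where v1: "v1 \<in> carrier OA" "star OA v1 \<otimes>\<^bsub>OA\<^esub> v1 = \<one>\<^bsub>OA\<^esub>"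
    "\<And>x. x \<in> carrier OA \<Longrightarrow> elementary.phi J I B A D C (phi x) = v1 \<otimes>\<^bsub>OA\<^esub> x \<otimes>\<^bsub>OA\<^esub> star OA v1"
    using round_trip by blast
  obtain v2 where v2: "v2 \<in> carrier t.OA" "star t.OA v2 \<otimes>\<^bsub>t.OA\<^esub> v2 = \<one>\<^bsub>t.OA\<^esub>"
    "\<And>x. x \<in> carrier t.OA \<Longrightarrow> elementary.phi J I (\<lambda>u v. B v u) (\<lambda>i j. A j i) (\<lambda>u i. C i u) (\<lambda>i u. D u i) (t.phi x) =
      v2 \<otimes>\<^bsub>t.OA\<^esub> x \<otimes>\<^bsub>t.OA\<^esub> star t.OA v2"
    using t.round_trip by blast
  interpret Yc: corner_cstar Y.T c' by (rule corner_cstarI[OF Y.cstar_T assms(3)])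
  interpret Xc: corner_cstar X.T c by (rule corner_cstarI[OF X.cstar_T assms(6)])
  interpret Ycc: cstar "corner Y.T c'" by (rule Yc.cstar_C)
  interpret Xcc: cstar "corner X.T c" by (rule Xc.cstar_C)
  interpret Ph: star_hom_pair X.T "corner Y.T c'" \<Phi>
    by (rule star_hom_pairI[OF X.T.star_alg_axioms Ycc.star_alg_axioms assms(1)])
  interpret Ps: star_hom_pair Y.T "corner X.T c" \<Psi>
    by (rule star_hom_pairI[OF Y.T.star_alg_axioms Xcc.star_alg_axioms assms(4)])
  have Phc [simp]: "\<Phi> x \<in> carrier Y.T" if "x \<in> carrier X.T" for x by (rule Yc.C_D[OF Ph.closed[OF that]])
  have Psc [simp]: "\<Psi> x \<in> carrier X.T" if "x \<in> carrier Y.T" for x by (rule Xc.C_D[OF Ps.closed[OF that]])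
  have phc: "phi y \<in> carrier OB" if "y \<in> carrier OA" for y
  proof -
    interpret K: corner_cstar OB unit by (rule corner_cstarI[OF gck_cstar[OF finite_J] unit_projection])
    show ?thesis using phi(1) that unfolding star_hom_def by (blast intro: K.C_D)
  qed
  have tphc: "t.phi y \<in> carrier t.OB" if "y \<in> carrier t.OA" for y
  proof -
    interpret K: corner_cstar t.OB t.unit by (rule corner_cstarI[OF gck_cstar[OF finite_J] t.unit_projection])
    show ?thesis using t.phi(1) that unfolding star_hom_def by (blast intro: K.C_D)
  qed
  define v where "v = X.t v2 v1"
  have v [simp]: "v \<in> carrier X.T" using v1 v2 by (simp add: v_def)
  have vv: "star X.T v \<otimes>\<^bsub>X.T\<^esub> v = \<one>\<^bsub>X.T\<^esub>"
    using v1(1,2) v2(1,2) by (simp add: v_def X.t_star X.t_mult X.t_one)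
  have el: "\<Psi> (\<Phi> (X.t x y)) = v \<otimes>\<^bsub>X.T\<^esub> X.t x y \<otimes>\<^bsub>X.T\<^esub> star X.T v"
    if "x \<in> carrier t.OA" "y \<in> carrier OA" for x y
  proof -
    have "\<Psi> (\<Phi> (X.t x y)) = X.t (v2 \<otimes>\<^bsub>t.OA\<^esub> x \<otimes>\<^bsub>t.OA\<^esub> star t.OA v2) (v1 \<otimes>\<^bsub>OA\<^esub> y \<otimes>\<^bsub>OA\<^esub> star OA v1)"
      using assms(2,5) that v1(3) v2(3) phc tphc by simp
    then show ?thesis using that v1(1) v2(1) by (simp add: v_def X.t_star X.t_mult)
  qed
  note cj = conjugation_hom[OF X.cstar_T v vv]
  interpret VC: corner_cstar X.T "v \<otimes>\<^bsub>X.T\<^esub> star X.T v" by (rule corner_cstarI[OF X.cstar_T cj(1)])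
  have cV: "c = \<Psi> \<one>\<^bsub>Y.T\<^esub>" using Ps.one by simp
  have one: "\<Psi> (\<Phi> \<one>\<^bsub>X.T\<^esub>) = v \<otimes>\<^bsub>X.T\<^esub> star X.T v"
    using el[OF X.P.one_closed X.Q.one_closed] by (simp add: X.t_one)
  \<comment> \<open>As for one factor, the composite has to be placed in the corner of the range of
    \<open>v\<close> before \<open>tensor_hom_unique\<close> can compare it with the
    conjugation.\<close>
  have hom: "star_hom X.T (corner X.T (v \<otimes>\<^bsub>X.T\<^esub> star X.T v)) (\<lambda>x. \<Psi> (\<Phi> x))"
    unfolding star_hom_def
  proof (intro conjI ballI allI)
    show "\<Psi> (\<Phi> \<one>\<^bsub>X.T\<^esub>) = \<one>\<^bsub>corner X.T (v \<otimes>\<^bsub>X.T\<^esub> star X.T v)\<^esub>" using one by simp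
    fix x y k assume x: "x \<in> carrier X.T" and y: "y \<in> carrier X.T"
    show "\<Psi> (\<Phi> x) \<in> carrier (corner X.T (v \<otimes>\<^bsub>X.T\<^esub> star X.T v))"
    proof (rule VC.C_I)
      show "\<Psi> (\<Phi> x) \<in> carrier X.T" using x by simp
      have "\<Psi> (\<Phi> (\<one>\<^bsub>X.T\<^esub> \<otimes>\<^bsub>X.T\<^esub> x)) = \<Psi> (\<Phi> \<one>\<^bsub>X.T\<^esub>) \<otimes>\<^bsub>X.T\<^esub> \<Psi> (\<Phi> x)"
        using x Ph.mult[of "\<one>\<^bsub>X.T\<^esub>" x] Ps.mult[of "\<Phi> \<one>\<^bsub>X.T\<^esub>" "\<Phi> x"] by simp
      then show "v \<otimes>\<^bsub>X.T\<^esub> star X.T v \<otimes>\<^bsub>X.T\<^esub> \<Psi> (\<Phi> x) = \<Psi> (\<Phi> x)" using x one by simp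
      have "\<Psi> (\<Phi> (x \<otimes>\<^bsub>X.T\<^esub> \<one>\<^bsub>X.T\<^esub>)) = \<Psi> (\<Phi> x) \<otimes>\<^bsub>X.T\<^esub> \<Psi> (\<Phi> \<one>\<^bsub>X.T\<^esub>)"
        using x Ph.mult[of x "\<one>\<^bsub>X.T\<^esub>"] Ps.mult[of "\<Phi> x" "\<Phi> \<one>\<^bsub>X.T\<^esub>"] by simp
      then show "\<Psi> (\<Phi> x) \<otimes>\<^bsub>X.T\<^esub> (v \<otimes>\<^bsub>X.T\<^esub> star X.T v) = \<Psi> (\<Phi> x)" using x one by simp
    qed
    show "\<Psi> (\<Phi> (x \<oplus>\<^bsub>X.T\<^esub> y)) = \<Psi> (\<Phi> x) \<oplus>\<^bsub>corner X.T (v \<otimes>\<^bsub>X.T\<^esub> star X.T v)\<^esub> \<Psi> (\<Phi> y)"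
      using Ph.add[OF x y] Ps.add[OF Phc[OF x] Phc[OF y]] by simp
    show "\<Psi> (\<Phi> (x \<otimes>\<^bsub>X.T\<^esub> y)) = \<Psi> (\<Phi> x) \<otimes>\<^bsub>corner X.T (v \<otimes>\<^bsub>X.T\<^esub> star X.T v)\<^esub> \<Psi> (\<Phi> y)"
      using Ph.mult[OF x y] Ps.mult[OF Phc[OF x] Phc[OF y]] by simp
    show "\<Psi> (\<Phi> (scale X.T k x)) = scale (corner X.T (v \<otimes>\<^bsub>X.T\<^esub> star X.T v)) k (\<Psi> (\<Phi> x))"
      using Ph.scale[OF x] Ps.scale[OF Phc[OF x]] by simp
    show "\<Psi> (\<Phi> (star X.T x)) = star (corner X.T (v \<otimes>\<^bsub>X.T\<^esub> star X.T v)) (\<Psi> (\<Phi> x))"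
      using Ph.star[OF x] Ps.star[OF Phc[OF x]] by simp
  qed
  have "\<Psi> (\<Phi> x) = v \<otimes>\<^bsub>X.T\<^esub> x \<otimes>\<^bsub>X.T\<^esub> star X.T v" if x: "x \<in> carrier X.T" for x
    by (rule X.tensor_hom_unique[OF VC.cstar_C hom cj(2) el x])
  then show ?thesis unfolding eqs using v vv by blast
qed

text \<open>\<open>corner_round_trip\<close> is used in both orders: injectivity of the composite
  starting at \<open>A\<close> makes the compressed map injective, surjectivity of the one starting
  at \<open>B\<close> makes it surjective. No formula for the inverse is required.\<close>

theorem (in elementary) gruelle_isomorphic: "star_isomorphic (gruelle I A) (gruelle J B)"
proof -
  interpret s: elementary J I B A D C by (rule swap)
  interpret t: elementary I J "\<lambda>i j. A j i" "\<lambda>u v. B v u" "\<lambda>i u. D u i" "\<lambda>u i. C i u" by (rule transposed)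
  interpret ts: elementary J I "\<lambda>u v. B v u" "\<lambda>i j. A j i" "\<lambda>u i. C i u" "\<lambda>i u. D u i" by (rule t.swap)
  interpret X: tensor t.OA OA by (intro tensor.intro gck_cstar finite_I)
  interpret Y: tensor t.OB OB by (intro tensor.intro gck_cstar finite_J)
  have c': "star_alg.projection (gck_tensor J B) (gck_elem J B t.unit unit)"
    unfolding gck_tensor_def gck_elem_def by (rule Y.t_projection[OF t.unit_projection unit_projection])
  have c: "star_alg.projection (gck_tensor I A) (gck_elem I A ts.unit s.unit)"
    unfolding gck_tensor_def gck_elem_def by (rule X.t_projection[OF ts.unit_projection s.unit_projection])
  obtain \<Phi> w where \<Phi>: "star_hom (gck_tensor I A) (corner (gck_tensor J B) (gck_elem J B t.unit unit)) \<Phi>"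
    "\<forall>x\<in>carrier t.OA. \<forall>y\<in>carrier OA. \<Phi> (gck_elem I A x y) = gck_elem J B (t.phi x) (phi y)"
    and w: "w \<in> carrier (gck_tensor J B)" "w \<otimes>\<^bsub>gck_tensor J B\<^esub> star (gck_tensor J B) w = gck_proj J B"
    "star (gck_tensor J B) w \<otimes>\<^bsub>gck_tensor J B\<^esub> w = \<Phi> (gck_proj I A)"
    using lift by blast
  obtain \<Psi> w' where \<Psi>: "star_hom (gck_tensor J B) (corner (gck_tensor I A) (gck_elem I A ts.unit s.unit)) \<Psi>"
    "\<forall>x\<in>carrier ts.OA. \<forall>y\<in>carrier s.OA. \<Psi> (gck_elem J B x y) = gck_elem I A (ts.phi x) (s.phi y)"
    and w': "w' \<in> carrier (gck_tensor I A)" "w' \<otimes>\<^bsub>gck_tensor I A\<^esub> star (gck_tensor I A) w' = gck_proj I A"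
    "star (gck_tensor I A) w' \<otimes>\<^bsub>gck_tensor I A\<^esub> w' = \<Psi> (gck_proj J B)"
    using s.lift by blast
  obtain v where v: "v \<in> carrier (gck_tensor I A)" "star (gck_tensor I A) v \<otimes>\<^bsub>gck_tensor I A\<^esub> v = \<one>\<^bsub>gck_tensor I A\<^esub>"
    "\<And>x. x \<in> carrier (gck_tensor I A) \<Longrightarrow> \<Psi> (\<Phi> x) = v \<otimes>\<^bsub>gck_tensor I A\<^esub> x \<otimes>\<^bsub>gck_tensor I A\<^esub> star (gck_tensor I A) v"
    using gck_round_trip[OF \<Phi> c' \<Psi> c] by blast
  obtain v' where v': "v' \<in> carrier (gck_tensor J B)" "star (gck_tensor J B) v' \<otimes>\<^bsub>gck_tensor J B\<^esub> v' = \<one>\<^bsub>gck_tensor J B\<^esub>"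
    "\<And>x. x \<in> carrier (gck_tensor J B) \<Longrightarrow> \<Phi> (\<Psi> x) = v' \<otimes>\<^bsub>gck_tensor J B\<^esub> x \<otimes>\<^bsub>gck_tensor J B\<^esub> star (gck_tensor J B) v'"
    using s.gck_round_trip[OF \<Psi> c \<Phi> c'] by blast
  note M = gck_tensor_cstar[OF finite_I, of A] gck_tensor_cstar[OF finite_J, of B]
  note E = gck_proj_projection[OF finite_I, of A] gck_proj_projection[OF finite_J, of B]
  note 1 = corner_round_trip[OF M E c c' \<Phi>(1) \<Psi>(1) w w' v]
  note 2 = corner_round_trip[OF M(2,1) E(2,1) c' c \<Psi>(1) \<Phi>(1) w' w v']
  let ?f = "\<lambda>x. w \<otimes>\<^bsub>gck_tensor J B\<^esub> \<Phi> x \<otimes>\<^bsub>gck_tensor J B\<^esub> star (gck_tensor J B) w"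
  let ?f' = "\<lambda>x. w' \<otimes>\<^bsub>gck_tensor I A\<^esub> \<Psi> x \<otimes>\<^bsub>gck_tensor I A\<^esub> star (gck_tensor I A) w'"
  have f: "star_hom (gruelle I A) (gruelle J B) ?f" unfolding gruelle_def by (rule 1(1))
  have f': "star_hom (gruelle J B) (gruelle I A) ?f'" unfolding gruelle_def by (rule 2(1))
  have maps: "?f x \<in> carrier (gruelle J B)" if "x \<in> carrier (gruelle I A)" for x
    using f that unfolding star_hom_def by blast
  have maps': "?f' x \<in> carrier (gruelle I A)" if "x \<in> carrier (gruelle J B)" for x
    using f' that unfolding star_hom_def by blast
  have "inj_on ?f (carrier (gruelle I A))"
  proof (rule inj_onI)
    fix x y assume xy: "x \<in> carrier (gruelle I A)" "y \<in> carrier (gruelle I A)" and "?f x = ?f y"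
    then have "?f' (?f x) = ?f' (?f y)" by simp
    then show "x = y" using inj_onD[OF 1(2)] xy unfolding gruelle_def by blast
  qed
  moreover have "?f ` carrier (gruelle I A) = carrier (gruelle J B)"
  proof (intro equalityI subsetI)
    fix y assume "y \<in> carrier (gruelle J B)"
    then obtain x where "x \<in> carrier (gruelle J B)" "y = ?f (?f' x)"
      using 2(3) unfolding gruelle_def by blast
    then show "y \<in> ?f ` carrier (gruelle I A)" using maps' by blast
  qed (use maps in blast)
  ultimately show ?thesis using f unfolding star_isomorphic_def bij_betw_def by blast
qed

section \<open>K-theory\<close>

definition block :: "('a, 'z) star_algebra_scheme \<Rightarrow> nat \<Rightarrow> nat \<Rightarrow> (nat \<Rightarrow> nat \<Rightarrow> 'a) \<Rightarrow> (nat \<Rightarrow> nat \<Rightarrow> 'a) \<Rightarrow> nat \<Rightarrow> nat \<Rightarrow> 'a" where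
  "block R k l x y = (\<lambda>i j. if i < k \<and> j < l then x i j
     else if k \<le> i \<and> l \<le> j then y (i - k) (j - l) else \<zero>\<^bsub>R\<^esub>)"

text \<open>The off-diagonal companion of \<open>block\<close>: \<open>x\<close> sits in the upper
  right corner with \<open>k\<close> rows, \<open>y\<close> in the lower left with \<open>l\<close>
  columns. Filled with two projections it is the partial isometry that swaps the summands of their
  block sum.\<close>

definition antiblock :: "('a, 'z) star_algebra_scheme \<Rightarrow> nat \<Rightarrow> nat \<Rightarrow> (nat \<Rightarrow> nat \<Rightarrow> 'a) \<Rightarrow> (nat \<Rightarrow> nat \<Rightarrow> 'a) \<Rightarrow> nat \<Rightarrow> nat \<Rightarrow> 'a" where
  "antiblock R k l x y = (\<lambda>i j. if i < k \<and> l \<le> j then x i (j - l)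
     else if k \<le> i \<and> j < l then y (i - k) j else \<zero>\<^bsub>R\<^esub>)"

lemma block_sum_eq: "block_sum R (m, p) (n, q) = (m + n, block R m m p q)"
  by (simp add: block_sum_def block_def)

context star_alg
begin

abbreviation "mats \<equiv> matrices R"
abbreviation "mm \<equiv> matrix_mult R"
abbreviation "adj \<equiv> matrix_adj R"
abbreviation "PJ \<equiv> projections R"
abbreviation "MvN \<equiv> murray_von_neumann R"

lemma matD: "x \<in> mats m n \<Longrightarrow> x i j \<in> carrier R" "x \<in> mats m n \<Longrightarrow> \<not> (i < m \<and> j < n) \<Longrightarrow> x i j = \<zero>"
  unfolding matrices_def by blast+

lemma matI: "(\<And>i j. x i j \<in> carrier R) \<Longrightarrow> (\<And>i j. \<not> (i < m \<and> j < n) \<Longrightarrow> x i j = \<zero>) \<Longrightarrow> x \<in> mats m n"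
  unfolding matrices_def by blast

lemma mm_closed: "x \<in> mats m n \<Longrightarrow> y \<in> mats n k \<Longrightarrow> mm n x y \<in> mats m k"
proof (rule matI)
  assume x: "x \<in> mats m n" and y: "y \<in> mats n k"
  show "mm n x y i j \<in> carrier R" for i j
    unfolding matrix_mult_def using matD(1)[OF x] matD(1)[OF y] by (intro finsum_in_carrier) simp
  show "mm n x y i j = \<zero>" if "\<not> (i < m \<and> j < k)" for i j
    unfolding matrix_mult_def
  proof (rule finsum_all_zero)
    fix l
    show "x i l \<otimes> y l j = \<zero>"
    proof (cases "i < m")
      case True
      then have "y l j = \<zero>" using that matD(2)[OF y] by blast
      then show ?thesis using matD(1)[OF x] by simp
    next
      case False
      then have "x i l = \<zero>" using matD(2)[OF x] by blast
      then show ?thesis using matD(1)[OF y] by simp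
    qed
  qed
qed

lemma mm_assoc:
  assumes x: "x \<in> mats m n" and y: "y \<in> mats n k" and z: "z \<in> mats k l"
  shows "mm k (mm n x y) z = mm n x (mm k y z)"
proof (intro ext)
  fix i j
  note c = matD(1)[OF x] matD(1)[OF y] matD(1)[OF z]
  have "mm k (mm n x y) z i j = finsum R (\<lambda>b. finsum R (\<lambda>a. x i a \<otimes> y a b \<otimes> z b j) {..<n}) {..<k}"
    unfolding matrix_mult_def
    by (intro finsum_eqI refl finsum_mult_left) (auto simp: c intro!: finsum_in_carrier)
  also have "\<dots> = finsum R (\<lambda>a. finsum R (\<lambda>b. x i a \<otimes> y a b \<otimes> z b j) {..<k}) {..<n}"
    by (rule finsum_swap) (auto simp: c)
  also have "\<dots> = mm n x (mm k y z) i j"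
    unfolding matrix_mult_def
    by (intro finsum_eqI refl) (auto simp: c finsum_mult_right m_assoc intro!: finsum_in_carrier m_closed)
  finally show "mm k (mm n x y) z i j = mm n x (mm k y z) i j" .
qed

lemma adj_closed: "x \<in> mats m n \<Longrightarrow> adj x \<in> mats n m"
  unfolding matrices_def matrix_adj_def by auto

lemma adj_adj: "x \<in> mats m n \<Longrightarrow> adj (adj x) = x"
  unfolding matrix_adj_def by (intro ext) (simp add: matD)

lemma adj_mm: "x \<in> mats m n \<Longrightarrow> y \<in> mats n k \<Longrightarrow> adj (mm n x y) = mm n (adj y) (adj x)"
  unfolding matrix_adj_def matrix_mult_def
  by (intro ext) (subst star_finsum, auto simp: star_mult matD intro!: finsum_eqI)

lemma block_closed: "x \<in> mats a b \<Longrightarrow> y \<in> mats c d \<Longrightarrow> block R a b x y \<in> mats (a + c) (b + d)"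
  by (rule matI) (auto simp: block_def matD(1) intro!: matD(2))

lemma antiblock_closed: "x \<in> mats a d \<Longrightarrow> y \<in> mats c b \<Longrightarrow> antiblock R a b x y \<in> mats (a + c) (b + d)"
  by (rule matI) (auto simp: antiblock_def matD(1) intro!: matD(2))

lemma adj_block: "adj (block R a b x y) = block R b a (adj x) (adj y)"
  unfolding matrix_adj_def block_def by (intro ext) auto

lemma adj_antiblock: "adj (antiblock R a b x y) = antiblock R b a (adj y) (adj x)"
  unfolding matrix_adj_def antiblock_def by (intro ext) auto

lemma split_sum: "(\<And>i. f i \<in> carrier R) \<Longrightarrow>
  finsum R f {..<b + d} = finsum R f {..<b} \<oplus> finsum R (\<lambda>k. f (b + k)) {..<d}" for f :: "nat \<Rightarrow> 'a"
proof -
  assume f: "\<And>i. f i \<in> carrier R"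
  have "{..<b + d} = {..<b} \<union> (\<lambda>k. b + k) ` {..<d}"
  proof (intro equalityI subsetI)
    fix i assume "i \<in> {..<b + d}"
    then show "i \<in> {..<b} \<union> (\<lambda>k. b + k) ` {..<d}"
      by (cases "i < b") (auto intro!: image_eqI[of _ _ "i - b"])
  qed auto
  moreover have "finsum R f ({..<b} \<union> (\<lambda>k. b + k) ` {..<d}) = finsum R f {..<b} \<oplus> finsum R f ((\<lambda>k. b + k) ` {..<d})"
    by (rule finsum_Un_disjoint) (auto simp: f)
  moreover have "finsum R f ((\<lambda>k. b + k) ` {..<d}) = finsum R (\<lambda>k. f (b + k)) {..<d}"
    by (rule finsum_reindex) (auto simp: f)
  ultimately show ?thesis by simp
qed

lemma block_mult:
  assumes x: "x \<in> mats a b" and y: "y \<in> mats c d" and x': "x' \<in> mats b k" and y': "y' \<in> mats d l"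
  shows "mm (b + d) (block R a b x y) (block R b k x' y') = block R a k (mm b x x') (mm d y y')"
proof (intro ext)
  fix i j
  note c = matD(1)[OF x] matD(1)[OF y] matD(1)[OF x'] matD(1)[OF y']
  have bc: "block R a b x y i n \<otimes> block R b k x' y' n j \<in> carrier R" for n
    by (simp add: block_def c)
  have "mm (b + d) (block R a b x y) (block R b k x' y') i j =
     finsum R (\<lambda>n. block R a b x y i n \<otimes> block R b k x' y' n j) {..<b} \<oplus>
     finsum R (\<lambda>n. block R a b x y i (b + n) \<otimes> block R b k x' y' (b + n) j) {..<d}"
    unfolding matrix_mult_def by (rule split_sum[OF bc])
  also have "finsum R (\<lambda>n. block R a b x y i n \<otimes> block R b k x' y' n j) {..<b} =
     (if i < a \<and> j < k then mm b x x' i j else \<zero>)"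
    unfolding matrix_mult_def
    by (auto simp: block_def c intro!: finsum_eqI finsum_all_zero)
  also have "finsum R (\<lambda>n. block R a b x y i (b + n) \<otimes> block R b k x' y' (b + n) j) {..<d} =
     (if a \<le> i \<and> k \<le> j then mm d y y' (i - a) (j - k) else \<zero>)"
    unfolding matrix_mult_def
    by (auto simp: block_def c intro!: finsum_eqI finsum_all_zero)
  finally show "mm (b + d) (block R a b x y) (block R b k x' y') i j = block R a k (mm b x x') (mm d y y') i j"
    using matD(1)[OF mm_closed[OF x x']] matD(1)[OF mm_closed[OF y y']]
    by (auto simp: block_def)
qed

lemma antiblock_mult:
  assumes x: "x \<in> mats a d" and y: "y \<in> mats c b" and x': "x' \<in> mats b l" and y': "y' \<in> mats d k"
  shows "mm (b + d) (antiblock R a b x y) (antiblock R b k x' y') = block R a k (mm d x y') (mm b y x')"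
proof (intro ext)
  fix i j
  note c = matD(1)[OF x] matD(1)[OF y] matD(1)[OF x'] matD(1)[OF y']
  have bc: "antiblock R a b x y i n \<otimes> antiblock R b k x' y' n j \<in> carrier R" for n
    by (simp add: antiblock_def c)
  have "mm (b + d) (antiblock R a b x y) (antiblock R b k x' y') i j =
     finsum R (\<lambda>n. antiblock R a b x y i n \<otimes> antiblock R b k x' y' n j) {..<b} \<oplus>
     finsum R (\<lambda>n. antiblock R a b x y i (b + n) \<otimes> antiblock R b k x' y' (b + n) j) {..<d}"
    unfolding matrix_mult_def by (rule split_sum[OF bc])
  also have "finsum R (\<lambda>n. antiblock R a b x y i n \<otimes> antiblock R b k x' y' n j) {..<b} =
     (if a \<le> i \<and> k \<le> j then mm b y x' (i - a) (j - k) else \<zero>)"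
    unfolding matrix_mult_def
    by (auto simp: antiblock_def c intro!: finsum_eqI finsum_all_zero)
  also have "finsum R (\<lambda>n. antiblock R a b x y i (b + n) \<otimes> antiblock R b k x' y' (b + n) j) {..<d} =
     (if i < a \<and> j < k then mm d x y' i j else \<zero>)"
    unfolding matrix_mult_def
    by (auto simp: antiblock_def c intro!: finsum_eqI finsum_all_zero)
  finally show "mm (b + d) (antiblock R a b x y) (antiblock R b k x' y') i j = block R a k (mm d x y') (mm b y x') i j"
    using matD(1)[OF mm_closed[OF x y']] matD(1)[OF mm_closed[OF y x']]
    by (auto simp: block_def)
qed

lemma PJ_iff: "(n, p) \<in> PJ \<longleftrightarrow> p \<in> mats n n \<and> mm n p p = p \<and> adj p = p"
  by (simp add: projections_def)

lemma MvN_iff: "((m, p), (n, q)) \<in> MvN \<longleftrightarrow> (m, p) \<in> PJ \<and> (n, q) \<in> PJ \<and>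
   (\<exists>v\<in>mats n m. mm n (adj v) v = p \<and> mm m v (adj v) = q)"
  by (simp add: murray_von_neumann_def)

lemma MvN_refl: "(n, p) \<in> PJ \<Longrightarrow> ((n, p), (n, p)) \<in> MvN"
  unfolding MvN_iff by (auto simp: PJ_iff intro!: bexI[of _ p])

lemma MvN_sym: "((m, p), (n, q)) \<in> MvN \<Longrightarrow> ((n, q), (m, p)) \<in> MvN"
proof -
  assume "((m, p), (n, q)) \<in> MvN"
  then obtain v where v: "(m, p) \<in> PJ" "(n, q) \<in> PJ" "v \<in> mats n m" "mm n (adj v) v = p" "mm m v (adj v) = q"
    unfolding MvN_iff by blast
  have "adj v \<in> mats m n" "mm m (adj (adj v)) (adj v) = q" "mm n (adj v) (adj (adj v)) = p"
    using v adj_closed adj_adj by auto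
  then show ?thesis unfolding MvN_iff using v by blast
qed

text \<open>The product v u works: \<open>adj u\<close> (\<open>adj v\<close> v) u =
  \<open>adj u\<close> q u = \<open>adj u\<close> (u \<open>adj u\<close>) u = p p = p, and likewise
  on the other side. Writing q as u times \<open>adj u\<close> avoids having to show first that u
  absorbs p.\<close>

lemma MvN_trans: "((m, p), (n, q)) \<in> MvN \<Longrightarrow> ((n, q), (k, r)) \<in> MvN \<Longrightarrow> ((m, p), (k, r)) \<in> MvN"
proof -
  assume "((m, p), (n, q)) \<in> MvN" "((n, q), (k, r)) \<in> MvN"
  then obtain u v where P: "(m, p) \<in> PJ" "(n, q) \<in> PJ" "(k, r) \<in> PJ"
    and u: "u \<in> mats n m" "mm n (adj u) u = p" "mm m u (adj u) = q"
    and v: "v \<in> mats k n" "mm k (adj v) v = q" "mm n v (adj v) = r"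
    unfolding MvN_iff by blast
  note au = adj_closed[OF u(1)] and av = adj_closed[OF v(1)]
  let ?w = "mm n v u"
  have w: "?w \<in> mats k m" by (rule mm_closed[OF v(1) u(1)])
  have aw: "adj ?w = mm n (adj u) (adj v)" by (rule adj_mm[OF v(1) u(1)])
  have "mm k (adj ?w) ?w = mm n (adj u) (mm k (adj v) ?w)"
    unfolding aw by (rule mm_assoc[OF au av w])
  also have "mm k (adj v) ?w = mm n (mm k (adj v) v) u" by (rule mm_assoc[OF av v(1) u(1), symmetric])
  also have "\<dots> = mm n (mm m u (adj u)) u" unfolding v(2) u(3) ..
  also have "\<dots> = mm m u p" unfolding mm_assoc[OF u(1) au u(1)] u(2) ..
  also have "mm n (adj u) (mm m u p) = mm m (mm n (adj u) u) p"
    by (rule mm_assoc[OF au u(1), symmetric]) (use P PJ_iff in blast)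
  also have "\<dots> = p" unfolding u(2) using P PJ_iff by blast
  finally have 1: "mm k (adj ?w) ?w = p" .
  have "mm m ?w (adj ?w) = mm n v (mm m u (adj ?w))"
    by (rule mm_assoc[OF v(1) u(1) adj_closed[OF w]])
  also have "mm m u (adj ?w) = mm n (mm m u (adj u)) (adj v)"
    unfolding aw by (rule mm_assoc[OF u(1) au av, symmetric])
  also have "\<dots> = mm n (mm k (adj v) v) (adj v)" unfolding v(2) u(3) ..
  also have "\<dots> = mm k (adj v) r" unfolding mm_assoc[OF av v(1) av] v(3) ..
  also have "mm n v (mm k (adj v) r) = mm k (mm n v (adj v)) r"
    by (rule mm_assoc[OF v(1) av, symmetric]) (use P PJ_iff in blast)
  also have "\<dots> = r" unfolding v(3) using P PJ_iff by blast
  finally have 2: "mm m ?w (adj ?w) = r" .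
  show ?thesis unfolding MvN_iff using P w 1 2 by blast
qed

lemma MvN_equiv: "equiv PJ MvN"
proof (rule equivI)
  show "MvN \<subseteq> PJ \<times> PJ" by (auto simp: murray_von_neumann_def)
  show "refl_on PJ MvN" by (rule refl_onI) (use MvN_refl in auto)
  show "sym MvN" by (rule symI) (metis MvN_sym surj_pair)
  show "trans MvN" by (rule transI) (metis MvN_trans surj_pair)
qed

lemma block_sum_PJ: "P \<in> PJ \<Longrightarrow> Q \<in> PJ \<Longrightarrow> block_sum R P Q \<in> PJ"
proof -
  assume P: "P \<in> PJ" and Q: "Q \<in> PJ"
  obtain m p n q where PQ: "P = (m, p)" "Q = (n, q)" by (cases P, cases Q)
  have p: "p \<in> mats m m" "mm m p p = p" "adj p = p" and q: "q \<in> mats n n" "mm n q q = q" "adj q = q"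
    using P Q unfolding PQ PJ_iff by blast+
  show ?thesis unfolding PQ block_sum_eq PJ_iff
    using block_closed[OF p(1) q(1)] block_mult[OF p(1) q(1) p(1) q(1)] adj_block[of m m p q] p q by simp
qed

lemma block_sum_MvN:
  assumes "(P, P') \<in> MvN" "(Q, Q') \<in> MvN"
  shows "(block_sum R P Q, block_sum R P' Q') \<in> MvN"
proof -
  obtain m p n q m' p' n' q' where PQ: "P = (m, p)" "Q = (n, q)" "P' = (m', p')" "Q' = (n', q')"
    by (cases P, cases Q, cases P', cases Q')
  have pj: "P \<in> PJ" "Q \<in> PJ" "P' \<in> PJ" "Q' \<in> PJ"
    using assms unfolding PQ MvN_iff by blast+
  obtain u where u: "u \<in> mats m' m" "mm m' (adj u) u = p" "mm m u (adj u) = p'"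
    using assms(1) unfolding PQ MvN_iff by blast
  obtain v where v: "v \<in> mats n' n" "mm n' (adj v) v = q" "mm n v (adj v) = q'"
    using assms(2) unfolding PQ MvN_iff by blast
  note au = adj_closed[OF u(1)] and av = adj_closed[OF v(1)]
  have "block R m' m u v \<in> mats (m' + n') (m + n)" by (rule block_closed[OF u(1) v(1)])
  moreover have "mm (m' + n') (adj (block R m' m u v)) (block R m' m u v) = block R m m p q"
    unfolding adj_block block_mult[OF au av u(1) v(1)] u v ..
  moreover have "mm (m + n) (block R m' m u v) (adj (block R m' m u v)) = block R m' m' p' q'"
    unfolding adj_block block_mult[OF u(1) v(1) au av] u v ..
  moreover have "block_sum R P Q \<in> PJ" "block_sum R P' Q' \<in> PJ" using block_sum_PJ pj by blast+
  ultimately show ?thesis unfolding PQ block_sum_eq MvN_iff by blast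
qed

lemma block_sum_commute:
  assumes "P \<in> PJ" "Q \<in> PJ"
  shows "(block_sum R P Q, block_sum R Q P) \<in> MvN"
proof -
  obtain m p n q where PQ: "P = (m, p)" "Q = (n, q)" by (cases P, cases Q)
  have p: "p \<in> mats m m" "mm m p p = p" "adj p = p" and q: "q \<in> mats n n" "mm n q q = q" "adj q = q"
    using assms unfolding PQ PJ_iff by blast+
  let ?w = "antiblock R n m q p"
  have "?w \<in> mats (n + m) (m + n)" by (rule antiblock_closed[OF q(1) p(1)])
  moreover have "mm (n + m) (adj ?w) ?w = block R m m p q"
    unfolding adj_antiblock p(3) q(3) antiblock_mult[OF p(1) q(1) q(1) p(1)] p q ..
  moreover have "mm (m + n) ?w (adj ?w) = block R n n q p"
    unfolding adj_antiblock p(3) q(3) antiblock_mult[OF q(1) p(1) p(1) q(1)] p q ..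
  moreover have "block_sum R P Q \<in> PJ" "block_sum R Q P \<in> PJ" using block_sum_PJ assms by blast+
  ultimately show ?thesis unfolding PQ block_sum_eq MvN_iff by blast
qed

text \<open>Associativity holds on the nose, before passing to classes, since rebracketing moves no
  entry.\<close>

lemma block_sum_assoc: "block_sum R (block_sum R P Q) S = block_sum R P (block_sum R Q S)"
proof -
  obtain m p n q k s where "P = (m, p)" "Q = (n, q)" "S = (k, s)" by (cases P, cases Q, cases S)
  moreover have "block R (m + n) (m + n) (block R m m p q) s = block R m m p (block R n n q s)"
  proof (intro ext)
    fix i j
    show "block R (m + n) (m + n) (block R m m p q) s i j = block R m m p (block R n n q s) i j"
      unfolding block_def by (cases "i < m"; cases "j < m"; cases "i < m + n"; cases "j < m + n") auto
  qed
  ultimately show ?thesis by (simp add: block_sum_eq add.assoc)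
qed

abbreviation "zero_proj \<equiv> (0 :: nat, \<lambda>i j. \<zero>)"

lemma zero_proj: "zero_proj \<in> PJ"
  by (auto simp: PJ_iff matrices_def matrix_mult_def matrix_adj_def)

lemma zero_block_sum: "block_sum R zero_proj P = P"
  by (cases P) (simp add: block_sum_eq block_def)

abbreviation "pc \<equiv> proj_class R"
abbreviation "PM \<equiv> proj_monoid R"

lemma pc_eqI: "(P, Q) \<in> MvN \<Longrightarrow> pc P = pc Q"
  unfolding proj_class_def by (rule equiv_class_eq[OF MvN_equiv])

lemma MvN_PJ: "(P, Q) \<in> MvN \<Longrightarrow> P \<in> PJ" "(P, Q) \<in> MvN \<Longrightarrow> Q \<in> PJ"
  by (auto simp: murray_von_neumann_def)

lemma pc_rep: "P \<in> PJ \<Longrightarrow> (P, class_rep (pc P)) \<in> MvN"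
proof -
  assume "P \<in> PJ"
  then have "P \<in> pc P" unfolding proj_class_def by (rule equiv_class_self[OF MvN_equiv])
  then have "class_rep (pc P) \<in> pc P" unfolding class_rep_def by (rule someI[where P = "\<lambda>z. z \<in> pc P"])
  then show ?thesis unfolding proj_class_def by blast
qed

lemma PM_carrier: "carrier PM = pc ` PJ"
  by (auto simp: proj_monoid_def quotient_def proj_class_def)

lemma PM_one: "\<one>\<^bsub>PM\<^esub> = pc zero_proj" by (simp add: proj_monoid_def)

lemma PM_mult: "P \<in> PJ \<Longrightarrow> Q \<in> PJ \<Longrightarrow> pc P \<otimes>\<^bsub>PM\<^esub> pc Q = pc (block_sum R P Q)"
  by (simp add: proj_monoid_def) (intro pc_eqI[symmetric] block_sum_MvN pc_rep)

lemma comm_monoid_PM: "comm_monoid PM"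
proof (rule comm_monoidI)
  show "\<one>\<^bsub>PM\<^esub> \<in> carrier PM" unfolding PM_carrier PM_one using zero_proj by blast
  fix X Y assume "X \<in> carrier PM" "Y \<in> carrier PM"
  then obtain P Q where PQ: "P \<in> PJ" "Q \<in> PJ" "X = pc P" "Y = pc Q" unfolding PM_carrier by blast
  show "X \<otimes>\<^bsub>PM\<^esub> Y \<in> carrier PM"
    unfolding PQ(3,4) PM_mult[OF PQ(1,2)] PM_carrier using block_sum_PJ[OF PQ(1,2)] by blast
  show "X \<otimes>\<^bsub>PM\<^esub> Y = Y \<otimes>\<^bsub>PM\<^esub> X"
    unfolding PQ(3,4) PM_mult[OF PQ(1,2)] PM_mult[OF PQ(2,1)] by (rule pc_eqI[OF block_sum_commute[OF PQ(1,2)]])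
  show "\<one>\<^bsub>PM\<^esub> \<otimes>\<^bsub>PM\<^esub> X = X" unfolding PQ PM_one PM_mult[OF zero_proj PQ(1)] zero_block_sum ..
  fix Z assume "Z \<in> carrier PM"
  then obtain S where S: "S \<in> PJ" "Z = pc S" unfolding PM_carrier by blast
  show "X \<otimes>\<^bsub>PM\<^esub> Y \<otimes>\<^bsub>PM\<^esub> Z = X \<otimes>\<^bsub>PM\<^esub> (Y \<otimes>\<^bsub>PM\<^esub> Z)"
    unfolding PQ(3,4) S(2) PM_mult[OF PQ(1,2)] PM_mult[OF PQ(2) S(1)]
      PM_mult[OF block_sum_PJ[OF PQ(1,2)] S(1)] PM_mult[OF PQ(1) block_sum_PJ[OF PQ(2) S(1)]] block_sum_assoc ..
qed

end

section \<open>Functoriality of the monoid of projection classes\<close>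

definition map_proj :: "('a \<Rightarrow> 'b) \<Rightarrow> nat \<times> (nat \<Rightarrow> nat \<Rightarrow> 'a) \<Rightarrow> nat \<times> (nat \<Rightarrow> nat \<Rightarrow> 'b)" where
  "map_proj f P = (fst P, \<lambda>i j. f (snd P i j))"

definition class_map :: "('b, 'z) star_algebra_scheme \<Rightarrow> ('a \<Rightarrow> 'b) \<Rightarrow>
    (nat \<times> (nat \<Rightarrow> nat \<Rightarrow> 'a)) set \<Rightarrow> (nat \<times> (nat \<Rightarrow> nat \<Rightarrow> 'b)) set" where
  "class_map S f X = proj_class S (map_proj f (class_rep X))"

context star_hom_pair
begin

lemma map_mats: "x \<in> matrices R m n \<Longrightarrow> (\<lambda>i j. f (x i j)) \<in> matrices S m n"
  unfolding matrices_def by (auto simp: zero)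

lemma map_mm: "x \<in> matrices R m n \<Longrightarrow> y \<in> matrices R n k \<Longrightarrow>
   (\<lambda>i j. f (matrix_mult R n x y i j)) = matrix_mult S n (\<lambda>i j. f (x i j)) (\<lambda>i j. f (y i j))"
  unfolding matrix_mult_def
  by (intro ext) (subst finsum, auto simp: R.matD mult intro!: S.finsum_eqI)

lemma map_adj: "x \<in> matrices R m n \<Longrightarrow> (\<lambda>i j. f (matrix_adj R x i j)) = matrix_adj S (\<lambda>i j. f (x i j))"
  unfolding matrix_adj_def by (intro ext) (simp add: star R.matD)

lemma map_PJ: "P \<in> projections R \<Longrightarrow> map_proj f P \<in> projections S"
proof -
  assume P: "P \<in> projections R"
  obtain n p where np: "P = (n, p)" by (cases P)
  have p: "p \<in> matrices R n n" "matrix_mult R n p p = p" "matrix_adj R p = p"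
    using P unfolding np R.PJ_iff by blast+
  show ?thesis unfolding np map_proj_def fst_conv snd_conv S.PJ_iff
    using map_mats[OF p(1)] map_mm[OF p(1) p(1)] map_adj[OF p(1)] by (simp add: p)
qed

lemma map_MvN: "(P, Q) \<in> murray_von_neumann R \<Longrightarrow> (map_proj f P, map_proj f Q) \<in> murray_von_neumann S"
proof -
  assume PQ: "(P, Q) \<in> murray_von_neumann R"
  obtain m p n q where np: "P = (m, p)" "Q = (n, q)" by (cases P, cases Q)
  obtain v where v: "v \<in> matrices R n m" "matrix_mult R n (matrix_adj R v) v = p" "matrix_mult R m v (matrix_adj R v) = q"
    using PQ unfolding np R.MvN_iff by blast
  have PJ: "map_proj f P \<in> projections S" "map_proj f Q \<in> projections S"
    using map_PJ R.MvN_PJ[OF PQ] by blast+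
  let ?v = "\<lambda>i j. f (v i j)"
  have "matrix_mult S n (matrix_adj S ?v) ?v = (\<lambda>i j. f (p i j))" "matrix_mult S m ?v (matrix_adj S ?v) = (\<lambda>i j. f (q i j))"
    using map_mm[OF R.adj_closed[OF v(1)] v(1)] map_mm[OF v(1) R.adj_closed[OF v(1)]] map_adj[OF v(1)] v(2,3) by simp_all
  then show ?thesis
    using PJ map_mats[OF v(1)] unfolding np map_proj_def fst_conv snd_conv S.MvN_iff by blast
qed

lemma map_block_sum: "map_proj f (block_sum R P Q) = block_sum S (map_proj f P) (map_proj f Q)"
  by (cases P; cases Q) (auto simp: map_proj_def block_sum_eq block_def zero intro!: ext)

lemma class_map: "P \<in> projections R \<Longrightarrow> class_map S f (proj_class R P) = proj_class S (map_proj f P)"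
  unfolding class_map_def by (rule S.pc_eqI[symmetric]) (rule map_MvN[OF R.pc_rep])

lemma class_map_hom:
  "X \<in> carrier (proj_monoid R) \<Longrightarrow> class_map S f X \<in> carrier (proj_monoid S)"
  "X \<in> carrier (proj_monoid R) \<Longrightarrow> Y \<in> carrier (proj_monoid R) \<Longrightarrow>
    class_map S f (X \<otimes>\<^bsub>proj_monoid R\<^esub> Y) = class_map S f X \<otimes>\<^bsub>proj_monoid S\<^esub> class_map S f Y"
  "class_map S f \<one>\<^bsub>proj_monoid R\<^esub> = \<one>\<^bsub>proj_monoid S\<^esub>"
proof -
  show "X \<in> carrier (proj_monoid R) \<Longrightarrow> class_map S f X \<in> carrier (proj_monoid S)"
    unfolding R.PM_carrier S.PM_carrier by (auto simp: class_map map_PJ)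
  show "class_map S f (X \<otimes>\<^bsub>proj_monoid R\<^esub> Y) = class_map S f X \<otimes>\<^bsub>proj_monoid S\<^esub> class_map S f Y"
    if "X \<in> carrier (proj_monoid R)" "Y \<in> carrier (proj_monoid R)"
    using that unfolding R.PM_carrier
    by (auto simp: class_map map_PJ R.PM_mult S.PM_mult R.block_sum_PJ map_block_sum)
  show "class_map S f \<one>\<^bsub>proj_monoid R\<^esub> = \<one>\<^bsub>proj_monoid S\<^esub>"
    unfolding R.PM_one S.PM_one class_map[OF R.zero_proj] by (simp add: map_proj_def zero)
qed

end

section \<open>The Grothendieck group of a commutative monoid and its functoriality\<close>

context comm_monoid
begin

abbreviation "GR \<equiv> grothendieck_rel G"
abbreviation "gc x \<equiv> GR `` {x}"

lemma GR_iff: "((a, b), (c, d)) \<in> GR \<longleftrightarrow> a \<in> carrier G \<and> b \<in> carrier G \<and> c \<in> carrier G \<and> d \<in> carrier G \<and>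
     (\<exists>e\<in>carrier G. a \<otimes> d \<otimes> e = c \<otimes> b \<otimes> e)"
  by (simp add: grothendieck_rel_def)

lemma GR_equiv: "equiv (carrier G \<times> carrier G) GR"
proof (rule equivI)
  show "GR \<subseteq> (carrier G \<times> carrier G) \<times> carrier G \<times> carrier G" by (auto simp: grothendieck_rel_def)
  show "refl_on (carrier G \<times> carrier G) GR" by (rule refl_onI) (auto simp: GR_iff)
  show "sym GR"
  proof (rule symI)
    fix x y assume "(x, y) \<in> GR"
    then show "(y, x) \<in> GR" by (cases x, cases y) (metis GR_iff)
  qed
  show "trans GR"
  proof (rule transI)
    fix x y z assume xy: "(x, y) \<in> GR" and yz: "(y, z) \<in> GR"
    obtain a b c d e f where v: "x = (a, b)" "y = (c, d)" "z = (e, f)" by (cases x, cases y, cases z)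
    obtain s where s: "a \<in> carrier G" "b \<in> carrier G" "c \<in> carrier G" "d \<in> carrier G" "s \<in> carrier G" "a \<otimes> d \<otimes> s = c \<otimes> b \<otimes> s"
      using xy unfolding v GR_iff by blast
    obtain t where t: "e \<in> carrier G" "f \<in> carrier G" "t \<in> carrier G" "c \<otimes> f \<otimes> t = e \<otimes> d \<otimes> t"
      using yz unfolding v GR_iff by blast
    \<comment> \<open>Without cancellation the middle entry \<open>d\<close> cannot be removed, so
      it joins \<open>s\<close> and \<open>t\<close> in the new witness.\<close>
    have "a \<otimes> f \<otimes> (d \<otimes> s \<otimes> t) = (a \<otimes> d \<otimes> s) \<otimes> (f \<otimes> t)" using s(1-5) t(1-3) by (simp add: m_ac)
    also have "\<dots> = (c \<otimes> b \<otimes> s) \<otimes> (f \<otimes> t)" by (simp only: s(6))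
    also have "\<dots> = (c \<otimes> f \<otimes> t) \<otimes> (b \<otimes> s)" using s(1-5) t(1-3) by (simp add: m_ac)
    also have "\<dots> = (e \<otimes> d \<otimes> t) \<otimes> (b \<otimes> s)" by (simp only: t(4))
    also have "\<dots> = e \<otimes> b \<otimes> (d \<otimes> s \<otimes> t)" using s(1-5) t(1-3) by (simp add: m_ac)
    finally have "a \<otimes> f \<otimes> (d \<otimes> s \<otimes> t) = e \<otimes> b \<otimes> (d \<otimes> s \<otimes> t)" .
    moreover have "d \<otimes> s \<otimes> t \<in> carrier G" using s t by simp
    ultimately show "(x, z) \<in> GR" unfolding v GR_iff using s t by blast
  qed
qed

lemma gc_eqI: "(x, y) \<in> GR \<Longrightarrow> gc x = gc y"
  by (rule equiv_class_eq[OF GR_equiv])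

lemma gc_rep: "x \<in> carrier G \<times> carrier G \<Longrightarrow> (x, class_rep (gc x)) \<in> GR"
proof -
  assume "x \<in> carrier G \<times> carrier G"
  then have "x \<in> gc x" by (rule equiv_class_self[OF GR_equiv])
  then have "class_rep (gc x) \<in> gc x" unfolding class_rep_def by (rule someI[where P = "\<lambda>z. z \<in> gc x"])
  then show ?thesis by (simp only: Image_singleton_iff)
qed

lemma gr_carrier: "carrier (grothendieck G) = gc ` (carrier G \<times> carrier G)"
  by (auto simp: grothendieck_def quotient_def)

lemma gr_mult:
  assumes "a \<in> carrier G" "b \<in> carrier G" "c \<in> carrier G" "d \<in> carrier G"
  shows "gc (a, b) \<otimes>\<^bsub>grothendieck G\<^esub> gc (c, d) = gc (a \<otimes> c, b \<otimes> d)"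
proof -
  obtain a' b' where ab: "class_rep (gc (a, b)) = (a', b')" by fastforce
  obtain c' d' where cd: "class_rep (gc (c, d)) = (c', d')" by fastforce
  obtain s where s: "a' \<in> carrier G" "b' \<in> carrier G" "s \<in> carrier G" "a \<otimes> b' \<otimes> s = a' \<otimes> b \<otimes> s"
    using gc_rep[of "(a, b)"] assms unfolding ab GR_iff by blast
  obtain t where t: "c' \<in> carrier G" "d' \<in> carrier G" "t \<in> carrier G" "c \<otimes> d' \<otimes> t = c' \<otimes> d \<otimes> t"
    using gc_rep[of "(c, d)"] assms unfolding cd GR_iff by blast
  have "a \<otimes> c \<otimes> (b' \<otimes> d') \<otimes> (s \<otimes> t) = (a \<otimes> b' \<otimes> s) \<otimes> (c \<otimes> d' \<otimes> t)"
    using assms s(1-3) t(1-3) by (simp add: m_ac)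
  also have "\<dots> = (a' \<otimes> b \<otimes> s) \<otimes> (c' \<otimes> d \<otimes> t)" by (simp only: s(4) t(4))
  also have "\<dots> = a' \<otimes> c' \<otimes> (b \<otimes> d) \<otimes> (s \<otimes> t)"
    using assms s(1-3) t(1-3) by (simp add: m_ac)
  finally have "a \<otimes> c \<otimes> (b' \<otimes> d') \<otimes> (s \<otimes> t) = a' \<otimes> c' \<otimes> (b \<otimes> d) \<otimes> (s \<otimes> t)" .
  then have "((a \<otimes> c, b \<otimes> d), (a' \<otimes> c', b' \<otimes> d')) \<in> GR"
    unfolding GR_iff using assms s(1-3) t(1-3) m_closed by blast
  from gc_eqI[OF this] show ?thesis unfolding grothendieck_def by (simp add: ab cd)
qed

end

definition groth_map :: "('w, 'z) monoid_scheme \<Rightarrow> ('v \<Rightarrow> 'w) \<Rightarrow> ('v \<times> 'v) set \<Rightarrow> ('w \<times> 'w) set" where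
  "groth_map W h X = grothendieck_rel W `` {map_prod h h (class_rep X)}"

locale comm_monoid_hom = V: comm_monoid V + W: comm_monoid W
  for V :: "('v, 'y) monoid_scheme" and W :: "('w, 'z) monoid_scheme" +
  fixes h
  assumes h_closed: "x \<in> carrier V \<Longrightarrow> h x \<in> carrier W"
    and h_mult: "x \<in> carrier V \<Longrightarrow> y \<in> carrier V \<Longrightarrow> h (x \<otimes>\<^bsub>V\<^esub> y) = h x \<otimes>\<^bsub>W\<^esub> h y"
begin

lemma groth_map: "a \<in> carrier V \<Longrightarrow> b \<in> carrier V \<Longrightarrow> groth_map W h (V.gc (a, b)) = W.gc (h a, h b)"
proof -
  assume ab: "a \<in> carrier V" "b \<in> carrier V"
  obtain a' b' where r: "class_rep (V.gc (a, b)) = (a', b')" by fastforce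
  obtain s where s: "a' \<in> carrier V" "b' \<in> carrier V" "s \<in> carrier V" "a \<otimes>\<^bsub>V\<^esub> b' \<otimes>\<^bsub>V\<^esub> s = a' \<otimes>\<^bsub>V\<^esub> b \<otimes>\<^bsub>V\<^esub> s"
    using V.gc_rep[of "(a, b)"] ab unfolding r V.GR_iff by blast
  have "h a \<otimes>\<^bsub>W\<^esub> h b' \<otimes>\<^bsub>W\<^esub> h s = h a' \<otimes>\<^bsub>W\<^esub> h b \<otimes>\<^bsub>W\<^esub> h s"
    using arg_cong[OF s(4), of h] ab s(1-3) by (simp add: h_mult)
  then have "((h a, h b), (h a', h b')) \<in> W.GR"
    unfolding W.GR_iff using ab s(1-3) h_closed by blast
  from W.gc_eqI[OF this] show ?thesis unfolding groth_map_def r by simp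
qed

lemma groth_map_hom: "groth_map W h \<in> hom (grothendieck V) (grothendieck W)"
proof (rule homI)
  fix X assume "X \<in> carrier (grothendieck V)"
  then show "groth_map W h X \<in> carrier (grothendieck W)"
    unfolding V.gr_carrier W.gr_carrier by (auto simp: groth_map h_closed)
next
  fix X Y assume "X \<in> carrier (grothendieck V)" "Y \<in> carrier (grothendieck V)"
  then obtain a b c d where abcd: "a \<in> carrier V" "b \<in> carrier V" "c \<in> carrier V" "d \<in> carrier V"
    and XY: "X = V.gc (a, b)" "Y = V.gc (c, d)"
    unfolding V.gr_carrier by blast
  show "groth_map W h (X \<otimes>\<^bsub>grothendieck V\<^esub> Y) = groth_map W h X \<otimes>\<^bsub>grothendieck W\<^esub> groth_map W h Y"
    unfolding XY using abcd by (simp add: V.gr_mult W.gr_mult groth_map h_closed h_mult)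
qed

end

section \<open>Isomorphic algebras have isomorphic pointed K_0-groups\<close>

lemma star_hom_inverse:
  assumes R: "star_alg R" and f: "star_hom R S f" and bij: "bij_betw f (carrier R) (carrier S)"
  shows "star_hom S R (inv_into (carrier R) f)"
proof -
  interpret R: star_alg R by fact
  let ?g = "inv_into (carrier R) f"
  have gc: "?g y \<in> carrier R" if "y \<in> carrier S" for y
    using that bij by (metis bij_betw_def inv_into_into)
  have fg: "f (?g y) = y" if "y \<in> carrier S" for y
    using that bij by (metis bij_betw_def f_inv_into_f)
  have gf: "?g (f x) = x" if "x \<in> carrier R" for x
    using that bij by (metis bij_betw_def inv_into_f_f)
  have eq: "?g y = x" if "x \<in> carrier R" "f x = y" for x y using gf that by blast
  show ?thesis unfolding star_hom_def
  proof (intro conjI ballI allI)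
    fix x y c assume xy: "x \<in> carrier S" "y \<in> carrier S"
    show "?g x \<in> carrier R" by (rule gc[OF xy(1)])
    show "?g (x \<oplus>\<^bsub>S\<^esub> y) = ?g x \<oplus>\<^bsub>R\<^esub> ?g y"
      by (rule eq) (use f xy gc fg in \<open>auto simp: star_hom_def\<close>)
    show "?g (x \<otimes>\<^bsub>S\<^esub> y) = ?g x \<otimes>\<^bsub>R\<^esub> ?g y"
      by (rule eq) (use f xy gc fg in \<open>auto simp: star_hom_def\<close>)
    show "?g (scale S c x) = scale R c (?g x)"
      by (rule eq) (use f xy gc fg in \<open>auto simp: star_hom_def\<close>)
    show "?g (star S x) = star R (?g x)"
      by (rule eq) (use f xy gc fg in \<open>auto simp: star_hom_def\<close>)
  next
    show "?g \<one>\<^bsub>S\<^esub> = \<one>\<^bsub>R\<^esub>" by (rule eq) (use f in \<open>auto simp: star_hom_def\<close>)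
  qed
qed

text \<open>Projections and their equivalence are defined by ring operations and adjoints alone, so
  a bijective star-homomorphism and its inverse act on classes and on formal differences. The unit
  goes to the unit because the homomorphism is unital.\<close>

theorem K0_isomorphic:
  assumes R: "star_alg R" and S: "star_alg S" and f: "star_hom R S f" and bij: "bij_betw f (carrier R) (carrier S)"
  shows "\<exists>\<phi>\<in>iso (K0 R) (K0 S). \<phi> (K0_unit R) = K0_unit S"
proof -
  define g where "g = inv_into (carrier R) f"
  interpret f: star_hom_pair R S f by (intro star_hom_pair.intro R S star_hom_pair_axioms.intro f)
  interpret g: star_hom_pair S R g
    unfolding g_def by (intro star_hom_pair.intro R S star_hom_pair_axioms.intro star_hom_inverse f bij)
  have fg: "f (g y) = y" if "y \<in> carrier S" for y
    using that bij unfolding g_def by (metis bij_betw_def f_inv_into_f)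
  have gf: "g (f x) = x" if "x \<in> carrier R" for x
    using that bij unfolding g_def by (metis bij_betw_def inv_into_f_f)
  let ?V = "proj_monoid R" and ?W = "proj_monoid S"
  let ?F = "class_map S f" and ?G = "class_map R g"
  interpret V: comm_monoid ?V by (rule f.R.comm_monoid_PM)
  interpret W: comm_monoid ?W by (rule f.S.comm_monoid_PM)
  interpret F: comm_monoid_hom ?V ?W ?F
    by (intro comm_monoid_hom.intro V.comm_monoid_axioms W.comm_monoid_axioms comm_monoid_hom_axioms.intro)
      (fact f.class_map_hom)+
  interpret G: comm_monoid_hom ?W ?V ?G
    by (intro comm_monoid_hom.intro V.comm_monoid_axioms W.comm_monoid_axioms comm_monoid_hom_axioms.intro)
      (fact g.class_map_hom)+
  have GF: "?G (?F X) = X" if X: "X \<in> carrier ?V" for X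
  proof -
    obtain P where P: "P \<in> projections R" "X = proj_class R P" using X unfolding f.R.PM_carrier by blast
    obtain n p where np: "P = (n, p)" by (cases P)
    have "p i j \<in> carrier R" for i j using P(1) unfolding np f.R.PJ_iff by (blast intro: f.R.matD)
    then have "map_proj g (map_proj f P) = P" unfolding np map_proj_def by (simp add: gf)
    then show ?thesis unfolding P(2) f.class_map[OF P(1)] g.class_map[OF f.map_PJ[OF P(1)]] by simp
  qed
  have FG: "?F (?G X) = X" if X: "X \<in> carrier ?W" for X
  proof -
    obtain P where P: "P \<in> projections S" "X = proj_class S P" using X unfolding f.S.PM_carrier by blast
    obtain n p where np: "P = (n, p)" by (cases P)
    have "p i j \<in> carrier S" for i j using P(1) unfolding np f.S.PJ_iff by (blast intro: f.S.matD)
    then have "map_proj f (map_proj g P) = P" unfolding np map_proj_def by (simp add: fg)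
    then show ?thesis unfolding P(2) g.class_map[OF P(1)] f.class_map[OF g.map_PJ[OF P(1)]] by simp
  qed
  let ?\<phi> = "groth_map ?W ?F"
  have "bij_betw ?\<phi> (carrier (K0 R)) (carrier (K0 S))"
  proof (rule bij_betw_byWitness[where f' = "groth_map ?V ?G"])
    show "\<forall>X\<in>carrier (K0 R). groth_map ?V ?G (?\<phi> X) = X"
      unfolding K0_def V.gr_carrier by (auto simp: F.groth_map G.groth_map F.h_closed GF)
    show "\<forall>X\<in>carrier (K0 S). ?\<phi> (groth_map ?V ?G X) = X"
      unfolding K0_def W.gr_carrier by (auto simp: F.groth_map G.groth_map G.h_closed FG)
    show "?\<phi> ` carrier (K0 R) \<subseteq> carrier (K0 S)"
      using F.groth_map_hom unfolding K0_def hom_def by blast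
    show "groth_map ?V ?G ` carrier (K0 S) \<subseteq> carrier (K0 R)"
      using G.groth_map_hom unfolding K0_def hom_def by blast
  qed
  then have iso: "?\<phi> \<in> iso (K0 R) (K0 S)"
    using F.groth_map_hom unfolding K0_def iso_def by blast
  let ?u = "(1 :: nat, \<lambda>i j. if i = 0 \<and> j = 0 then \<one>\<^bsub>R\<^esub> else \<zero>\<^bsub>R\<^esub>)"
  let ?u' = "(1 :: nat, \<lambda>i j. if i = 0 \<and> j = 0 then \<one>\<^bsub>S\<^esub> else \<zero>\<^bsub>S\<^esub>)"
  have "matrix_mult R 1 (snd ?u) (snd ?u) = snd ?u"
    unfolding matrix_mult_def by (intro ext) (auto simp: lessThan_Suc)
  then have u: "?u \<in> projections R"
    unfolding f.R.PJ_iff by (auto simp: matrices_def matrix_adj_def intro!: ext)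
  have mu: "map_proj f ?u = ?u'" unfolding map_proj_def by (auto simp: f.one f.zero intro!: ext)
  have "?\<phi> (K0_unit R) = K0_unit S"
  proof -
    have "proj_class R ?u \<in> carrier ?V" using u unfolding f.R.PM_carrier by blast
    then have "?\<phi> (K0_unit R) = W.gc (?F (proj_class R ?u), ?F \<one>\<^bsub>?V\<^esub>)"
      unfolding K0_unit_def by (rule F.groth_map) simp
    also have "\<dots> = K0_unit S"
      unfolding f.class_map[OF u] mu f.class_map_hom(3) K0_unit_def ..
    finally show ?thesis .
  qed
  then show ?thesis using iso by blast
qed

section \<open>Shift spaces\<close>

definition sh :: "int \<Rightarrow> (int \<Rightarrow> 'n) \<Rightarrow> int \<Rightarrow> 'n" where "sh k x = (\<lambda>i. x (i + k))"

lemma sh_sh [simp]: "sh k (sh l x) = sh (k + l) x" by (simp add: sh_def add.assoc)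
lemma sh_0 [simp]: "sh 0 x = x" by (simp add: sh_def)
lemma sh_apply: "sh k x i = x (i + k)" by (simp add: sh_def)

definition transition :: "(int \<Rightarrow> 'n) set \<Rightarrow> ((int \<Rightarrow> 'n) \<Rightarrow> 'l) \<Rightarrow> 'l \<Rightarrow> 'l \<Rightarrow> bool" where
  "transition X w p q \<longleftrightarrow> (\<exists>x\<in>X. w x = p \<and> w (sh 1 x) = q)"

text \<open>The code sequences form a Markov shift: two points with the same current letter have a common
  continuation that carries the past of one and the future of the other.\<close>

definition markov :: "(int \<Rightarrow> 'n) set \<Rightarrow> ((int \<Rightarrow> 'n) \<Rightarrow> 'l) \<Rightarrow> bool" where
  "markov X w \<longleftrightarrow> (\<forall>x\<in>X. \<forall>y\<in>X. w x = w y \<longrightarrow>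
     (\<exists>z\<in>X. (\<forall>k\<le>0. w (sh k z) = w (sh k x)) \<and> (\<forall>k\<ge>0. w (sh k z) = w (sh k y))))"

text \<open>The algebra depends on \<open>w\<close> only through the letters and transitions that
  occur in \<open>X\<close>. Composing \<open>w\<close> with the shift, or carrying it along a
  conjugacy, therefore leaves it literally the same.\<close>

definition coded :: "(int \<Rightarrow> 'n) set \<Rightarrow> ((int \<Rightarrow> 'n) \<Rightarrow> 'l) \<Rightarrow> 'l ck_tensor_elem cstar_algebra" where
  "coded X w = gruelle (w ` X) (transition X w)"

locale shift_space =
  fixes X :: "(int \<Rightarrow> 'n) set"
  assumes shift: "x \<in> X \<Longrightarrow> sh k x \<in> X"
begin

lemma markovE:
  assumes "markov X w" "x \<in> X" "y \<in> X" "w x = w y"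
  obtains z where "z \<in> X" "\<And>k. k \<le> 0 \<Longrightarrow> w (sh k z) = w (sh k x)" "\<And>k. k \<ge> 0 \<Longrightarrow> w (sh k z) = w (sh k y)"
  using assms unfolding markov_def by blast

text \<open>The code \<open>w\<close> lies half a step after \<open>v\<close>: two consecutive
  \<open>v\<close>-letters determine the \<open>w\<close>-letter between them, and two consecutive
  \<open>w\<close>-letters the \<open>v\<close>-letter between them. \<open>C\<close> and
  \<open>D\<close> are the two kinds of half steps that occur, and the Markov property realises two
  composable half steps by a single point.\<close>

lemma coded_elementary:
  fixes v :: "(int \<Rightarrow> 'n) \<Rightarrow> 'g" and w :: "(int \<Rightarrow> 'n) \<Rightarrow> 'h"
  assumes fin: "finite (v ` X)" "finite (w ` X)" and mv: "markov X v" and mw: "markov X w"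
    and vw: "\<And>x y. x \<in> X \<Longrightarrow> y \<in> X \<Longrightarrow> v x = v y \<Longrightarrow> v (sh 1 x) = v (sh 1 y) \<Longrightarrow> w x = w y"
    and wv: "\<And>x y. x \<in> X \<Longrightarrow> y \<in> X \<Longrightarrow> w x = w y \<Longrightarrow> w (sh 1 x) = w (sh 1 y) \<Longrightarrow> v (sh 1 x) = v (sh 1 y)"
  shows "star_isomorphic (coded X v) (coded X w)"
proof -
  define C where "C p q \<longleftrightarrow> (\<exists>x\<in>X. v x = p \<and> w x = q)" for p q
  define D where "D q p \<longleftrightarrow> (\<exists>x\<in>X. w x = q \<and> v (sh 1 x) = p)" for q p
  have CD: "\<exists>z\<in>X. v z = p \<and> v (sh 1 z) = p' \<and> w z = q" if cd: "C p q" "D q p'" for p q p'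
  proof -
    obtain x y where x: "x \<in> X" "v x = p" "w x = q" and y: "y \<in> X" "w y = q" "v (sh 1 y) = p'"
      using cd unfolding C_def D_def by blast
    obtain z where z: "z \<in> X" "\<And>k. k \<le> 0 \<Longrightarrow> w (sh k z) = w (sh k x)" "\<And>k. k \<ge> 0 \<Longrightarrow> w (sh k z) = w (sh k y)"
      using markovE[OF mw x(1) y(1)] x(3) y(2) by auto
    \<comment> \<open>This says \<open>v z = v x\<close>. The hypothesis \<open>wv\<close> yields
      the \<open>v\<close>-letter at the second of two consecutive points, hence the step back by
      one.\<close>
    have "v (sh 1 (sh (-1) z)) = v (sh 1 (sh (-1) x))"
      by (rule wv) (use z(2)[of "-1"] z(2)[of 0] shift z(1) x(1) in simp_all)
    moreover have "v (sh 1 z) = v (sh 1 y)"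
      by (rule wv) (use z(3)[of 0] z(3)[of 1] z(1) y(1) in simp_all)
    ultimately show ?thesis using z(1) z(2)[of 0] x y by auto
  qed
  have DC: "\<exists>z\<in>X. w z = q \<and> w (sh 1 z) = q' \<and> v (sh 1 z) = p" if cd: "D q p" "C p q'" for p q q'
  proof -
    obtain x y where x: "x \<in> X" "w x = q" "v (sh 1 x) = p" and y: "y \<in> X" "v y = p" "w y = q'"
      using cd unfolding C_def D_def by blast
    obtain z where z: "z \<in> X" "\<And>k. k \<le> 0 \<Longrightarrow> v (sh k z) = v (sh k (sh 1 x))" "\<And>k. k \<ge> 0 \<Longrightarrow> v (sh k z) = v (sh k y)"
      using markovE[OF mv shift[OF x(1), of 1] y(1)] x(3) y(2) by auto
    \<comment> \<open>\<open>z\<close> was glued from the past of \<open>sh 1 x\<close>, so its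
      predecessor corresponds to \<open>x\<close> itself.\<close>
    have "w (sh (-1) z) = w x"
      by (rule vw) (use z(2)[of "-1"] z(2)[of 0] shift z(1) x(1) in simp_all)
    moreover have "w z = w y"
      by (rule vw) (use z(3)[of 0] z(3)[of 1] z(1) y(1) in simp_all)
    moreover have "v z = p" using z(3)[of 0] y by simp
    ultimately show ?thesis
      using x y shift[OF z(1), of "-1"] by (intro bexI[of _ "sh (-1) z"]) simp_all
  qed
  have "elementary (v ` X) (w ` X) (transition X v) (transition X w) C D"
  proof
    show "transition X v i j \<longleftrightarrow> (\<exists>u\<in>w ` X. C i u \<and> D u j)" for i j
    proof
      assume "transition X v i j"
      then show "\<exists>u\<in>w ` X. C i u \<and> D u j" unfolding transition_def C_def D_def by blast
    next
      assume "\<exists>u\<in>w ` X. C i u \<and> D u j"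
      then show "transition X v i j" unfolding transition_def using CD by blast
    qed
    show "transition X w i j \<longleftrightarrow> (\<exists>u\<in>v ` X. D i u \<and> C u j)" for i j
    proof
      assume "transition X w i j"
      then show "\<exists>u\<in>v ` X. D i u \<and> C u j" unfolding transition_def C_def D_def using shift by blast
    next
      assume "\<exists>u\<in>v ` X. D i u \<and> C u j"
      then show "transition X w i j" unfolding transition_def using DC by blast
    qed
    show "u = u'" if "C i u" "D u j" "C i u'" "D u' j" for i j u u'
      using CD[OF that(1,2)] CD[OF that(3,4)] vw by metis
    show "i = i'" if "D u i" "C i u'" "D u i'" "C i' u'" for u u' i i'
      using DC[OF that(1,2)] DC[OF that(3,4)] wv by metis
    show "\<exists>u\<in>w ` X. D u i" if iv: "i \<in> v ` X" for i
    proof -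
      obtain x where x: "x \<in> X" "i = v x" using iv by blast
      have "D (w (sh (-1) x)) i"
        unfolding D_def by (rule bexI[OF _ shift[OF x(1), of "-1"]]) (simp add: x(2))
      then show ?thesis using shift[OF x(1)] by blast
    qed
    show "\<exists>i\<in>v ` X. C i u" if "u \<in> w ` X" for u using that unfolding C_def by blast
    show "\<exists>u\<in>w ` X. C i u" if "i \<in> v ` X" for i using that unfolding C_def by blast
    show "\<exists>i\<in>v ` X. D u i" if "u \<in> w ` X" for u using that shift unfolding D_def by blast
  qed (fact fin)+
  then show ?thesis unfolding coded_def by (rule elementary.gruelle_isomorphic)
qed

text \<open>The refined code adds what the next letter of \<open>v\<close> tells, as when a window
  is extended by one coordinate to the right. A refinement of this kind inherits the Markov property
  and is a half-step code for \<open>coded_elementary\<close>.\<close>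

lemma right_refinement:
  assumes fin: "finite (v ` X)" "finite (w ` X)" and mv: "markov X v"
    and vw: "\<And>x y. x \<in> X \<Longrightarrow> y \<in> X \<Longrightarrow> v x = v y \<Longrightarrow> v (sh 1 x) = v (sh 1 y) \<Longrightarrow> w x = w y"
    and wv: "\<And>x y. x \<in> X \<Longrightarrow> y \<in> X \<Longrightarrow> w x = w y \<Longrightarrow> v x = v y"
  shows "markov X w" "star_isomorphic (coded X v) (coded X w)"
proof -
  show mw: "markov X w" unfolding markov_def
  proof (intro ballI impI)
    fix x y assume x: "x \<in> X" and y: "y \<in> X" and xy: "w x = w y"
    obtain z where z: "z \<in> X" "\<And>k. k \<le> 0 \<Longrightarrow> v (sh k z) = v (sh k x)" "\<And>k. k \<ge> 0 \<Longrightarrow> v (sh k z) = v (sh k y)"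
      using markovE[OF mv x y wv[OF x y xy]] by blast
    have ge: "w (sh k z) = w (sh k y)" if "k \<ge> 0" for k
      by (rule vw) (use z(3)[of k] z(3)[of "1 + k"] that shift z(1) y in simp_all)
    have lt: "w (sh k z) = w (sh k x)" if "k < 0" for k
      by (rule vw) (use z(2)[of k] z(2)[of "1 + k"] that shift z(1) x in simp_all)
    \<comment> \<open>At \<open>k = 0\<close> the letter of \<open>w\<close> looks one step ahead
      into the future of \<open>y\<close>; there the assumption that \<open>w x = w y\<close> is
      used.\<close>
    have "w (sh k z) = w (sh k x)" if "k \<le> 0" for k
      using lt[of k] ge[of 0] xy that by (cases "k = 0") simp_all
    then show "\<exists>z\<in>X. (\<forall>k\<le>0. w (sh k z) = w (sh k x)) \<and> (\<forall>k\<ge>0. w (sh k z) = w (sh k y))"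
      using z(1) ge by blast
  qed
  show "star_isomorphic (coded X v) (coded X w)"
    by (rule coded_elementary[OF fin mv mw vw]) (use wv shift in blast)+
qed

text \<open>Mirror image of \<open>right_refinement\<close>, but \<open>coded_elementary\<close>
  treats the two directions unequally. Reading \<open>w\<close> one step later turns dependence on
  the previous and current letter into dependence on the current and next one.\<close>

lemma left_refinement:
  assumes fin: "finite (v ` X)" "finite (w ` X)" and mv: "markov X v"
    and vw: "\<And>x y. x \<in> X \<Longrightarrow> y \<in> X \<Longrightarrow> v (sh (-1) x) = v (sh (-1) y) \<Longrightarrow> v x = v y \<Longrightarrow> w x = w y"
    and wv: "\<And>x y. x \<in> X \<Longrightarrow> y \<in> X \<Longrightarrow> w x = w y \<Longrightarrow> v x = v y"
  shows "markov X w" "star_isomorphic (coded X v) (coded X w)"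
proof -
  show mw: "markov X w" unfolding markov_def
  proof (intro ballI impI)
    fix x y assume x: "x \<in> X" and y: "y \<in> X" and xy: "w x = w y"
    obtain z where z: "z \<in> X" "\<And>k. k \<le> 0 \<Longrightarrow> v (sh k z) = v (sh k x)" "\<And>k. k \<ge> 0 \<Longrightarrow> v (sh k z) = v (sh k y)"
      using markovE[OF mv x y wv[OF x y xy]] by blast
    have le: "w (sh k z) = w (sh k x)" if "k \<le> 0" for k
      by (rule vw) (use z(2)[of k] z(2)[of "-1 + k"] that shift z(1) x in simp_all)
    have gt: "w (sh k z) = w (sh k y)" if "k > 0" for k
      by (rule vw) (use z(3)[of k] z(3)[of "-1 + k"] that shift z(1) y in simp_all)
    have "w (sh k z) = w (sh k y)" if "k \<ge> 0" for k
      using gt[of k] le[of 0] xy that by (cases "k = 0") simp_all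
    then show "\<exists>z\<in>X. (\<forall>k\<le>0. w (sh k z) = w (sh k x)) \<and> (\<forall>k\<ge>0. w (sh k z) = w (sh k y))"
      using z(1) le by blast
  qed
  \<comment> \<open>Since \<open>sh 1\<close> maps \<open>X\<close> onto itself, the delayed code
    has the same letters and transitions as \<open>w\<close> and hence the same algebra.\<close>
  let ?u = "\<lambda>x. w (sh 1 x)"
  have sX: "sh 1 ` X = X"
  proof (intro equalityI subsetI)
    fix x assume "x \<in> X"
    then show "x \<in> sh 1 ` X" using shift[of x "-1"] by (intro image_eqI[of _ _ "sh (-1) x"]) simp_all
  qed (use shift in blast)
  have uX: "?u ` X = w ` X" using sX by (metis image_image)
  have tr: "transition X ?u = transition X w"
  proof (intro ext)
    fix p q
    have "(\<exists>x\<in>sh 1 ` X. w x = p \<and> w (sh 1 x) = q) \<longleftrightarrow> (\<exists>x\<in>X. ?u x = p \<and> ?u (sh 1 x) = q)"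
      by simp
    then show "transition X ?u p q = transition X w p q" unfolding transition_def sX by blast
  qed
  have mu: "markov X ?u" unfolding markov_def
  proof (intro ballI impI)
    fix x y assume x: "x \<in> X" and y: "y \<in> X" and xy: "w (sh 1 x) = w (sh 1 y)"
    obtain z where z: "z \<in> X" "\<And>k. k \<le> 0 \<Longrightarrow> w (sh k z) = w (sh k (sh 1 x))" "\<And>k. k \<ge> 0 \<Longrightarrow> w (sh k z) = w (sh k (sh 1 y))"
      using markovE[OF mw shift[OF x] shift[OF y] xy] by blast
    show "\<exists>z\<in>X. (\<forall>k\<le>0. w (sh 1 (sh k z)) = w (sh 1 (sh k x))) \<and> (\<forall>k\<ge>0. w (sh 1 (sh k z)) = w (sh 1 (sh k y)))"
      using z(2,3) by (intro bexI[OF _ shift[OF z(1), of "-1"]]) (simp add: add.commute)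
  qed
  have "star_isomorphic (coded X v) (coded X ?u)"
  proof (rule coded_elementary[OF fin(1) _ mv mu])
    show "finite (?u ` X)" using fin(2) uX by simp
    show "w (sh 1 x) = w (sh 1 y)" if "x \<in> X" "y \<in> X" "v x = v y" "v (sh 1 x) = v (sh 1 y)" for x y
      by (rule vw) (use that shift in simp_all)
    show "v (sh 1 x) = v (sh 1 y)" if "x \<in> X" "y \<in> X" "w (sh 1 x) = w (sh 1 y)" for x y
      by (rule wv) (use that shift in simp_all)
  qed
  then show "star_isomorphic (coded X v) (coded X w)" unfolding coded_def uX tr .
qed

end

lemma star_isomorphic_trans: "star_isomorphic R S \<Longrightarrow> star_isomorphic S T \<Longrightarrow> star_isomorphic R T"
proof -
  assume "star_isomorphic R S" "star_isomorphic S T"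
  then obtain f g where "star_hom R S f" "bij_betw f (carrier R) (carrier S)" "star_hom S T g" "bij_betw g (carrier S) (carrier T)"
    unfolding star_isomorphic_def by blast
  then show ?thesis unfolding star_isomorphic_def
    using star_hom_comp[of R S f T g] bij_betw_trans[of f _ _ g] by (intro exI[of _ "\<lambda>x. g (f x)"]) (simp add: comp_def)
qed

lemma mem_markov: "x \<in> markov_space A \<longleftrightarrow> (\<forall>i. A $ x i $ x (i + 1) = 1)"
  by (simp add: markov_space_def)

lemma shift_space_markov: "shift_space (markov_space A)"
proof
  fix x k assume "x \<in> markov_space A"
  then have "A $ x (i + k) $ x (i + k + 1) = 1" for i unfolding mem_markov by blast
  then show "sh k x \<in> markov_space A" unfolding mem_markov sh_apply by (simp add: add.commute add.left_commute)
qed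

lemma glue:
  assumes x: "x \<in> markov_space A" and y: "y \<in> markov_space A" and xy: "x 0 = y 0"
  shows "\<exists>z\<in>markov_space A. (\<forall>k\<le>0. z k = x k) \<and> (\<forall>k\<ge>0. z k = y k)"
proof -
  let ?z = "\<lambda>k. if k < 0 then x k else y k"
  have "A $ ?z i $ ?z (i + 1) = 1" for i
  proof (cases "i + 1 = 0")
    case True
    then have "i < 0" "A $ x i $ x 0 = 1" using x unfolding mem_markov by (auto dest: spec[of _ i])
    then show ?thesis using True xy by simp
  next
    case False
    then have "i + 1 < 0 \<or> i \<ge> 0" by linarith
    then show ?thesis using x y unfolding mem_markov by auto
  qed
  then have "?z \<in> markov_space A" unfolding mem_markov by blast
  then show ?thesis using xy by (intro bexI[of _ ?z]) auto
qed

text \<open>A conjugacy shifted so far that \<open>h x i\<close> depends on the coordinates of \<open>x\<close> from \<open>i\<close> on, while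
  \<open>x i\<close> depends on the coordinates of \<open>h x\<close> strictly before \<open>i\<close>.\<close>

locale shifted_conjugacy =
  fixes A :: "nat^'n^'n" and B :: "nat^'m^'m" and h :: "(int \<Rightarrow> 'n) \<Rightarrow> int \<Rightarrow> 'm" and n m :: nat
  assumes image: "h ` markov_space A = markov_space B"
    and equivariant: "x \<in> markov_space A \<Longrightarrow> h (sh k x) = sh k (h x)"
    and code: "x \<in> markov_space A \<Longrightarrow> y \<in> markov_space A \<Longrightarrow> (\<And>j. i \<le> j \<Longrightarrow> j \<le> i + int n \<Longrightarrow> x j = y j) \<Longrightarrow> h x i = h y i"
    and decode: "x \<in> markov_space A \<Longrightarrow> y \<in> markov_space A \<Longrightarrow> (\<And>j. i - int m \<le> j \<Longrightarrow> j < i \<Longrightarrow> h x j = h y j) \<Longrightarrow> x i = y i"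
begin

abbreviation "X \<equiv> markov_space A"

sublocale shift_space X by (rule shift_space_markov)

text \<open>An interval whose upper end lies below its lower end gives an empty list. So one
  function covers windows in \<open>x\<close> only, in \<open>h x\<close> only, and in both.\<close>

definition window :: "int \<Rightarrow> int \<Rightarrow> int \<Rightarrow> int \<Rightarrow> (int \<Rightarrow> 'n) \<Rightarrow> 'n list \<times> 'm list" where
  "window a b c d x = (map x [a..b], map (h x) [c..d])"

lemma window_eq: "window a b c d x = window a b c d y \<longleftrightarrow>
   (\<forall>i. a \<le> i \<longrightarrow> i \<le> b \<longrightarrow> x i = y i) \<and> (\<forall>i. c \<le> i \<longrightarrow> i \<le> d \<longrightarrow> h x i = h y i)"
  by (auto simp: window_def)

lemma window_eqI:
  assumes "\<And>i. a \<le> i \<Longrightarrow> i \<le> b \<Longrightarrow> x i = y i" "\<And>i. c \<le> i \<Longrightarrow> i \<le> d \<Longrightarrow> h x i = h y i"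
  shows "window a b c d x = window a b c d y"
  unfolding window_eq using assms by blast

lemma window_eqD:
  assumes "window a b c d x = window a b c d y"
  shows "a \<le> i \<Longrightarrow> i \<le> b \<Longrightarrow> x i = y i" "c \<le> i \<Longrightarrow> i \<le> d \<Longrightarrow> h x i = h y i"
  using assms unfolding window_eq by blast+

lemma window_mono:
  assumes "window a' b' c' d' x = window a' b' c' d' y" "a' \<le> a" "b \<le> b'" "c' \<le> c" "d \<le> d'"
  shows "window a b c d x = window a b c d y"
  by (rule window_eqI) (use assms(2-5) window_eqD[OF assms(1)] in \<open>meson order_trans\<close>)+

lemma window_shiftD:
  assumes "x \<in> X" "y \<in> X" "window a b c d (sh k x) = window a b c d (sh k y)"
  shows "a \<le> i \<Longrightarrow> i \<le> b \<Longrightarrow> x (i + k) = y (i + k)" "c \<le> i \<Longrightarrow> i \<le> d \<Longrightarrow> h x (i + k) = h y (i + k)"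
  using window_eqD[OF assms(3), of i] assms(1,2) by (simp_all add: equivariant sh_apply)

lemma window_finite: "finite (window a b c d ` X)"
proof (rule finite_subset)
  show "window a b c d ` X \<subseteq> {xs. set xs \<subseteq> UNIV \<and> length xs = length [a..b]} \<times> {xs. set xs \<subseteq> UNIV \<and> length xs = length [c..d]}"
    by (auto simp: window_def)
qed (intro finite_cartesian_product finite_lists_length_eq finite)

lemma markov_coordinate: "markov X (\<lambda>x. x 0)" unfolding markov_def
proof (intro ballI impI)
  fix x y assume "x \<in> X" "y \<in> X" "x 0 = y 0"
  from glue[OF this] show "\<exists>z\<in>X. (\<forall>k\<le>0. sh k z 0 = sh k x 0) \<and> (\<forall>k\<ge>0. sh k z 0 = sh k y 0)"
    by (simp add: sh_apply)
qed

lemma markov_image: "markov X (\<lambda>x. h x 0)" unfolding markov_def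
proof (intro ballI impI)
  fix x y assume x: "x \<in> X" and y: "y \<in> X" and xy: "h x 0 = h y 0"
  have "h x \<in> markov_space B" "h y \<in> markov_space B" using x y image by blast+
  from glue[OF this xy] obtain v where v: "v \<in> markov_space B" "\<forall>k\<le>0. v k = h x k" "\<forall>k\<ge>0. v k = h y k" by blast
  obtain z where z: "z \<in> X" "v = h z" using v(1) image by blast
  show "\<exists>z\<in>X. (\<forall>k\<le>0. h (sh k z) 0 = h (sh k x) 0) \<and> (\<forall>k\<ge>0. h (sh k z) 0 = h (sh k y) 0)"
    using v(2,3) z x y by (intro bexI[OF _ z(1)]) (simp add: equivariant sh_apply)
qed

text \<open>The window in \<open>x\<close> grows to the right; the window in \<open>h x\<close>
  stays empty. The new last coordinate is the old last coordinate of the shifted point.\<close>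

lemma chain_x: "markov X (window 0 (int k) 0 (-1)) \<and>
  star_isomorphic (coded X (\<lambda>x. x 0)) (coded X (window 0 (int k) 0 (-1)))"
proof (induction k)
  case 0
  have "markov X (window 0 0 0 (-1))" "star_isomorphic (coded X (\<lambda>x. x 0)) (coded X (window 0 0 0 (-1)))"
  proof (rule right_refinement[OF _ window_finite markov_coordinate])
    show w: "window 0 0 0 (-1) x = window 0 0 0 (-1) y" if "x 0 = y 0" for x y
    proof (rule window_eqI)
      fix i :: int assume "0 \<le> i" "i \<le> 0"
      then have "i = 0" by linarith
      then show "x i = y i" using that by simp
    next
      fix i :: int assume "0 \<le> i" "i \<le> -1"
      then have False by linarith
      then show "h x i = h y i" ..
    qed
    show v: "x 0 = y 0" if "window 0 0 0 (-1) x = window 0 0 0 (-1) y" for x y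
      by (rule window_eqD(1)[OF that]) simp_all
    show "star_isomorphic (coded X (\<lambda>x. x 0)) (coded X (window 0 0 0 (-1)))"
      by (rule right_refinement(2)[OF _ window_finite markov_coordinate]) (simp, rule w, simp, rule v)
  qed simp
  then show ?case by simp
next
  case (Suc k)
  have 1: "window 0 (int (Suc k)) 0 (-1) x = window 0 (int (Suc k)) 0 (-1) y"
    if "x \<in> X" "y \<in> X" "window 0 (int k) 0 (-1) x = window 0 (int k) 0 (-1) y"
      "window 0 (int k) 0 (-1) (sh 1 x) = window 0 (int k) 0 (-1) (sh 1 y)" for x y
  proof -
    note a1 = window_eqD(1)[OF that(3)] and a2 = window_shiftD(1)[OF that(1,2,4)]
    have "x i = y i" if i: "0 \<le> i" "i \<le> int (Suc k)" for i
    proof (cases "i \<le> int k")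
      case True
      show ?thesis by (rule a1[OF i(1) True])
    next
      case False
      then have "i = int k + 1" using i by linarith
      then show ?thesis using a2[of "int k"] by simp
    qed
    then show ?thesis
    proof (rule window_eqI)
      fix i :: int assume "0 \<le> i" "i \<le> -1"
      then have False by linarith
      then show "h x i = h y i" ..
    qed
  qed
  have 2: "window 0 (int k) 0 (-1) x = window 0 (int k) 0 (-1) y"
    if "window 0 (int (Suc k)) 0 (-1) x = window 0 (int (Suc k)) 0 (-1) y" for x y
    by (rule window_mono[OF that]) simp_all
  note s = right_refinement[OF window_finite window_finite conjunct1[OF Suc] 1 2]
  show ?case using s star_isomorphic_trans[OF conjunct2[OF Suc]] by blast
qed

text \<open>The same growth in \<open>h x\<close>. The empty window in \<open>x\<close> may be
  placed at any \<open>j\<close>, and is later placed where that window is to start growing.\<close>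

lemma chain_y: "markov X (window j (j - 1) 0 (int k)) \<and>
  star_isomorphic (coded X (\<lambda>x. h x 0)) (coded X (window j (j - 1) 0 (int k)))"
proof (induction k)
  case 0
  have "markov X (window j (j - 1) 0 0)" "star_isomorphic (coded X (\<lambda>x. h x 0)) (coded X (window j (j - 1) 0 0))"
  proof (rule right_refinement[OF _ window_finite markov_image])
    show w: "window j (j - 1) 0 0 x = window j (j - 1) 0 0 y" if "h x 0 = h y 0" for x y
    proof (rule window_eqI)
      fix i :: int assume "0 \<le> i" "i \<le> 0"
      then have "i = 0" by linarith
      then show "h x i = h y i" using that by simp
    next
      fix i :: int assume "j \<le> i" "i \<le> j - 1"
      then have False by linarith
      then show "x i = y i" ..
    qed
    show v: "h x 0 = h y 0" if "window j (j - 1) 0 0 x = window j (j - 1) 0 0 y" for x y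
      by (rule window_eqD(2)[OF that]) simp_all
    show "star_isomorphic (coded X (\<lambda>x. h x 0)) (coded X (window j (j - 1) 0 0))"
      by (rule right_refinement(2)[OF _ window_finite markov_image]) (simp, rule w, simp, rule v)
  qed simp
  then show ?case by simp
next
  case (Suc k)
  have 1: "window j (j - 1) 0 (int (Suc k)) x = window j (j - 1) 0 (int (Suc k)) y"
    if "x \<in> X" "y \<in> X" "window j (j - 1) 0 (int k) x = window j (j - 1) 0 (int k) y"
      "window j (j - 1) 0 (int k) (sh 1 x) = window j (j - 1) 0 (int k) (sh 1 y)" for x y
  proof -
    note a1 = window_eqD(2)[OF that(3)] and a2 = window_shiftD(2)[OF that(1,2,4)]
    have "h x i = h y i" if i: "0 \<le> i" "i \<le> int (Suc k)" for i
    proof (cases "i \<le> int k")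
      case True
      show ?thesis by (rule a1[OF i(1) True])
    next
      case False
      then have "i = int k + 1" using i by linarith
      then show ?thesis using a2[of "int k"] by simp
    qed
    note h = this
    show ?thesis
    proof (rule window_eqI[OF _ h])
      fix i :: int assume "j \<le> i" "i \<le> j - 1"
      then have False by linarith
      then show "x i = y i" ..
    qed
  qed
  have 2: "window j (j - 1) 0 (int k) x = window j (j - 1) 0 (int k) y"
    if "window j (j - 1) 0 (int (Suc k)) x = window j (j - 1) 0 (int (Suc k)) y" for x y
    by (rule window_mono[OF that]) simp_all
  note s = right_refinement[OF window_finite window_finite conjunct1[OF Suc] 1 2]
  show ?case using s star_isomorphic_trans[OF conjunct2[OF Suc]] by blast
qed

text \<open>\<open>decode\<close> needs the \<open>m\<close> coordinates of \<open>h x\<close>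
  before \<open>J\<close>. With \<open>J = m + 1\<close> the window from 0 to \<open>J - 1\<close>
  contains them and is nonempty even if \<open>m = 0\<close>, as \<open>chain_y\<close> produces
  it.\<close>

abbreviation "J \<equiv> int m + 1"

text \<open>With \<open>h x\<close> known from 0 to \<open>J - 1\<close>, coordinates of
  \<open>x\<close> from \<open>J\<close> on are added on the right. This refinement is allowed since
  \<open>x J\<close> is already determined and each later coordinate is read off the shifted
  point.\<close>

lemma chain_yx: "markov X (window J (J - 1 + int k) 0 (J - 1)) \<and>
  star_isomorphic (coded X (\<lambda>x. h x 0)) (coded X (window J (J - 1 + int k) 0 (J - 1)))"
proof (induction k)
  case 0
  show ?case using chain_y[of J m] by simp
next
  case (Suc k)
  have 1: "window J (J - 1 + int (Suc k)) 0 (J - 1) x = window J (J - 1 + int (Suc k)) 0 (J - 1) y"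
    if xy: "x \<in> X" "y \<in> X" and "window J (J - 1 + int k) 0 (J - 1) x = window J (J - 1 + int k) 0 (J - 1) y"
      "window J (J - 1 + int k) 0 (J - 1) (sh 1 x) = window J (J - 1 + int k) 0 (J - 1) (sh 1 y)" for x y
  proof -
    note a2 = window_shiftD(1)[OF that(1,2,4)] and a3 = window_eqD(2)[OF that(3)]
    have "x i = y i" if i: "J \<le> i" "i \<le> J - 1 + int (Suc k)" for i
    proof (cases "i = J")
      case True
      \<comment> \<open>The coordinate \<open>J\<close> is the only one that the shifted window does
        not supply; it comes from the window in \<open>h x\<close>.\<close>
      show ?thesis by (rule decode[OF xy], rule a3) (use True in linarith)+
    next
      case False
      then have "J \<le> i - 1" "i - 1 \<le> J - 1 + int k" using i by linarith+
      then have "x (i - 1 + 1) = y (i - 1 + 1)" by (rule a2)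
      then show ?thesis by simp
    qed
    note xs = this
    show ?thesis by (rule window_eqI[OF xs a3])
  qed
  have 2: "window J (J - 1 + int k) 0 (J - 1) x = window J (J - 1 + int k) 0 (J - 1) y"
    if "window J (J - 1 + int (Suc k)) 0 (J - 1) x = window J (J - 1 + int (Suc k)) 0 (J - 1) y" for x y
    by (rule window_mono[OF that]) simp_all
  note s = right_refinement[OF window_finite window_finite conjunct1[OF Suc] 1 2]
  show ?case using s star_isomorphic_trans[OF conjunct2[OF Suc]] by blast
qed

text \<open>Each step trades the last coordinate of \<open>h x\<close> for one more coordinate of
  \<open>x\<close> on the left. The discarded coordinate is recovered by \<open>code\<close> from
  the \<open>n + 1\<close> coordinates of \<open>x\<close> that start at its place, which is why the
  window in \<open>x\<close> was first extended to \<open>J + n\<close>.\<close>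

lemma chain_left: "k \<le> Suc m \<Longrightarrow> markov X (window (J - int k) (J + int n) 0 (J - 1 - int k)) \<and>
  star_isomorphic (coded X (\<lambda>x. h x 0)) (coded X (window (J - int k) (J + int n) 0 (J - 1 - int k)))"
proof (induction k)
  case 0
  show ?case using chain_yx[of "Suc n"] by (simp add: algebra_simps)
next
  case (Suc k)
  define j where "j = J - int (Suc k)"
  have j: "J - int k = j + 1" "J - 1 - int k = j" "J - 1 - int (Suc k) = j - 1" "0 \<le> j" "j < J"
    using Suc.prems by (auto simp: j_def)
  note IH = Suc.IH[OF Suc_leD[OF Suc.prems], unfolded j]
  have 1: "window j (J + int n) 0 (j - 1) x = window j (J + int n) 0 (j - 1) y"
    if xy: "x \<in> X" "y \<in> X" and "window (j + 1) (J + int n) 0 j (sh (-1) x) = window (j + 1) (J + int n) 0 j (sh (-1) y)"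
      "window (j + 1) (J + int n) 0 j x = window (j + 1) (J + int n) 0 j y" for x y
  proof -
    note a1 = window_shiftD(1)[OF that(1,2,3)] and a2 = window_eqD[OF that(4)]
    have "x i = y i" if i: "j \<le> i" "i \<le> J + int n" for i
    proof (cases "i = j")
      case True
      have "x (j + 1 + - 1) = y (j + 1 + - 1)" by (rule a1) (use j(5) in linarith)+
      then show ?thesis using True by simp
    next
      case False
      then show ?thesis by (intro a2(1)) (use i in linarith)+
    qed
    note xs = this
    show ?thesis by (rule window_eqI[OF xs a2(2)]) linarith+
  qed
  have 2: "window (j + 1) (J + int n) 0 j x = window (j + 1) (J + int n) 0 j y"
    if xy: "x \<in> X" "y \<in> X" and "window j (J + int n) 0 (j - 1) x = window j (J + int n) 0 (j - 1) y" for x y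
  proof -
    note a = window_eqD[OF that(3)]
    \<comment> \<open>Here \<open>j < J\<close>, so the coordinates from \<open>j\<close> to
      \<open>j + n\<close> that \<open>code\<close> reads lie inside the window of \<open>x\<close>,
      which ends at \<open>J + n\<close>.\<close>
    have hj: "h x j = h y j" by (rule code[OF xy], rule a(1)) (use j in linarith)+
    have hs: "h x i = h y i" if i: "0 \<le> i" "i \<le> j" for i
    proof (cases "i = j")
      case False
      then show ?thesis by (intro a(2)) (use i in linarith)+
    qed (simp add: hj)
    show ?thesis by (rule window_eqI[OF a(1) hs]) linarith+
  qed
  note s = left_refinement[OF window_finite window_finite conjunct1[OF IH] 1 2]
  have "markov X (window j (J + int n) 0 (j - 1)) \<and> star_isomorphic (coded X (\<lambda>x. h x 0)) (coded X (window j (J + int n) 0 (j - 1)))"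
    using s star_isomorphic_trans[OF conjunct2[OF IH]] by blast
  then show ?case unfolding j(3) j_def[symmetric] .
qed

text \<open>Both chains end at the same window, from 0 to \<open>J + n\<close> in \<open>x\<close>
  alone: the first after \<open>Suc m + n\<close> extensions, the second once all
  \<open>Suc m\<close> coordinates of \<open>h x\<close> have been traded.\<close>

lemma coded_endpoints:
  "star_isomorphic (coded X (\<lambda>x. x 0)) (coded X (window 0 (J + int n) 0 (-1)))"
  "star_isomorphic (coded X (\<lambda>x. h x 0)) (coded X (window 0 (J + int n) 0 (-1)))"
  using chain_x[of "Suc m + n"] chain_left[of "Suc m"] by (simp_all add: add_ac)

lemma coded_image: "coded X (\<lambda>x. h x 0) = coded (markov_space B) (\<lambda>x. x 0)"
proof -
  have "(\<lambda>x. h x 0) ` X = (\<lambda>x. x 0) ` markov_space B" unfolding image[symmetric] by (simp add: image_image)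
  moreover have "transition X (\<lambda>x. h x 0) = transition (markov_space B) (\<lambda>x. x 0)"
    unfolding transition_def image[symmetric] by (intro ext) (auto simp: equivariant)
  ultimately show ?thesis unfolding coded_def by simp
qed

end

section \<open>Conjugacies are block codes\<close>

abbreviation full_topology :: "(int \<Rightarrow> 'n) topology" where
  "full_topology \<equiv> product_topology (\<lambda>_. discrete_topology UNIV) UNIV"

lemma topspace_markov [simp]: "topspace (markov_topology A) = markov_space A"
  by (simp add: markov_topology_def)

lemma coordinate_continuous: "continuous_map full_topology (discrete_topology UNIV) (\<lambda>x. x i)"
  by (rule continuous_map_product_projection) simp

lemma openin_coordinate: "openin full_topology {x. x i \<in> V}"
  using openin_continuous_map_preimage[OF coordinate_continuous, of V i] by simp

text \<open>The full shift over finitely many letters is compact, and the complement of the Markov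
  space is a union of cylinders, one for each place and each forbidden pair of letters.\<close>

lemma compactin_markov: "compactin full_topology (markov_space (A :: nat^'n^'n))"
proof (rule closedin_compact_space)
  show "compact_space (full_topology :: (int \<Rightarrow> 'n) topology)"
    by (simp add: compact_space_product_topology compact_space_discrete_topology)
  have "- markov_space A = \<Union>{{x. x i \<in> {a}} \<inter> {x. x (i + 1) \<in> {b}} |i a b. A $ a $ b \<noteq> 1}" (is "_ = \<Union>?U")
  proof (intro equalityI subsetI)
    fix x assume "x \<in> - markov_space A"
    then obtain i where "A $ x i $ x (i + 1) \<noteq> 1" by (auto simp: mem_markov)
    then have "{y. y i \<in> {x i}} \<inter> {y. y (i + 1) \<in> {x (i + 1)}} \<in> ?U" by blast
    then show "x \<in> \<Union>?U" by (rule UnionI) simp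
  qed (auto simp: mem_markov)
  moreover have "openin full_topology \<dots>"
    by (rule openin_Union) (auto simp only: mem_Collect_eq intro!: openin_Int openin_coordinate)
  ultimately show "closedin full_topology (markov_space A)"
    unfolding closedin_def by (simp add: Compl_eq_Diff_UNIV)
qed

lemma open_cylinder:
  assumes "openin full_topology U" "x \<in> U"
  shows "\<exists>N::nat. \<forall>y. (\<forall>i. \<bar>i\<bar> \<le> int N \<longrightarrow> y i = x i) \<longrightarrow> y \<in> U"
proof -
  obtain V where V: "finite {i. V i \<noteq> UNIV}" "x \<in> Pi\<^sub>E UNIV V" "Pi\<^sub>E UNIV V \<subseteq> U"
    using assms unfolding openin_product_topology_alt by auto
  \<comment> \<open>A crude common bound: the sum of the absolute values dominates each restricted
    coordinate.\<close>
  define N where "N = (\<Sum>i\<in>{i. V i \<noteq> UNIV}. nat \<bar>i\<bar>)"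
  have N: "\<bar>i\<bar> \<le> int N" if "V i \<noteq> UNIV" for i
  proof -
    have "nat \<bar>i\<bar> \<le> N" unfolding N_def by (rule member_le_sum) (use V(1) that in auto)
    then show ?thesis by linarith
  qed
  have "y \<in> U" if y: "\<forall>i. \<bar>i\<bar> \<le> int N \<longrightarrow> y i = x i" for y
  proof -
    have "y i \<in> V i" for i
    proof (cases "V i = UNIV")
      case False
      then have "y i = x i" using y N by blast
      then show ?thesis using V(2) by auto
    qed simp
    then have "y \<in> Pi\<^sub>E UNIV V" by auto
    then show ?thesis using V(3) by blast
  qed
  then show ?thesis by blast
qed

text \<open>Continuity gives each point a cylinder on whose points of the space \<open>f\<close> is
  constant. By compactness finitely many cylinders suffice, and their widths together bound the
  coordinates on which \<open>f\<close> depends.\<close>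

lemma uniform_block:
  fixes A :: "nat^'n^'n"
  assumes f: "continuous_map (markov_topology A) (discrete_topology UNIV) f"
  shows "\<exists>N::nat. \<forall>x\<in>markov_space A. \<forall>y\<in>markov_space A. (\<forall>i. \<bar>i\<bar> \<le> int N \<longrightarrow> x i = y i) \<longrightarrow> f x = f y"
proof -
  have "\<exists>N::nat. \<forall>y\<in>markov_space A. (\<forall>i. \<bar>i\<bar> \<le> int N \<longrightarrow> y i = x i) \<longrightarrow> f y = f x" if x: "x \<in> markov_space A" for x
  proof -
    have "openin (markov_topology A) {y \<in> markov_space A. f y \<in> {f x}}"
      using openin_continuous_map_preimage[OF f, of "{f x}"] by simp
    then obtain U where U: "openin full_topology U" "{y \<in> markov_space A. f y \<in> {f x}} = U \<inter> markov_space A"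
      unfolding markov_topology_def openin_subtopology by blast
    have "x \<in> U" using U(2) x by blast
    then obtain N where "\<forall>y. (\<forall>i. \<bar>i\<bar> \<le> int N \<longrightarrow> y i = x i) \<longrightarrow> y \<in> U" using open_cylinder[OF U(1)] by blast
    then show ?thesis using U(2) by blast
  qed
  then obtain N where N: "\<And>x y. x \<in> markov_space A \<Longrightarrow> y \<in> markov_space A \<Longrightarrow>
      (\<forall>i. \<bar>i\<bar> \<le> int (N x) \<longrightarrow> y i = x i) \<Longrightarrow> f y = f x" by metis
  define cyl where "cyl x = {y. \<forall>i. \<bar>i\<bar> \<le> int (N x) \<longrightarrow> y i = x i}" for x
  have "openin full_topology (cyl x)" for x
  proof -
    have "cyl x = \<Inter> ((\<lambda>i. {y. y i \<in> {x i}}) ` {- int (N x)..int (N x)})"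
      by (auto simp: cyl_def abs_le_iff)
    moreover have "openin full_topology \<dots>"
      by (rule openin_Inter) (auto intro: openin_coordinate[of _ "{_}", simplified])
    ultimately show ?thesis by simp
  qed
  moreover have "markov_space A \<subseteq> \<Union> (cyl ` markov_space A)" by (auto simp: cyl_def)
  ultimately obtain \<F> where F: "finite \<F>" "\<F> \<subseteq> cyl ` markov_space A" "markov_space A \<subseteq> \<Union> \<F>"
    using compactin_markov[of A] unfolding compactin_def by (metis (no_types, lifting) imageE)
  then obtain G where G: "G \<subseteq> markov_space A" "finite G" "\<F> = cyl ` G" by (meson finite_subset_image)
  \<comment> \<open>\<open>x\<close> lies in the cylinder of some \<open>g\<close> in
    \<open>G\<close>, and agreement on the larger window puts \<open>y\<close> into the same
    one.\<close>
  have "f x = f y" if xy: "x \<in> markov_space A" "y \<in> markov_space A"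
    and eq: "\<forall>i. \<bar>i\<bar> \<le> int (\<Sum>g\<in>G. N g) \<longrightarrow> x i = y i" for x y
  proof -
    obtain g where g: "g \<in> G" "x \<in> cyl g" using F(3) G(3) xy(1) by blast
    have le: "N g \<le> (\<Sum>g\<in>G. N g)" by (rule member_le_sum) (use g(1) G(2) in auto)
    have xg: "\<forall>i. \<bar>i\<bar> \<le> int (N g) \<longrightarrow> x i = g i" using g(2) by (simp add: cyl_def)
    have yg: "\<forall>i. \<bar>i\<bar> \<le> int (N g) \<longrightarrow> y i = g i"
    proof (intro allI impI)
      fix i assume i: "\<bar>i\<bar> \<le> int (N g)"
      then have "\<bar>i\<bar> \<le> int (\<Sum>g\<in>G. N g)" using le by linarith
      then have "x i = y i" using eq by blast
      then show "y i = g i" using xg i by simp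
    qed
    have gX: "g \<in> markov_space A" using g(1) G(1) by blast
    have "f x = f g" "f y = f g" using N[OF gX xy(1) xg] N[OF gX xy(2) yg] by blast+
    then show ?thesis by simp
  qed
  then show ?thesis by blast
qed

lemma bi_shift_eq: "bi_shift x = sh 1 x" by (simp add: bi_shift_def sh_def)

lemma equivariant_int:
  assumes "\<And>x. x \<in> markov_space A \<Longrightarrow> h (sh 1 x) = sh 1 (h x)" "x \<in> markov_space A"
  shows "h (sh k x) = sh k (h x)"
proof -
  interpret shift_space "markov_space A" by (rule shift_space_markov)
  have nat: "h (sh (int j) y) = sh (int j) (h y)" if y: "y \<in> markov_space A" for j y
  proof (induction j)
    case (Suc j)
    have "h (sh 1 (sh (int j) y)) = sh 1 (sh (int j) (h y))" using assms(1)[OF shift[OF y]] Suc by simp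
    then show ?case by simp
  qed simp
  show ?thesis
  proof (cases "k \<ge> 0")
    case True
    then show ?thesis using nat[OF assms(2), of "nat k"] by simp
  next
    case False
    have "h x = sh (- k) (h (sh k x))"
      using nat[OF shift[OF assms(2), of k], of "nat (- k)"] False by simp
    then have "sh k (h x) = sh k (sh (- k) (h (sh k x)))" by simp
    then show ?thesis by simp
  qed
qed

text \<open>The Curtis-Hedlund-Lyndon theorem: uniform continuity controls the coordinate at 0, and
  equivariance carries the same window to every place.\<close>

lemma block_code:
  fixes A :: "nat^'n^'n" and B :: "nat^'m^'m"
  assumes cont: "continuous_map (markov_topology A) (markov_topology B) h"
    and eqv: "\<And>x k. x \<in> markov_space A \<Longrightarrow> h (sh k x) = sh k (h x)"
  shows "\<exists>N::nat. \<forall>x\<in>markov_space A. \<forall>y\<in>markov_space A. \<forall>i.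
    (\<forall>j. i - int N \<le> j \<longrightarrow> j \<le> i + int N \<longrightarrow> x j = y j) \<longrightarrow> h x i = h y i"
proof -
  interpret shift_space "markov_space A" by (rule shift_space_markov)
  have "continuous_map (markov_topology B) (discrete_topology UNIV) (\<lambda>x. x 0)"
    unfolding markov_topology_def by (rule continuous_map_from_subtopology[OF coordinate_continuous])
  from continuous_map_compose[OF cont this]
  have "continuous_map (markov_topology A) (discrete_topology UNIV) (\<lambda>x. h x 0)" by (simp add: comp_def)
  from uniform_block[OF this] obtain N :: nat where N: "\<And>x y. x \<in> markov_space A \<Longrightarrow> y \<in> markov_space A \<Longrightarrow>
    (\<forall>i. \<bar>i\<bar> \<le> int N \<longrightarrow> x i = y i) \<Longrightarrow> h x 0 = h y 0" by blast
  have "h x i = h y i" if xy: "x \<in> markov_space A" "y \<in> markov_space A"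
    and eq: "\<forall>j. i - int N \<le> j \<longrightarrow> j \<le> i + int N \<longrightarrow> x j = y j" for x y i
  proof -
    have "h (sh i x) 0 = h (sh i y) 0"
    proof (rule N[OF shift[OF xy(1)] shift[OF xy(2)]], intro allI impI)
      fix j assume "\<bar>j\<bar> \<le> int N"
      then have "i - int N \<le> j + i" "j + i \<le> i + int N" by linarith+
      then show "sh i x j = sh i y j" using eq unfolding sh_apply by blast
    qed
    then show ?thesis unfolding eqv[OF xy(1)] eqv[OF xy(2)] sh_apply by simp
  qed
  then show ?thesis by blast
qed

lemma conjugacy_shifted:
  fixes A :: "nat^'n^'n" and B :: "nat^'m^'m"
  assumes "topologically_conjugate A B"
  shows "\<exists>h n m. shifted_conjugacy A B h n m"
proof -
  obtain h where "homeomorphic_map (markov_topology A) (markov_topology B) h"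
    and h1: "\<And>x. x \<in> markov_space A \<Longrightarrow> h (bi_shift x) = bi_shift (h x)"
    using assms unfolding topologically_conjugate_def by blast
  then obtain g where hg: "homeomorphic_maps (markov_topology A) (markov_topology B) h g"
    unfolding homeomorphic_map_maps by blast
  have cont: "continuous_map (markov_topology A) (markov_topology B) h" "continuous_map (markov_topology B) (markov_topology A) g"
    and gh: "\<And>x. x \<in> markov_space A \<Longrightarrow> g (h x) = x" and hg: "\<And>y. y \<in> markov_space B \<Longrightarrow> h (g y) = y"
    using hg unfolding homeomorphic_maps_def by auto
  have hB: "h x \<in> markov_space B" if "x \<in> markov_space A" for x
    using continuous_map_image_subset_topspace[OF cont(1)] that by (auto simp: image_subset_iff)
  have gA: "g y \<in> markov_space A" if "y \<in> markov_space B" for y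
    using continuous_map_image_subset_topspace[OF cont(2)] that by (auto simp: image_subset_iff)
  interpret A: shift_space "markov_space A" by (rule shift_space_markov)
  interpret B: shift_space "markov_space B" by (rule shift_space_markov)
  have eqv: "h (sh k x) = sh k (h x)" if "x \<in> markov_space A" for x k
    by (rule equivariant_int[OF _ that]) (use h1 in \<open>simp add: bi_shift_eq\<close>)
  have eqv': "g (sh k y) = sh k (g y)" if y: "y \<in> markov_space B" for y k
  proof -
    have "g (sh k y) = g (h (sh k (g y)))" by (simp add: eqv[OF gA[OF y]] hg[OF y])
    then show ?thesis using gh[OF A.shift[OF gA[OF y]]] by simp
  qed
  obtain N :: nat where N: "\<And>x y i. x \<in> markov_space A \<Longrightarrow> y \<in> markov_space A \<Longrightarrow>
      (\<And>j. i - int N \<le> j \<Longrightarrow> j \<le> i + int N \<Longrightarrow> x j = y j) \<Longrightarrow> h x i = h y i"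
    using block_code[OF cont(1) eqv] by blast
  obtain M :: nat where M: "\<And>x y i. x \<in> markov_space B \<Longrightarrow> y \<in> markov_space B \<Longrightarrow>
      (\<And>j. i - int M \<le> j \<Longrightarrow> j \<le> i + int M \<Longrightarrow> x j = y j) \<Longrightarrow> g x i = g y i"
    using block_code[OF cont(2) eqv'] by blast
  \<comment> \<open>After the shift by \<open>s\<close>, coordinate \<open>i\<close> of the image
    depends on \<open>x\<close> from i + M + 1 to i + 2N + M + 1, and \<open>x i\<close> depends on
    the shifted image from i - 2M - N - 1 to i - N - 1. So the one dependence looks forward and the
    other strictly backward.\<close>
  define s where "s = int N + int M + 1"
  have "shifted_conjugacy A B (\<lambda>x. sh s (h x)) (2 * N + M + 1) (2 * M + N + 1)"
  proof
    show "(\<lambda>x. sh s (h x)) ` markov_space A = markov_space B"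
    proof (intro equalityI subsetI)
      fix y assume y: "y \<in> markov_space B"
      show "y \<in> (\<lambda>x. sh s (h x)) ` markov_space A"
        by (rule image_eqI[OF _ gA[OF B.shift[OF y, of "- s"]]]) (simp add: hg[OF B.shift[OF y]])
    qed (use hB B.shift in blast)
    show "sh s (h (sh k x)) = sh k (sh s (h x))" if "x \<in> markov_space A" for x k
      by (simp add: eqv[OF that] add.commute)
    show "sh s (h x) i = sh s (h y) i" if xy: "x \<in> markov_space A" "y \<in> markov_space A"
      and eq: "\<And>j. i \<le> j \<Longrightarrow> j \<le> i + int (2 * N + M + 1) \<Longrightarrow> x j = y j" for x y i
      unfolding sh_apply by (rule N[OF xy], rule eq) (unfold s_def, linarith+)
    show "x i = y i" if xy: "x \<in> markov_space A" "y \<in> markov_space A"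
      and eq: "\<And>j. i - int (2 * M + N + 1) \<le> j \<Longrightarrow> j < i \<Longrightarrow> sh s (h x) j = sh s (h y) j" for x y i
    proof -
      have "g (h x) i = g (h y) i"
      proof (rule M[OF hB[OF xy(1)] hB[OF xy(2)]])
        fix j assume j: "i - int M \<le> j" "j \<le> i + int M"
        have "sh s (h x) (j - s) = sh s (h y) (j - s)"
          by (rule eq) (use j in \<open>unfold s_def, linarith+\<close>)
        then show "h x j = h y j" by (simp add: sh_apply)
      qed
      then show ?thesis using gh xy by simp
    qed
  qed
  then show ?thesis by blast
qed

section \<open>The extended Ruelle algebra as a coded algebra\<close>

lemma ck_relators_eq:
  assumes "zero_one_matrix (A :: nat^'n^'n)"
  shows "ck_relators A = gck_relators UNIV (\<lambda>i j. A $ i $ j = 1)"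
proof -
  let ?F = "free_star_algebra :: ('n letter list \<Rightarrow> complex) star_algebra"
  interpret FS: star_alg ?F unfolding F_eq by (rule F.star_alg_S)
  let ?r = "\<lambda>i. free_gen i \<otimes>\<^bsub>?F\<^esub> star ?F (free_gen i)"
  have rc: "?r i \<in> carrier ?F" for i by (intro FS.m_closed FS.star_closed free_gen_closed)
  have "finsum ?F (\<lambda>j. scale ?F (of_nat (A $ i $ j)) (?r j)) UNIV = finsum ?F ?r {j\<in>UNIV. A $ i $ j = 1}" for i
  proof -
    have "finsum ?F (\<lambda>j. scale ?F (of_nat (A $ i $ j)) (?r j)) UNIV = finsum ?F (\<lambda>j. if A $ i $ j = 1 then ?r j else \<zero>\<^bsub>?F\<^esub>) UNIV"
    proof (rule FS.finsum_eqI[OF refl])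
      fix j
      have "A $ i $ j = 0 \<or> A $ i $ j = 1" using assms unfolding zero_one_matrix_def by blast
      then show "scale ?F (of_nat (A $ i $ j)) (?r j) = (if A $ i $ j = 1 then ?r j else \<zero>\<^bsub>?F\<^esub>)"
        using rc[of j] by auto
      show "(if A $ i $ j = 1 then ?r j else \<zero>\<^bsub>?F\<^esub>) \<in> carrier ?F" using rc[of j] by simp
    qed
    also have "\<dots> = finsum ?F ?r {j\<in>UNIV. A $ i $ j = 1}"
      by (rule FS.finsum_restrict_set) (simp_all add: rc)
    finally show ?thesis .
  qed
  then show ?thesis unfolding ck_relators_def gck_relators_def Let_def by simp
qed

lemma cuntz_krieger_eq:
  assumes "zero_one_matrix A"
  shows "cuntz_krieger A = gck UNIV (\<lambda>i j. A $ i $ j = 1)" "ck_gen A = gck_gen UNIV (\<lambda>i j. A $ i $ j = 1)"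
  unfolding cuntz_krieger_def gck_def ck_gen_def[abs_def] gck_gen_def[abs_def] ck_relators_eq[OF assms] by simp_all

lemma extended_ruelle_eq:
  assumes A: "zero_one_matrix A"
  shows "extended_ruelle A = gruelle UNIV (\<lambda>i j. A $ i $ j = 1)"
proof -
  have "zero_one_matrix (transpose A)" using A by (simp add: zero_one_matrix_def transpose_def)
  note t = cuntz_krieger_eq[OF this]
  have tr: "(\<lambda>i j. transpose A $ i $ j = 1) = (\<lambda>i j. A $ j $ i = 1)" by (simp add: transpose_def)
  show ?thesis
    unfolding extended_ruelle_def gruelle_def ck_tensor_def gck_tensor_def ruelle_projection_def gck_proj_def gck_elem_def
      t[unfolded tr] cuntz_krieger_eq[OF A] Let_def ..
qed

text \<open>A positive diagonal entry of a positive power is a closed path through \<open>i\<close>.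
  Its first edge leaves \<open>i\<close> and its last edge enters \<open>i\<close>.\<close>

lemma irreducible_edges:
  assumes "irreducible_matrix A"
  shows "\<exists>j. 0 < A $ i $ j" "\<exists>j. 0 < A $ j $ i"
proof -
  obtain k where k: "k \<ge> 1" "0 < (((**) A ^^ k) (mat 1)) $ i $ i"
    using assms unfolding irreducible_matrix_def by blast
  obtain l where l: "k = Suc l" using k(1) by (cases k) auto
  have "0 < (\<Sum>j\<in>UNIV. A $ i $ j * (((**) A ^^ l) (mat 1)) $ j $ i)"
    using k(2) unfolding l by (simp add: matrix_matrix_mult_def)
  then obtain j where "A $ i $ j * (((**) A ^^ l) (mat 1)) $ j $ i \<noteq> 0"
    by (metis (mono_tags, lifting) less_numeral_extra(3) sum.neutral)
  then show "\<exists>j. 0 < A $ i $ j" by auto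
  \<comment> \<open>The power is built by multiplying on the left, so the last edge is reached only
    by induction on the exponent, with the starting letter \<open>i'\<close> left arbitrary.\<close>
  have "0 < (((**) A ^^ Suc l) (mat 1)) $ i' $ i \<Longrightarrow> \<exists>j. 0 < A $ j $ i" for i' l
  proof (induction l arbitrary: i')
    case 0
    then have "0 < A $ i' $ i" by (simp only: funpow.simps comp_def id_apply matrix_mul_rid)
    then show ?case by blast
  next
    case (Suc l)
    have "0 < (\<Sum>j\<in>UNIV. A $ i' $ j * (((**) A ^^ Suc l) (mat 1)) $ j $ i)"
      using Suc.prems unfolding funpow.simps(2)[of "Suc l"] by (simp add: matrix_matrix_mult_def)
    then obtain j where "A $ i' $ j * (((**) A ^^ Suc l) (mat 1)) $ j $ i \<noteq> 0"
      by (metis (mono_tags, lifting) less_numeral_extra(3) sum.neutral)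
    then have "0 < (((**) A ^^ Suc l) (mat 1)) $ j $ i" by (metis gr0I mult_is_0)
    then show ?case by (rule Suc.IH)
  qed
  then show "\<exists>j. 0 < A $ j $ i" using k(2) unfolding l by blast
qed

text \<open>From the edge one follows a chosen successor forever to the right and a chosen
  predecessor forever to the left; \<open>irreducible_edges\<close> provides them.\<close>

lemma edge_path:
  fixes A :: "nat^'n^'n"
  assumes A: "zero_one_matrix A" "irreducible_matrix A" and ij: "A $ i $ j = 1"
  shows "\<exists>x\<in>markov_space A. x 0 = i \<and> x 1 = j"
proof -
  have one: "A $ a $ b = 1" if "0 < A $ a $ b" for a b
    using A(1) that unfolding zero_one_matrix_def by (metis insertE less_numeral_extra(3) singletonD)
  obtain nx where nx: "\<And>a. A $ a $ nx a = 1" using irreducible_edges(1)[OF A(2)] one by metis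
  obtain pv where pv: "\<And>a. A $ pv a $ a = 1" using irreducible_edges(2)[OF A(2)] one by metis
  define x where "x k = (if k \<ge> 1 then (nx ^^ nat (k - 1)) j else (pv ^^ nat (- k)) i)" for k :: int
  have "A $ x k $ x (k + 1) = 1" for k
  proof (cases "k \<ge> 1")
    case True
    then have "nat (k + 1 - 1) = Suc (nat (k - 1))" by linarith
    then show ?thesis using True nx by (simp add: x_def)
  next
    case False
    show ?thesis
    proof (cases "k = 0")
      case True
      then show ?thesis using ij by (simp add: x_def)
    next
      case f: False
      then have "nat (- k) = Suc (nat (- (k + 1)))" using False by linarith
      then show ?thesis using False f pv by (simp add: x_def)
    qed
  qed
  then have "x \<in> markov_space A" unfolding mem_markov by blast
  then show ?thesis by (intro bexI[of _ x]) (simp_all add: x_def)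
qed

text \<open>\<open>coded\<close> sees only letters and transitions that occur in some two-sided
  sequence. Irreducibility makes every letter and every edge occur, so none is missing from the
  extended Ruelle algebra.\<close>

lemma coded_coordinate:
  fixes A :: "nat^'n^'n"
  assumes A: "zero_one_matrix A" "irreducible_matrix A"
  shows "coded (markov_space A) (\<lambda>x. x 0) = extended_ruelle A"
proof -
  have one: "A $ a $ b = 1" if "0 < A $ a $ b" for a b
    using A(1) that unfolding zero_one_matrix_def by (metis insertE less_numeral_extra(3) singletonD)
  have "i \<in> (\<lambda>x. x 0) ` markov_space A" for i
  proof -
    obtain j where "A $ i $ j = 1" using irreducible_edges(1)[OF A(2)] one by blast
    from edge_path[OF A this] show ?thesis by blast
  qed
  then have U: "(\<lambda>x. x 0) ` markov_space A = UNIV" by blast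
  have "transition (markov_space A) (\<lambda>x. x 0) i j \<longleftrightarrow> A $ i $ j = 1" for i j
  proof
    assume "transition (markov_space A) (\<lambda>x. x 0) i j"
    then obtain x where x: "x \<in> markov_space A" "x 0 = i" "x 1 = j" unfolding transition_def sh_apply by auto
    then have "A $ x 0 $ x (0 + 1) = 1" unfolding mem_markov by blast
    then show "A $ i $ j = 1" using x by simp
  next
    assume "A $ i $ j = 1"
    from edge_path[OF A this] show "transition (markov_space A) (\<lambda>x. x 0) i j"
      unfolding transition_def sh_apply by simp
  qed
  then have "transition (markov_space A) (\<lambda>x. x 0) = (\<lambda>i j. A $ i $ j = 1)" by (intro ext) blast
  then show ?thesis unfolding coded_def U extended_ruelle_eq[OF A(1)] by simp
qed

lemma star_alg_extended_ruelle:
  assumes "zero_one_matrix A"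
  shows "star_alg (extended_ruelle A)"
proof -
  let ?A = "\<lambda>i j. A $ i $ j = 1"
  interpret corner_cstar "gck_tensor UNIV ?A" "gck_proj UNIV ?A"
    by (rule corner_cstarI[OF gck_tensor_cstar gck_proj_projection]) simp_all
  show ?thesis unfolding extended_ruelle_eq[OF assms] gruelle_def by (rule star_alg_C)
qed

theorem proposition5p1:
  fixes A :: "nat^'n^'n" and B :: "nat^'m^'m"
  assumes "zero_one_matrix A" and "irreducible_matrix A" and "\<not> is_permutation_matrix A"
    and "zero_one_matrix B" and "irreducible_matrix B" and "\<not> is_permutation_matrix B"
    and "topologically_conjugate A B"
  shows "\<exists>\<phi> \<in> iso (K0 (extended_ruelle A)) (K0 (extended_ruelle B)).
           \<phi> (K0_unit (extended_ruelle A)) = K0_unit (extended_ruelle B)"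
proof -
  obtain h n m where "shifted_conjugacy A B h n m" using conjugacy_shifted[OF assms(7)] by blast
  then interpret shifted_conjugacy A B h n m .
  note A = star_alg_extended_ruelle[OF assms(1)] and B = star_alg_extended_ruelle[OF assms(4)]
  \<comment> \<open>The common window at which both chains of recodings end. Both extended Ruelle
    algebras map isomorphically onto its algebra, and the second isomorphism is inverted.\<close>
  let ?W = "coded X (window 0 (J + int n) 0 (-1))"
  obtain f where f: "star_hom (extended_ruelle A) ?W f" "bij_betw f (carrier (extended_ruelle A)) (carrier ?W)"
    using coded_endpoints(1) unfolding coded_coordinate[OF assms(1,2)] star_isomorphic_def by blast
  obtain g where g: "star_hom (extended_ruelle B) ?W g" "bij_betw g (carrier (extended_ruelle B)) (carrier ?W)"
    using coded_endpoints(2) unfolding coded_image coded_coordinate[OF assms(4,5)] star_isomorphic_def by blast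
  let ?g = "inv_into (carrier (extended_ruelle B)) g"
  have "star_hom (extended_ruelle A) (extended_ruelle B) (\<lambda>x. ?g (f x))"
    by (rule star_hom_comp[OF f(1) star_hom_inverse[OF B g]])
  moreover have "bij_betw (\<lambda>x. ?g (f x)) (carrier (extended_ruelle A)) (carrier (extended_ruelle B))"
    using bij_betw_trans[OF f(2) bij_betw_inv_into[OF g(2)]] by (simp add: comp_def)
  ultimately show ?thesis by (rule K0_isomorphic[OF A B])
qed

end
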